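(* Let $(M,\omega)$ be a closed connected symplectic manifold. Then $\mathrm{Hameo}(M,\omega)$ contains all $C^{1,1}$-Hamiltonian diffeomorphisms. More precisely, let $\phi$ be the time-one map of Hamilton's equation $\dot x=X_H(t,x)$ for a $C^1$-function $H:[0,1]\times M\to\mathbb R$ such that (1) $\|H_t\|_{C^{1,1}}\le C$, where $C>0$ is independent of $t\in[0,1]$, and (2) the map $[0,1]\times M\to T^*M$, $(t,x)\mapsto dH_t(x)$, is continuous. Then $\phi\in\mathrm{Hameo}(M,\omega)$.
   Context: Let $(M,\omega)$ be a closed connected symplectic manifold of dimension $2n$ and let $\mu$ be the Liouville measure, induced by the volume form $\Omega=\frac{1}{n!}\omega^n$. Fix a Riemannian metric on $M$ with distance $d$ and put $d_{C^0}(\phi,\psi)=\max_{x\in M}d(\phi(x),\psi(x))$. The group $\mathrm{Homeo}(M)$ of homeomorphisms of $M$ carries the complete metric $\overline d(\phi,\psi)=\max\{d_{C^0}(\phi,\psi),d_{C^0}(\phi^{-1},\psi^{-1})\}$, whose topology is called the $C^0$-topology. $\mathcal P(\mathrm{Homeo}(M),id)$ is the space of continuous paths $\lambda:[0,1]\to\mathrm{Homeo}(M)$ with $\lambda(0)=id$, with metric $\overline d(\lambda,\mu)=\max_{t\in[0,1]}\overline d(\lambda(t),\mu(t))$. For a function $H:[0,1]\times M\to\mathbb R$ write $H_t=H(t,\cdot)$; $X_H$ is the time-dependent vector field defined by $X_H\rfloor\omega=dH_t$, and $\phi_H:t\mapsto\phi_H^t$ is its flow with $\phi_H^0=id$. The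 norm $\|\cdot\|_{C^{1,1}}$ is the $C^1$-norm plus the Lipschitz constant of the first derivative (with respect to a fixed Riemannian metric). A smooth $H$ is normalized if $\int_M H_t\,d\mu=0$ for all $t$; $C_m^\infty([0,1]\times M,\mathbb R)$ is the space of normalized smooth functions, with norm $\|H\|=\int_0^1\left(\max_x H_t(x)-\min_x H_t(x)\right)dt$, and $L_m^{(1,\infty)}([0,1]\times M,\mathbb R)$ is its completion. Let $\mathcal Q=\{(\phi_H,H): H\in C_m^\infty([0,1]\times M,\mathbb R)\}\subset \mathcal P(\mathrm{Homeo}(M),id)\times L_m^{(1,\infty)}([0,1]\times M,\mathbb R)$, and let $\overline{\mathcal Q}$ be its closure with respect to the product metric (the sum of $\overline d$ and $\|\cdot\|$). Then $\mathrm{Hameo}(M,\omega)=\{\lambda(1):(\lambda,H)\in\overline{\mathcal Q}\}\subset\mathrm{Homeo}(M)$. *)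

theory Defs
  imports "HOL-Analysis.Analysis" "HOL-Combinatorics.Permutations"
begin

section \<open>Functions of class C^k, k = 0, 1, ..., infinity\<close>

primrec Ck_open ::
  "nat \<Rightarrow> 'a::euclidean_space set \<Rightarrow> ('a \<Rightarrow> 'b::real_normed_vector) \<Rightarrow> bool" where
  "Ck_open 0 U f \<longleftrightarrow> continuous_on U f"
| "Ck_open (Suc k) U f \<longleftrightarrow>
     (\<forall>x\<in>U. f differentiable (at x)) \<and>
     (\<forall>v. Ck_open k U (\<lambda>x. frechet_derivative f (at x) v))"

text \<open>On a set that need not be open (here \<open>[0,1] \<times> V\<close> with \<open>V\<close> open, or a
  relatively open subset of \<open>[0,1]\<close>), a function is of class \<open>C^k\<close> if near each point of the set
  it has an extension to an open set that is of class \<open>C^k\<close>.\<close>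

definition C_on ::
  "enat \<Rightarrow> 'a::euclidean_space set \<Rightarrow> ('a \<Rightarrow> 'b::real_normed_vector) \<Rightarrow> bool" where
  "C_on k S f \<longleftrightarrow>
     (\<forall>x\<in>S. \<exists>U h. open U \<and> x \<in> U \<and> (\<forall>j. enat j \<le> k \<longrightarrow> Ck_open j U h) \<and>
                  (\<forall>y\<in>U \<inter> S. h y = f y))"


section \<open>Closed manifolds and tensor fields\<close>

text \<open>The manifold is the type \<open>'m\<close>, modelled on the Euclidean space \<open>'e\<close>. A chart
  is a domain together with a coordinate map, whose values outside the domain are irrelevant.\<close>

type_synonym ('m, 'e) chart = "'m set \<times> ('m \<Rightarrow> 'e)"

abbreviation cdom :: "('m, 'e) chart \<Rightarrow> 'm set" where "cdom c \<equiv> fst c"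
abbreviation cmap :: "('m, 'e) chart \<Rightarrow> 'm \<Rightarrow> 'e" where "cmap c \<equiv> snd c"

definition cran :: "('m, 'e) chart \<Rightarrow> 'e set" where
  "cran c = cmap c ` cdom c"

definition cinv :: "('m, 'e) chart \<Rightarrow> 'e \<Rightarrow> 'm" where
  "cinv c = inv_into (cdom c) (cmap c)"

definition transition :: "('m, 'e) chart \<Rightarrow> ('m, 'e) chart \<Rightarrow> 'e \<Rightarrow> 'e" where
  "transition c c' = cmap c' \<circ> cinv c"

definition jac ::
  "('m, 'e::euclidean_space) chart \<Rightarrow> ('m, 'e) chart \<Rightarrow> 'e \<Rightarrow> 'e \<Rightarrow> 'e" where
  "jac c c' u = frechet_derivative (transition c c') (at u)"

definition smooth_atlas :: "('m::topological_space, 'e::euclidean_space) chart set \<Rightarrow> bool" where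
  "smooth_atlas A \<longleftrightarrow>
     (\<forall>c\<in>A. open (cdom c) \<and> open (cran c) \<and>
             homeomorphism (cdom c) (cran c) (cmap c) (cinv c)) \<and>
     (\<Union>c\<in>A. cdom c) = UNIV \<and>
     (\<forall>c\<in>A. \<forall>c'\<in>A. C_on \<infinity> (cmap c ` (cdom c \<inter> cdom c')) (transition c c'))"

text \<open>Second countability follows from compactness.\<close>

definition closed_connected_manifold ::
  "('m::t2_space, 'e::euclidean_space) chart set \<Rightarrow> bool" where
  "closed_connected_manifold A \<longleftrightarrow>
     smooth_atlas A \<and> compact (UNIV :: 'm set) \<and> connected (UNIV :: 'm set)"

text \<open>A covariant 2-tensor field is given by its expressions \<open>b c u v w\<close> in the charts
  \<open>c\<close> of the atlas, at the point with coordinates \<open>u\<close> and on the tangent vectors with components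
  \<open>v\<close> and \<open>w\<close>; these have to be related by the tensor transformation law.\<close>

type_synonym ('m, 'e) tensor2 = "('m, 'e) chart \<Rightarrow> 'e \<Rightarrow> 'e \<Rightarrow> 'e \<Rightarrow> real"

definition smooth_tensor2 ::
  "('m, 'e::euclidean_space) chart set \<Rightarrow> ('m, 'e) tensor2 \<Rightarrow> bool" where
  "smooth_tensor2 A b \<longleftrightarrow>
     (\<forall>c\<in>A. (\<forall>u\<in>cran c. bilinear (b c u)) \<and> (\<forall>v w. C_on \<infinity> (cran c) (\<lambda>u. b c u v w))) \<and>
     (\<forall>c\<in>A. \<forall>c'\<in>A. \<forall>u\<in>cmap c ` (cdom c \<inter> cdom c'). \<forall>v w.
        b c u v w = b c' (transition c c' u) (jac c c' u v) (jac c c' u w))"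

definition symplectic_form ::
  "('m, 'e::euclidean_space) chart set \<Rightarrow> ('m, 'e) tensor2 \<Rightarrow> bool" where
  "symplectic_form A \<omega> \<longleftrightarrow>
     smooth_tensor2 A \<omega> \<and>
     (\<forall>c\<in>A. \<forall>u\<in>cran c.
        (\<forall>v. \<omega> c u v v = 0) \<and>
        (\<forall>v. v \<noteq> 0 \<longrightarrow> (\<exists>w. \<omega> c u v w \<noteq> 0)) \<and>
        \<comment> \<open>\<open>d\<omega> = 0\<close>, evaluated on constant coordinate vector fields\<close>
        (\<forall>v w z. frechet_derivative (\<lambda>y. \<omega> c y v w) (at u) z
               + frechet_derivative (\<lambda>y. \<omega> c y w z) (at u) v
               + frechet_derivative (\<lambda>y. \<omega> c y z v) (at u) w = 0))"

definition riemannian_metric ::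
  "('m, 'e::euclidean_space) chart set \<Rightarrow> ('m, 'e) tensor2 \<Rightarrow> bool" where
  "riemannian_metric A g \<longleftrightarrow>
     smooth_tensor2 A g \<and>
     (\<forall>c\<in>A. \<forall>u\<in>cran c.
        (\<forall>v w. g c u v w = g c u w v) \<and> (\<forall>v. v \<noteq> 0 \<longrightarrow> g c u v v > 0))"


section \<open>The Liouville measure\<close>

text \<open>The value of \<open>\<omega>^n / n!\<close> on the vectors \<open>v 0, \<dots>, v (2 * n - 1)\<close>, for an
  alternating bilinear form \<open>\<omega>\<close>, with the wedge product normalised so that
  \<open>(\<alpha> \<and> \<beta>) (x, y) = \<alpha> x * \<beta> y - \<alpha> y * \<beta> x\<close> for 1-forms.\<close>

definition wedge_power_form :: "nat \<Rightarrow> ('e \<Rightarrow> 'e \<Rightarrow> real) \<Rightarrow> (nat \<Rightarrow> 'e) \<Rightarrow> real" where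
  "wedge_power_form n \<omega> v =
     1 / fact n * (1 / 2 ^ n *
       (\<Sum>p | p permutes {..<2 * n}.
          of_int (sign p) * (\<Prod>i<n. \<omega> (v (p (2 * i))) (v (p (2 * i + 1))))))"

text \<open>\<open>from_nat_into Basis\<close> enumerates an orthonormal basis of \<open>'e\<close>. The absolute value is
  independent of the enumeration, and accounts for the orientation of the manifold being the one
  defined by the volume form, with which the chart need not be compatible.\<close>

definition liouville_density ::
  "nat \<Rightarrow> ('m, 'e::euclidean_space) tensor2 \<Rightarrow> ('m, 'e) chart \<Rightarrow> 'e \<Rightarrow> real" where
  "liouville_density n \<omega> c u = \<bar>wedge_power_form n (\<omega> c u) (from_nat_into Basis)\<bar>"

text \<open>Since the chart domains cover the manifold, this determines the measure uniquely.\<close>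

definition liouville_measure ::
  "nat \<Rightarrow> ('m::topological_space, 'e::euclidean_space) chart set \<Rightarrow> ('m, 'e) tensor2 \<Rightarrow>
   'm measure \<Rightarrow> bool" where
  "liouville_measure n A \<omega> \<mu> \<longleftrightarrow>
     sets \<mu> = sets borel \<and>
     (\<forall>c\<in>A. \<forall>B\<in>sets borel. B \<subseteq> cdom c \<longrightarrow>
        emeasure \<mu> B = (\<integral>\<^sup>+ u\<in>cmap c ` B. ennreal (liouville_density n \<omega> c u) \<partial>lborel))"


section \<open>Curves, Riemannian distance, parallel transport\<close>

definition C1_curve ::
  "('m::topological_space, 'e::euclidean_space) chart set \<Rightarrow> (real \<Rightarrow> 'm) \<Rightarrow> bool" where
  "C1_curve A \<gamma> \<longleftrightarrow>
     continuous_on {0..1} \<gamma> \<and>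
     (\<forall>c\<in>A. C_on 1 {t\<in>{0..1}. \<gamma> t \<in> cdom c} (cmap c \<circ> \<gamma>))"

definition velocity ::
  "('m, 'e::euclidean_space) chart \<Rightarrow> (real \<Rightarrow> 'm) \<Rightarrow> real \<Rightarrow> 'e" where
  "velocity c \<gamma> t = vector_derivative (cmap c \<circ> \<gamma>) (at t within {0..1})"

definition tangent_norm ::
  "('m, 'e) tensor2 \<Rightarrow> ('m, 'e) chart \<Rightarrow> 'e \<Rightarrow> 'e \<Rightarrow> real" where
  "tangent_norm g c u v = sqrt (g c u v v)"

text \<open>By the transformation law, the choice of the chart is irrelevant.\<close>

definition speed ::
  "('m, 'e::euclidean_space) chart set \<Rightarrow> ('m, 'e) tensor2 \<Rightarrow> (real \<Rightarrow> 'm) \<Rightarrow> real \<Rightarrow> real" where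
  "speed A g \<gamma> t =
     (let c = (SOME c. c \<in> A \<and> \<gamma> t \<in> cdom c)
      in tangent_norm g c (cmap c (\<gamma> t)) (velocity c \<gamma> t))"

definition curve_length ::
  "('m, 'e::euclidean_space) chart set \<Rightarrow> ('m, 'e) tensor2 \<Rightarrow> (real \<Rightarrow> 'm) \<Rightarrow> real" where
  "curve_length A g \<gamma> = integral {0..1} (speed A g \<gamma>)"

text \<open>The curves need not be regular, so that corners can be passed with zero velocity:
  admitting piecewise \<open>C^1\<close> curves would give the same infimum.\<close>

definition riemannian_dist ::
  "('m::topological_space, 'e::euclidean_space) chart set \<Rightarrow> ('m, 'e) tensor2 \<Rightarrow>
   'm \<Rightarrow> 'm \<Rightarrow> real" where
  "riemannian_dist A g p q =
     Inf {curve_length A g \<gamma> | \<gamma>. C1_curve A \<gamma> \<and> \<gamma> 0 = p \<and> \<gamma> 1 = q}"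

text \<open>The Christoffel symbols of the Levi-Civita connection, characterised by the Koszul formula
  for constant coordinate vector fields \<open>v\<close>, \<open>w\<close>, \<open>x\<close>.\<close>

definition christoffel ::
  "('m, 'e::euclidean_space) tensor2 \<Rightarrow> ('m, 'e) chart \<Rightarrow> 'e \<Rightarrow> 'e \<Rightarrow> 'e \<Rightarrow> 'e" where
  "christoffel g c u v w =
     (THE z. \<forall>x. 2 * g c u z x =
         frechet_derivative (\<lambda>y. g c y w x) (at u) v
       + frechet_derivative (\<lambda>y. g c y v x) (at u) w
       - frechet_derivative (\<lambda>y. g c y v w) (at u) x)"

text \<open>\<open>V c t\<close> are the components with respect to \<open>c\<close> of a tangent vector at \<open>\<gamma> t\<close>.\<close>

definition parallel_along ::
  "('m, 'e::euclidean_space) chart set \<Rightarrow> ('m, 'e) tensor2 \<Rightarrow> (real \<Rightarrow> 'm) \<Rightarrow>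
   (('m, 'e) chart \<Rightarrow> real \<Rightarrow> 'e) \<Rightarrow> bool" where
  "parallel_along A g \<gamma> V \<longleftrightarrow>
     (\<forall>c\<in>A. \<forall>c'\<in>A. \<forall>t\<in>{0..1}. \<gamma> t \<in> cdom c \<inter> cdom c' \<longrightarrow>
        V c' t = jac c c' (cmap c (\<gamma> t)) (V c t)) \<and>
     (\<forall>c\<in>A. \<forall>t\<in>{0..1}. \<gamma> t \<in> cdom c \<longrightarrow>
        (V c has_vector_derivative
           - christoffel g c (cmap c (\<gamma> t)) (velocity c \<gamma> t) (V c t)) (at t within {0..1}))"


section \<open>The differential of a function and the norm of class C^{1,1}\<close>

definition differential ::
  "('m, 'e::euclidean_space) chart \<Rightarrow> ('m \<Rightarrow> real) \<Rightarrow> 'e \<Rightarrow> 'e \<Rightarrow> real" where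
  "differential c F u = frechet_derivative (F \<circ> cinv c) (at u)"

definition C1_norm ::
  "('m, 'e::euclidean_space) chart set \<Rightarrow> ('m, 'e) tensor2 \<Rightarrow> ('m \<Rightarrow> real) \<Rightarrow> ennreal" where
  "C1_norm A g F =
     (SUP p. ennreal \<bar>F p\<bar>) +
     (SUP (c, u, v) \<in> {(c, u, v). c \<in> A \<and> u \<in> cran c \<and> tangent_norm g c u v \<le> 1}.
        ennreal \<bar>differential c F u v\<bar>)"

text \<open>The covectors \<open>dF\<close> at different points are compared by parallel transport: \<open>L\<close> is a
  Lipschitz constant of \<open>dF\<close> iff the covector at one end of a curve and the parallel transport
  along the curve of the covector at the other end differ by at most \<open>L\<close> times the length of the
  curve. The infimum of the empty set is infinity.\<close>

definition differential_lipschitz ::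
  "('m::topological_space, 'e::euclidean_space) chart set \<Rightarrow> ('m, 'e) tensor2 \<Rightarrow>
   ('m \<Rightarrow> real) \<Rightarrow> real \<Rightarrow> bool" where
  "differential_lipschitz A g F L \<longleftrightarrow>
     L \<ge> 0 \<and>
     (\<forall>\<gamma> V. C1_curve A \<gamma> \<and> parallel_along A g \<gamma> V \<longrightarrow>
        (\<forall>c\<in>A. \<forall>c'\<in>A. \<gamma> 0 \<in> cdom c \<and> \<gamma> 1 \<in> cdom c' \<longrightarrow>
           \<bar>differential c' F (cmap c' (\<gamma> 1)) (V c' 1) - differential c F (cmap c (\<gamma> 0)) (V c 0)\<bar>
             \<le> L * curve_length A g \<gamma> * tangent_norm g c (cmap c (\<gamma> 0)) (V c 0)))"

definition C11_norm ::
  "('m::topological_space, 'e::euclidean_space) chart set \<Rightarrow> ('m, 'e) tensor2 \<Rightarrow>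
   ('m \<Rightarrow> real) \<Rightarrow> ennreal" where
  "C11_norm A g F = C1_norm A g F + Inf (ennreal ` {L. differential_lipschitz A g F L})"


section \<open>Time-dependent Hamiltonians and their flows\<close>

text \<open>A function on \<open>[0,1] \<times> M\<close> is a function \<open>H :: real \<Rightarrow> 'm \<Rightarrow> real\<close> of which only
  the values \<open>H t x\<close> with \<open>0 \<le> t \<le> 1\<close> matter.\<close>

definition C_hamiltonian ::
  "enat \<Rightarrow> ('m, 'e::euclidean_space) chart set \<Rightarrow> (real \<Rightarrow> 'm \<Rightarrow> real) \<Rightarrow> bool" where
  "C_hamiltonian k A H \<longleftrightarrow>
     (\<forall>c\<in>A. C_on k ({0..1} \<times> cran c) (\<lambda>(t, u). H t (cinv c u)))"

text \<open>Continuity of \<open>(t, x) \<mapsto> dH_t(x)\<close> as a map into the cotangent bundle, whose topology is the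
  one for which the chart-induced trivialisations are homeomorphisms. Covectors on \<open>'e\<close> depend
  continuously on a parameter iff their values on each fixed vector do.\<close>

definition continuous_differential ::
  "('m, 'e::euclidean_space) chart set \<Rightarrow> (real \<Rightarrow> 'm \<Rightarrow> real) \<Rightarrow> bool" where
  "continuous_differential A H \<longleftrightarrow>
     (\<forall>c\<in>A. \<forall>v. continuous_on ({0..1} \<times> cran c) (\<lambda>(t, u). differential c (H t) u v))"

definition hamiltonian_vf ::
  "('m, 'e::euclidean_space) tensor2 \<Rightarrow> (real \<Rightarrow> 'm \<Rightarrow> real) \<Rightarrow>
   real \<Rightarrow> ('m, 'e) chart \<Rightarrow> 'e \<Rightarrow> 'e" where
  "hamiltonian_vf \<omega> H t c u = (THE X. \<forall>w. \<omega> c u X w = differential c (H t) u w)"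

definition hamiltonian_solution ::
  "('m::topological_space, 'e::euclidean_space) chart set \<Rightarrow> ('m, 'e) tensor2 \<Rightarrow>
   (real \<Rightarrow> 'm \<Rightarrow> real) \<Rightarrow> (real \<Rightarrow> 'm) \<Rightarrow> bool" where
  "hamiltonian_solution A \<omega> H \<gamma> \<longleftrightarrow>
     continuous_on {0..1} \<gamma> \<and>
     (\<forall>c\<in>A. \<forall>t\<in>{0..1}. \<gamma> t \<in> cdom c \<longrightarrow>
        ((cmap c \<circ> \<gamma>) has_vector_derivative hamiltonian_vf \<omega> H t c (cmap c (\<gamma> t)))
          (at t within {0..1}))"

definition hamiltonian_flow ::
  "('m::topological_space, 'e::euclidean_space) chart set \<Rightarrow> ('m, 'e) tensor2 \<Rightarrow>
   (real \<Rightarrow> 'm \<Rightarrow> real) \<Rightarrow> real \<Rightarrow> 'm \<Rightarrow> 'm" where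
  "hamiltonian_flow A \<omega> H =
     restrict (\<lambda>t p. THE q. \<exists>\<gamma>. hamiltonian_solution A \<omega> H \<gamma> \<and> \<gamma> 0 = p \<and> \<gamma> t = q) {0..1}"

text \<open>Extensionality makes the elements correspond bijectively to functions on \<open>[0,1] \<times> M\<close>.\<close>

definition normalized_smooth ::
  "('m, 'e::euclidean_space) chart set \<Rightarrow> 'm measure \<Rightarrow> (real \<Rightarrow> 'm \<Rightarrow> real) set" where
  "normalized_smooth A \<mu> =
     {H \<in> extensional {0..1}.
        C_hamiltonian \<infinity> A H \<and> (\<forall>t\<in>{0..1}. (LINT x|\<mu>. H t x) = 0)}"

definition ham_norm :: "(real \<Rightarrow> 'm \<Rightarrow> real) \<Rightarrow> real" where
  "ham_norm H = integral {0..1} (\<lambda>t. (SUP x. H t x) - (INF x. H t x))"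

definition ham_dist :: "(real \<Rightarrow> 'm \<Rightarrow> real) \<Rightarrow> (real \<Rightarrow> 'm \<Rightarrow> real) \<Rightarrow> real" where
  "ham_dist H K = ham_norm (\<lambda>t x. H t x - K t x)"


section \<open>Completion and closure in metric spaces\<close>

text \<open>The completion of \<open>(X, d)\<close>, realised by equivalence classes of Cauchy sequences.\<close>

definition cauchy_seqs :: "'a set \<Rightarrow> ('a \<Rightarrow> 'a \<Rightarrow> real) \<Rightarrow> (nat \<Rightarrow> 'a) set" where
  "cauchy_seqs X d =
     {s. range s \<subseteq> X \<and> (\<forall>\<epsilon>>0. \<exists>N. \<forall>i\<ge>N. \<forall>j\<ge>N. d (s i) (s j) < \<epsilon>)}"

definition cauchy_equiv :: "'a set \<Rightarrow> ('a \<Rightarrow> 'a \<Rightarrow> real) \<Rightarrow> ((nat \<Rightarrow> 'a) \<times> (nat \<Rightarrow> 'a)) set" where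
  "cauchy_equiv X d =
     {(s, r). s \<in> cauchy_seqs X d \<and> r \<in> cauchy_seqs X d \<and> (\<lambda>i. d (s i) (r i)) \<longlonglongrightarrow> 0}"

definition completion :: "'a set \<Rightarrow> ('a \<Rightarrow> 'a \<Rightarrow> real) \<Rightarrow> (nat \<Rightarrow> 'a) set set" where
  "completion X d = cauchy_seqs X d // cauchy_equiv X d"

definition completion_dist ::
  "('a \<Rightarrow> 'a \<Rightarrow> real) \<Rightarrow> (nat \<Rightarrow> 'a) set \<Rightarrow> (nat \<Rightarrow> 'a) set \<Rightarrow> real" where
  "completion_dist d \<xi> \<eta> = (THE l. \<exists>s\<in>\<xi>. \<exists>r\<in>\<eta>. (\<lambda>i. d (s i) (r i)) \<longlonglongrightarrow> l)"

definition completion_embed :: "'a set \<Rightarrow> ('a \<Rightarrow> 'a \<Rightarrow> real) \<Rightarrow> 'a \<Rightarrow> (nat \<Rightarrow> 'a) set" where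
  "completion_embed X d x = cauchy_equiv X d `` {\<lambda>_. x}"

definition dist_closure :: "'a set \<Rightarrow> ('a \<Rightarrow> 'a \<Rightarrow> real) \<Rightarrow> 'a set \<Rightarrow> 'a set" where
  "dist_closure X d S = {x \<in> X. \<forall>\<epsilon>>0. \<exists>y\<in>S. d x y < \<epsilon>}"


section \<open>Hamiltonian homeomorphisms\<close>

definition Homeo :: "('m::topological_space \<Rightarrow> 'm) set" where
  "Homeo = {\<phi>. \<exists>\<psi>. homeomorphism UNIV UNIV \<phi> \<psi>}"

definition homeo_dist :: "('m \<Rightarrow> 'm \<Rightarrow> real) \<Rightarrow> ('m \<Rightarrow> 'm) \<Rightarrow> ('m \<Rightarrow> 'm) \<Rightarrow> real" where
  "homeo_dist d \<phi> \<psi> = max (SUP x. d (\<phi> x) (\<psi> x)) (SUP x. d (inv \<phi> x) (inv \<psi> x))"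

definition homeo_paths ::
  "('m::topological_space \<Rightarrow> 'm \<Rightarrow> real) \<Rightarrow> (real \<Rightarrow> 'm \<Rightarrow> 'm) set" where
  "homeo_paths d =
     {\<Lambda> \<in> extensional {0..1}.
        (\<forall>t\<in>{0..1}. \<Lambda> t \<in> Homeo) \<and> \<Lambda> 0 = id \<and>
        (\<forall>t\<in>{0..1}. \<forall>\<epsilon>>0. \<exists>\<delta>>0. \<forall>s\<in>{0..1}. \<bar>s - t\<bar> < \<delta> \<longrightarrow> homeo_dist d (\<Lambda> s) (\<Lambda> t) < \<epsilon>)}"

definition path_dist ::
  "('m \<Rightarrow> 'm \<Rightarrow> real) \<Rightarrow> (real \<Rightarrow> 'm \<Rightarrow> 'm) \<Rightarrow> (real \<Rightarrow> 'm \<Rightarrow> 'm) \<Rightarrow> real" where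
  "path_dist d \<Lambda> \<Theta> = (SUP t\<in>{0..1}. homeo_dist d (\<Lambda> t) (\<Theta> t))"

type_synonym 'm ham_completion = "(nat \<Rightarrow> real \<Rightarrow> 'm \<Rightarrow> real) set"

definition smooth_ham_pairs ::
  "('m::topological_space, 'e::euclidean_space) chart set \<Rightarrow> ('m, 'e) tensor2 \<Rightarrow> 'm measure \<Rightarrow>
   ((real \<Rightarrow> 'm \<Rightarrow> 'm) \<times> 'm ham_completion) set" where
  "smooth_ham_pairs A \<omega> \<mu> =
     (\<lambda>H. (hamiltonian_flow A \<omega> H, completion_embed (normalized_smooth A \<mu>) ham_dist H))
       ` normalized_smooth A \<mu>"

definition ham_pairs_closure ::
  "('m::topological_space, 'e::euclidean_space) chart set \<Rightarrow> ('m, 'e) tensor2 \<Rightarrow>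
   ('m, 'e) tensor2 \<Rightarrow> 'm measure \<Rightarrow> ((real \<Rightarrow> 'm \<Rightarrow> 'm) \<times> 'm ham_completion) set" where
  "ham_pairs_closure A g \<omega> \<mu> =
     dist_closure
       (homeo_paths (riemannian_dist A g) \<times> completion (normalized_smooth A \<mu>) ham_dist)
       (\<lambda>(\<Lambda>, \<xi>1) (\<Theta>, \<xi>2).
          path_dist (riemannian_dist A g) \<Lambda> \<Theta> + completion_dist ham_dist \<xi>1 \<xi>2)
       (smooth_ham_pairs A \<omega> \<mu>)"

definition Hameo ::
  "('m::topological_space, 'e::euclidean_space) chart set \<Rightarrow> ('m, 'e) tensor2 \<Rightarrow>
   ('m, 'e) tensor2 \<Rightarrow> 'm measure \<Rightarrow> ('m \<Rightarrow> 'm) set" where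
  "Hameo A g \<omega> \<mu> = (\<lambda>(\<Lambda>, \<xi>). \<Lambda> 1) ` ham_pairs_closure A g \<omega> \<mu>"

end

theory Submission
  imports Defs
begin

text \<open>
  The flow of \<open>H\<close> and of approximating smooth Hamiltonians are compared by Gronwall's inequality. To
  do this globally, the manifold is mapped to a Euclidean space by finitely many smooth functions
  (cut-off coordinates); the resulting distance \<open>\<delta>\<close> dominates the Riemannian distance, and the
  derivatives of these functions along the Hamiltonian vector field are \<open>\<delta>\<close>-Lipschitz as soon as the
  differential of the Hamiltonian is Lipschitz in coordinate balls. The latter is extracted from the
  \<open>C^{1,1}\<close> bound by transporting covectors along short coordinate segments. Hence the flow depends
  continuously on the Hamiltonian in the uniform \<open>C^1\<close> topology, forwards and backwards in time.

  It remains to approximate \<open>H\<close> in this topology by normalized smooth Hamiltonians. Each \<open>H_t\<close> is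
  smoothed by a partition of unity and convolution in charts, and finitely many of these functions
  are joined by a smooth partition of unity in time. Since the Hofer norm only sees oscillations,
  subtracting the mean values does no harm, and the approximations form a Cauchy sequence.
\<close>

text \<open>Gronwall is run with the Lipschitz constant of the limit \<open>H\<close> alone. The
  approximating Hamiltonians therefore only have to be uniformly C^1-close to \<open>H\<close>,
  while their own Lipschitz constants may blow up; this is how a C^{1,1} bound on \<open>H\<close>
  comes to suffice, although smooth functions are not dense in the C^{1,1} norm. The square of
  \<open>\<delta>\<close> is a finite sum of squares of smooth functions, so it can be
  differentiated along a pair of solutions without any chart containing both. Membership in the
  closure asks for upper bounds only, so one inequality between \<open>\<delta>\<close> and the
  Riemannian distance carries the result over. The obstacle lies in the hypothesis: the Lipschitz
  bound on dH_t speaks of fields that are parallel in every chart at once. To exploit it, the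
  transport equation is solved in one chart and the solution is pushed to the others. That this is
  again parallel there is the transformation law of the Christoffel symbols, which rests on the
  symmetry of second derivatives of the transition maps. Forward and inverse flows have to converge;
  all estimates are therefore stated for two arbitrary times, in either order.\<close>

section \<open>Calculus of functions of class C^k\<close>

lemma Ck_open_SucD:
  "Ck_open (Suc k) U f \<Longrightarrow> x \<in> U \<Longrightarrow> (f has_derivative frechet_derivative f (at x)) (at x)"
  by (simp add: frechet_derivative_works)

lemma frechet_derivative_cong_open:
  assumes "open U" "x \<in> U" "\<And>y. y \<in> U \<Longrightarrow> f y = g y"
  shows "frechet_derivative f (at x) = frechet_derivative g (at x)"
proof -
  have "(f has_derivative D) (at x) \<longleftrightarrow> (g has_derivative D) (at x)" for D
    using has_derivative_transform_within_open[of f D x UNIV U g]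
      has_derivative_transform_within_open[of g D x UNIV U f] assms by auto
  then show ?thesis by (simp add: frechet_derivative_def)
qed

lemma differentiable_cong_open:
  assumes "open U" "x \<in> U" "\<And>y. y \<in> U \<Longrightarrow> f y = g y"
  shows "f differentiable (at x) \<longleftrightarrow> g differentiable (at x)"
  using differentiable_transform_within[of f x UNIV]
  unfolding differentiable_def using has_derivative_transform_within_open assms by metis

lemma Ck_open_cong:
  "open U \<Longrightarrow> (\<And>x. x \<in> U \<Longrightarrow> f x = g x) \<Longrightarrow> Ck_open k U f = Ck_open k U g"
proof (induction k arbitrary: f g)
  case 0
  then show ?case by (simp cong: continuous_on_cong)
next
  case (Suc k)
  have "Ck_open k U (\<lambda>x. frechet_derivative f (at x) v) = Ck_open k U (\<lambda>x. frechet_derivative g (at x) v)" for v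
    by (rule Suc.IH[OF Suc.prems(1)]) (metis frechet_derivative_cong_open Suc.prems)
  moreover have "f differentiable (at x) \<longleftrightarrow> g differentiable (at x)" if "x \<in> U" for x
    using differentiable_cong_open[of U x f g] Suc.prems that by blast
  ultimately show ?case by simp
qed

text \<open>Allows an explicit derivative formula in place of \<open>frechet_derivative\<close>. The
  two agree only on \<open>U\<close>, and are differentiated again there; hence the openness of
  \<open>U\<close>.\<close>

lemma Ck_open_SucI:
  assumes "\<And>x. x \<in> U \<Longrightarrow> (f has_derivative f' x) (at x)" "open U" "\<And>v. Ck_open k U (\<lambda>x. f' x v)"
  shows "Ck_open (Suc k) U f"
proof -
  have "frechet_derivative f (at x) = f' x" if "x \<in> U" for x
    using assms(1)[OF that] frechet_derivative_at by metis
  then have "Ck_open k U (\<lambda>x. frechet_derivative f (at x) v)" for v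
    using Ck_open_cong[OF assms(2), of "\<lambda>x. frechet_derivative f (at x) v" "\<lambda>x. f' x v"] assms(3)[of v]
    by simp
  then show ?thesis using assms(1) by (auto simp: differentiable_def)
qed

lemma Ck_open_Suc_imp: "Ck_open (Suc k) U f \<Longrightarrow> Ck_open k U f"
proof (induction k arbitrary: f)
  case 0
  then show ?case
    by (simp add: continuous_at_imp_continuous_on differentiable_imp_continuous_within)
qed auto

lemma Ck_open_mono: "j \<le> k \<Longrightarrow> Ck_open k U f \<Longrightarrow> Ck_open j U f"
  by (induction rule: dec_induct) (blast dest: Ck_open_Suc_imp)+

lemma Ck_open_subset: "V \<subseteq> U \<Longrightarrow> Ck_open k U f \<Longrightarrow> Ck_open k V f"
  by (induction k arbitrary: f) (auto intro: continuous_on_subset)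

text \<open>Serves functions given by different formulas on different open sets, such as extensions
  by zero.\<close>

lemma Ck_open_locally:
  assumes "\<And>x. x \<in> S \<Longrightarrow> \<exists>U. open U \<and> x \<in> U \<and> Ck_open k U f"
  shows "Ck_open k S f"
  using assms
proof (induction k arbitrary: f)
  case 0
  then show ?case
    by (metis Ck_open.simps(1) continuous_at_imp_continuous_on continuous_on_eq_continuous_at)
next
  case (Suc k)
  have "f differentiable at x" if "x \<in> S" for x
    using Suc.prems[OF that] by auto
  moreover have "Ck_open k S (\<lambda>x. frechet_derivative f (at x) v)" for v
    by (rule Suc.IH) (use Suc.prems in fastforce)
  ultimately show ?case by simp
qed

lemma Ck_open_const: "open U \<Longrightarrow> Ck_open k U (\<lambda>x. c)"
  by (induction k arbitrary: c) (auto intro!: Ck_open_SucI derivative_eq_intros)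

lemma Ck_open_linear:
  assumes "bounded_linear f" "open U"
  shows "Ck_open k U f"
proof (cases k)
  case 0
  then show ?thesis using assms by (simp add: linear_continuous_on)
next
  case (Suc j)
  then show ?thesis
    by (auto intro!: Ck_open_SucI[where f'="\<lambda>x. f"] bounded_linear_imp_has_derivative assms Ck_open_const
        simp del: Ck_open.simps)
qed

lemma Ck_open_add:
  assumes "open U"
  shows "Ck_open k U f \<Longrightarrow> Ck_open k U g \<Longrightarrow> Ck_open k U (\<lambda>x. f x + g x)"
proof (induction k arbitrary: f g)
  case 0
  then show ?case by (simp add: continuous_on_add)
next
  case (Suc k)
  show ?case
  proof (rule Ck_open_SucI[where f'="\<lambda>x v. frechet_derivative f (at x) v + frechet_derivative g (at x) v"])
    show "((\<lambda>x. f x + g x) has_derivative (\<lambda>v. frechet_derivative f (at x) v + frechet_derivative g (at x) v)) (at x)"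
      if "x \<in> U" for x
      by (rule has_derivative_add[OF Ck_open_SucD[OF Suc.prems(1) that] Ck_open_SucD[OF Suc.prems(2) that]])
    show "Ck_open k U (\<lambda>x. frechet_derivative f (at x) v + frechet_derivative g (at x) v)" for v
      using Suc by simp
  qed (fact assms)
qed

lemma Ck_open_scaleR:
  assumes "open U"
  shows "Ck_open k U f \<Longrightarrow> Ck_open k U g \<Longrightarrow> Ck_open k U (\<lambda>x. f x *\<^sub>R g x)"
proof (induction k arbitrary: f g)
  case 0
  then show ?case by (simp add: continuous_on_scaleR)
next
  case (Suc k)
  show ?case
  proof (rule Ck_open_SucI[where f'="\<lambda>x v. f x *\<^sub>R frechet_derivative g (at x) v + frechet_derivative f (at x) v *\<^sub>R g x"])
    show "((\<lambda>x. f x *\<^sub>R g x) has_derivative (\<lambda>v. f x *\<^sub>R frechet_derivative g (at x) v + frechet_derivative f (at x) v *\<^sub>R g x)) (at x)"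
      if "x \<in> U" for x
      by (rule has_derivative_scaleR[OF Ck_open_SucD[OF Suc.prems(1) that] Ck_open_SucD[OF Suc.prems(2) that]])
    show "Ck_open k U (\<lambda>x. f x *\<^sub>R frechet_derivative g (at x) v + frechet_derivative f (at x) v *\<^sub>R g x)" for v
      using Suc Ck_open_Suc_imp[OF Suc.prems(1)] Ck_open_Suc_imp[OF Suc.prems(2)]
      by (intro Ck_open_add assms Suc.IH) simp_all
  qed (fact assms)
qed

lemma Ck_open_mult:
  assumes "open U" "Ck_open k U f" "Ck_open k U (g::_\<Rightarrow>real)"
  shows "Ck_open k U (\<lambda>x. f x * g x)"
  using Ck_open_scaleR[OF assms] by simp

lemma Ck_open_minus:
  assumes "open U" "Ck_open k U f"
  shows "Ck_open k U (\<lambda>x. - f x)"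
  using Ck_open_scaleR[OF assms(1) Ck_open_const[OF assms(1), of _ "-1"] assms(2)] by simp

lemma Ck_open_diff:
  assumes "open U" "Ck_open k U f" "Ck_open k U g"
  shows "Ck_open k U (\<lambda>x. f x - g x)"
  using Ck_open_add[OF assms(1,2) Ck_open_minus[OF assms(1,3)]] by simp

lemma Ck_open_sum:
  assumes "open U" "\<And>i. i \<in> I \<Longrightarrow> Ck_open k U (f i)"
  shows "Ck_open k U (\<lambda>x. \<Sum>i\<in>I. f i x)"
  using assms(2)
  by (induction I rule: infinite_finite_induct) (simp_all add: Ck_open_const Ck_open_add assms(1))

lemma Ck_open_compose_linear:
  assumes "bounded_linear L" "open U"
  shows "Ck_open k U f \<Longrightarrow> Ck_open k U (\<lambda>x. L (f x))"
proof (induction k arbitrary: f)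
  case 0
  then show ?case
    using assms linear_continuous_on continuous_on_compose2 by (metis Ck_open.simps(1) subset_UNIV)
next
  case (Suc k)
  show ?case
  proof (rule Ck_open_SucI[where f'="\<lambda>x v. L (frechet_derivative f (at x) v)"])
    show "((\<lambda>x. L (f x)) has_derivative (\<lambda>v. L (frechet_derivative f (at x) v))) (at x)" if "x \<in> U" for x
      by (rule bounded_linear.has_derivative[OF assms(1) Ck_open_SucD[OF Suc.prems that]])
    show "Ck_open k U (\<lambda>x. L (frechet_derivative f (at x) v))" for v
      using Suc by simp
  qed (fact assms)
qed

text \<open>\<open>Ck_open\<close> speaks of derivatives in fixed directions, whereas the chain rule
  evaluates the derivative of \<open>f\<close> in a direction that moves with the point. Expanding
  this direction in \<open>Basis\<close> leaves derivatives of \<open>f\<close> in fixed directions,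
  to which the induction hypothesis applies.\<close>

lemma Ck_open_compose:
  fixes g :: "'a::euclidean_space \<Rightarrow> 'b::euclidean_space" and f :: "'b \<Rightarrow> 'c::real_normed_vector"
  assumes "open U" "open V"
  shows "Ck_open k V f \<Longrightarrow> Ck_open k U g \<Longrightarrow> g ` U \<subseteq> V \<Longrightarrow> Ck_open k U (\<lambda>x. f (g x))"
proof (induction k arbitrary: f)
  case 0
  then show ?case by (auto intro: continuous_on_compose2)
next
  case (Suc k)
  let ?f' = "\<lambda>x v. \<Sum>b\<in>Basis. (frechet_derivative g (at x) v \<bullet> b) *\<^sub>R frechet_derivative f (at (g x)) b"
  show ?case
  proof (rule Ck_open_SucI[where f'="?f'"])
    fix x assume x: "x \<in> U"
    then have gx: "g x \<in> V" using Suc.prems by auto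
    note fd = Ck_open_SucD[OF Suc.prems(1) gx]
    have D: "((\<lambda>x. f (g x)) has_derivative (\<lambda>v. frechet_derivative f (at (g x)) (frechet_derivative g (at x) v))) (at x)"
      using has_derivative_compose[OF Ck_open_SucD[OF Suc.prems(2) x] fd] .
    have eq: "frechet_derivative f (at (g x)) w = (\<Sum>b\<in>Basis. (w \<bullet> b) *\<^sub>R frechet_derivative f (at (g x)) b)" for w
    proof -
      interpret bounded_linear "frechet_derivative f (at (g x))" using fd by (rule has_derivative_bounded_linear)
      have "frechet_derivative f (at (g x)) w = frechet_derivative f (at (g x)) (\<Sum>b\<in>Basis. (w \<bullet> b) *\<^sub>R b)"
        by (simp add: euclidean_representation)
      also have "\<dots> = (\<Sum>b\<in>Basis. (w \<bullet> b) *\<^sub>R frechet_derivative f (at (g x)) b)"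
        by (simp add: sum scaleR)
      finally show ?thesis .
    qed
    show "((\<lambda>x. f (g x)) has_derivative ?f' x) (at x)"
      by (rule has_derivative_eq_rhs[OF D]) (rule ext, rule eq)
  next
    fix v
    have "Ck_open k U (\<lambda>x. frechet_derivative g (at x) v \<bullet> b)" for b
      using Suc.prems(2) by (auto intro!: Ck_open_compose_linear[OF bounded_linear_inner_left] assms)
    moreover have "Ck_open k U (\<lambda>x. frechet_derivative f (at (g x)) b)" for b
      by (rule Suc.IH) (use Suc.prems(1,3) Ck_open_Suc_imp[OF Suc.prems(2)] in auto)
    ultimately show "Ck_open k U (\<lambda>x. ?f' x v)"
      by (intro Ck_open_sum Ck_open_scaleR assms)
  qed (fact assms(1))
qed

text \<open>The derivative is a polynomial in \<open>inverse\<close> itself, so the induction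
  closes.\<close>

lemma Ck_open_inverse: "Ck_open k {0<..} (inverse :: real \<Rightarrow> real)"
proof (induction k)
  case 0
  show ?case by (simp add: continuous_on_inverse continuous_on_id)
next
  case (Suc k)
  show ?case
  proof (rule Ck_open_SucI[where f'="\<lambda>x v. - (inverse x * v * inverse x)"])
    show "(inverse has_derivative (\<lambda>v. - (inverse x * v * inverse x))) (at x)" if "x \<in> {0<..}" for x :: real
      using has_derivative_inverse'[of x UNIV] that by simp
    show "Ck_open k {0<..} (\<lambda>x. - (inverse x * v * inverse x))" for v :: real
      by (intro Ck_open_minus Ck_open_mult Ck_open_const Suc open_greaterThan)
  qed simp
qed

section \<open>Smooth functions on open sets\<close>

definition smooth_on :: "'a::euclidean_space set \<Rightarrow> ('a \<Rightarrow> 'b::real_normed_vector) \<Rightarrow> bool" where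
  "smooth_on U f \<longleftrightarrow> (\<forall>k. Ck_open k U f)"

text \<open>Near a point of an open set the local extension demanded by \<open>C_on\<close>
  coincides with \<open>f\<close>.\<close>

lemma C_on_infinity_open:
  assumes "open U"
  shows "C_on \<infinity> U f \<longleftrightarrow> smooth_on U f"
proof
  assume "smooth_on U f"
  then show "C_on \<infinity> U f" using assms unfolding C_on_def smooth_on_def by blast
next
  assume f: "C_on \<infinity> U f"
  show "smooth_on U f"
    unfolding smooth_on_def
  proof (intro allI Ck_open_locally)
    fix k x assume "x \<in> U"
    from bspec[OF f[unfolded C_on_def] this]
    obtain V h where V: "open V" "x \<in> V" "\<And>j. Ck_open j V h" "\<And>y. y \<in> V \<inter> U \<Longrightarrow> h y = f y"
      by auto
    have "Ck_open k (V \<inter> U) h" using Ck_open_subset V(3) by blast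
    then have "Ck_open k (V \<inter> U) f"
      using Ck_open_cong[of "V \<inter> U" h f k, OF _ V(4)] assms V(1) by (simp add: open_Int)
    then show "\<exists>V. open V \<and> x \<in> V \<and> Ck_open k V f"
      using V assms \<open>x \<in> U\<close> by (intro exI[of _ "V \<inter> U"]) auto
  qed
qed

named_theorems smooth_intros

lemma smooth_on_const [smooth_intros]: "open U \<Longrightarrow> smooth_on U (\<lambda>x. c)"
  by (simp add: smooth_on_def Ck_open_const)
lemma smooth_on_linear: "bounded_linear f \<Longrightarrow> open U \<Longrightarrow> smooth_on U f"
  by (simp add: smooth_on_def Ck_open_linear)
lemma smooth_on_ident [smooth_intros]: "open U \<Longrightarrow> smooth_on U (\<lambda>x. x)"
  by (simp add: smooth_on_linear)
lemma smooth_on_add [smooth_intros]: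
  "open U \<Longrightarrow> smooth_on U f \<Longrightarrow> smooth_on U g \<Longrightarrow> smooth_on U (\<lambda>x. f x + g x)"
  by (simp add: smooth_on_def Ck_open_add)
lemma smooth_on_diff [smooth_intros]:
  "open U \<Longrightarrow> smooth_on U f \<Longrightarrow> smooth_on U g \<Longrightarrow> smooth_on U (\<lambda>x. f x - g x)"
  by (simp add: smooth_on_def Ck_open_diff)
lemma smooth_on_mult [smooth_intros]:
  "open U \<Longrightarrow> smooth_on U f \<Longrightarrow> smooth_on U (g::_\<Rightarrow>real) \<Longrightarrow> smooth_on U (\<lambda>x. f x * g x)"
  by (simp add: smooth_on_def Ck_open_mult)
lemma smooth_on_sum [smooth_intros]:
  "open U \<Longrightarrow> (\<And>i. i \<in> I \<Longrightarrow> smooth_on U (f i)) \<Longrightarrow> smooth_on U (\<lambda>x. \<Sum>i\<in>I. f i x)"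
  by (simp add: smooth_on_def Ck_open_sum)
lemma smooth_on_inner_right [smooth_intros]:
  "open U \<Longrightarrow> smooth_on U f \<Longrightarrow> smooth_on U (\<lambda>x. f x \<bullet> c)"
  by (simp add: smooth_on_def Ck_open_compose_linear[OF bounded_linear_inner_left])
lemma smooth_on_compose:
  "open U \<Longrightarrow> open V \<Longrightarrow> smooth_on V f \<Longrightarrow> smooth_on U g \<Longrightarrow> g ` U \<subseteq> V \<Longrightarrow> smooth_on U (\<lambda>x. f (g x))"
  unfolding smooth_on_def using Ck_open_compose[of U V _ f g] by auto
lemma smooth_on_subset: "smooth_on U f \<Longrightarrow> V \<subseteq> U \<Longrightarrow> smooth_on V f"
  unfolding smooth_on_def using Ck_open_subset by blast
lemma smooth_on_inverse [smooth_intros]: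
  "open U \<Longrightarrow> smooth_on U f \<Longrightarrow> (\<And>x. x \<in> U \<Longrightarrow> f x > (0::real)) \<Longrightarrow> smooth_on U (\<lambda>x. inverse (f x))"
  by (rule smooth_on_compose[where V="{0<..}"]) (auto simp: Ck_open_inverse smooth_on_def)
lemma smooth_on_inner [smooth_intros]:
  assumes "open U" "smooth_on U f" "smooth_on U (g::_\<Rightarrow>'b::euclidean_space)"
  shows "smooth_on U (\<lambda>x. f x \<bullet> g x)"
  unfolding euclidean_inner[of "f _" "g _"] using assms by (intro smooth_intros)
lemma smooth_on_scaleR [smooth_intros]:
  "open U \<Longrightarrow> smooth_on U f \<Longrightarrow> smooth_on U g \<Longrightarrow> smooth_on U (\<lambda>x. f x *\<^sub>R g x)"
  by (simp add: smooth_on_def Ck_open_scaleR)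

lemma smooth_on_has_derivative:
  "smooth_on U f \<Longrightarrow> x \<in> U \<Longrightarrow> (f has_derivative frechet_derivative f (at x)) (at x)"
  unfolding smooth_on_def using Ck_open_SucD by blast
lemma smooth_on_continuous_on: "smooth_on U f \<Longrightarrow> continuous_on U f"
  unfolding smooth_on_def using Ck_open.simps(1) by blast
lemma smooth_on_frechet_derivative: "smooth_on U f \<Longrightarrow> smooth_on U (\<lambda>x. frechet_derivative f (at x) v)"
  unfolding smooth_on_def using Ck_open.simps(2) by blast

section \<open>A smooth step function\<close>

text \<open>For n = 0 this is the classical function exp(-1/x), which is flat at 0; the members with
  larger n occur in its derivatives.\<close>

definition flat :: "nat \<Rightarrow> real \<Rightarrow> real" where
  "flat n x = (if x \<le> 0 then 0 else inverse x ^ n * exp (- inverse x))"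

text \<open>To the right of 0, the substitution y = 1/x turns this into the limit of y^n / exp y at
  infinity.\<close>

lemma flat_tendsto_0: "(flat n \<longlongrightarrow> 0) (at 0)"
proof -
  have l: "(flat n \<longlongrightarrow> 0) (at_left 0)"
    by (rule tendsto_eventually) (auto simp: eventually_at_left_field flat_def intro: exI[of _ "-1"])
  have "((\<lambda>y. y ^ n / exp y) \<longlongrightarrow> 0) (at_top :: real filter)" by (rule tendsto_power_div_exp_0)
  then have "((\<lambda>x. inverse x ^ n / exp (inverse x)) \<longlongrightarrow> 0) (at_right (0::real))"
    using filterlim_compose filterlim_inverse_at_top_right by blast
  then have r: "(flat n \<longlongrightarrow> 0) (at_right 0)"
    by (rule Lim_transform_eventually)
      (auto simp: eventually_at_right_field flat_def exp_minus field_simps intro: exI[of _ 1])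
  show ?thesis using l r by (simp add: filterlim_split_at)
qed

text \<open>The derivatives of \<open>flat n\<close> are combinations of functions of the same family.\<close>

lemma flat_has_derivative:
  "(flat n has_field_derivative (flat (n + 2) x - n * flat (n + 1) x)) (at x)"
proof -
  consider "x < 0" | "x = 0" | "x > 0" by linarith
  then show ?thesis
  proof cases
    case 1
    have "((\<lambda>x. 0) has_field_derivative 0) (at x)" by simp
    then have "(flat n has_field_derivative 0) (at x)"
      by (rule has_field_derivative_transform_within_open[where S="{..<0}"]) (use 1 in \<open>auto simp: flat_def\<close>)
    then show ?thesis using 1 by (simp add: flat_def)
  next
    case 2
    \<comment> \<open>At 0 the difference quotient is the next member of the family, so the limit
      just proved says that the derivative is 0.\<close>
    have "(flat n (0 + h) - flat n 0) / h = flat (Suc n) h" for h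
      by (simp add: flat_def divide_inverse)
    then have "(flat n has_field_derivative 0) (at 0)"
      unfolding DERIV_def using flat_tendsto_0[of "Suc n"] by presburger
    then show ?thesis using 2 by (simp add: flat_def)
  next
    case 3
    have "((\<lambda>x. inverse x ^ n * exp (- inverse x)) has_field_derivative (flat (n + 2) x - n * flat (n + 1) x)) (at x)"
    proof (rule DERIV_cong)
      show "((\<lambda>x. inverse x ^ n * exp (- inverse x)) has_field_derivative
          (of_nat n * (- (inverse x ^ Suc (Suc 0)) * inverse x ^ (n - Suc 0))) * exp (- inverse x)
            + exp (- inverse x) * - (- (inverse x ^ Suc (Suc 0))) * inverse x ^ n) (at x)"
        using 3 by (intro DERIV_mult DERIV_power DERIV_inverse DERIV_minus DERIV_fun_exp) simp_all
      show "(of_nat n * (- (inverse x ^ Suc (Suc 0)) * inverse x ^ (n - Suc 0))) * exp (- inverse x)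
            + exp (- inverse x) * - (- (inverse x ^ Suc (Suc 0))) * inverse x ^ n
        = flat (n + 2) x - n * flat (n + 1) x"
        using 3 by (cases n) (simp_all add: flat_def algebra_simps)
    qed
    then show ?thesis
      by (rule has_field_derivative_transform_within_open[where S="{0<..}"]) (use 3 in \<open>auto simp: flat_def\<close>)
  qed
qed

lemma Ck_open_flat: "Ck_open k UNIV (flat n)"
proof (induction k arbitrary: n)
  case 0
  have "isCont (flat n) x" for x using flat_has_derivative DERIV_isCont by blast
  then show ?case by (simp add: continuous_at_imp_continuous_on)
next
  case (Suc k)
  show ?case
  proof (rule Ck_open_SucI[where f'="\<lambda>x v. (flat (n + 2) x - n * flat (n + 1) x) * v"])
    show "(flat n has_derivative (\<lambda>v. (flat (n + 2) x - n * flat (n + 1) x) * v)) (at x)" for x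
      using flat_has_derivative[of n x] by (simp add: has_field_derivative_def)
    show "Ck_open k UNIV (\<lambda>x. (flat (n + 2) x - n * flat (n + 1) x) * v)" for v
      by (intro Suc Ck_open_mult Ck_open_diff Ck_open_const open_UNIV)
  qed simp
qed

definition smooth_step :: "real \<Rightarrow> real" where
  "smooth_step x = flat 0 x * inverse (flat 0 x + flat 0 (1 - x))"

lemma flat_nonneg: "flat 0 x \<ge> 0" by (simp add: flat_def)

lemma flat_sum_pos: "flat 0 x + flat 0 (1 - x) > 0"
  by (cases "x \<le> 0") (auto simp: flat_def add_pos_nonneg)

lemma smooth_smooth_step: "smooth_on UNIV smooth_step"
proof -
  have f: "smooth_on UNIV (flat 0)" by (simp add: Ck_open_flat smooth_on_def)
  have "smooth_on UNIV (\<lambda>x. flat 0 (1 - x))"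
    by (rule smooth_on_compose[where V=UNIV]) (auto intro!: smooth_intros f)
  then have "smooth_on UNIV (\<lambda>x. flat 0 x * inverse (flat 0 x + flat 0 (1 - x)))"
    by (intro smooth_intros f) (auto simp: flat_sum_pos)
  then show ?thesis unfolding smooth_step_def[abs_def] .
qed

lemma smooth_step_simps: "x \<le> 0 \<Longrightarrow> smooth_step x = 0" "x \<ge> 1 \<Longrightarrow> smooth_step x = 1"
  by (auto simp: smooth_step_def flat_def)

lemma smooth_step_range: "0 \<le> smooth_step x" "smooth_step x \<le> 1"
  using flat_sum_pos[of x] flat_nonneg[of x] flat_nonneg[of "1-x"]
  by (auto simp: smooth_step_def divide_simps divide_inverse[symmetric])

text \<open>Makes the differences in \<open>time_bump\<close> nonnegative. After clearing
  denominators the claim is f(x) f(1 - y) \<le> f(y) f(1 - x) for the monotone nonnegative function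
  f = \<open>flat 0\<close>.\<close>

lemma smooth_step_mono: assumes "x \<le> y" shows "smooth_step x \<le> smooth_step y"
proof -
  have m: "flat 0 x \<le> flat 0 y" if "x \<le> y" for x y
    using that by (auto simp: flat_def le_imp_inverse_le)
  have "flat 0 x * flat 0 (1 - y) \<le> flat 0 y * flat 0 (1 - x)"
    using assms by (intro mult_mono m flat_nonneg) auto
  then show ?thesis using flat_sum_pos[of x] flat_sum_pos[of y]
    by (simp add: smooth_step_def divide_inverse[symmetric] frac_le_eq divide_nonpos_pos field_simps)
qed

text \<open>This lemma and its companion for upper bounds make constants uniform over the finite
  cover, over \<open>Basis\<close> or over a finite set of functions; they stand for the usual
  minimum or maximum of finitely many constants.\<close>

lemma finite_ex_pos:
  fixes P :: "'i \<Rightarrow> real \<Rightarrow> bool"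
  assumes "finite S" "\<And>i. i \<in> S \<Longrightarrow> \<exists>d>0. P i d"
    and "\<And>i d d'. i \<in> S \<Longrightarrow> P i d \<Longrightarrow> 0 < d' \<Longrightarrow> d' \<le> d \<Longrightarrow> P i d'"
  shows "\<exists>d>0. \<forall>i\<in>S. P i d"
proof -
  obtain f where f: "\<And>i. i \<in> S \<Longrightarrow> f i > 0 \<and> P i (f i)" using assms(2) by metis
  show ?thesis
  proof (cases "S = {}")
    case True then show ?thesis by (auto intro: exI[of _ 1])
  next
    case False
    have "Min (f ` S) > 0" using False f assms(1) by auto
    moreover have "P i (Min (f ` S))" if "i \<in> S" for i
      using assms(3)[OF that, of "f i" "Min (f ` S)"] f that calculation assms(1) by auto
    ultimately show ?thesis by blast
  qed
qed

lemma finite_ex_bound: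
  fixes P :: "'i \<Rightarrow> real \<Rightarrow> bool"
  assumes "finite S" "\<And>i. i \<in> S \<Longrightarrow> \<exists>C. P i C"
    and "\<And>i C C'. i \<in> S \<Longrightarrow> P i C \<Longrightarrow> C \<le> C' \<Longrightarrow> P i C'"
  shows "\<exists>C>0. \<forall>i\<in>S. P i C"
proof -
  obtain f where f: "\<And>i. i \<in> S \<Longrightarrow> P i (f i)" using assms(2) by metis
  have "P i (Max (insert 1 (f ` S)))" if "i \<in> S" for i
    by (rule assms(3)[OF that f[OF that]]) (use that assms(1) in auto)
  moreover have "Max (insert 1 (f ` S)) \<ge> 1" using assms(1) by auto
  ultimately show ?thesis by (intro exI[of _ "Max (insert 1 (f ` S))"]) auto
qed

section \<open>Smoothing by convolution\<close>

text \<open>All derivatives fall on the kernel, so the induction generalizes over \<open>\<kappa>\<close>.\<close>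

lemma Ck_open_convolution:
  fixes f \<kappa> :: "'a::euclidean_space \<Rightarrow> real"
  assumes f: "continuous_on UNIV f"
  shows "smooth_on UNIV \<kappa> \<Longrightarrow> Ck_open k UNIV (\<lambda>x. integral (cbox a b) (\<lambda>z. f z * \<kappa> (x - z)))"
proof (induction k arbitrary: \<kappa>)
  case (0 \<kappa>)
  have k: "continuous_on UNIV \<kappa>" using smooth_on_continuous_on[OF 0] .
  have "continuous_on UNIV (\<lambda>x. integral (cbox a b) (\<lambda>z. f z * \<kappa> (x - z)))"
    by (rule integral_continuous_on_param)
      (auto simp: split_beta intro!: continuous_intros continuous_on_compose2[OF f] continuous_on_compose2[OF k])
  then show ?case by simp
next
  case (Suc k)
  let ?D = "\<lambda>x. frechet_derivative \<kappa> (at x)"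
  have k: "continuous_on UNIV \<kappa>" using smooth_on_continuous_on[OF Suc.prems] .
  have D: "(\<kappa> has_derivative ?D x) (at x)" for x using smooth_on_has_derivative[OF Suc.prems] by simp
  have bl: "bounded_linear (?D x)" for x using D has_derivative_bounded_linear by blast
  have Dc: "continuous_on UNIV (\<lambda>x. ?D x v)" for v
    using smooth_on_continuous_on[OF smooth_on_frechet_derivative[OF Suc.prems]] .
  \<comment> \<open>The Leibniz rule wants the derivative as a continuous family of bounded linear
    maps; in finite dimension its continuity can be checked on each fixed vector.\<close>
  define fx where "fx x z = f z *\<^sub>R Blinfun (?D (x - z))" for x z
  have fx: "blinfun_apply (fx x z) v = f z * ?D (x - z) v" for x z v
    by (simp add: fx_def blinfun.scaleR_left bounded_linear_Blinfun_apply[OF bl])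
  have fxc: "continuous_on S (\<lambda>p. fx (fst p) (snd p))" for S
    by (rule continuous_on_blinfun_componentwise)
      (auto simp: fx intro!: continuous_intros continuous_on_compose2[OF f] continuous_on_compose2[OF Dc])
  have fxi: "fx x integrable_on cbox a b" for x
  proof (rule integrable_continuous)
    have "continuous_on (cbox a b) (\<lambda>z. fx (fst (x, z)) (snd (x, z)))"
      by (rule continuous_on_compose2[OF fxc[of UNIV]]) (auto intro!: continuous_intros)
    then show "continuous_on (cbox a b) (fx x)" by simp
  qed
  show ?case
  proof (rule Ck_open_SucI[where f'="\<lambda>x v. integral (cbox a b) (\<lambda>z. f z * ?D (x - z) v)"])
    fix x :: 'a
    have "((\<lambda>x. integral (cbox a b) (\<lambda>z. f z * \<kappa> (x - z))) has_derivative
        blinfun_apply (integral (cbox a b) (fx x))) (at x within UNIV)"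
    proof (rule leibniz_rule)
      fix x z
      have "((\<lambda>x. \<kappa> (x - z)) has_derivative (\<lambda>v. ?D (x - z) (v - 0))) (at x)"
        by (rule has_derivative_compose[OF has_derivative_diff[OF has_derivative_ident has_derivative_const] D])
      then have "((\<lambda>x. f z * \<kappa> (x - z)) has_derivative (\<lambda>v. f z * ?D (x - z) v)) (at x)"
        using has_derivative_mult_right by fastforce
      moreover have "blinfun_apply (fx x z) = (\<lambda>v. f z * ?D (x - z) v)" using fx by auto
      ultimately show "((\<lambda>x. f z * \<kappa> (x - z)) has_derivative blinfun_apply (fx x z)) (at x within UNIV)"
        by simp
    next
      fix x show "(\<lambda>z. f z * \<kappa> (x - z)) integrable_on cbox a b"
        by (rule integrable_continuous)
          (auto intro!: continuous_intros continuous_on_compose2[OF f] continuous_on_compose2[OF k])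
    next
      show "continuous_on (UNIV \<times> cbox a b) (\<lambda>(x, t). fx x t)"
        using fxc by (simp add: split_beta)
    qed auto
    moreover have "blinfun_apply (integral (cbox a b) (fx x)) v = integral (cbox a b) (\<lambda>z. f z * ?D (x - z) v)" for v
    proof -
      have "integral (cbox a b) ((\<lambda>B. blinfun_apply B v) \<circ> fx x) = blinfun_apply (integral (cbox a b) (fx x)) v"
        by (rule integral_linear[OF fxi bounded_linear_apply_blinfun])
      then show ?thesis by (simp add: o_def fx)
    qed
    ultimately show "((\<lambda>x. integral (cbox a b) (\<lambda>z. f z * \<kappa> (x - z))) has_derivative
      (\<lambda>v. integral (cbox a b) (\<lambda>z. f z * ?D (x - z) v))) (at x)"
      by (metis (no_types, lifting) ext)
  next
    fix v
    show "Ck_open k UNIV (\<lambda>x. integral (cbox a b) (\<lambda>z. f z * ?D (x - z) v))"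
      by (rule Suc.IH[OF smooth_on_frechet_derivative[OF Suc.prems]])
  qed simp
qed

text \<open>Substitution y = x - z, once both integrals are extended by zero to the whole space. The
  left side has \<open>x\<close> in the kernel and carries the smoothness; the right side is a
  weighted sum of translates of \<open>f\<close> and carries the closeness to
  \<open>f\<close>.\<close>

lemma integral_convolution_commute:
  fixes f \<kappa> :: "'a::euclidean_space \<Rightarrow> real"
  assumes f: "continuous_on UNIV f" and k: "continuous_on UNIV \<kappa>"
    and f0: "\<And>x. x \<notin> cbox a b \<Longrightarrow> f x = 0" and k0: "\<And>x. x \<notin> cbox c d \<Longrightarrow> \<kappa> x = 0"
  shows "integral (cbox a b) (\<lambda>z. f z * \<kappa> (x - z)) = integral (cbox c d) (\<lambda>y. f (x - y) * \<kappa> y)"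
proof -
  have "((\<lambda>z. f z * \<kappa> (x - z)) has_integral integral (cbox a b) (\<lambda>z. f z * \<kappa> (x - z))) (cbox a b)"
    by (intro integrable_integral integrable_continuous)
      (auto intro!: continuous_intros continuous_on_compose2[OF f] continuous_on_compose2[OF k])
  from has_integral_affinity[OF this, of "-1" x]
  have 1: "((\<lambda>y. f (x - y) * \<kappa> y) has_integral integral (cbox a b) (\<lambda>z. f z * \<kappa> (x - z)))
      ((\<lambda>z. x - z) ` cbox a b)"
    by (simp add: algebra_simps)
  have 2: "((\<lambda>y. f (x - y) * \<kappa> y) has_integral integral (cbox a b) (\<lambda>z. f z * \<kappa> (x - z))) UNIV"
  proof (rule has_integral_on_superset[OF 1])
    fix y assume y: "y \<notin> (\<lambda>z. x - z) ` cbox a b"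
    have "x - y \<notin> cbox a b"
    proof
      assume "x - y \<in> cbox a b"
      then have "x - (x - y) \<in> (\<lambda>z. x - z) ` cbox a b" by (rule imageI)
      then show False using y by simp
    qed
    then show "f (x - y) * \<kappa> y = 0" using f0 by simp
  qed simp
  have "((\<lambda>y. f (x - y) * \<kappa> y) has_integral integral (cbox c d) (\<lambda>y. f (x - y) * \<kappa> y)) (cbox c d)"
    by (intro integrable_integral integrable_continuous)
      (auto intro!: continuous_intros continuous_on_compose2[OF f] continuous_on_compose2[OF k])
  then have "((\<lambda>y. f (x - y) * \<kappa> y) has_integral integral (cbox c d) (\<lambda>y. f (x - y) * \<kappa> y)) UNIV"
    by (rule has_integral_on_superset) (auto simp: k0)
  with 2 show ?thesis by (rule has_integral_unique)
qed

lemma uniformly_continuous_compact_support: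
  fixes F :: "'a::euclidean_space \<Rightarrow> real"
  assumes F: "continuous_on UNIV F" and F0: "\<And>x. norm x \<ge> R \<Longrightarrow> F x = 0" and "\<epsilon> > 0"
  shows "\<exists>\<delta>>0. \<forall>x y. norm y \<le> \<delta> \<longrightarrow> \<bar>F (x - y) - F x\<bar> \<le> \<epsilon>"
proof -
  have "uniformly_continuous_on (cball 0 (R + 2)) F"
    by (rule compact_uniformly_continuous[OF continuous_on_subset[OF F]]) auto
  then obtain d where d: "d > 0" "\<And>x y. x \<in> cball 0 (R + 2) \<Longrightarrow> y \<in> cball 0 (R + 2) \<Longrightarrow> dist y x < d \<Longrightarrow> dist (F y) (F x) < \<epsilon>"
    unfolding uniformly_continuous_on_def using \<open>\<epsilon> > 0\<close> by metis
  \<comment> \<open>For |x| \<le> R + 1 a shift by at most 1 stays in the ball of radius R + 2,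
    where \<open>F\<close> is uniformly continuous; for larger |x| both values are 0.\<close>
  have "\<bar>F (x - y) - F x\<bar> \<le> \<epsilon>" if "norm y \<le> min (d / 2) 1" for x y
  proof (cases "norm x \<le> R + 1")
    case True
    have "norm (x - y) \<le> R + 2" using norm_triangle_ineq4[of x y] True that by simp
    then show ?thesis using d(2)[of x "x - y"] True that d(1) by (simp add: dist_norm norm_minus_commute less_imp_le)
  next
    case False
    have "norm (x - y) \<ge> R" using norm_triangle_ineq2[of x y] False that by simp
    then show ?thesis using F0[of x] F0[of "x - y"] False \<open>\<epsilon> > 0\<close> by simp
  qed
  then show ?thesis using d(1) by (intro exI[of _ "min (d / 2) 1"]) auto
qed

lemma mem_cbox_One: "norm (x::'a::euclidean_space) \<le> \<delta> \<Longrightarrow> x \<in> cbox (- \<delta> *\<^sub>R One) (\<delta> *\<^sub>R One)"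
  using Basis_le_norm[of _ x] by (fastforce simp: mem_box)

text \<open>Mollification. Values and partial derivatives of the convolution are weighted means of
  values and partial derivatives of \<open>f\<close> at nearby points, so a modulus of continuity
  common to \<open>f\<close> and its partial derivatives controls both errors.\<close>

lemma smooth_C1_approximation:
  fixes f :: "'a::euclidean_space \<Rightarrow> real"
  assumes f': "\<And>x. (f has_derivative f' x) (at x)" and f'c: "\<And>v. continuous_on UNIV (\<lambda>x. f' x v)"
    and f0: "\<And>x. norm x \<ge> R \<Longrightarrow> f x = 0" and "\<epsilon> > 0"
  shows "\<exists>h. smooth_on UNIV h \<and> (\<forall>x. \<bar>h x - f x\<bar> < \<epsilon>) \<and>
    (\<forall>x. \<forall>b\<in>Basis. \<bar>frechet_derivative h (at x) b - f' x b\<bar> < \<epsilon>)"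
proof -
  have f: "continuous_on UNIV f"
    using f' has_derivative_continuous continuous_at_imp_continuous_on by blast
  \<comment> \<open>The radius grows by 1 so that \<open>f\<close> vanishes on a whole neighbourhood
    of \<open>x\<close>.\<close>
  have f'0: "f' x v = 0" if "norm x \<ge> R + 1" for x v
  proof -
    have "((\<lambda>x. 0) has_derivative f' x) (at x)"
      by (rule has_derivative_transform_within_open[OF f', of "- cball 0 R"]) (use that f0 in auto)
    then have "f' x = (\<lambda>v. 0)"
      using has_derivative_unique[OF _ has_derivative_const] by blast
    then show ?thesis by simp
  qed
  define \<F> where "\<F> = insert f ((\<lambda>b x. f' x b) ` Basis)"
  have "\<exists>\<delta>>0. \<forall>F\<in>\<F>. \<forall>x y. norm y \<le> \<delta> \<longrightarrow> \<bar>F (x - y) - F x\<bar> \<le> \<epsilon> / 2"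
  proof (rule finite_ex_pos)
    fix F assume "F \<in> \<F>"
    then have "continuous_on UNIV F" "\<And>x. norm x \<ge> R + 1 \<Longrightarrow> F x = 0"
      using f f'c f'0 f0 by (auto simp: \<F>_def)
    then show "\<exists>\<delta>>0. \<forall>x y. norm y \<le> \<delta> \<longrightarrow> \<bar>F (x - y) - F x\<bar> \<le> \<epsilon> / 2"
      by (rule uniformly_continuous_compact_support) (use \<open>\<epsilon> > 0\<close> in auto)
  qed (auto simp: \<F>_def)
  then obtain \<delta> where \<delta>: "\<delta> > 0" "\<And>F x y. F \<in> \<F> \<Longrightarrow> norm y \<le> \<delta> \<Longrightarrow> \<bar>F (x - y) - F x\<bar> \<le> \<epsilon> / 2"
    by blast
  \<comment> \<open>The kernel is 1 at the origin and 0 at distance \<open>\<delta>\<close> or more.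
    It is not normalized; its integral \<open>c\<close> is divided out afterwards.\<close>
  define \<kappa> :: "'a \<Rightarrow> real" where "\<kappa> y = smooth_step (1 - (y \<bullet> y) * inverse (\<delta>\<^sup>2))" for y
  have ks: "smooth_on UNIV \<kappa>"
    unfolding \<kappa>_def[abs_def]
    by (rule smooth_on_compose[OF _ _ smooth_smooth_step]) (auto intro!: smooth_intros)
  have k: "continuous_on UNIV \<kappa>" using smooth_on_continuous_on[OF ks] .
  have k_nonneg: "\<kappa> y \<ge> 0" for y by (simp add: \<kappa>_def smooth_step_range)
  have k0: "\<kappa> y = 0" if "norm y \<ge> \<delta>" for y
  proof -
    have "\<delta>\<^sup>2 \<le> y \<bullet> y" using that \<delta>(1) by (simp add: power2_norm_eq_inner[symmetric])
    then have "1 - (y \<bullet> y) * inverse (\<delta>\<^sup>2) \<le> 0"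
      using \<delta>(1) by (simp add: divide_inverse[symmetric])
    then show ?thesis by (simp add: \<kappa>_def smooth_step_simps)
  qed
  have k00: "\<kappa> 0 = 1" by (simp add: \<kappa>_def smooth_step_simps)
  define Q :: "'a set" where "Q = cbox (- \<delta> *\<^sub>R One) (\<delta> *\<^sub>R One)"
  have kQ: "\<kappa> y = 0" if "y \<notin> Q" for y
    using that k0[of y] mem_cbox_One[of y \<delta>] unfolding Q_def by force
  define c where "c = integral Q \<kappa>"
  have kI: "(\<kappa> has_integral c) Q"
    unfolding c_def Q_def by (intro integrable_integral integrable_continuous continuous_on_subset[OF k]) simp
  have c: "c > 0"
  proof -
    have "c \<ge> 0" using has_integral_nonneg[OF kI] k_nonneg by simp
    \<comment> \<open>A continuous nonnegative function with integral 0 over a nondegenerate box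
      vanishes on it, contrary to the value 1 at the origin.\<close>
    moreover have "c \<noteq> 0"
    proof
      assume "c = 0"
      then have "\<kappa> 0 = 0"
        using has_integral_0_cbox_imp_0[OF continuous_on_subset[OF k] k_nonneg, where a="- \<delta> *\<^sub>R One" and b="\<delta> *\<^sub>R One" and x=0] kI \<delta>(1)
        by (auto simp: box_ne_empty mem_box Q_def)
      then show False using k00 by simp
    qed
    ultimately show ?thesis by simp
  qed
  have avg: "\<bar>integral Q (\<lambda>y. F (x - y) * \<kappa> y) / c - F x\<bar> < \<epsilon>" if F: "F \<in> \<F>" for F x
  proof -
    have Fc: "continuous_on UNIV F" using F f f'c by (auto simp: \<F>_def)
    have i1: "(\<lambda>y. F (x - y) * \<kappa> y) integrable_on Q"
      unfolding Q_def
      by (intro integrable_continuous continuous_intros continuous_on_compose2[OF Fc] continuous_on_subset[OF k]) auto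
    have i2: "((\<lambda>y. F x * \<kappa> y) has_integral F x * c) Q"
      by (rule has_integral_mult_right[OF kI])
    have i3: "((\<lambda>y. \<epsilon> / 2 * \<kappa> y) has_integral \<epsilon> / 2 * c) Q"
      by (rule has_integral_mult_right[OF kI])
    have i4: "((\<lambda>y. F (x - y) * \<kappa> y - F x * \<kappa> y) has_integral integral Q (\<lambda>y. F (x - y) * \<kappa> y) - F x * c) Q"
      by (rule has_integral_diff[OF integrable_integral[OF i1] i2])
    have "norm (integral Q (\<lambda>y. F (x - y) * \<kappa> y - F x * \<kappa> y)) \<le> integral Q (\<lambda>y. \<epsilon> / 2 * \<kappa> y)"
    proof (rule integral_norm_bound_integral)
      fix y
      show "norm (F (x - y) * \<kappa> y - F x * \<kappa> y) \<le> \<epsilon> / 2 * \<kappa> y"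
      proof (cases "norm y \<le> \<delta>")
        case True
        have "norm (F (x - y) * \<kappa> y - F x * \<kappa> y) = \<bar>F (x - y) - F x\<bar> * \<kappa> y"
          using k_nonneg[of y] by (simp add: abs_mult left_diff_distrib[symmetric])
        also have "\<dots> \<le> \<epsilon> / 2 * \<kappa> y" by (intro mult_right_mono \<delta>(2) F True k_nonneg)
        finally show ?thesis .
      qed (simp add: k0)
    qed (use i4 i3 in \<open>auto simp: has_integral_integrable\<close>)
    then have "\<bar>integral Q (\<lambda>y. F (x - y) * \<kappa> y) - F x * c\<bar> \<le> \<epsilon> / 2 * c"
      unfolding integral_unique[OF i4] integral_unique[OF i3] by simp
    then have "\<bar>(integral Q (\<lambda>y. F (x - y) * \<kappa> y) - F x * c) / c\<bar> \<le> \<epsilon> / 2"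
      using c by (simp add: abs_divide pos_divide_le_eq)
    also have "(integral Q (\<lambda>y. F (x - y) * \<kappa> y) - F x * c) / c = integral Q (\<lambda>y. F (x - y) * \<kappa> y) / c - F x"
      using c by (simp add: diff_divide_distrib)
    finally show ?thesis using \<open>\<epsilon> > 0\<close> by linarith
  qed
  define P :: "'a set" where "P = cbox (- R *\<^sub>R One) (R *\<^sub>R One)"
  define h where "h x = inverse c * integral P (\<lambda>z. f z * \<kappa> (x - z))" for x
  have fP: "f y = 0" if "y \<notin> P" for y
    using that f0[of y] mem_cbox_One[of y R] unfolding P_def by force
  have hs: "smooth_on UNIV h"
    unfolding h_def[abs_def] P_def smooth_on_def
    by (intro allI Ck_open_mult Ck_open_const Ck_open_convolution f ks) simp_all
  have h_eq: "h x = integral Q (\<lambda>y. f (x - y) * \<kappa> y) / c" for x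
  proof -
    have "integral P (\<lambda>z. f z * \<kappa> (x - z)) = integral Q (\<lambda>y. f (x - y) * \<kappa> y)"
      unfolding Q_def P_def
      by (rule integral_convolution_commute[OF f k]; (rule fP[unfolded P_def] | rule kQ[unfolded Q_def]); assumption)
    then show ?thesis by (simp add: h_def divide_inverse)
  qed
  \<comment> \<open>\<open>h\<close> is already known to be differentiable, through the form with
    \<open>x\<close> in the kernel. It remains to compute its derivative along a line, where the
    Leibniz rule in one real variable applies to the form with \<open>x\<close> in
    \<open>f\<close>.\<close>
  have h': "frechet_derivative h (at x) b = integral Q (\<lambda>y. f' (x - y) b * \<kappa> y) / c" for x b
  proof -
    have l: "linear (f' z)" for z using f' has_derivative_linear by blast
    have "((\<lambda>s. integral Q (\<lambda>y. f (x + s *\<^sub>R b - y) * \<kappa> y)) has_vector_derivative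
        integral Q (\<lambda>y. f' (x + 0 *\<^sub>R b - y) b * \<kappa> y)) (at 0 within UNIV)"
      unfolding Q_def
    proof (rule leibniz_rule_vector_derivative)
      fix s :: real and y
      have "((\<lambda>s. f (x + s *\<^sub>R b - y)) has_derivative (\<lambda>v. f' (x + s *\<^sub>R b - y) (v *\<^sub>R b))) (at s)"
        by (rule has_derivative_compose[OF _ f']) (auto intro!: derivative_eq_intros)
      then have "((\<lambda>s. f (x + s *\<^sub>R b - y)) has_vector_derivative f' (x + s *\<^sub>R b - y) b) (at s)"
        unfolding has_vector_derivative_def by (simp add: linear_scale[OF l])
      then show "((\<lambda>s. f (x + s *\<^sub>R b - y) * \<kappa> y) has_vector_derivative f' (x + s *\<^sub>R b - y) b * \<kappa> y) (at s within UNIV)"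
        by (simp add: has_vector_derivative_mult_left)
    next
      fix s :: real
      show "(\<lambda>y. f (x + s *\<^sub>R b - y) * \<kappa> y) integrable_on cbox (- \<delta> *\<^sub>R One) (\<delta> *\<^sub>R One)"
        by (intro integrable_continuous continuous_intros continuous_on_compose2[OF f] continuous_on_subset[OF k]) auto
    next
      show "continuous_on (UNIV \<times> cbox (- \<delta> *\<^sub>R One) (\<delta> *\<^sub>R One)) (\<lambda>(s, y). f' (x + s *\<^sub>R b - y) b * \<kappa> y)"
        unfolding split_beta
        by (intro continuous_intros continuous_on_compose2[OF f'c] continuous_on_compose2[OF k]) auto
    qed auto
    then have "((\<lambda>s. integral Q (\<lambda>y. f (x + s *\<^sub>R b - y) * \<kappa> y) / c) has_vector_derivative
        integral Q (\<lambda>y. f' (x - y) b * \<kappa> y) / c) (at 0)"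
      by (intro has_vector_derivative_divide) simp
    then have 1: "((\<lambda>s. h (x + s *\<^sub>R b)) has_vector_derivative integral Q (\<lambda>y. f' (x - y) b * \<kappa> y) / c) (at 0)"
      by (simp add: h_eq)
    note hD = smooth_on_has_derivative[OF hs, simplified]
    have "((\<lambda>s. h (x + s *\<^sub>R b)) has_derivative (\<lambda>v. frechet_derivative h (at (x + 0 *\<^sub>R b)) (v *\<^sub>R b))) (at 0)"
      by (rule has_derivative_compose[OF _ hD]) (auto intro!: derivative_eq_intros)
    then have "((\<lambda>s. h (x + s *\<^sub>R b)) has_vector_derivative frechet_derivative h (at x) b) (at 0)"
      unfolding has_vector_derivative_def by (simp add: linear_scale[OF has_derivative_linear[OF hD]])
    then show ?thesis using 1 vector_derivative_unique_at by blast
  qed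
  have "\<forall>x. \<bar>h x - f x\<bar> < \<epsilon>" using avg[of f] by (auto simp: \<F>_def h_eq)
  moreover have "\<forall>x. \<forall>b\<in>Basis. \<bar>frechet_derivative h (at x) b - f' x b\<bar> < \<epsilon>"
  proof (intro allI ballI)
    fix x and b :: 'a assume "b \<in> Basis"
    then have "(\<lambda>x. f' x b) \<in> \<F>" by (auto simp: \<F>_def)
    from avg[OF this, of x] show "\<bar>frechet_derivative h (at x) b - f' x b\<bar> < \<epsilon>" by (simp add: h')
  qed
  ultimately show ?thesis using hs by blast
qed

section \<open>Ordinary differential equations\<close>

text \<open>For E = D + b/a the hypothesis reads |E'| \<le> a E, so E(t) exp(a t) increases and E(t)
  exp(-a t) decreases; the order of \<open>s\<close> and \<open>t\<close> decides which of the two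
  gives the bound. Inverse flows are compared by running solutions backwards, hence both
  orders.\<close>

lemma gronwall:
  fixes D :: "real \<Rightarrow> real"
  assumes D: "\<And>t. t \<in> {0..1} \<Longrightarrow> (D has_real_derivative D' t) (at t within {0..1})"
    and D': "\<And>t. t \<in> {0..1} \<Longrightarrow> \<bar>D' t\<bar> \<le> a * D t + b"
    and nonneg: "\<And>t. t \<in> {0..1} \<Longrightarrow> 0 \<le> D t" and a: "a > 0" and b: "b \<ge> 0"
    and st: "s \<in> {0..1}" "t \<in> {0..1}"
  shows "D t \<le> (D s + b / a) * exp a"
proof -
  have aux: "(D t + b / a) * exp (\<sigma> * a * t) \<le> (D s + b / a) * exp (\<sigma> * a * s)"
    if \<sigma>: "\<sigma> = 1 \<and> t \<le> s \<or> \<sigma> = -1 \<and> s \<le> t" for \<sigma>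
  proof -
    let ?F = "\<lambda>\<tau>. (D \<tau> + b / a) * exp (\<sigma> * a * \<tau>)"
    let ?F' = "\<lambda>\<tau>. (D' \<tau> + \<sigma> * (a * D \<tau> + b)) * exp (\<sigma> * a * \<tau>)"
    have F: "(?F has_derivative (\<lambda>h. h * ?F' \<tau>)) (at \<tau> within {u..v})"
      if "u \<in> {0..1}" "v \<in> {0..1}" "\<tau> \<in> {u..v}" for u v \<tau>
    proof -
      have D: "(D has_real_derivative D' \<tau>) (at \<tau> within {u..v})"
        by (rule DERIV_subset[OF D]) (use that in auto)
      have "(?F has_real_derivative ?F' \<tau>) (at \<tau> within {u..v})"
        using a by (auto intro!: derivative_eq_intros D simp: field_simps)
      then show ?thesis by (simp only: has_field_derivative_def mult.commute[of _ "?F' \<tau>"])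
    qed
    have lb: "D' \<tau> \<le> a * D \<tau> + b \<and> - (a * D \<tau> + b) \<le> D' \<tau>" if "\<tau> \<in> {0..1}" for \<tau>
      using D'[OF that] by linarith
    from \<sigma> show ?thesis
    proof
      assume h: "\<sigma> = 1 \<and> t \<le> s"
      have "\<exists>\<tau>\<in>{t..s}. ?F s - ?F t = (s - t) * ?F' \<tau>"
        by (rule mvt_very_simple) (use h F[OF st(2,1)] in auto)
      then obtain \<tau> where \<tau>: "\<tau> \<in> {t..s}" "?F s - ?F t = (s - t) * ?F' \<tau>" by blast
      have "(s - t) * ?F' \<tau> \<ge> 0"
        using lb[of \<tau>] \<tau>(1) st h by (intro mult_nonneg_nonneg) auto
      then show ?thesis using \<tau> by linarith
    next
      assume h: "\<sigma> = -1 \<and> s \<le> t"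
      have "\<exists>\<tau>\<in>{s..t}. ?F t - ?F s = (t - s) * ?F' \<tau>"
        by (rule mvt_very_simple) (use h F[OF st] in auto)
      then obtain \<tau> where \<tau>: "\<tau> \<in> {s..t}" "?F t - ?F s = (t - s) * ?F' \<tau>" by blast
      have "(t - s) * ?F' \<tau> \<le> 0"
        using lb[of \<tau>] \<tau>(1) st h by (intro mult_nonneg_nonpos mult_nonpos_nonneg) auto
      then show ?thesis using \<tau> by linarith
    qed
  qed
  define \<sigma> :: real where "\<sigma> = (if t \<le> s then 1 else -1)"
  have "(D t + b / a) * exp (\<sigma> * a * t) \<le> (D s + b / a) * exp (\<sigma> * a * s)"
    by (rule aux) (auto simp: \<sigma>_def)
  then have "(D t + b / a) * exp (\<sigma> * a * t) * exp (- (\<sigma> * a * t)) \<le> (D s + b / a) * exp (\<sigma> * a * s) * exp (- (\<sigma> * a * t))"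
    by (rule mult_right_mono) simp
  then have "D t + b / a \<le> (D s + b / a) * exp (\<sigma> * a * s - \<sigma> * a * t)"
    by (simp add: mult.assoc flip: exp_add)
  also have "\<dots> \<le> (D s + b / a) * exp a"
  proof (intro mult_left_mono)
    \<comment> \<open>Two times in the unit interval differ by at most 1, which leaves the exponent
      \<open>a\<close>.\<close>
    have "a * (\<sigma> * (s - t)) \<le> a * 1" using a st by (intro mult_left_mono) (auto simp: \<sigma>_def)
    then show "exp (\<sigma> * a * s - \<sigma> * a * t) \<le> exp a" by (simp add: algebra_simps)
    show "0 \<le> D s + b / a" using nonneg[OF st(1)] a b by simp
  qed
  finally show ?thesis using a b by (smt (verit) divide_nonneg_pos)
qed

text \<open>The initial time may lie anywhere in the interval, so that forward and backward
  solutions are obtained together. The displacement from \<open>u0\<close> is a difference of two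
  integrals starting at \<open>a\<close>, each at most (b - a) m, whence the factor 2; in the
  condition on \<open>L\<close> this factor is doubled once more to reach the contraction constant
  1/2.\<close>

lemma picard_local:
  fixes X :: "real \<Rightarrow> 'a::euclidean_space \<Rightarrow> 'a"
  assumes t0: "t0 \<in> {a..b}" and r: "r \<ge> 0"
    and cont: "continuous_on ({a..b} \<times> cball u0 r) (\<lambda>(t, u). X t u)"
    and lip: "\<And>t u v. t \<in> {a..b} \<Longrightarrow> u \<in> cball u0 r \<Longrightarrow> v \<in> cball u0 r \<Longrightarrow> norm (X t u - X t v) \<le> L * norm (u - v)"
    and m: "\<And>t u. t \<in> {a..b} \<Longrightarrow> u \<in> cball u0 r \<Longrightarrow> norm (X t u) \<le> m"
    and small: "2 * (b - a) * m \<le> r" "4 * (b - a) * L \<le> 1" and L: "L \<ge> 0"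
  obtains \<gamma> where "\<gamma> t0 = u0" "\<And>t. t \<in> {a..b} \<Longrightarrow> \<gamma> t \<in> cball u0 r"
    "\<And>t. t \<in> {a..b} \<Longrightarrow> (\<gamma> has_vector_derivative X t (\<gamma> t)) (at t within {a..b})"
proof -
  have ab: "a \<le> b" using t0 by simp
  \<comment> \<open>Bounded continuous functions on the whole line, confined to the ball only at
    times in \<open>{a..b}\<close>: a closed subset of a complete space.\<close>
  define S where "S = PiC {a..b} (\<lambda>_. cball u0 r)"
  have S: "apply_bcontfun \<gamma> t \<in> cball u0 r" if "\<gamma> \<in> S" "t \<in> {a..b}" for \<gamma> t
    using that by (auto simp: S_def mem_PiC_iff)
  define F where "F \<gamma> t = integral {a..t} (\<lambda>s. X s (apply_bcontfun \<gamma> s))" for \<gamma> t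
  have Xc: "continuous_on {a..b} (\<lambda>s. X s (apply_bcontfun \<gamma> s))" if "\<gamma> \<in> S" for \<gamma>
  proof -
    have "continuous_on {a..b} (\<lambda>s. (\<lambda>(t, u). X t u) (s, apply_bcontfun \<gamma> s))"
      by (rule continuous_on_compose2[OF cont]) (use S[OF that] in \<open>auto intro!: continuous_intros\<close>)
    then show ?thesis by simp
  qed
  have F': "(F \<gamma> has_vector_derivative X t (apply_bcontfun \<gamma> t)) (at t within {a..b})"
    if "\<gamma> \<in> S" "t \<in> {a..b}" for \<gamma> t
    unfolding F_def[abs_def] using integral_has_vector_derivative[OF Xc[OF that(1)] that(2)] by simp
  have Fc: "continuous_on {a..b} (F \<gamma>)" if "\<gamma> \<in> S" for \<gamma>
    using F'[OF that] has_vector_derivative_continuous continuous_on_eq_continuous_within by blast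
  have m0: "m \<ge> 0" using order_trans[OF norm_ge_zero m[OF t0, of u0]] r by simp
  have Fm: "norm (F \<gamma> t) \<le> (b - a) * m" if "\<gamma> \<in> S" "t \<in> {a..b}" for \<gamma> t
  proof -
    have "norm (F \<gamma> t) \<le> m * (t - a)"
      unfolding F_def
      by (rule integral_bound) (use that S m in \<open>auto intro: continuous_on_subset[OF Xc[OF that(1)]]\<close>)
    also have "\<dots> \<le> m * (b - a)" using that m0 by (intro mult_left_mono) auto
    finally show ?thesis by (simp add: mult.commute)
  qed
  have FL: "norm (F \<gamma> t - F \<eta> t) \<le> (b - a) * (L * dist \<gamma> \<eta>)" if "\<gamma> \<in> S" "\<eta> \<in> S" "t \<in> {a..b}" for \<gamma> \<eta> t
  proof -
    have sub: "{a..t} \<subseteq> {a..b}" using that by auto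
    have "F \<gamma> t - F \<eta> t = integral {a..t} (\<lambda>s. X s (apply_bcontfun \<gamma> s) - X s (apply_bcontfun \<eta> s))"
      unfolding F_def
      by (rule integral_diff[symmetric];
          intro integrable_continuous_interval continuous_on_subset[OF Xc sub] that)
    also have "norm \<dots> \<le> (L * dist \<gamma> \<eta>) * (t - a)"
    proof (rule integral_bound)
      show "continuous_on {a..t} (\<lambda>s. X s (apply_bcontfun \<gamma> s) - X s (apply_bcontfun \<eta> s))"
        by (intro continuous_on_diff continuous_on_subset[OF Xc sub] that)
      fix s assume s: "s \<in> {a..t}"
      have "norm (X s (apply_bcontfun \<gamma> s) - X s (apply_bcontfun \<eta> s)) \<le> L * norm (apply_bcontfun \<gamma> s - apply_bcontfun \<eta> s)"
        using s sub S that by (intro lip) auto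
      also have "\<dots> \<le> L * dist \<gamma> \<eta>"
        using L dist_bounded[of \<gamma> s \<eta>] by (intro mult_left_mono) (auto simp: dist_norm)
      finally show "norm (X s (apply_bcontfun \<gamma> s) - X s (apply_bcontfun \<eta> s)) \<le> L * dist \<gamma> \<eta>" .
    qed (use that in auto)
    also have "\<dots> \<le> (L * dist \<gamma> \<eta>) * (b - a)" using that L by (intro mult_left_mono) auto
    finally show ?thesis by (simp add: mult.commute)
  qed
  \<comment> \<open>The Picard iterate is meaningful on \<open>{a..b}\<close> only;
    \<open>clamp\<close> continues it constantly beyond the end points, so that it becomes an
    element of the function space.\<close>
  have "\<exists>g. \<forall>t. apply_bcontfun g t = u0 + F \<gamma> (clamp a b t) - F \<gamma> t0" if "\<gamma> \<in> S" for \<gamma>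
  proof -
    have "continuous_on (cbox a b) (\<lambda>t. u0 + F \<gamma> t - F \<gamma> t0)"
      using Fc[OF that] by (auto intro!: continuous_intros)
    from continuous_on_cbox_bcontfunE[OF this] show ?thesis by metis
  qed
  then obtain P where P: "\<And>\<gamma> t. \<gamma> \<in> S \<Longrightarrow> apply_bcontfun (P \<gamma>) t = u0 + F \<gamma> (clamp a b t) - F \<gamma> t0"
    by metis
  have cl: "clamp a b t \<in> {a..b}" for t using clamp_in_interval[of a b t] ab by simp
  have cl': "clamp a b t = t" if "t \<in> {a..b}" for t using that by simp
  have "\<exists>!\<gamma>. \<gamma> \<in> S \<and> P \<gamma> = \<gamma>"
  proof (rule Banach_fix[where c="1/2"])
    show "complete S" unfolding S_def complete_eq_closed by (rule closed_PiC) simp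
    have "const_bcontfun u0 \<in> S" using r by (simp add: S_def mem_PiC_iff const_bcontfun.rep_eq)
    then show "S \<noteq> {}" by blast
    show "P ` S \<subseteq> S"
    proof
      fix g assume "g \<in> P ` S"
      then obtain \<gamma> where \<gamma>: "\<gamma> \<in> S" "g = P \<gamma>" by blast
      have "apply_bcontfun g t \<in> cball u0 r" for t
      proof -
        have "norm (F \<gamma> (clamp a b t) - F \<gamma> t0) \<le> (b - a) * m + (b - a) * m"
          by (rule order_trans[OF norm_triangle_ineq4 add_mono[OF Fm[OF \<gamma>(1) cl] Fm[OF \<gamma>(1) t0]]])
        then show ?thesis using small(1) by (simp add: \<gamma>(2) P[OF \<gamma>(1)] dist_norm norm_minus_commute algebra_simps)
      qed
      then show "g \<in> S" by (auto simp: S_def mem_PiC_iff)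
    qed
    show "dist (P \<gamma>) (P \<eta>) \<le> 1 / 2 * dist \<gamma> \<eta>" if "\<gamma> \<in> S" "\<eta> \<in> S" for \<gamma> \<eta>
    proof (rule dist_bound)
      fix t
      have "norm ((F \<gamma> (clamp a b t) - F \<eta> (clamp a b t)) - (F \<gamma> t0 - F \<eta> t0)) \<le> (b - a) * (L * dist \<gamma> \<eta>) + (b - a) * (L * dist \<gamma> \<eta>)"
        by (rule order_trans[OF norm_triangle_ineq4 add_mono]; rule FL) (use that cl t0 in auto)
      also have "\<dots> = (4 * (b - a) * L) * (1/2 * dist \<gamma> \<eta>)" by (simp add: algebra_simps)
      also have "\<dots> \<le> 1 * (1/2 * dist \<gamma> \<eta>)" using small(2) by (intro mult_right_mono) auto
      finally show "dist (apply_bcontfun (P \<gamma>) t) (apply_bcontfun (P \<eta>) t) \<le> 1 / 2 * dist \<gamma> \<eta>"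
        using that by (simp add: P dist_norm algebra_simps)
    qed
  qed simp_all
  then obtain \<gamma> where \<gamma>: "\<gamma> \<in> S" "P \<gamma> = \<gamma>" by blast
  have eq: "apply_bcontfun \<gamma> t = u0 + F \<gamma> t - F \<gamma> t0" if "t \<in> {a..b}" for t
    using P[OF \<gamma>(1), of t] \<gamma>(2) cl'[OF that] by simp
  show ?thesis
  proof
    show "apply_bcontfun \<gamma> t0 = u0" using eq[OF t0] by simp
    show "apply_bcontfun \<gamma> t \<in> cball u0 r" if "t \<in> {a..b}" for t using S[OF \<gamma>(1) that] .
    show "(apply_bcontfun \<gamma> has_vector_derivative X t (apply_bcontfun \<gamma> t)) (at t within {a..b})"
      if "t \<in> {a..b}" for t
    proof (rule has_vector_derivative_transform[OF that])
      show "((\<lambda>t. u0 + F \<gamma> t - F \<gamma> t0) has_vector_derivative X t (apply_bcontfun \<gamma> t)) (at t within {a..b})"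
        using has_vector_derivative_diff[OF has_vector_derivative_add[OF has_vector_derivative_const F'[OF \<gamma>(1) that]] has_vector_derivative_const]
        by simp
    qed (simp add: eq)
  qed
qed

section \<open>Charts and smooth functions on a closed manifold\<close>

locale closed_manifold =
  fixes A :: "('m::t2_space, 'e::euclidean_space) chart set"
  assumes closed_connected_manifold: "closed_connected_manifold A"
begin

definition overlap :: "('m, 'e) chart \<Rightarrow> ('m, 'e) chart \<Rightarrow> 'e set" where
  "overlap c c' = cmap c ` (cdom c \<inter> cdom c')"

lemma atlas: "smooth_atlas A" and compact_UNIV: "compact (UNIV :: 'm set)"
  using closed_connected_manifold by (auto simp: closed_connected_manifold_def)

lemma chart:
  assumes "c \<in> A"
  shows open_cdom: "open (cdom c)" and open_cran: "open (cran c)"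
    and homeo: "homeomorphism (cdom c) (cran c) (cmap c) (cinv c)"
  using atlas assms by (auto simp: smooth_atlas_def)

lemma cinv_cmap [simp]: "c \<in> A \<Longrightarrow> p \<in> cdom c \<Longrightarrow> cinv c (cmap c p) = p"
  using homeomorphism_apply1[OF homeo] .
lemma cmap_cinv [simp]: "c \<in> A \<Longrightarrow> u \<in> cran c \<Longrightarrow> cmap c (cinv c u) = u"
  using homeomorphism_apply2[OF homeo] .
lemma cinv_in [simp]: "c \<in> A \<Longrightarrow> u \<in> cran c \<Longrightarrow> cinv c u \<in> cdom c"
  using homeomorphism_image2[OF homeo] by blast
lemma cmap_in [simp]: "p \<in> cdom c \<Longrightarrow> cmap c p \<in> cran c"
  by (auto simp: cran_def)
lemma continuous_cmap: "c \<in> A \<Longrightarrow> continuous_on (cdom c) (cmap c)"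
  using homeomorphism_cont1[OF homeo] .
lemma continuous_cinv: "c \<in> A \<Longrightarrow> continuous_on (cran c) (cinv c)"
  using homeomorphism_cont2[OF homeo] .

lemma ex_chart: "\<exists>c\<in>A. p \<in> cdom c"
  using atlas by (auto simp: smooth_atlas_def)

lemma overlap_iff: "c \<in> A \<Longrightarrow> u \<in> overlap c c' \<longleftrightarrow> u \<in> cran c \<and> cinv c u \<in> cdom c'"
  by (auto simp: overlap_def cran_def intro!: image_eqI[of u "cmap c" "cinv c u"])

lemma open_cran_preimage:
  assumes c: "c \<in> A" and "open W"
  shows "open (cran c \<inter> cinv c -` W)"
  using continuous_open_preimage[OF continuous_cinv open_cran] assms by auto

lemma open_cdom_preimage:
  assumes c: "c \<in> A" and "open W"
  shows "open (cdom c \<inter> cmap c -` W)"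
  using continuous_open_preimage[OF continuous_cmap open_cdom] assms by auto

lemma open_overlap: "c \<in> A \<Longrightarrow> c' \<in> A \<Longrightarrow> open (overlap c c')"
proof -
  assume a: "c \<in> A" "c' \<in> A"
  have "overlap c c' = cran c \<inter> cinv c -` cdom c'" by (rule set_eqI) (simp add: overlap_iff[OF a(1)])
  then show ?thesis using open_cran_preimage[OF a(1) open_cdom[OF a(2)]] by simp
qed

lemma smooth_transition: "c \<in> A \<Longrightarrow> c' \<in> A \<Longrightarrow> smooth_on (overlap c c') (transition c c')"
  using atlas C_on_infinity_open[OF open_overlap, of c c' "transition c c'"]
  unfolding smooth_atlas_def overlap_def by blast

lemma jac_has_derivative:
  "c \<in> A \<Longrightarrow> c' \<in> A \<Longrightarrow> u \<in> overlap c c' \<Longrightarrow> (transition c c' has_derivative jac c c' u) (at u)"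
  unfolding jac_def by (rule smooth_on_has_derivative[OF smooth_transition])

lemma linear_jac: "c \<in> A \<Longrightarrow> c' \<in> A \<Longrightarrow> u \<in> overlap c c' \<Longrightarrow> linear (jac c c' u)"
  using jac_has_derivative has_derivative_linear by blast

lemma transition_cmap [simp]: "c \<in> A \<Longrightarrow> p \<in> cdom c \<Longrightarrow> transition c c' (cmap c p) = cmap c' p"
  by (simp add: transition_def)

lemma cmap_overlap: "p \<in> cdom c \<Longrightarrow> p \<in> cdom c' \<Longrightarrow> cmap c p \<in> overlap c c'"
  by (auto simp: overlap_def)

lemma cinv_transition: "c \<in> A \<Longrightarrow> c' \<in> A \<Longrightarrow> u \<in> overlap c c' \<Longrightarrow> cinv c' (transition c c' u) = cinv c u"
  by (simp add: transition_def overlap_iff)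

lemma transition_overlap:
  "c \<in> A \<Longrightarrow> c' \<in> A \<Longrightarrow> u \<in> overlap c c' \<Longrightarrow> transition c c' u \<in> overlap c' c"
  by (metis cinv_in cmap_overlap comp_apply overlap_iff transition_def)

lemma transition_cran: "c \<in> A \<Longrightarrow> c' \<in> A \<Longrightarrow> u \<in> overlap c c' \<Longrightarrow> transition c c' u \<in> cran c'"
  using transition_overlap overlap_iff by blast

lemma jac_cocycle:
  assumes c: "c \<in> A" "c' \<in> A" "c'' \<in> A" and p: "p \<in> cdom c" "p \<in> cdom c'" "p \<in> cdom c''"
  shows "jac c' c'' (cmap c' p) (jac c c' (cmap c p) v) = jac c c'' (cmap c p) v"
proof -
  let ?u = "cmap c p"
  have t: "transition c c' ?u = cmap c' p" using c p by simp
  have "(transition c c' has_derivative jac c c' ?u) (at ?u)"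
    using c p by (intro jac_has_derivative cmap_overlap)
  moreover have "(transition c' c'' has_derivative jac c' c'' (cmap c' p)) (at (transition c c' ?u))"
    unfolding t using c p by (intro jac_has_derivative cmap_overlap)
  ultimately have 1: "((\<lambda>y. transition c' c'' (transition c c' y)) has_derivative
      (\<lambda>v. jac c' c'' (cmap c' p) (jac c c' ?u v))) (at ?u)"
    by (rule has_derivative_compose)
  have 2: "(transition c c'' has_derivative (\<lambda>v. jac c' c'' (cmap c' p) (jac c c' ?u v))) (at ?u)"
  proof (rule has_derivative_transform_within_open[OF 1])
    show "open (overlap c c')" using c by (simp add: open_overlap)
    show "?u \<in> overlap c c'" using p cmap_overlap by blast
    show "transition c' c'' (transition c c' y) = transition c c'' y" if "y \<in> overlap c c'" for y
      using that c by (simp add: transition_def overlap_iff)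
  qed
  have "(transition c c'' has_derivative jac c c'' ?u) (at ?u)"
    using c p by (intro jac_has_derivative cmap_overlap)
  then show ?thesis using has_derivative_unique[OF 2] by metis
qed

lemma jac_self:
  assumes "c \<in> A" "u \<in> cran c"
  shows "jac c c u v = v"
proof -
  have "((\<lambda>x. x) has_derivative (\<lambda>v. v)) (at u)" by simp
  then have "(transition c c has_derivative (\<lambda>v. v)) (at u)"
    by (rule has_derivative_transform_within_open[OF _ open_cran[OF assms(1)] assms(2)])
      (simp add: transition_def assms)
  moreover have "(transition c c has_derivative jac c c u) (at u)"
    using assms by (intro jac_has_derivative) (auto simp: overlap_iff)
  ultimately show ?thesis using has_derivative_unique by metis
qed

lemma jac_inverse:
  assumes "c \<in> A" "c' \<in> A" "p \<in> cdom c" "p \<in> cdom c'"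
  shows "jac c' c (cmap c' p) (jac c c' (cmap c p) v) = v"
  using jac_cocycle[of c c' c p v] jac_self[of c] assms by simp

lemma has_vector_derivative_change_chart:
  assumes c: "c \<in> A" "c' \<in> A" and t: "t \<in> T" "\<gamma> t \<in> cdom c" "\<gamma> t \<in> cdom c'"
    and cont: "continuous_on T \<gamma>"
    and d: "((cmap c \<circ> \<gamma>) has_vector_derivative v) (at t within T)"
  shows "((cmap c' \<circ> \<gamma>) has_vector_derivative jac c c' (cmap c (\<gamma> t)) v) (at t within T)"
proof -
  have "(transition c c' has_derivative jac c c' (cmap c (\<gamma> t))) (at ((cmap c \<circ> \<gamma>) t))"
    using c t by (auto intro!: jac_has_derivative cmap_overlap)
  from diff_chain_within[OF d[unfolded has_vector_derivative_def] has_derivative_at_withinI[OF this]]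
  have 1: "((transition c c' \<circ> (cmap c \<circ> \<gamma>)) has_vector_derivative jac c c' (cmap c (\<gamma> t)) v) (at t within T)"
    using linear_scale[OF linear_jac[OF c cmap_overlap[OF t(2,3)]]]
    by (simp add: has_vector_derivative_def o_def)
  have "\<forall>\<^sub>F s in at t within T. \<gamma> s \<in> cdom c"
    using cont t open_cdom[OF c(1)] unfolding continuous_on_def by (blast intro: topological_tendstoD)
  then have ev: "\<forall>\<^sub>F s in at t within T. (transition c c' \<circ> (cmap c \<circ> \<gamma>)) s = (cmap c' \<circ> \<gamma>) s"
    by eventually_elim (simp add: c)
  show ?thesis
    using has_derivative_transform_eventually[OF 1[unfolded has_vector_derivative_def] ev] t c
    by (simp add: has_vector_derivative_def o_def)
qed

section \<open>Smooth and continuously differentiable functions on the manifold\<close>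

definition smooth_fun :: "('m \<Rightarrow> real) \<Rightarrow> bool" where
  "smooth_fun f \<longleftrightarrow> (\<forall>c\<in>A. smooth_on (cran c) (f \<circ> cinv c))"

lemma smooth_fun_const: "smooth_fun (\<lambda>p. a)"
  by (auto simp: smooth_fun_def o_def intro!: smooth_intros open_cran)
lemma smooth_fun_diff: "smooth_fun f \<Longrightarrow> smooth_fun g \<Longrightarrow> smooth_fun (\<lambda>p. f p - g p)"
  by (auto simp: smooth_fun_def o_def intro!: smooth_intros open_cran)
lemma smooth_fun_mult: "smooth_fun f \<Longrightarrow> smooth_fun g \<Longrightarrow> smooth_fun (\<lambda>p. f p * g p)"
  by (auto simp: smooth_fun_def o_def intro!: smooth_intros open_cran)
lemma smooth_fun_sum: "(\<And>i. i \<in> I \<Longrightarrow> smooth_fun (f i)) \<Longrightarrow> smooth_fun (\<lambda>p. \<Sum>i\<in>I. f i p)"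
  by (auto simp: smooth_fun_def o_def intro!: smooth_intros open_cran)
lemma smooth_fun_inverse: "smooth_fun f \<Longrightarrow> (\<And>p. f p > 0) \<Longrightarrow> smooth_fun (\<lambda>p. inverse (f p))"
  by (auto simp: smooth_fun_def o_def intro!: smooth_intros open_cran)

definition C1_fun :: "('m \<Rightarrow> real) \<Rightarrow> bool" where
  "C1_fun f \<longleftrightarrow> (\<forall>c\<in>A. Ck_open 1 (cran c) (f \<circ> cinv c))"

lemma smooth_fun_imp_C1: "smooth_fun f \<Longrightarrow> C1_fun f"
  unfolding smooth_fun_def C1_fun_def smooth_on_def by blast

lemma C1_fun_iff:
  "C1_fun f \<longleftrightarrow> (\<forall>c\<in>A. (\<forall>u\<in>cran c. (f \<circ> cinv c) differentiable at u) \<and>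
     (\<forall>v. continuous_on (cran c) (\<lambda>u. differential c f u v)))"
  by (simp add: C1_fun_def differential_def[abs_def])

lemma C1_fun_has_derivative:
  "C1_fun f \<Longrightarrow> c \<in> A \<Longrightarrow> u \<in> cran c \<Longrightarrow> ((f \<circ> cinv c) has_derivative differential c f u) (at u)"
  unfolding C1_fun_iff differential_def by (simp add: frechet_derivative_works)

lemma continuous_via_charts:
  fixes f :: "'m \<Rightarrow> 'b::topological_space"
  assumes "\<And>c. c \<in> A \<Longrightarrow> continuous_on (cran c) (f \<circ> cinv c)"
  shows "continuous_on UNIV f"
proof -
  have "isCont f p" for p
  proof -
    obtain c where c: "c \<in> A" "p \<in> cdom c" using ex_chart by blast
    have "continuous_on (cdom c) ((f \<circ> cinv c) \<circ> cmap c)"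
      by (rule continuous_on_compose[OF continuous_cmap[OF c(1)]])
        (use homeomorphism_image1[OF homeo[OF c(1)]] assms[OF c(1)] in simp)
    then have "continuous_on (cdom c) f"
      by (rule continuous_on_eq) (simp add: c)
    then show ?thesis using c open_cdom continuous_on_eq_continuous_at by blast
  qed
  then show ?thesis by (simp add: continuous_at_imp_continuous_on)
qed

lemma C1_fun_continuous: "C1_fun f \<Longrightarrow> continuous_on UNIV f"
proof (rule continuous_via_charts)
  fix c assume "C1_fun f" "c \<in> A"
  then have "Ck_open 1 (cran c) (f \<circ> cinv c)" by (simp add: C1_fun_def)
  then show "continuous_on (cran c) (f \<circ> cinv c)" using Ck_open_mono[of 0 1 "cran c" "f \<circ> cinv c"] by (simp del: Ck_open.simps(2) One_nat_def)
qed

lemma differential_linear: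
  "C1_fun f \<Longrightarrow> c \<in> A \<Longrightarrow> u \<in> cran c \<Longrightarrow> linear (differential c f u)"
  using C1_fun_has_derivative has_derivative_linear by blast

lemma differential_change_chart:
  assumes d: "((f \<circ> cinv c') has_derivative D) (at (cmap c' p))"
    and c: "c \<in> A" "c' \<in> A" and p: "p \<in> cdom c" "p \<in> cdom c'"
  shows "((f \<circ> cinv c) has_derivative (\<lambda>v. D (jac c c' (cmap c p) v))) (at (cmap c p))"
proof -
  have "(transition c c' has_derivative jac c c' (cmap c p)) (at (cmap c p))"
    using c p by (intro jac_has_derivative cmap_overlap)
  moreover have "((f \<circ> cinv c') has_derivative D) (at (transition c c' (cmap c p)))" using d c p by simp
  ultimately have 1: "((\<lambda>u. (f \<circ> cinv c') (transition c c' u)) has_derivative (\<lambda>v. D (jac c c' (cmap c p) v))) (at (cmap c p))"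
    by (rule has_derivative_compose)
  show ?thesis
    by (rule has_derivative_transform_within_open[OF 1 open_overlap[OF c] cmap_overlap[OF p]])
      (simp add: cinv_transition c)
qed

lemma differential_transform:
  assumes f: "C1_fun f" and c: "c \<in> A" "c' \<in> A" and p: "p \<in> cdom c" "p \<in> cdom c'"
  shows "differential c f (cmap c p) v = differential c' f (cmap c' p) (jac c c' (cmap c p) v)"
proof -
  have "((f \<circ> cinv c) has_derivative (\<lambda>v. differential c' f (cmap c' p) (jac c c' (cmap c p) v))) (at (cmap c p))"
    by (rule differential_change_chart[OF C1_fun_has_derivative[OF f c(2)] c p]) (simp add: p)
  moreover have "((f \<circ> cinv c) has_derivative differential c f (cmap c p)) (at (cmap c p))"
    by (rule C1_fun_has_derivative[OF f c(1)]) (simp add: p)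
  ultimately show ?thesis using has_derivative_unique by metis
qed

section \<open>Extension by zero from a chart, bump functions, and the finite cover\<close>

definition lift :: "('m, 'e) chart \<Rightarrow> ('e \<Rightarrow> real) \<Rightarrow> 'm \<Rightarrow> real" where
  "lift c G p = (if p \<in> cdom c then G (cmap c p) else 0)"

lemma lift_outside:
  assumes c: "c \<in> A" and K: "compact K" "K \<subseteq> cran c" and G: "\<And>u. u \<in> cran c \<Longrightarrow> u \<notin> K \<Longrightarrow> G u = 0"
  shows "open (- cinv c ` K)" "\<And>p. p \<notin> cinv c ` K \<Longrightarrow> lift c G p = 0"
proof -
  have "compact (cinv c ` K)"
    by (rule compact_continuous_image[OF continuous_on_subset[OF continuous_cinv[OF c]]]) (use K in auto)
  then show "open (- cinv c ` K)" by (simp add: compact_imp_closed open_Compl)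
  show "lift c G p = 0" if p: "p \<notin> cinv c ` K" for p
  proof (cases "p \<in> cdom c")
    case True
    then have "cmap c p \<notin> K" using p c by (metis cinv_cmap image_eqI)
    then show ?thesis using G True by (simp add: lift_def)
  qed (simp add: lift_def)
qed

text \<open>Two open sets cover the manifold: the domain of \<open>c\<close>, where the function is
  \<open>G\<close> in the coordinates of \<open>c\<close>, and the complement of the image of
  \<open>K\<close>, where it is 0. The second is open because a compact subset of a Hausdorff space
  is closed.\<close>

lemma Ck_open_lift:
  assumes c: "c \<in> A" and K: "compact K" "K \<subseteq> cran c" and G: "\<And>u. u \<in> cran c \<Longrightarrow> u \<notin> K \<Longrightarrow> G u = 0"
    and sG: "Ck_open k (cran c) G" and c': "c' \<in> A"
  shows "Ck_open k (cran c') (lift c G \<circ> cinv c')"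
proof (rule Ck_open_locally)
  fix u assume u: "u \<in> cran c'"
  show "\<exists>U. open U \<and> u \<in> U \<and> Ck_open k U (lift c G \<circ> cinv c')"
  proof (cases "cinv c' u \<in> cdom c")
    case True
    have "Ck_open k (overlap c' c) (transition c' c)"
      using smooth_transition[OF c' c] by (simp add: smooth_on_def)
    then have "Ck_open k (overlap c' c) (\<lambda>u. G (transition c' c u))"
      using transition_cran[OF c' c]
      by (intro Ck_open_compose[OF open_overlap[OF c' c] open_cran[OF c] sG]) auto
    then have "Ck_open k (overlap c' c) (lift c G \<circ> cinv c')"
      by (subst Ck_open_cong[OF open_overlap[OF c' c], of _ "\<lambda>u. G (transition c' c u)"])
       (auto simp: lift_def transition_def overlap_iff c')
    then show ?thesis using open_overlap[OF c' c] True u c' by (auto simp: overlap_iff)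
  next
    case False
    let ?U = "cran c' \<inter> cinv c' -` (- cinv c ` K)"
    have o: "open ?U" by (rule open_cran_preimage[OF c' lift_outside(1)[OF c K G]])
    have "Ck_open k ?U (lift c G \<circ> cinv c')"
      by (subst Ck_open_cong[OF o, of _ "\<lambda>_. 0"])
        (auto simp: lift_outside(2)[OF c K G] intro!: Ck_open_const o)
    moreover have "u \<in> ?U" using u False K c by auto
    ultimately show ?thesis using o by blast
  qed
qed

lemma smooth_fun_lift:
  assumes c: "c \<in> A" and K: "compact K" "K \<subseteq> cran c" and G: "\<And>u. u \<in> cran c \<Longrightarrow> u \<notin> K \<Longrightarrow> G u = 0"
    and sG: "smooth_on (cran c) G"
  shows "smooth_fun (lift c G)"
  unfolding smooth_fun_def smooth_on_def
proof (intro ballI allI)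
  fix c' k assume "c' \<in> A"
  moreover have "Ck_open k (cran c) G" using sG by (simp add: smooth_on_def)
  ultimately show "Ck_open k (cran c') (lift c G \<circ> cinv c')" by (intro Ck_open_lift[OF c K G])
qed

text \<open>Equal to 1 up to radius r and to 0 from radius sqrt 2 * r on. The room that is left up
  to radius 2 * r accommodates a second cut-off that is 1 on the support of this one.\<close>

definition bump :: "'e \<Rightarrow> real \<Rightarrow> 'e \<Rightarrow> real" where
  "bump x r u = smooth_step (2 - ((u - x) \<bullet> (u - x)) * inverse (r\<^sup>2))"

lemma smooth_bump: "smooth_on U (bump x r)"
proof -
  have "smooth_on UNIV (bump x r)"
    unfolding bump_def[abs_def]
    by (rule smooth_on_compose[OF _ _ smooth_smooth_step]) (auto intro!: smooth_intros)
  then show ?thesis by (rule smooth_on_subset) simp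
qed

lemma bump_eq_1: "r > 0 \<Longrightarrow> u \<in> cball x r \<Longrightarrow> bump x r u = 1"
proof -
  assume r: "r > 0" "u \<in> cball x r"
  then have "(u - x) \<bullet> (u - x) \<le> r\<^sup>2"
    by (simp add: power2_norm_eq_inner[symmetric] dist_norm norm_minus_commute power_mono)
  then have "((u - x) \<bullet> (u - x)) * inverse (r\<^sup>2) \<le> 1" using r by (simp add: divide_inverse[symmetric])
  then show ?thesis by (simp add: bump_def smooth_step_simps)
qed

lemma bump_eq_0: "r > 0 \<Longrightarrow> u \<notin> cball x (2 * r) \<Longrightarrow> bump x r u = 0"
proof -
  assume r: "r > 0" "u \<notin> cball x (2 * r)"
  then have "norm (u - x) \<ge> 2 * r" by (simp add: dist_norm norm_minus_commute)
  then have "(norm (u - x))\<^sup>2 \<ge> (2 * r)\<^sup>2" using r by (intro power_mono) auto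
  then have "(u - x) \<bullet> (u - x) \<ge> 2 * r\<^sup>2"
    by (simp add: power2_norm_eq_inner power_mult_distrib) (smt (verit) zero_le_power2)
  then have "((u - x) \<bullet> (u - x)) * inverse (r\<^sup>2) \<ge> 2" using r by (simp add: divide_inverse[symmetric] le_divide_eq)
  then show ?thesis by (simp add: bump_def smooth_step_simps)
qed

lemma bump_range: "0 \<le> bump x r u" "bump x r u \<le> 1"
  by (auto simp: bump_def smooth_step_range)

text \<open>The balls of radius r are meant to cover the manifold; the doubled balls contain the
  supports of the cut-offs and all points close to the smaller balls.\<close>

definition ball_chart :: "('m, 'e) chart \<times> 'e \<times> real \<Rightarrow> bool" where
  "ball_chart = (\<lambda>(c, x, r). c \<in> A \<and> r > 0 \<and> cball x (2 * r) \<subseteq> cran c)"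

lemma ex_finite_cover:
  "\<exists>I. finite I \<and> (\<forall>i\<in>I. ball_chart i) \<and> (\<forall>p. \<exists>(c, x, r)\<in>I. p \<in> cdom c \<and> cmap c p \<in> ball x r)"
proof -
  define B where "B = (\<lambda>(c::('m,'e) chart, x, r). cdom c \<inter> cmap c -` ball x r)"
  have "\<exists>C\<subseteq>Collect ball_chart. finite C \<and> UNIV \<subseteq> (\<Union>i\<in>C. B i)"
  proof (rule compactE_image[OF compact_UNIV, of "Collect ball_chart" B])
    show "open (B i)" if "i \<in> Collect ball_chart" for i
      using that open_cdom_preimage[OF _ open_ball] by (auto simp: B_def ball_chart_def)
    show "UNIV \<subseteq> (\<Union>i\<in>Collect ball_chart. B i)"
    proof
      fix p :: 'm
      obtain c where c: "c \<in> A" "p \<in> cdom c" using ex_chart by blast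
      obtain e where e: "e > 0" "cball (cmap c p) e \<subseteq> cran c"
        using open_contains_cball open_cran[OF c(1)] cmap_in[OF c(2)] by blast
      have "(c, cmap c p, e / 2) \<in> Collect ball_chart" using c e by (simp add: ball_chart_def)
      moreover have "p \<in> B (c, cmap c p, e / 2)" using c e by (simp add: B_def)
      ultimately show "p \<in> (\<Union>i\<in>Collect ball_chart. B i)" by blast
    qed
  qed blast
  then obtain I where "I \<subseteq> Collect ball_chart" "finite I" "UNIV \<subseteq> (\<Union>i\<in>I. B i)" by blast
  then show ?thesis by (intro exI[of _ I]) (fastforce simp: B_def)
qed

end

section \<open>A separating family of smooth functions\<close>

locale covered_manifold = closed_manifold A
  for A :: "('m::t2_space, 'e::euclidean_space) chart set" +
  fixes I :: "(('m, 'e) chart \<times> 'e \<times> real) set"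
  assumes finite_I: "finite I" and I_charts: "i \<in> I \<Longrightarrow> ball_chart i"
    and I_cover: "\<exists>(c, x, r)\<in>I. p \<in> cdom c \<and> cmap c p \<in> ball x r"
begin

lemma I_in: assumes "(c, x, r) \<in> I" shows "c \<in> A" "r > 0" "cball x (2 * r) \<subseteq> cran c" "cball x r \<subseteq> cran c"
  using I_charts[OF assms] by (auto simp: ball_chart_def subset_eq)

definition \<beta> :: "('m, 'e) chart \<times> 'e \<times> real \<Rightarrow> 'm \<Rightarrow> real" where
  "\<beta> = (\<lambda>(c, x, r). lift c (bump x r))"

definition \<xi> :: "('m, 'e) chart \<times> 'e \<times> real \<Rightarrow> 'e \<Rightarrow> 'm \<Rightarrow> real" where
  "\<xi> = (\<lambda>(c, x, r) b. lift c (\<lambda>u. bump x r u * (u \<bullet> b)))"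

text \<open>The functions used to embed a compact manifold into a Euclidean space: the cut-offs tell
  in which ball a point lies, and the quotients of cut-off coordinates by cut-offs are its
  coordinates there.\<close>

definition \<F> :: "('m \<Rightarrow> real) set" where
  "\<F> = \<beta> ` I \<union> (\<lambda>(i, b). \<xi> i b) ` (I \<times> Basis)"

lemma finite_\<F>: "finite \<F>" by (simp add: \<F>_def finite_I)

lemma smooth_\<beta>: "i \<in> I \<Longrightarrow> smooth_fun (\<beta> i)"
proof -
  assume "i \<in> I"
  obtain c x r where i: "i = (c, x, r)" by (cases i)
  then have I: "(c, x, r) \<in> I" using \<open>i \<in> I\<close> by simp
  show ?thesis
    unfolding i \<beta>_def prod.case
    by (rule smooth_fun_lift[where K="cball x (2 * r)"])
      (use I_in[OF I] in \<open>auto simp: bump_eq_0 smooth_bump\<close>)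
qed

lemma smooth_\<F>: "f \<in> \<F> \<Longrightarrow> smooth_fun f"
proof -
  have "smooth_fun (\<xi> (c, x, r) b)" if i: "(c, x, r) \<in> I" for c x r b
    unfolding \<xi>_def prod.case
    by (rule smooth_fun_lift[where K="cball x (2 * r)"])
      (use I_in[OF i] in \<open>auto simp: bump_eq_0 intro!: smooth_intros smooth_bump open_cran\<close>)
  then show "f \<in> \<F> \<Longrightarrow> smooth_fun f"
    by (auto simp: \<F>_def smooth_\<beta>)
qed

text \<open>The Euclidean distance after mapping the manifold by \<open>\<F>\<close> to a Euclidean space.\<close>

definition \<delta> :: "'m \<Rightarrow> 'm \<Rightarrow> real" where
  "\<delta> p q = sqrt (\<Sum>f\<in>\<F>. (f p - f q)\<^sup>2)"

lemma \<delta>_nonneg: "0 \<le> \<delta> p q" by (simp add: \<delta>_def sum_nonneg)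
lemma \<delta>_power2: "(\<delta> p q)\<^sup>2 = (\<Sum>f\<in>\<F>. (f p - f q)\<^sup>2)" by (simp add: \<delta>_def sum_nonneg)
lemma \<delta>_refl [simp]: "\<delta> p p = 0" by (simp add: \<delta>_def)
lemma \<delta>_sym: "\<delta> p q = \<delta> q p" by (simp add: \<delta>_def power2_commute)

lemma \<delta>_ge:
  assumes "f \<in> \<F>" shows "\<bar>f p - f q\<bar> \<le> \<delta> p q"
proof -
  have "(f p - f q)\<^sup>2 \<le> (\<Sum>f\<in>\<F>. (f p - f q)\<^sup>2)"
    by (rule member_le_sum) (use assms finite_\<F> in auto)
  then show ?thesis unfolding \<delta>_def using real_le_rsqrt by fastforce
qed

lemma continuous_\<delta>: "continuous_on UNIV (\<delta> p)"
  unfolding \<delta>_def[abs_def]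
  by (intro continuous_intros C1_fun_continuous smooth_fun_imp_C1 smooth_\<F>)

lemma \<beta>_eq_1: "(c, x, r) \<in> I \<Longrightarrow> p \<in> cdom c \<Longrightarrow> cmap c p \<in> cball x r \<Longrightarrow> \<beta> (c, x, r) p = 1"
  using I_in by (simp add: \<beta>_def lift_def bump_eq_1)

text \<open>The embedding has a locally Lipschitz inverse. At \<open>p\<close> the cut-off is 1, so
  \<delta> < 1/2 keeps it above 1/2 at \<open>q\<close>; this forces \<open>q\<close> into the
  doubled ball and allows division by the cut-off at the price of a factor 2.\<close>

lemma \<delta>_local:
  "\<exists>C>0. \<forall>(c, x, r)\<in>I. \<forall>p q. p \<in> cdom c \<longrightarrow> cmap c p \<in> cball x r \<longrightarrow> \<delta> p q < 1/2 \<longrightarrow>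
     q \<in> cdom c \<and> cmap c q \<in> cball x (2 * r) \<and> norm (cmap c q - cmap c p) \<le> C * \<delta> p q"
proof -
  define P where "P i C \<longleftrightarrow> (case i of (c, x, r) \<Rightarrow> \<forall>p q. p \<in> cdom c \<longrightarrow> cmap c p \<in> cball x r \<longrightarrow> \<delta> p q < 1/2 \<longrightarrow>
     q \<in> cdom c \<and> cmap c q \<in> cball x (2 * r) \<and> norm (cmap c q - cmap c p) \<le> C * \<delta> p q)" for i :: "('m, 'e) chart \<times> 'e \<times> real" and C :: real
  have "\<exists>C>0. \<forall>i\<in>I. P i C"
  proof (rule finite_ex_bound[OF finite_I])
  fix i assume "i \<in> I"
  obtain c x r where i: "i = (c, x, r)" by (cases i)
  then have I: "(c, x, r) \<in> I" using \<open>i \<in> I\<close> by simp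
  have "q \<in> cdom c \<and> cmap c q \<in> cball x (2 * r) \<and>
      norm (cmap c q - cmap c p) \<le> (real DIM('e) * (2 * (1 + (norm x + r)))) * \<delta> p q"
    if p: "p \<in> cdom c" "cmap c p \<in> cball x r" and d: "\<delta> p q < 1/2" for p q
  proof -
    have 1: "\<beta> i p = 1" using \<beta>_eq_1[OF I p] i by simp
    have "\<beta> i \<in> \<F>" using I i by (auto simp: \<F>_def)
    then have 2: "\<bar>\<beta> i p - \<beta> i q\<bar> \<le> \<delta> p q" by (rule \<delta>_ge)
    then have 3: "\<beta> i q > 1/2" using 1 d by linarith
    then have q: "q \<in> cdom c" "cmap c q \<in> cball x (2 * r)"
      using bump_eq_0[OF I_in(2)[OF I], of "cmap c q" x] by (auto simp: i \<beta>_def lift_def split: if_splits)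
    have b: "\<bar>(cmap c q - cmap c p) \<bullet> b\<bar> \<le> 2 * (1 + (norm x + r)) * \<delta> p q" if b: "b \<in> Basis" for b
    proof -
      have "\<xi> i b \<in> \<F>" using b I i by (auto simp: \<F>_def)
      then have 4: "\<bar>\<xi> i b p - \<xi> i b q\<bar> \<le> \<delta> p q" by (rule \<delta>_ge)
      have 5: "\<xi> i b p = \<beta> i p * (cmap c p \<bullet> b)" "\<xi> i b q = \<beta> i q * (cmap c q \<bullet> b)"
        using p q by (auto simp: \<xi>_def \<beta>_def i lift_def)
      have 6: "\<bar>cmap c p \<bullet> b\<bar> \<le> norm x + r"
        using Basis_le_norm[OF b, of "cmap c p"] p(2) norm_triangle_sub[of "cmap c p" x]
        by (simp add: dist_norm norm_minus_commute)
      \<comment> \<open>Both terms on the right are differences of members of \<open>\<F>\<close>,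
        up to the bounded factor given by the coordinate of \<open>p\<close>.\<close>
      have "\<beta> i q * ((cmap c q - cmap c p) \<bullet> b) = (\<xi> i b q - \<xi> i b p) + (\<beta> i p - \<beta> i q) * (cmap c p \<bullet> b)"
        by (simp add: 5 algebra_simps)
      also have "\<bar>\<dots>\<bar> \<le> \<bar>\<xi> i b p - \<xi> i b q\<bar> + \<bar>\<beta> i p - \<beta> i q\<bar> * \<bar>cmap c p \<bullet> b\<bar>"
        by (metis abs_minus_commute abs_mult abs_triangle_ineq)
      also have "\<dots> \<le> \<delta> p q + \<delta> p q * (norm x + r)"
        by (intro add_mono mult_mono 4 2 6 \<delta>_nonneg) simp
      finally have "\<beta> i q * \<bar>(cmap c q - cmap c p) \<bullet> b\<bar> \<le> (1 + (norm x + r)) * \<delta> p q"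
        using 3 unfolding abs_mult by (simp add: distrib_right distrib_left mult.commute)
      moreover have "1/2 * \<bar>(cmap c q - cmap c p) \<bullet> b\<bar> \<le> \<beta> i q * \<bar>(cmap c q - cmap c p) \<bullet> b\<bar>"
        using 3 by (intro mult_right_mono) auto
      ultimately show ?thesis by linarith
    qed
    have "norm (cmap c q - cmap c p) \<le> (\<Sum>b\<in>Basis. \<bar>(cmap c q - cmap c p) \<bullet> b\<bar>)" by (rule norm_le_l1)
    also have "\<dots> \<le> real DIM('e) * (2 * (1 + (norm x + r)) * \<delta> p q)"
      by (rule sum_bounded_above) (rule b)
    finally show ?thesis using q by (simp add: mult.assoc)
  qed
  then show "\<exists>C. P i C"
    unfolding i P_def by (intro exI[of _ "real DIM('e) * (2 * (1 + (norm x + r)))"]) (simp only: prod.case, blast)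
next
  fix i C C' assume "P i C" and "(C::real) \<le> C'"
  have "C * \<delta> p q \<le> C' * \<delta> p q" for p q using \<open>C \<le> C'\<close> \<delta>_nonneg by (rule mult_right_mono)
  then show "P i C'"
    using \<open>P i C\<close> unfolding P_def by (fastforce split: prod.splits intro: order_trans)
qed
  then show ?thesis unfolding P_def .
qed

end

section \<open>Nondegenerate bilinear forms\<close>

lemma linear_Basis_expand:
  fixes f :: "'a::euclidean_space \<Rightarrow> 'b::real_vector"
  assumes "linear f"
  shows "f v = (\<Sum>b\<in>Basis. (v \<bullet> b) *\<^sub>R f b)"
proof -
  have "f v = f (\<Sum>b\<in>Basis. (v \<bullet> b) *\<^sub>R b)" by (simp add: euclidean_representation)
  also have "\<dots> = (\<Sum>b\<in>Basis. (v \<bullet> b) *\<^sub>R f b)" by (simp add: linear_sum[OF assms] linear_scale[OF assms])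
  finally show ?thesis .
qed

lemma linear_norm_bound:
  fixes f :: "'a::euclidean_space \<Rightarrow> 'b::real_normed_vector"
  assumes "linear f"
  shows "norm (f v) \<le> norm v * (\<Sum>b\<in>Basis. norm (f b))"
proof -
  have "norm (f v) = norm (\<Sum>b\<in>Basis. (v \<bullet> b) *\<^sub>R f b)" using linear_Basis_expand[OF assms, of v] by simp
  also have "\<dots> \<le> (\<Sum>b\<in>Basis. norm v * norm (f b))"
    by (rule sum_norm_le) (auto intro!: mult_right_mono Basis_le_norm)
  finally show ?thesis by (simp add: sum_distrib_left)
qed

lemma continuous_compact_bound:
  fixes f :: "'a::topological_space \<Rightarrow> 'b::real_normed_vector"
  assumes "compact K" "continuous_on K f"
  shows "\<exists>M\<ge>0. \<forall>x\<in>K. norm (f x) \<le> M"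
proof -
  have "bounded (f ` K)" using compact_imp_bounded compact_continuous_image assms by blast
  then show ?thesis unfolding bounded_pos by (auto intro: less_imp_le)
qed

lemma lipschitz_mult:
  fixes a b :: "'a \<Rightarrow> real"
  assumes "\<bar>a u - a v\<bar> \<le> L * d" "\<bar>b u - b v\<bar> \<le> L' * d" "\<bar>a u\<bar> \<le> M" "\<bar>b v\<bar> \<le> M'" "0 \<le> d" "0 \<le> M" "0 \<le> M'"
  shows "\<bar>a u * b u - a v * b v\<bar> \<le> (M * L' + L * M') * d"
proof -
  have "a u * b u - a v * b v = a u * (b u - b v) + (a u - a v) * b v" by (simp add: algebra_simps)
  also have "\<bar>\<dots>\<bar> \<le> \<bar>a u\<bar> * \<bar>b u - b v\<bar> + \<bar>a u - a v\<bar> * \<bar>b v\<bar>" by (metis abs_mult abs_triangle_ineq)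
  also have "\<dots> \<le> M * (L' * d) + (L * d) * M'"
    using assms by (intro add_mono mult_mono) (auto intro: order_trans[OF abs_ge_zero])
  finally show ?thesis by (simp add: algebra_simps)
qed

lemma C1_lipschitz:
  fixes f :: "'a::euclidean_space \<Rightarrow> real"
  assumes f: "Ck_open 1 U f" and K: "compact K" "convex K" "K \<subseteq> U"
  shows "\<exists>L\<ge>0. \<forall>u\<in>K. \<forall>v\<in>K. \<bar>f u - f v\<bar> \<le> L * norm (u - v)"
proof -
  let ?D = "\<lambda>x. frechet_derivative f (at x)"
  have D: "(f has_derivative ?D x) (at x)" if "x \<in> U" for x
    using f that by (simp add: frechet_derivative_works)
  have "continuous_on K (\<lambda>x. \<Sum>b\<in>Basis. norm (?D x b))"
    using f continuous_on_subset[OF _ K(3)] by (auto intro!: continuous_intros)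
  then have "bounded ((\<lambda>x. \<Sum>b\<in>Basis. norm (?D x b)) ` K)"
    using compact_imp_bounded compact_continuous_image K(1) by blast
  then obtain B where B: "\<And>x. x \<in> K \<Longrightarrow> (\<Sum>b\<in>Basis. norm (?D x b)) \<le> B"
    unfolding bounded_iff by force
  have "norm (f u - f v) \<le> max B 0 * norm (u - v)" if uv: "u \<in> K" "v \<in> K" for u v
  proof (rule differentiable_bound[OF K(2) _ _ uv])
    fix x assume x: "x \<in> K"
    then have xU: "x \<in> U" using K by auto
    show "(f has_derivative ?D x) (at x within K)" by (rule has_derivative_at_withinI[OF D[OF xU]])
    show "onorm (?D x) \<le> max B 0"
    proof (rule onorm_le)
      fix w
      have "norm (?D x w) \<le> norm w * (\<Sum>b\<in>Basis. norm (?D x b))"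
        by (rule linear_norm_bound[OF has_derivative_linear[OF D[OF xU]]])
      also have "\<dots> \<le> norm w * max B 0" using B[OF x] by (intro mult_left_mono) auto
      finally show "norm (?D x w) \<le> max B 0 * norm w" by (simp add: mult.commute)
    qed
  qed
  then show ?thesis by (intro exI[of _ "max B 0"]) auto
qed

lemma bilinear_linear: "bilinear h \<Longrightarrow> linear (h x)" "bilinear h \<Longrightarrow> linear (\<lambda>x. h x y)"
  by (simp_all add: bilinear_def)

text \<open>\<open>T\<close> identifies the covector h(z, -) with the vector of its values on
  \<open>Basis\<close>. It is injective by nondegeneracy, hence surjective in finite dimension. This
  justifies the definite descriptions behind Hamiltonian vector fields and Christoffel
  symbols.\<close>

lemma nondegenerate_ex1:
  fixes h :: "'e::euclidean_space \<Rightarrow> 'e \<Rightarrow> real"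
  assumes h: "bilinear h" and nd: "\<And>v. v \<noteq> 0 \<Longrightarrow> \<exists>w. h v w \<noteq> 0" and l: "linear l"
  shows "\<exists>!z. \<forall>w. h z w = l w"
proof -
  have ext: "\<forall>w. h z w = l' w" if "\<And>b. b \<in> Basis \<Longrightarrow> h z b = l' b" "linear l'" for z l'
    using linear_eq_stdbasis[OF bilinear_linear(1)[OF h] that(2), of z] that(1) by metis
  define T where "T z = (\<Sum>b\<in>Basis. h z b *\<^sub>R b)" for z
  have Tb: "T z \<bullet> b = h z b" if "b \<in> Basis" for z b
    using that by (simp add: T_def inner_sum_left inner_Basis if_distrib cong: if_cong)
  have lT: "linear T"
    by (rule linearI) (simp_all add: T_def bilinear_ladd[OF h] bilinear_lmul[OF h] scaleR_add_left sum.distrib scaleR_sum_right)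
  have "inj T"
    unfolding linear_injective_0[OF lT]
  proof (intro allI impI)
    fix v assume "T v = 0"
    then have "h v b = 0" if "b \<in> Basis" for b using Tb[OF that, of v] by simp
    then have "\<forall>w. h v w = 0" using ext[of v "\<lambda>_. 0"] by (simp add: linear_iff)
    then show "v = 0" using nd by blast
  qed
  then have "surj T" by (rule linear_inj_imp_surj[OF lT])
  then obtain z where z: "T z = (\<Sum>b\<in>Basis. l b *\<^sub>R b)" by (metis surjD)
  have "h z b = l b" if "b \<in> Basis" for b
    using that by (simp add: Tb[OF that, symmetric] z inner_sum_left inner_Basis if_distrib cong: if_cong)
  then have z: "\<forall>w. h z w = l w" using ext l by blast
  moreover have "z' = z" if "\<forall>w. h z' w = l w" for z'
  proof -
    have "h (z' - z) w = 0" for w using that z by (simp add: bilinear_lsub[OF h])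
    then show ?thesis using nd[of "z' - z"] by auto
  qed
  ultimately show ?thesis by blast
qed

text \<open>The constant is the minimum over \<open>K\<close> times the unit sphere, which is
  compact; nondegeneracy makes the minimum positive, and homogeneity in \<open>v\<close> does the
  rest.\<close>

lemma nondegenerate_uniform:
  fixes h :: "'s::euclidean_space \<Rightarrow> 'e::euclidean_space \<Rightarrow> 'e \<Rightarrow> real"
  assumes K: "compact K" and h: "\<And>u. u \<in> K \<Longrightarrow> bilinear (h u)"
    and nd: "\<And>u v. u \<in> K \<Longrightarrow> v \<noteq> 0 \<Longrightarrow> \<exists>w. h u v w \<noteq> 0"
    and cont: "\<And>v w. continuous_on K (\<lambda>u. h u v w)"
  shows "\<exists>\<kappa>>0. \<forall>u\<in>K. \<forall>v. \<kappa> * norm v \<le> (\<Sum>b\<in>Basis. \<bar>h u v b\<bar>)"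
proof (cases "K = {}")
  case True
  then show ?thesis by (auto intro: exI[of _ 1])
next
  case False
  let ?S = "sphere (0::'e) 1"
  \<comment> \<open>The vector is expanded in \<open>Basis\<close>, because continuity of
    \<open>h\<close> in \<open>u\<close> is available for fixed vectors only, and joint continuity
    is required.\<close>
  let ?g = "\<lambda>p. \<Sum>b\<in>Basis. \<bar>\<Sum>a\<in>Basis. (snd p \<bullet> a) * h (fst p) a b\<bar>"
  have g: "?g (u, v) = (\<Sum>b\<in>Basis. \<bar>h u v b\<bar>)" if "u \<in> K" for u v
    using linear_Basis_expand[OF bilinear_linear(2)[OF h[OF that]], of v] by simp
  have "continuous_on (K \<times> ?S) ?g"
    by (intro continuous_intros continuous_on_compose2[OF cont]) auto
  moreover have "compact (K \<times> ?S)" "K \<times> ?S \<noteq> {}"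
    using K False SOME_Basis by (auto simp: compact_Times intro!: exI[of _ "SOME i. i \<in> Basis"])
  ultimately obtain p where p: "p \<in> K \<times> ?S" "\<And>q. q \<in> K \<times> ?S \<Longrightarrow> ?g p \<le> ?g q"
    using continuous_attains_inf[of "K \<times> ?S" ?g] by blast
  obtain u0 v0 where p0: "p = (u0, v0)" "u0 \<in> K" "norm v0 = 1" using p by (cases p) auto
  have "?g p \<noteq> 0"
  proof
    assume "?g p = 0"
    then have "h u0 v0 b = 0" if "b \<in> Basis" for b
      using that unfolding p0(1) g[OF p0(2)] by (simp add: sum_nonneg_eq_0_iff)
    then have "h u0 v0 = (\<lambda>_. 0)"
      using linear_eq_stdbasis[OF bilinear_linear(1)[OF h[OF p0(2)]], of "\<lambda>_. 0" v0] by (simp add: linear_iff)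
    moreover have "v0 \<noteq> 0" using p0(3) by auto
    ultimately show False using nd[OF p0(2), of v0] by auto
  qed
  moreover have "?g p \<ge> 0" by (simp add: sum_nonneg)
  ultimately have pos: "?g p > 0" by linarith
  have "?g p * norm v \<le> (\<Sum>b\<in>Basis. \<bar>h u v b\<bar>)" if u: "u \<in> K" for u v
  proof (cases "v = 0")
    case False
    have "(u, (1 / norm v) *\<^sub>R v) \<in> K \<times> ?S" using u False by simp
    then have "?g p \<le> ?g (u, (1 / norm v) *\<^sub>R v)" by (rule p(2))
    also have "\<dots> = (\<Sum>b\<in>Basis. \<bar>h u ((1 / norm v) *\<^sub>R v) b\<bar>)" by (rule g[OF u])
    also have "\<dots> = (\<Sum>b\<in>Basis. \<bar>h u v b\<bar>) / norm v"
      by (simp add: bilinear_lmul[OF h[OF u]] abs_mult sum_divide_distrib)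
    finally show ?thesis using False by (simp add: le_divide_eq)
  qed (simp add: sum_nonneg)
  then show ?thesis using pos by blast
qed

context closed_manifold
begin

definition nondegenerate :: "('m, 'e) tensor2 \<Rightarrow> bool" where
  "nondegenerate h \<longleftrightarrow> smooth_tensor2 A h \<and> (\<forall>c\<in>A. \<forall>u\<in>cran c. \<forall>v. v \<noteq> 0 \<longrightarrow> (\<exists>w. h c u v w \<noteq> 0))"

text \<open>The solution \<open>z\<close> of \<open>h(z, w) = l(w)\<close> is linear in \<open>l\<close>; these are the solutions for the dual basis.\<close>

definition frame :: "('m, 'e) tensor2 \<Rightarrow> ('m, 'e) chart \<Rightarrow> 'e \<Rightarrow> 'e \<Rightarrow> 'e" where
  "frame h c b u = (THE z. \<forall>w. h c u z w = b \<bullet> w)"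

lemma tensor_bilinear: "smooth_tensor2 A h \<Longrightarrow> c \<in> A \<Longrightarrow> u \<in> cran c \<Longrightarrow> bilinear (h c u)"
  by (simp add: smooth_tensor2_def)
lemma tensor_smooth: "smooth_tensor2 A h \<Longrightarrow> c \<in> A \<Longrightarrow> smooth_on (cran c) (\<lambda>u. h c u v w)"
  using C_on_infinity_open[OF open_cran, of c "\<lambda>u. h c u v w"] unfolding smooth_tensor2_def by blast
lemma tensor_continuous: "smooth_tensor2 A h \<Longrightarrow> c \<in> A \<Longrightarrow> continuous_on (cran c) (\<lambda>u. h c u v w)"
  using tensor_smooth smooth_on_continuous_on by blast
lemma tensor_transform: "smooth_tensor2 A h \<Longrightarrow> c \<in> A \<Longrightarrow> c' \<in> A \<Longrightarrow> p \<in> cdom c \<Longrightarrow> p \<in> cdom c' \<Longrightarrow>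
    h c (cmap c p) v w = h c' (cmap c' p) (jac c c' (cmap c p) v) (jac c c' (cmap c p) w)"
  unfolding smooth_tensor2_def using transition_cmap[of c p c'] by (metis IntI image_eqI)

lemma nondegenerateD:
  assumes "nondegenerate h" "c \<in> A" "u \<in> cran c"
  shows "smooth_tensor2 A h" "bilinear (h c u)" "v \<noteq> 0 \<Longrightarrow> \<exists>w. h c u v w \<noteq> 0"
  using assms by (auto simp: nondegenerate_def intro: tensor_bilinear)

lemma form_ex1:
  assumes "nondegenerate h" "c \<in> A" "u \<in> cran c" "linear l"
  shows "\<exists>!z. \<forall>w. h c u z w = l w"
  using nondegenerate_ex1[OF nondegenerateD(2)[OF assms(1-3)] nondegenerateD(3)[OF assms(1-3)] assms(4)] .

lemma form_solution:
  assumes "nondegenerate h" "c \<in> A" "u \<in> cran c" "linear l"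
  shows "h c u (THE z. \<forall>w. h c u z w = l w) w = l w"
  using theI'[OF form_ex1[OF assms]] by blast

lemma form_solution_unique:
  assumes "nondegenerate h" "c \<in> A" "u \<in> cran c" "linear l" "\<And>w. h c u z w = l w"
  shows "(THE z. \<forall>w. h c u z w = l w) = z"
  using the1_equality[OF form_ex1[OF assms(1-4)]] assms(5) by blast

lemma form_cancel:
  assumes "nondegenerate h" "c \<in> A" "u \<in> cran c" "\<And>w. h c u z w = h c u z' w"
  shows "z = z'"
proof -
  have "linear (h c u z')" using nondegenerateD(2)[OF assms(1-3)] by (rule bilinear_linear)
  from form_ex1[OF assms(1-3) this] show ?thesis using assms(4) by blast
qed

lemma frame_spec:
  assumes "nondegenerate h" "c \<in> A" "u \<in> cran c"
  shows "h c u (frame h c b u) w = b \<bullet> w"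
  unfolding frame_def by (rule form_solution[OF assms]) (simp add: bounded_linear_inner_right bounded_linear.linear)

lemma form_solution_expand:
  assumes h: "nondegenerate h" "c \<in> A" "u \<in> cran c" and l: "linear l"
  shows "(THE z. \<forall>w. h c u z w = l w) = (\<Sum>b\<in>Basis. l b *\<^sub>R frame h c b u)"
proof (rule form_solution_unique[OF h l])
  fix w
  note B = nondegenerateD(2)[OF h]
  have "h c u (\<Sum>b\<in>Basis. l b *\<^sub>R frame h c b u) w = (\<Sum>b\<in>Basis. l b * h c u (frame h c b u) w)"
    unfolding linear_sum[OF bilinear_linear(2)[OF B]] by (simp add: bilinear_lmul[OF B])
  also have "\<dots> = (\<Sum>b\<in>Basis. (w \<bullet> b) *\<^sub>R l b)"
    by (simp add: frame_spec[OF h] inner_commute mult.commute)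
  also have "\<dots> = l w" by (rule linear_Basis_expand[OF l, symmetric])
  finally show "h c u (\<Sum>b\<in>Basis. l b *\<^sub>R frame h c b u) w = l w" .
qed

text \<open>Let z_u solve h_u(z_u, -) = b. Then h_u(z_u - z_v, -) = (h_v - h_u)(z_v, -), so uniform
  nondegeneracy bounds z_u - z_v by the variation of \<open>h\<close>. In this way no inverse matrix
  has to be differentiated.\<close>

lemma frame_lipschitz:
  assumes h: "nondegenerate h" and c: "c \<in> A" and K: "compact K" "convex K" "K \<subseteq> cran c"
  shows "\<exists>L\<ge>0. \<forall>b\<in>Basis. \<forall>u\<in>K. \<forall>v\<in>K. norm (frame h c b u - frame h c b v) \<le> L * norm (u - v)"
proof -
  have s: "smooth_tensor2 A h" using h by (simp add: nondegenerate_def)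
  have Kc: "u \<in> cran c" if "u \<in> K" for u using K that by auto
  obtain \<kappa> where \<kappa>: "\<kappa> > 0" "\<And>u v. u \<in> K \<Longrightarrow> \<kappa> * norm v \<le> (\<Sum>b\<in>Basis. \<bar>h c u v b\<bar>)"
    using nondegenerate_uniform[OF K(1), of "h c"] nondegenerateD(2,3)[OF h c]
      continuous_on_subset[OF tensor_continuous[OF s c] K(3)] Kc by metis
  have "\<exists>L>0. \<forall>(a, b)\<in>Basis\<times>Basis. \<forall>u\<in>K. \<forall>v\<in>K. \<bar>h c u a b - h c v a b\<bar> \<le> L * norm (u - v)"
  proof -
    have "\<exists>L>0. \<forall>p\<in>Basis\<times>Basis. \<forall>u\<in>K. \<forall>v\<in>K. \<bar>h c u (fst p) (snd p) - h c v (fst p) (snd p)\<bar> \<le> L * norm (u - v)"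
    proof (rule finite_ex_bound)
      fix p :: "'e \<times> 'e"
      have "Ck_open 1 (cran c) (\<lambda>u. h c u (fst p) (snd p))"
        using tensor_smooth[OF s c] unfolding smooth_on_def by blast
      from C1_lipschitz[OF this K]
      show "\<exists>L. \<forall>u\<in>K. \<forall>v\<in>K. \<bar>h c u (fst p) (snd p) - h c v (fst p) (snd p)\<bar> \<le> L * norm (u - v)" by blast
    next
      fix p L L' assume "\<forall>u\<in>K. \<forall>v\<in>K. \<bar>h c u (fst p) (snd p) - h c v (fst p) (snd p)\<bar> \<le> L * norm (u - v)" "(L::real) \<le> L'"
      then show "\<forall>u\<in>K. \<forall>v\<in>K. \<bar>h c u (fst p) (snd p) - h c v (fst p) (snd p)\<bar> \<le> L' * norm (u - v)"
        by (meson mult_right_mono norm_ge_zero order_trans)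
    qed auto
    then show ?thesis by (auto simp: split_beta)
  qed
  then obtain L where L: "L > 0" "\<And>a b u v. a \<in> Basis \<Longrightarrow> b \<in> Basis \<Longrightarrow> u \<in> K \<Longrightarrow> v \<in> K \<Longrightarrow> \<bar>h c u a b - h c v a b\<bar> \<le> L * norm (u - v)"
    by blast
  define d where "d = real DIM('e)"
  have "norm (frame h c b u - frame h c b v) \<le> (d * (d * (1 / \<kappa> * L)) / \<kappa>) * norm (u - v)"
    if b: "b \<in> Basis" and uv: "u \<in> K" "v \<in> K" for b u v
  proof -
    let ?z = "frame h c b v"
    have sp: "h c w (frame h c b w) y = b \<bullet> y" if "w \<in> K" for w y using frame_spec[OF h c Kc[OF that]] .
    have "\<kappa> * norm ?z \<le> (\<Sum>b'\<in>Basis. \<bar>b \<bullet> b'\<bar>)" using \<kappa>(2)[OF uv(2), of ?z] by (simp add: sp[OF uv(2)])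
    also have "\<dots> = (\<Sum>b'\<in>Basis. if b' = b then 1 else 0)" using b by (intro sum.cong) (auto simp: inner_Basis)
    also have "\<dots> = 1" using b by simp
    finally have nz: "norm ?z \<le> 1 / \<kappa>" using \<kappa>(1) by (simp add: field_simps)
    have dz: "\<bar>h c u (frame h c b u - ?z) b'\<bar> \<le> d * (1 / \<kappa> * (L * norm (u - v)))" if b': "b' \<in> Basis" for b'
    proof -
      \<comment> \<open>The two defining equations have the same right-hand side and are
        subtracted.\<close>
      have "h c u (frame h c b u - ?z) b' = h c v ?z b' - h c u ?z b'"
        using sp[OF uv(1)] sp[OF uv(2)] by (simp add: bilinear_lsub[OF nondegenerateD(2)[OF h c Kc[OF uv(1)]]])
      also have "\<dots> = (\<Sum>a\<in>Basis. (?z \<bullet> a) * (h c v a b' - h c u a b'))"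
        using linear_Basis_expand[OF bilinear_linear(2)[OF nondegenerateD(2)[OF h c Kc[OF uv(1)]]], of ?z b']
          linear_Basis_expand[OF bilinear_linear(2)[OF nondegenerateD(2)[OF h c Kc[OF uv(2)]]], of ?z b']
        by (simp add: algebra_simps sum_subtractf)
      also have "\<bar>\<dots>\<bar> \<le> (\<Sum>a\<in>(Basis::'e set). 1 / \<kappa> * (L * norm (u - v)))"
      proof (rule order_trans[OF sum_abs sum_mono])
        fix a :: 'e assume a: "a \<in> Basis"
        have "\<bar>?z \<bullet> a\<bar> \<le> 1 / \<kappa>" using Basis_le_norm[OF a, of ?z] nz by linarith
        moreover have "\<bar>h c v a b' - h c u a b'\<bar> \<le> L * norm (u - v)"
          using L(2)[OF a b' uv(1) uv(2)] by (simp add: abs_minus_commute)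
        ultimately show "\<bar>(?z \<bullet> a) * (h c v a b' - h c u a b')\<bar> \<le> 1 / \<kappa> * (L * norm (u - v))"
          unfolding abs_mult by (intro mult_mono) (use \<kappa>(1) in auto)
      qed
      finally show ?thesis by (simp add: d_def)
    qed
    have "\<kappa> * norm (frame h c b u - ?z) \<le> (\<Sum>b'\<in>Basis. \<bar>h c u (frame h c b u - ?z) b'\<bar>)"
      by (rule \<kappa>(2)[OF uv(1)])
    also have "\<dots> \<le> real DIM('e) * (d * (1 / \<kappa> * (L * norm (u - v))))"
      by (rule sum_bounded_above) (rule dz)
    finally show ?thesis using \<kappa>(1) by (simp add: d_def[symmetric] field_simps)
  qed
  moreover have "d * (d * (1 / \<kappa> * L)) / \<kappa> \<ge> 0" using \<kappa>(1) L(1) by (simp add: d_def)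
  ultimately show ?thesis by blast
qed

lemma continuous_frame:
  assumes h: "nondegenerate h" and c: "c \<in> A" and b: "b \<in> Basis"
  shows "continuous_on (cran c) (frame h c b)"
proof (rule continuous_at_imp_continuous_on, rule ballI)
  fix u assume u: "u \<in> cran c"
  obtain e where e: "e > 0" "cball u e \<subseteq> cran c" using open_contains_cball open_cran[OF c] u by blast
  obtain L where L: "L \<ge> 0" "\<And>v w. v \<in> cball u e \<Longrightarrow> w \<in> cball u e \<Longrightarrow> norm (frame h c b v - frame h c b w) \<le> L * norm (v - w)"
    using frame_lipschitz[OF h c compact_cball convex_cball e(2)] b by blast
  have "continuous_on (cball u e) (frame h c b)"
    by (rule lipschitz_on_continuous_on[of L]) (auto simp: lipschitz_on_def dist_norm L)
  then show "isCont (frame h c b) u"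
    using e(1) by (intro continuous_on_interior[of "cball u e"]) auto
qed

end

section \<open>Hamiltonians with Lipschitz differential and their vector fields\<close>

locale symplectic_manifold = covered_manifold A I
  for A :: "('m::t2_space, 'e::euclidean_space) chart set" and I +
  fixes \<omega> :: "('m, 'e) tensor2"
  assumes symplectic: "symplectic_form A \<omega>"
begin

lemma nondegenerate_\<omega>: "nondegenerate \<omega>"
  using symplectic by (simp add: symplectic_form_def nondegenerate_def)

lemma smooth_\<omega>: "smooth_tensor2 A \<omega>"
  using symplectic by (simp add: symplectic_form_def)

text \<open>The chart form of the C^{1,1} condition: the Lipschitz constant may depend on the ball
  but not on time. The given Hamiltonian and its smooth approximants share this property, so the
  theory of flows is developed once for both.\<close>

definition regular :: "(real \<Rightarrow> 'm \<Rightarrow> real) \<Rightarrow> bool" where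
  "regular H \<longleftrightarrow> (\<forall>t\<in>{0..1}. C1_fun (H t)) \<and>
    (\<forall>c\<in>A. \<forall>v. continuous_on ({0..1} \<times> cran c) (\<lambda>(t, u). differential c (H t) u v)) \<and>
    (\<forall>c\<in>A. \<forall>x r. cball x r \<subseteq> cran c \<longrightarrow>
      (\<exists>L\<ge>0. \<forall>t\<in>{0..1}. \<forall>u\<in>cball x r. \<forall>v\<in>cball x r. \<forall>b\<in>Basis.
         \<bar>differential c (H t) u b - differential c (H t) v b\<bar> \<le> L * norm (u - v)))"

lemma regular_lipschitz:
  assumes H: "regular H" and c: "c \<in> A" and K: "cball x r \<subseteq> cran c"
  shows "\<exists>L\<ge>0. \<forall>t\<in>{0..1}. \<forall>u\<in>cball x r. \<forall>v\<in>cball x r. \<forall>b\<in>Basis.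
         \<bar>differential c (H t) u b - differential c (H t) v b\<bar> \<le> L * norm (u - v)"
proof -
  from H have "\<forall>c\<in>A. \<forall>x r. cball x r \<subseteq> cran c \<longrightarrow>
      (\<exists>L\<ge>0. \<forall>t\<in>{0..1}. \<forall>u\<in>cball x r. \<forall>v\<in>cball x r. \<forall>b\<in>Basis.
         \<bar>differential c (H t) u b - differential c (H t) v b\<bar> \<le> L * norm (u - v))"
    unfolding regular_def by (elim conjE)
  from this[rule_format, OF c K] show ?thesis by blast
qed

lemma regular_continuous:
  "regular H \<Longrightarrow> c \<in> A \<Longrightarrow> continuous_on ({0..1} \<times> cran c) (\<lambda>(t, u). differential c (H t) u v)"
  unfolding regular_def by blast

abbreviation "vf \<equiv> hamiltonian_vf \<omega>"

lemma regular_C1: "regular H \<Longrightarrow> t \<in> {0..1} \<Longrightarrow> C1_fun (H t)"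
  by (simp add: regular_def)

lemma regular_linear:
  "regular H \<Longrightarrow> t \<in> {0..1} \<Longrightarrow> c \<in> A \<Longrightarrow> u \<in> cran c \<Longrightarrow> linear (differential c (H t) u)"
  by (simp add: regular_C1 differential_linear)

lemma vf_spec:
  assumes "regular H" "t \<in> {0..1}" "c \<in> A" "u \<in> cran c"
  shows "\<omega> c u (vf H t c u) w = differential c (H t) u w"
  unfolding hamiltonian_vf_def using form_solution[OF nondegenerate_\<omega> assms(3,4) regular_linear[OF assms]] .

lemma vf_expand:
  assumes "regular H" "t \<in> {0..1}" "c \<in> A" "u \<in> cran c"
  shows "vf H t c u = (\<Sum>b\<in>Basis. differential c (H t) u b *\<^sub>R frame \<omega> c b u)"
  unfolding hamiltonian_vf_def using form_solution_expand[OF nondegenerate_\<omega> assms(3,4) regular_linear[OF assms]] .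

text \<open>Both sides have the same pairing with every vector, since \<omega> and dH are invariant.
  As a consequence, a curve that solves Hamilton's equation in one chart solves it in every chart it
  meets.\<close>

lemma vf_transform:
  assumes H: "regular H" "t \<in> {0..1}" and c: "c \<in> A" "c' \<in> A" and p: "p \<in> cdom c" "p \<in> cdom c'"
  shows "vf H t c' (cmap c' p) = jac c c' (cmap c p) (vf H t c (cmap c p))"
proof (rule form_cancel[OF nondegenerate_\<omega> c(2) cmap_in[OF p(2)]])
  fix w
  let ?w = "jac c' c (cmap c' p) w"
  have w: "jac c c' (cmap c p) ?w = w" using jac_inverse c p by blast
  have "\<omega> c' (cmap c' p) (jac c c' (cmap c p) (vf H t c (cmap c p))) w = \<omega> c (cmap c p) (vf H t c (cmap c p)) ?w"
    using tensor_transform[OF smooth_\<omega> c p] w by metis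
  also have "\<dots> = differential c (H t) (cmap c p) ?w" by (rule vf_spec[OF H c(1) cmap_in[OF p(1)]])
  also have "\<dots> = differential c' (H t) (cmap c' p) w"
    using differential_transform[OF regular_C1[OF H] c p] w by metis
  also have "\<dots> = \<omega> c' (cmap c' p) (vf H t c' (cmap c' p)) w" by (rule vf_spec[OF H c(2) cmap_in[OF p(2)], symmetric])
  finally show "\<omega> c' (cmap c' p) (vf H t c' (cmap c' p)) w = \<omega> c' (cmap c' p) (jac c c' (cmap c p) (vf H t c (cmap c p))) w"
    by simp
qed

lemma vf_continuous:
  assumes H: "regular H" and c: "c \<in> A"
  shows "continuous_on ({0..1} \<times> cran c) (\<lambda>(t, u). vf H t c u)"
proof -
  have "continuous_on ({0..1} \<times> cran c) (\<lambda>p. \<Sum>b\<in>Basis. (case p of (t, u) \<Rightarrow> differential c (H t) u b) *\<^sub>R frame \<omega> c b (snd p))"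
    by (intro continuous_intros continuous_on_compose2[OF continuous_frame[OF nondegenerate_\<omega> c]]
        regular_continuous[OF H c]) auto
  then show ?thesis
    by (rule continuous_on_eq) (auto simp: vf_expand H c)
qed

lemma vf_bounded:
  assumes H: "regular H" and c: "c \<in> A" and K: "compact K" "K \<subseteq> cran c"
  shows "\<exists>m\<ge>0. \<forall>t\<in>{0..1}. \<forall>u\<in>K. norm (vf H t c u) \<le> m"
  using continuous_compact_bound[of "{0..1} \<times> K" "\<lambda>(t, u). vf H t c u"]
    continuous_on_subset[OF vf_continuous[OF H c], of "{0..1} \<times> K"] K by (auto simp: compact_Times)

lemma vf_lipschitz:
  assumes H: "regular H" and c: "c \<in> A" and K: "cball x r \<subseteq> cran c"
  shows "\<exists>L\<ge>0. \<forall>t\<in>{0..1}. \<forall>u\<in>cball x r. \<forall>v\<in>cball x r. norm (vf H t c u - vf H t c v) \<le> L * norm (u - v)"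
proof -
  let ?K = "cball x r"
  obtain L1 where L1: "L1 \<ge> 0" "\<And>t u v b. t \<in> {0..1} \<Longrightarrow> u \<in> ?K \<Longrightarrow> v \<in> ?K \<Longrightarrow> b \<in> Basis \<Longrightarrow>
      \<bar>differential c (H t) u b - differential c (H t) v b\<bar> \<le> L1 * norm (u - v)"
    using regular_lipschitz[OF H c K] by blast
  obtain L2 where L2: "L2 \<ge> 0" "\<And>u v b. u \<in> ?K \<Longrightarrow> v \<in> ?K \<Longrightarrow> b \<in> Basis \<Longrightarrow> norm (frame \<omega> c b u - frame \<omega> c b v) \<le> L2 * norm (u - v)"
    using frame_lipschitz[OF nondegenerate_\<omega> c compact_cball convex_cball K] by blast
  have "\<exists>M>0. \<forall>b\<in>Basis. \<forall>t\<in>{0..1}. \<forall>u\<in>?K. \<bar>differential c (H t) u b\<bar> \<le> M \<and> norm (frame \<omega> c b u) \<le> M"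
  proof (rule finite_ex_bound[OF finite_Basis])
    fix b :: 'e assume b: "b \<in> Basis"
    have 1: "continuous_on ({0..1} \<times> ?K) (\<lambda>(t, u). differential c (H t) u b)"
      by (rule continuous_on_subset[OF regular_continuous[OF H c]]) (use K in auto)
    obtain M1 where M1: "\<forall>p\<in>{0..1} \<times> ?K. norm (case p of (t, u) \<Rightarrow> differential c (H t) u b) \<le> M1"
      using continuous_compact_bound[OF _ 1] by (auto simp: compact_Times)
    obtain M2 where M2: "\<forall>u\<in>?K. norm (frame \<omega> c b u) \<le> M2"
      using continuous_compact_bound[OF compact_cball continuous_on_subset[OF continuous_frame[OF nondegenerate_\<omega> c b] K]] by blast
    show "\<exists>M. \<forall>t\<in>{0..1}. \<forall>u\<in>?K. \<bar>differential c (H t) u b\<bar> \<le> M \<and> norm (frame \<omega> c b u) \<le> M"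
    proof (intro exI[of _ "max M1 M2"] ballI conjI)
      fix t :: real and u assume "t \<in> {0..1}" "u \<in> ?K"
      then have "\<bar>differential c (H t) u b\<bar> \<le> M1" "norm (frame \<omega> c b u) \<le> M2"
        using M1 M2 by (force, blast)
      then show "\<bar>differential c (H t) u b\<bar> \<le> max M1 M2" "norm (frame \<omega> c b u) \<le> max M1 M2" by linarith+
    qed
  qed (meson order_trans)
  then obtain M where M: "M > 0" "\<And>b t u. b \<in> Basis \<Longrightarrow> t \<in> {0..1} \<Longrightarrow> u \<in> ?K \<Longrightarrow> \<bar>differential c (H t) u b\<bar> \<le> M"
     "\<And>b u. b \<in> Basis \<Longrightarrow> u \<in> ?K \<Longrightarrow> norm (frame \<omega> c b u) \<le> M"
    by (metis atLeastAtMost_iff order_refl zero_le_one)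
  have "norm (vf H t c u - vf H t c v) \<le> real DIM('e) * (M * L2 + L1 * M) * norm (u - v)"
    if t: "t \<in> {0..1}" and uv: "u \<in> ?K" "v \<in> ?K" for t u v
  proof -
    let ?d = "\<lambda>u b. differential c (H t) u b" and ?f = "\<lambda>u b. frame \<omega> c b u"
    have "vf H t c u - vf H t c v = (\<Sum>b\<in>Basis. ?d u b *\<^sub>R ?f u b - ?d v b *\<^sub>R ?f v b)"
      using uv K vf_expand[OF H t c] by (auto simp: sum_subtractf subset_eq)
    also have "norm \<dots> \<le> (\<Sum>b\<in>(Basis::'e set). (M * L2 + L1 * M) * norm (u - v))"
    proof (rule sum_norm_le)
      fix b :: 'e assume b: "b \<in> Basis"
      have "?d u b *\<^sub>R ?f u b - ?d v b *\<^sub>R ?f v b = ?d u b *\<^sub>R (?f u b - ?f v b) + (?d u b - ?d v b) *\<^sub>R ?f v b"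
        by (simp add: algebra_simps)
      also have "norm \<dots> \<le> \<bar>?d u b\<bar> * norm (?f u b - ?f v b) + \<bar>?d u b - ?d v b\<bar> * norm (?f v b)"
        by (rule order_trans[OF norm_triangle_ineq]) simp
      also have "\<dots> \<le> M * (L2 * norm (u - v)) + (L1 * norm (u - v)) * M"
        using M L1 L2 b t uv by (intro add_mono mult_mono) auto
      finally show "norm (?d u b *\<^sub>R ?f u b - ?d v b *\<^sub>R ?f v b) \<le> (M * L2 + L1 * M) * norm (u - v)"
        by (simp add: algebra_simps)
    qed
    finally show ?thesis by simp
  qed
  moreover have "real DIM('e) * (M * L2 + L1 * M) \<ge> 0" using M L1 L2 by simp
  ultimately show ?thesis by blast
qed

text \<open>The derivative of \<open>f\<close> in the direction of the Hamiltonian vector field.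
  Unlike the components of that field this is a global scalar function, and can be compared at two
  distant points.\<close>

definition along :: "('m \<Rightarrow> real) \<Rightarrow> (real \<Rightarrow> 'm \<Rightarrow> real) \<Rightarrow> real \<Rightarrow> 'm \<Rightarrow> real" where
  "along f H t p = (let c = (SOME c. c \<in> A \<and> p \<in> cdom c) in differential c f (cmap c p) (vf H t c (cmap c p)))"

lemma along_eq:
  assumes f: "C1_fun f" and H: "regular H" "t \<in> {0..1}" and c: "c \<in> A" "p \<in> cdom c"
  shows "along f H t p = differential c f (cmap c p) (vf H t c (cmap c p))"
proof -
  define c' where "c' = (SOME c. c \<in> A \<and> p \<in> cdom c)"
  have "c' \<in> A \<and> p \<in> cdom c'"
    unfolding c'_def by (rule someI_ex) (use c in blast)
  then have c': "c' \<in> A" "p \<in> cdom c'" by blast+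
  have "along f H t p = differential c' f (cmap c' p) (vf H t c' (cmap c' p))"
    by (simp add: along_def c'_def Let_def)
  also have "\<dots> = differential c f (cmap c p) (vf H t c (cmap c p))"
    unfolding vf_transform[OF H c(1) c'(1) c(2) c'(2)]
    by (rule differential_transform[OF f c(1) c'(1) c(2) c'(2), symmetric])
  finally show ?thesis .
qed

text \<open>If \<delta> < 1/2, both points lie in one doubled ball, where
  \<open>vf_lipschitz\<close> applies and coordinate distances are controlled by
  \<open>\<delta>\<close>. Points further apart are handled by boundedness.\<close>

lemma along_bounded_lipschitz:
  assumes H: "regular H"
  shows "\<exists>L>0. \<forall>f\<in>\<F>. \<forall>t\<in>{0..1}. \<forall>p q. \<bar>along f H t p\<bar> \<le> L \<and> \<bar>along f H t p - along f H t q\<bar> \<le> L * \<delta> p q"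
proof (rule finite_ex_bound[OF finite_\<F>])
  fix f assume f: "f \<in> \<F>"
  note C1 = smooth_fun_imp_C1[OF smooth_\<F>[OF f]]
  define G where "G c t u = differential c f u (vf H t c u)" for c t u
  define P where "P i C \<longleftrightarrow> (case i of (c, x, r) \<Rightarrow> \<forall>t\<in>{0..1}. \<forall>u\<in>cball x (2*r). \<forall>v\<in>cball x (2*r).
      \<bar>G c t u\<bar> \<le> C \<and> \<bar>G c t u - G c t v\<bar> \<le> C * norm (u - v))" for i :: "('m, 'e) chart \<times> 'e \<times> real" and C :: real
  have "\<exists>C>0. \<forall>i\<in>I. P i C"
  proof (rule finite_ex_bound[OF finite_I])
    fix i assume "i \<in> I"
    obtain c x r where i: "i = (c, x, r)" by (cases i)
    then have I: "(c, x, r) \<in> I" using \<open>i \<in> I\<close> by simp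
    note c = I_in(1)[OF I] and K = I_in(3)[OF I]
    let ?K = "cball x (2 * r)"
    obtain L m where Lm: "L \<ge> 0" "m \<ge> 0" "\<And>t u. t \<in> {0..1} \<Longrightarrow> u \<in> ?K \<Longrightarrow> norm (vf H t c u) \<le> m"
      "\<And>t u v. t \<in> {0..1} \<Longrightarrow> u \<in> ?K \<Longrightarrow> v \<in> ?K \<Longrightarrow> norm (vf H t c u - vf H t c v) \<le> L * norm (u - v)"
      using vf_lipschitz[OF H c K] vf_bounded[OF H c compact_cball K] by metis
    have sd: "smooth_on (cran c) (\<lambda>u. differential c f u b)" for b
      unfolding differential_def using smooth_\<F>[OF f] c by (auto simp: smooth_fun_def intro!: smooth_on_frechet_derivative)
    have "\<exists>M>0. \<forall>b\<in>Basis. (\<forall>u\<in>?K. \<bar>differential c f u b\<bar> \<le> M) \<and>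
        (\<forall>u\<in>?K. \<forall>v\<in>?K. \<bar>differential c f u b - differential c f v b\<bar> \<le> M * norm (u - v))"
    proof (rule finite_ex_bound[OF finite_Basis])
      fix b :: 'e
      have "Ck_open 1 (cran c) (\<lambda>u. differential c f u b)" using sd[of b] unfolding smooth_on_def by blast
      from C1_lipschitz[OF this compact_cball convex_cball K] obtain M1 where
        M1: "\<forall>u\<in>?K. \<forall>v\<in>?K. \<bar>differential c f u b - differential c f v b\<bar> \<le> M1 * norm (u - v)" by blast
      obtain M2 where M2: "\<forall>u\<in>?K. norm (differential c f u b) \<le> M2"
        using continuous_compact_bound[OF compact_cball continuous_on_subset[OF smooth_on_continuous_on[OF sd] K]] by blast
      have m: "M1 * norm (u - v) \<le> max M1 M2 * norm (u - v)" for u v :: 'e by (rule mult_right_mono) auto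
      show "\<exists>M. (\<forall>u\<in>?K. \<bar>differential c f u b\<bar> \<le> M) \<and>
        (\<forall>u\<in>?K. \<forall>v\<in>?K. \<bar>differential c f u b - differential c f v b\<bar> \<le> M * norm (u - v))"
      proof (intro exI[of _ "max M1 M2"] conjI ballI)
        show "\<bar>differential c f u b\<bar> \<le> max M1 M2" if "u \<in> ?K" for u
          using bspec[OF M2 that] by simp
        show "\<bar>differential c f u b - differential c f v b\<bar> \<le> max M1 M2 * norm (u - v)" if "u \<in> ?K" "v \<in> ?K" for u v
          using bspec[OF bspec[OF M1 that(1)] that(2)] m[of u v] by linarith
      qed
    next
      fix b M M' assume a: "(\<forall>u\<in>?K. \<bar>differential c f u b\<bar> \<le> M) \<and>
        (\<forall>u\<in>?K. \<forall>v\<in>?K. \<bar>differential c f u b - differential c f v b\<bar> \<le> M * norm (u - v))" "(M::real) \<le> M'"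
      have m: "M * norm (u - v) \<le> M' * norm (u - v)" for u v :: 'e using a(2) by (rule mult_right_mono) auto
      show "(\<forall>u\<in>?K. \<bar>differential c f u b\<bar> \<le> M') \<and>
        (\<forall>u\<in>?K. \<forall>v\<in>?K. \<bar>differential c f u b - differential c f v b\<bar> \<le> M' * norm (u - v))"
      proof (intro conjI ballI)
        show "\<bar>differential c f u b\<bar> \<le> M'" if "u \<in> ?K" for u
          using bspec[OF conjunct1[OF a(1)] that] a(2) by linarith
        show "\<bar>differential c f u b - differential c f v b\<bar> \<le> M' * norm (u - v)" if "u \<in> ?K" "v \<in> ?K" for u v
          using bspec[OF bspec[OF conjunct2[OF a(1)] that(1)] that(2)] m[of u v] by linarith
      qed
    qed
    then obtain M where M: "M > 0" "\<And>b u. b \<in> Basis \<Longrightarrow> u \<in> ?K \<Longrightarrow> \<bar>differential c f u b\<bar> \<le> M"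
      "\<And>b u v. b \<in> Basis \<Longrightarrow> u \<in> ?K \<Longrightarrow> v \<in> ?K \<Longrightarrow> \<bar>differential c f u b - differential c f v b\<bar> \<le> M * norm (u - v)"
      by blast
    have G: "G c t u = (\<Sum>b\<in>Basis. (vf H t c u \<bullet> b) * differential c f u b)" if "u \<in> ?K" for t u
      using linear_Basis_expand[OF differential_linear[OF C1 c], of u "vf H t c u"] K that by (auto simp: G_def)
    let ?C = "real DIM('e) * max (m * M) (m * M + L * M)"
    have Gb: "\<bar>G c t u\<bar> \<le> ?C" if "t \<in> {0..1}" "u \<in> ?K" for t u
    proof -
      have "\<bar>G c t u\<bar> \<le> (\<Sum>b\<in>(Basis::'e set). max (m * M) (m * M + L * M))"
        unfolding G[OF that(2)]
      proof (rule order_trans[OF sum_abs sum_mono])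
        fix b :: 'e assume b: "b \<in> Basis"
        have "\<bar>(vf H t c u \<bullet> b) * differential c f u b\<bar> \<le> m * M"
          unfolding abs_mult using Basis_le_norm[OF b, of "vf H t c u"] Lm(3)[OF that] M(2)[OF b that(2)] Lm(2)
          by (intro mult_mono) auto
        then show "\<bar>(vf H t c u \<bullet> b) * differential c f u b\<bar> \<le> max (m * M) (m * M + L * M)" by simp
      qed
      then show ?thesis by simp
    qed
    moreover have "\<bar>G c t u - G c t v\<bar> \<le> ?C * norm (u - v)" if t: "t \<in> {0..1}" and uv: "u \<in> ?K" "v \<in> ?K" for t u v
    proof -
      have "\<bar>G c t u - G c t v\<bar> \<le> (\<Sum>b\<in>(Basis::'e set). max (m * M) (m * M + L * M) * norm (u - v))"
        unfolding G[OF uv(1)] G[OF uv(2)] sum_subtractf[symmetric]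
      proof (rule order_trans[OF sum_abs sum_mono])
        fix b :: 'e assume b: "b \<in> Basis"
        have "\<bar>vf H t c u \<bullet> b - vf H t c v \<bullet> b\<bar> \<le> L * norm (u - v)"
          using Basis_le_norm[OF b, of "vf H t c u - vf H t c v"] Lm(4)[OF t uv] by (simp add: inner_diff_left)
        moreover have "\<bar>vf H t c u \<bullet> b\<bar> \<le> m" using Basis_le_norm[OF b, of "vf H t c u"] Lm(3)[OF t uv(1)] by simp
        ultimately have "\<bar>(vf H t c u \<bullet> b) * differential c f u b - (vf H t c v \<bullet> b) * differential c f v b\<bar> \<le> (m * M + L * M) * norm (u - v)"
          using lipschitz_mult[of "\<lambda>u. vf H t c u \<bullet> b" u v L "norm (u - v)" "\<lambda>u. differential c f u b" M m M]
            M(2)[OF b uv(2)] M(3)[OF b uv] M(1) Lm(2) by simp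
        also have "\<dots> \<le> max (m * M) (m * M + L * M) * norm (u - v)" by (rule mult_right_mono) auto
        finally show "\<bar>(vf H t c u \<bullet> b) * differential c f u b - (vf H t c v \<bullet> b) * differential c f v b\<bar>
           \<le> max (m * M) (m * M + L * M) * norm (u - v)" .
      qed
      then show ?thesis by (simp add: mult.assoc)
    qed
    ultimately show "\<exists>C. P i C" unfolding P_def i by (intro exI[of _ ?C]) (simp only: prod.case, blast)
  next
    fix i C C' assume "P i C" "(C::real) \<le> C'"
    have "C * norm (u - v) \<le> C' * norm (u - v)" for u v :: 'e using \<open>C \<le> C'\<close> by (rule mult_right_mono) auto
    then show "P i C'" using \<open>P i C\<close> \<open>C \<le> C'\<close> unfolding P_def by (cases i) (simp only: prod.case, blast intro: order_trans)
  qed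
  then obtain C where C: "C > 0" "\<And>c x r t u v. (c, x, r) \<in> I \<Longrightarrow> t \<in> {0..1} \<Longrightarrow> u \<in> cball x (2*r) \<Longrightarrow> v \<in> cball x (2*r) \<Longrightarrow>
      \<bar>G c t u\<bar> \<le> C \<and> \<bar>G c t u - G c t v\<bar> \<le> C * norm (u - v)"
    unfolding P_def by fast
  obtain C' where C': "C' > 0" "\<And>c x r p q. (c, x, r) \<in> I \<Longrightarrow> p \<in> cdom c \<Longrightarrow> cmap c p \<in> cball x r \<Longrightarrow> \<delta> p q < 1/2 \<Longrightarrow>
     q \<in> cdom c \<and> cmap c q \<in> cball x (2 * r) \<and> norm (cmap c q - cmap c p) \<le> C' * \<delta> p q"
    using \<delta>_local by fast
  have bound: "\<bar>along f H t p\<bar> \<le> C" if "t \<in> {0..1}" for t p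
  proof -
    obtain c x r where i: "(c, x, r) \<in> I" "p \<in> cdom c" "cmap c p \<in> ball x r" using I_cover[of p] by blast
    have "cmap c p \<in> cball x (2 * r)" using i(3) I_in(2)[OF i(1)] by (simp add: less_imp_le)
    then show ?thesis using C(2)[OF i(1) that] along_eq[OF C1 H that I_in(1)[OF i(1)] i(2)] by (simp add: G_def)
  qed
  \<comment> \<open>The first entry of the maximum is for close points. The second is for \<delta>
    \<ge> 1/2, where the difference is at most 2 C \<le> 4 C \<delta>.\<close>
  have "\<bar>along f H t p - along f H t q\<bar> \<le> max (C * C') (4 * C) * \<delta> p q" if t: "t \<in> {0..1}" for t p q
  proof (cases "\<delta> p q < 1/2")
    case True
    obtain c x r where i: "(c, x, r) \<in> I" "p \<in> cdom c" "cmap c p \<in> ball x r" using I_cover[of p] by blast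
    have p: "cmap c p \<in> cball x (2 * r)" "cmap c p \<in> cball x r" using i(3) I_in(2)[OF i(1)] by (simp_all add: less_imp_le)
    note q = C'(2)[OF i(1,2) p(2) True]
    have "\<bar>along f H t p - along f H t q\<bar> = \<bar>G c t (cmap c p) - G c t (cmap c q)\<bar>"
      using along_eq[OF C1 H t I_in(1)[OF i(1)]] i(2) q by (simp add: G_def)
    also have "\<dots> \<le> C * norm (cmap c p - cmap c q)" using C(2)[OF i(1) t p(1)] q by blast
    also have "\<dots> \<le> C * (C' * \<delta> p q)" using q C(1) by (intro mult_left_mono) (auto simp: norm_minus_commute)
    also have "\<dots> \<le> max (C * C') (4 * C) * \<delta> p q" unfolding mult.assoc[symmetric] by (intro mult_right_mono \<delta>_nonneg) auto
    finally show ?thesis .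
  next
    case False
    have "\<bar>along f H t p - along f H t q\<bar> \<le> C + C" using bound[OF t, of p] bound[OF t, of q] by linarith
    also have "\<dots> \<le> 4 * C * \<delta> p q" using False C(1) mult_left_mono[of "1/2" "\<delta> p q" "4 * C"] by simp
    also have "\<dots> \<le> max (C * C') (4 * C) * \<delta> p q" by (intro mult_right_mono \<delta>_nonneg) auto
    finally show ?thesis .
  qed
  moreover have "\<bar>along f H t p\<bar> \<le> max (C * C') (4 * C)" if "t \<in> {0..1}" for t p
    using bound[OF that, of p] C(1) by simp
  ultimately show "\<exists>L. \<forall>t\<in>{0..1}. \<forall>p q. \<bar>along f H t p\<bar> \<le> L \<and> \<bar>along f H t p - along f H t q\<bar> \<le> L * \<delta> p q" by blast
next
  fix f L L' assume h: "\<forall>t\<in>{0..1}. \<forall>p q. \<bar>along f H t p\<bar> \<le> L \<and> \<bar>along f H t p - along f H t q\<bar> \<le> L * \<delta> p q" "(L::real) \<le> L'"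
  have "L * \<delta> p q \<le> L' * \<delta> p q" for p q using h(2) \<delta>_nonneg by (rule mult_right_mono)
  then show "\<forall>t\<in>{0..1}. \<forall>p q. \<bar>along f H t p\<bar> \<le> L' \<and> \<bar>along f H t p - along f H t q\<bar> \<le> L' * \<delta> p q"
    using h by (meson order_trans)
qed

text \<open>The vector field is linear in dH, with coefficients from \<open>frame\<close>; hence
  \<open>C\<close> depends on \<open>\<F>\<close> and \<omega> only. It is quantified before
  \<open>H\<close> and \<open>K\<close>, because it has to serve a whole sequence of
  approximants.\<close>

lemma along_close:
  "\<exists>C>0. \<forall>H K t \<epsilon> f p. regular H \<longrightarrow> regular K \<longrightarrow> t \<in> {0..1} \<longrightarrow> f \<in> \<F> \<longrightarrow>
     (\<forall>(c, x, r)\<in>I. \<forall>u\<in>cball x r. \<forall>b\<in>Basis. \<bar>differential c (H t) u b - differential c (K t) u b\<bar> \<le> \<epsilon>) \<longrightarrow>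
     \<bar>along f H t p - along f K t p\<bar> \<le> C * \<epsilon>"
proof -
  define P where "P i C \<longleftrightarrow> (case i of (c, x, r) \<Rightarrow> \<forall>f\<in>\<F>. \<forall>u\<in>cball x r. \<forall>b\<in>Basis.
      \<bar>differential c f u (frame \<omega> c b u)\<bar> \<le> C)" for i :: "('m, 'e) chart \<times> 'e \<times> real" and C :: real
  have "\<exists>C>0. \<forall>i\<in>I. P i C"
  proof (rule finite_ex_bound[OF finite_I])
    fix i assume "i \<in> I"
    obtain c x r where i: "i = (c, x, r)" by (cases i)
    then have I: "(c, x, r) \<in> I" using \<open>i \<in> I\<close> by simp
    note c = I_in(1)[OF I] and K = I_in(4)[OF I]
    have "\<exists>C>0. \<forall>p\<in>\<F> \<times> Basis. \<forall>u\<in>cball x r. \<bar>differential c (fst p) u (frame \<omega> c (snd p) u)\<bar> \<le> C"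
    proof (rule finite_ex_bound)
      fix p :: "('m \<Rightarrow> real) \<times> 'e" assume p: "p \<in> \<F> \<times> Basis"
      have C1: "C1_fun (fst p)" using p smooth_fun_imp_C1 smooth_\<F> by (metis mem_Times_iff)
      have "continuous_on (cran c) (\<lambda>u. \<Sum>a\<in>Basis. (frame \<omega> c (snd p) u \<bullet> a) *\<^sub>R differential c (fst p) u a)"
        using C1 c continuous_frame[OF nondegenerate_\<omega> c, of "snd p"] p
        by (intro continuous_intros) (auto simp: C1_fun_iff)
      then have "continuous_on (cran c) (\<lambda>u. differential c (fst p) u (frame \<omega> c (snd p) u))"
        by (rule continuous_on_eq) (rule linear_Basis_expand[OF differential_linear[OF C1 c], symmetric])
      from continuous_compact_bound[OF compact_cball continuous_on_subset[OF this K]]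
      show "\<exists>C. \<forall>u\<in>cball x r. \<bar>differential c (fst p) u (frame \<omega> c (snd p) u)\<bar> \<le> C" by auto
    qed (auto simp: finite_\<F> intro: order_trans)
    then show "\<exists>C. P i C" unfolding P_def i by fastforce
  next
    fix i C C' assume "P i C" "(C::real) \<le> C'"
    then show "P i C'" unfolding P_def by (cases i) (simp only: prod.case, meson order_trans)
  qed
  then obtain C where C: "C > 0" "\<And>c x r f u b. (c, x, r) \<in> I \<Longrightarrow> f \<in> \<F> \<Longrightarrow> u \<in> cball x r \<Longrightarrow> b \<in> Basis \<Longrightarrow>
      \<bar>differential c f u (frame \<omega> c b u)\<bar> \<le> C"
    unfolding P_def by fast
  have "\<bar>along f H t p - along f K t p\<bar> \<le> (real DIM('e) * C) * \<epsilon>"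
    if H: "regular H" and K: "regular K" and t: "t \<in> {0..1}" and f: "f \<in> \<F>" and
     e: "\<forall>(c, x, r)\<in>I. \<forall>u\<in>cball x r. \<forall>b\<in>Basis. \<bar>differential c (H t) u b - differential c (K t) u b\<bar> \<le> \<epsilon>" for H K t \<epsilon> f p
  proof -
    note C1 = smooth_fun_imp_C1[OF smooth_\<F>[OF f]]
    obtain c x r where i: "(c, x, r) \<in> I" "p \<in> cdom c" "cmap c p \<in> ball x r" using I_cover[of p] by blast
    let ?u = "cmap c p"
    note c = I_in(1)[OF i(1)]
    have u: "?u \<in> cball x r" using i(3) by simp
    have uc: "?u \<in> cran c" using i(2) by simp
    note lin = differential_linear[OF C1 c uc]
    have "along f H t p - along f K t p = differential c f ?u (vf H t c ?u - vf K t c ?u)"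
      using along_eq[OF C1 _ t c i(2)] H K by (simp add: linear_diff[OF lin])
    also have "vf H t c ?u - vf K t c ?u = (\<Sum>b\<in>Basis. (differential c (H t) ?u b - differential c (K t) ?u b) *\<^sub>R frame \<omega> c b ?u)"
      unfolding vf_expand[OF H t c uc] vf_expand[OF K t c uc] by (simp add: sum_subtractf scaleR_diff_left)
    also have "differential c f ?u \<dots> = (\<Sum>b\<in>Basis. (differential c (H t) ?u b - differential c (K t) ?u b) * differential c f ?u (frame \<omega> c b ?u))"
      by (simp add: linear_sum[OF lin] linear_scale[OF lin])
    also have "\<bar>\<dots>\<bar> \<le> (\<Sum>b\<in>(Basis::'e set). \<epsilon> * C)"
    proof (rule order_trans[OF sum_abs sum_mono])
      fix b :: 'e assume b: "b \<in> Basis"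
      have "\<bar>differential c (H t) ?u b - differential c (K t) ?u b\<bar> \<le> \<epsilon>" using e i(1) u b by blast
      then show "\<bar>(differential c (H t) ?u b - differential c (K t) ?u b) * differential c f ?u (frame \<omega> c b ?u)\<bar> \<le> \<epsilon> * C"
        unfolding abs_mult using C(2)[OF i(1) f u b] by (intro mult_mono) auto
    qed
    finally show ?thesis by (simp add: mult.commute mult.left_commute)
  qed
  then show ?thesis using C(1) by (intro exI[of _ "real DIM('e) * C"]) auto
qed

end

section \<open>Hamiltonian flows\<close>

lemma abs_mult2_le: "\<bar>2 * x * y\<bar> \<le> x\<^sup>2 + y\<^sup>2" for x y :: real
proof -
  have "(\<bar>x\<bar> - \<bar>y\<bar>)\<^sup>2 \<ge> 0" by simp
  then show ?thesis by (simp add: power2_diff abs_mult)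
qed

context symplectic_manifold
begin

text \<open>A version of \<open>hamiltonian_solution\<close> on an arbitrary set of times, so that
  solutions can be restricted and glued.\<close>

definition solves :: "(real \<Rightarrow> 'm \<Rightarrow> real) \<Rightarrow> real set \<Rightarrow> (real \<Rightarrow> 'm) \<Rightarrow> bool" where
  "solves H S \<gamma> \<longleftrightarrow> continuous_on S \<gamma> \<and>
     (\<forall>c\<in>A. \<forall>t\<in>S. \<gamma> t \<in> cdom c \<longrightarrow>
        ((cmap c \<circ> \<gamma>) has_vector_derivative vf H t c (cmap c (\<gamma> t))) (at t within S))"

lemma hamiltonian_solution_iff: "hamiltonian_solution A \<omega> H \<gamma> \<longleftrightarrow> solves H {0..1} \<gamma>"
  by (simp add: hamiltonian_solution_def solves_def)

lemma solvesD:
  "solves H S \<gamma> \<Longrightarrow> c \<in> A \<Longrightarrow> t \<in> S \<Longrightarrow> \<gamma> t \<in> cdom c \<Longrightarrow>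
    ((cmap c \<circ> \<gamma>) has_vector_derivative vf H t c (cmap c (\<gamma> t))) (at t within S)"
  by (simp add: solves_def)

lemma solves_continuous: "solves H S \<gamma> \<Longrightarrow> continuous_on S \<gamma>"
  by (simp add: solves_def)

lemma solves_subset: "solves H S \<gamma> \<Longrightarrow> T \<subseteq> S \<Longrightarrow> solves H T \<gamma>"
  unfolding solves_def
  by (intro conjI ballI impI) (auto intro: continuous_on_subset has_vector_derivative_within_subset)

lemma solves_along:
  assumes H: "regular H" and S: "S \<subseteq> {0..1}" and \<gamma>: "solves H S \<gamma>" and t: "t \<in> S" and f: "C1_fun f"
  shows "((\<lambda>s. f (\<gamma> s)) has_real_derivative along f H t (\<gamma> t)) (at t within S)"
proof -
  obtain c where c: "c \<in> A" "\<gamma> t \<in> cdom c" using ex_chart by blast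
  have t1: "t \<in> {0..1}" using S t by auto
  let ?D = "differential c f (cmap c (\<gamma> t))"
  have D: "((f \<circ> cinv c) has_derivative ?D) (at ((cmap c \<circ> \<gamma>) t))"
    using C1_fun_has_derivative[OF f c(1) cmap_in[OF c(2)]] by simp
  have "(((f \<circ> cinv c) \<circ> (cmap c \<circ> \<gamma>)) has_derivative (?D \<circ> (\<lambda>s. s *\<^sub>R vf H t c (cmap c (\<gamma> t))))) (at t within S)"
    by (rule diff_chain_within[OF solvesD[OF \<gamma> c(1) t c(2), unfolded has_vector_derivative_def] has_derivative_at_withinI[OF D]])
  moreover have "?D (s *\<^sub>R vf H t c (cmap c (\<gamma> t))) = along f H t (\<gamma> t) * s" for s
    using linear_scale[OF differential_linear[OF f c(1) cmap_in[OF c(2)]]] along_eq[OF f H t1 c] by simp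
  ultimately have 1: "(((f \<circ> cinv c) \<circ> (cmap c \<circ> \<gamma>)) has_derivative (\<lambda>s. along f H t (\<gamma> t) * s)) (at t within S)"
    by (simp add: o_def)
  have "\<forall>\<^sub>F s in at t within S. \<gamma> s \<in> cdom c"
    using solves_continuous[OF \<gamma>] t c open_cdom[OF c(1)] unfolding continuous_on_def by (blast intro: topological_tendstoD)
  then have ev: "\<forall>\<^sub>F s in at t within S. ((f \<circ> cinv c) \<circ> (cmap c \<circ> \<gamma>)) s = f (\<gamma> s)"
    by eventually_elim (simp add: c)
  show ?thesis
    unfolding has_field_derivative_def
    by (rule has_derivative_transform_eventually[OF 1 ev]) (use t c in auto)
qed

lemma \<delta>_eq_0D: assumes "\<delta> p q = 0" shows "p = q"
proof -
  obtain C where C: "C > 0" "\<And>c x r p q. (c, x, r) \<in> I \<Longrightarrow> p \<in> cdom c \<Longrightarrow> cmap c p \<in> cball x r \<Longrightarrow> \<delta> p q < 1/2 \<Longrightarrow>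
     q \<in> cdom c \<and> cmap c q \<in> cball x (2 * r) \<and> norm (cmap c q - cmap c p) \<le> C * \<delta> p q"
    using \<delta>_local by fast
  obtain c x r where i: "(c, x, r) \<in> I" "p \<in> cdom c" "cmap c p \<in> ball x r" using I_cover[of p] by blast
  have "q \<in> cdom c \<and> norm (cmap c q - cmap c p) \<le> C * \<delta> p q" using C(2)[OF i(1,2), of q] i(3) assms by simp
  then show ?thesis using assms i(2) I_in(1)[OF i(1)] cinv_cmap by (metis mult_zero_right norm_le_zero_iff right_minus_eq)
qed

text \<open>Together with \<open>continuous_\<delta>\<close> this says that \<open>\<delta>\<close>
  induces the topology of the manifold, so that continuity can be tested with it.\<close>

lemma \<delta>_nhds:
  assumes W: "open W" "p \<in> W"
  shows "\<exists>\<eta>>0. \<forall>q. \<delta> p q < \<eta> \<longrightarrow> q \<in> W"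
proof -
  obtain C where C: "C > 0" "\<And>c x r p q. (c, x, r) \<in> I \<Longrightarrow> p \<in> cdom c \<Longrightarrow> cmap c p \<in> cball x r \<Longrightarrow> \<delta> p q < 1/2 \<Longrightarrow>
     q \<in> cdom c \<and> cmap c q \<in> cball x (2 * r) \<and> norm (cmap c q - cmap c p) \<le> C * \<delta> p q"
    using \<delta>_local by fast
  obtain c x r where i: "(c, x, r) \<in> I" "p \<in> cdom c" "cmap c p \<in> ball x r" using I_cover[of p] by blast
  note c = I_in(1)[OF i(1)]
  have "open (cran c \<inter> cinv c -` W)" by (rule open_cran_preimage[OF c W(1)])
  moreover have "cmap c p \<in> cran c \<inter> cinv c -` W" using i(2) W(2) c by simp
  ultimately obtain e where e: "e > 0" "ball (cmap c p) e \<subseteq> cran c \<inter> cinv c -` W"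
    using open_contains_ball by blast
  show ?thesis
  proof (intro exI[of _ "min (1/2) (e / C)"] conjI allI impI)
    fix q assume q: "\<delta> p q < min (1/2) (e / C)"
    then have q1: "q \<in> cdom c" "norm (cmap c q - cmap c p) \<le> C * \<delta> p q"
      using C(2)[OF i(1,2), of q] i(3) by auto
    have "C * \<delta> p q < e" using q C(1) by (simp add: pos_less_divide_eq mult.commute)
    then have "cmap c q \<in> ball (cmap c p) e" using q1 by (simp add: dist_norm norm_minus_commute)
    then show "q \<in> W" using e(2) q1(1) c by auto
  qed (use e C in auto)
qed

section \<open>Stability and uniqueness of solutions\<close>

lemma along_bounded:
  assumes "regular H"
  shows "\<exists>L>0. \<forall>f\<in>\<F>. \<forall>t\<in>{0..1}. \<forall>p. \<bar>along f H t p\<bar> \<le> L"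
proof -
  obtain L where "L > 0" "\<forall>f\<in>\<F>. \<forall>t\<in>{0..1}. \<forall>p q. \<bar>along f H t p\<bar> \<le> L \<and> \<bar>along f H t p - along f H t q\<bar> \<le> L * \<delta> p q"
    using along_bounded_lipschitz[OF assms] by blast
  then show ?thesis by (intro exI[of _ L]) simp
qed

lemma along_lipschitz:
  assumes "regular H"
  shows "\<exists>L>0. \<forall>f\<in>\<F>. \<forall>t\<in>{0..1}. \<forall>p q. \<bar>along f H t p - along f H t q\<bar> \<le> L * \<delta> p q"
proof -
  obtain L where "L > 0" "\<forall>f\<in>\<F>. \<forall>t\<in>{0..1}. \<forall>p q. \<bar>along f H t p\<bar> \<le> L \<and> \<bar>along f H t p - along f H t q\<bar> \<le> L * \<delta> p q"
    using along_bounded_lipschitz[OF assms] by blast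
  then show ?thesis by (intro exI[of _ L]) simp
qed

text \<open>Only differentials are compared, because the vector field depends on nothing
  else.\<close>

definition close_on :: "real \<Rightarrow> (real \<Rightarrow> 'm \<Rightarrow> real) \<Rightarrow> (real \<Rightarrow> 'm \<Rightarrow> real) \<Rightarrow> bool" where
  "close_on \<epsilon> H K \<longleftrightarrow> (\<forall>t\<in>{0..1}. \<forall>(c, x, r)\<in>I. \<forall>u\<in>cball x r. \<forall>b\<in>Basis.
      \<bar>differential c (H t) u b - differential c (K t) u b\<bar> \<le> \<epsilon>)"

text \<open>Gronwall for the squared distance of the two solutions. The Lipschitz bound is that of
  \<open>H\<close>, while \<open>K\<close> enters through its distance from \<open>H\<close> along
  the second solution; so \<open>d\<close> depends neither on \<open>K\<close> nor on the solutions
  nor on the times. Continuity of the flow and its inverse, uniqueness and convergence all follow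
  from this one statement.\<close>

lemma stability:
  assumes H: "regular H" and \<epsilon>: "\<epsilon> > 0"
  shows "\<exists>d>0. \<forall>K \<gamma> \<eta>. regular K \<longrightarrow> close_on d H K \<longrightarrow> solves H {0..1} \<gamma> \<longrightarrow> solves K {0..1} \<eta> \<longrightarrow>
    (\<forall>s\<in>{0..1}. \<forall>t\<in>{0..1}. \<delta> (\<gamma> s) (\<eta> s) \<le> d \<longrightarrow> \<delta> (\<gamma> t) (\<eta> t) < \<epsilon>)"
proof -
  obtain L where L: "L > 0" "\<And>f t p q. f \<in> \<F> \<Longrightarrow> t \<in> {0..1} \<Longrightarrow> \<bar>along f H t p - along f H t q\<bar> \<le> L * \<delta> p q"
    using along_lipschitz[OF H] by blast
  obtain C where C: "C > 0" "\<And>H K t \<epsilon> f p. regular H \<Longrightarrow> regular K \<Longrightarrow> t \<in> {0..1} \<Longrightarrow> f \<in> \<F> \<Longrightarrow>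
     (\<forall>(c, x, r)\<in>I. \<forall>u\<in>cball x r. \<forall>b\<in>Basis. \<bar>differential c (H t) u b - differential c (K t) u b\<bar> \<le> \<epsilon>) \<Longrightarrow>
     \<bar>along f H t p - along f K t p\<bar> \<le> C * \<epsilon>" using along_close by blast
  define N where "N = real (card \<F>)"
  \<comment> \<open>The terms (f(\<gamma>) - f(\<eta>))^2 + 2 L^2 D + 2 (C d)^2 are summed over the
    \<open>N\<close> functions: the factor of D is \<open>a\<close>, the remainder is 2 N (C
    d)^2.\<close>
  define a where "a = 1 + 2 * N * L\<^sup>2"
  have N: "N \<ge> 0" by (simp add: N_def)
  have a: "a > 0" using N L by (simp add: a_def add_pos_nonneg)
  define M where "M = (1 + 2 * N * C\<^sup>2 / a) * exp a"
  have M: "M > 0" unfolding M_def using N a by (intro mult_pos_pos add_pos_nonneg) auto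
  \<comment> \<open>If the initial distance and the distance of the differentials are both at most
    \<open>d\<close>, Gronwall yields D(t) \<le> d^2 M; this is below \<epsilon>^2 because M < (1 +
    M)^2.\<close>
  define d where "d = \<epsilon> / (1 + M)"
  have d: "d > 0" using \<epsilon> M by (simp add: d_def)
  have dM: "d\<^sup>2 * M < \<epsilon>\<^sup>2"
  proof -
    have "M < 1 + M * 2 + M * M" using M by (simp add: add_pos_pos)
    then have "M < (1 + M)\<^sup>2" by (simp add: power2_eq_square algebra_simps)
    then have "d\<^sup>2 * M < d\<^sup>2 * (1 + M)\<^sup>2"
      using d by (intro mult_strict_left_mono) simp_all
    also have "\<dots> = \<epsilon>\<^sup>2" using M by (simp add: d_def power_divide)
    finally show ?thesis .
  qed
  have "\<delta> (\<gamma> t) (\<eta> t) < \<epsilon>"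
    if K: "regular K" and cl: "close_on d H K" and \<gamma>: "solves H {0..1} \<gamma>" and \<eta>: "solves K {0..1} \<eta>"
      and st: "s \<in> {0..1}" "t \<in> {0..1}" and s: "\<delta> (\<gamma> s) (\<eta> s) \<le> d" for K \<gamma> \<eta> s t
  proof -
    define D where "D t = (\<Sum>f\<in>\<F>. (f (\<gamma> t) - f (\<eta> t))\<^sup>2)" for t
    define D' where "D' t = (\<Sum>f\<in>\<F>. 2 * (f (\<gamma> t) - f (\<eta> t)) * (along f H t (\<gamma> t) - along f K t (\<eta> t)))" for t
    have D_\<delta>: "D t = (\<delta> (\<gamma> t) (\<eta> t))\<^sup>2" for t by (simp add: D_def \<delta>_power2)
    have "D t \<le> (D s + 2 * N * (C * d)\<^sup>2 / a) * exp a"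
    proof (rule gronwall[where D=D and D'=D' and a=a and s=s and t=t and b="2 * N * (C * d)\<^sup>2"])
      fix \<tau> :: real assume \<tau>: "\<tau> \<in> {0..1}"
      have "((\<lambda>t. (f (\<gamma> t) - f (\<eta> t))\<^sup>2) has_real_derivative
          2 * (f (\<gamma> \<tau>) - f (\<eta> \<tau>)) * (along f H \<tau> (\<gamma> \<tau>) - along f K \<tau> (\<eta> \<tau>))) (at \<tau> within {0..1})" if f: "f \<in> \<F>" for f
      proof -
        note C1 = smooth_fun_imp_C1[OF smooth_\<F>[OF f]]
        have d1: "((\<lambda>t. f (\<gamma> t) - f (\<eta> t)) has_real_derivative along f H \<tau> (\<gamma> \<tau>) - along f K \<tau> (\<eta> \<tau>)) (at \<tau> within {0..1})"
          by (intro DERIV_diff solves_along[OF H _ \<gamma> \<tau> C1] solves_along[OF K _ \<eta> \<tau> C1]) auto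
        show ?thesis by (rule DERIV_cong[OF DERIV_power[OF d1, of 2]]) simp
      qed
      then show "(D has_real_derivative D' \<tau>) (at \<tau> within {0..1})"
        unfolding D_def[abs_def] D'_def by (intro DERIV_sum)
      have "\<bar>D' \<tau>\<bar> \<le> (\<Sum>f\<in>\<F>. (f (\<gamma> \<tau>) - f (\<eta> \<tau>))\<^sup>2 + (2 * L\<^sup>2 * D \<tau> + 2 * (C * d)\<^sup>2))"
        unfolding D'_def
      proof (rule order_trans[OF sum_abs sum_mono])
        fix f assume f: "f \<in> \<F>"
        let ?x = "f (\<gamma> \<tau>) - f (\<eta> \<tau>)" and ?y = "along f H \<tau> (\<gamma> \<tau>) - along f K \<tau> (\<eta> \<tau>)"
        have "\<bar>along f H \<tau> (\<eta> \<tau>) - along f K \<tau> (\<eta> \<tau>)\<bar> \<le> C * d"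
          by (rule C(2)[OF H K \<tau> f bspec[OF cl[unfolded close_on_def] \<tau>]])
        then have y: "\<bar>?y\<bar> \<le> L * \<delta> (\<gamma> \<tau>) (\<eta> \<tau>) + C * d"
          using L(2)[OF f \<tau>, of "\<gamma> \<tau>" "\<eta> \<tau>"] by linarith
        have sq: "(u + v)\<^sup>2 \<le> 2 * u\<^sup>2 + 2 * v\<^sup>2" for u v :: real
          using zero_le_power2[of "u - v"] by (simp add: power2_eq_square algebra_simps)
        have "?y\<^sup>2 \<le> (L * \<delta> (\<gamma> \<tau>) (\<eta> \<tau>) + C * d)\<^sup>2" using power_mono[OF y, of 2] by simp
        also have "\<dots> \<le> 2 * L\<^sup>2 * D \<tau> + 2 * (C * d)\<^sup>2"
          using sq[of "L * \<delta> (\<gamma> \<tau>) (\<eta> \<tau>)" "C * d"] by (simp add: D_\<delta> power_mult_distrib)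
        finally have "?y\<^sup>2 \<le> 2 * L\<^sup>2 * D \<tau> + 2 * (C * d)\<^sup>2" .
        moreover have "\<bar>2 * ?x * ?y\<bar> \<le> ?x\<^sup>2 + ?y\<^sup>2"
          by (rule abs_mult2_le)
        ultimately show "\<bar>2 * ?x * ?y\<bar> \<le> ?x\<^sup>2 + (2 * L\<^sup>2 * D \<tau> + 2 * (C * d)\<^sup>2)" by linarith
      qed
      also have "\<dots> = D \<tau> + N * (2 * L\<^sup>2 * D \<tau> + 2 * (C * d)\<^sup>2)"
        by (simp add: sum.distrib D_def N_def)
      also have "\<dots> = a * D \<tau> + 2 * N * (C * d)\<^sup>2" by (simp add: a_def algebra_simps)
      finally show "\<bar>D' \<tau>\<bar> \<le> a * D \<tau> + 2 * N * (C * d)\<^sup>2" .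
      show "0 \<le> D \<tau>" by (simp add: D_\<delta>)
    qed (use a N st in auto)
    also have "\<dots> \<le> (d\<^sup>2 + 2 * N * (C * d)\<^sup>2 / a) * exp a"
      using power_mono[OF s \<delta>_nonneg, of 2] by (intro mult_right_mono add_right_mono) (auto simp: D_\<delta>)
    also have "\<dots> = d\<^sup>2 * M" by (simp add: M_def power_mult_distrib algebra_simps)
    also have "\<dots> < \<epsilon>\<^sup>2" by (rule dM)
    finally show ?thesis unfolding D_\<delta> using \<epsilon> power2_less_imp_less by fastforce
  qed
  then show ?thesis using d by blast
qed

lemma close_on_refl: "0 \<le> d \<Longrightarrow> close_on d H H"
  by (auto simp: close_on_def)

lemma stability_self:
  assumes H: "regular H" and \<epsilon>: "\<epsilon> > 0"
  shows "\<exists>d>0. \<forall>\<gamma> \<eta>. solves H {0..1} \<gamma> \<longrightarrow> solves H {0..1} \<eta> \<longrightarrow>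
    (\<forall>s\<in>{0..1}. \<forall>t\<in>{0..1}. \<delta> (\<gamma> s) (\<eta> s) \<le> d \<longrightarrow> \<delta> (\<gamma> t) (\<eta> t) < \<epsilon>)"
proof -
  obtain d where d: "d > 0" "\<forall>K \<gamma> \<eta>. regular K \<longrightarrow> close_on d H K \<longrightarrow> solves H {0..1} \<gamma> \<longrightarrow> solves K {0..1} \<eta> \<longrightarrow>
    (\<forall>s\<in>{0..1}. \<forall>t\<in>{0..1}. \<delta> (\<gamma> s) (\<eta> s) \<le> d \<longrightarrow> \<delta> (\<gamma> t) (\<eta> t) < \<epsilon>)"
    using stability[OF assms] by blast
  show ?thesis
    by (rule exI[of _ d], rule conjI[OF d(1)])
      (use d(2)[rule_format, OF H close_on_refl] d(1) in \<open>simp only: less_imp_le, blast\<close>)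
qed

text \<open>If the solutions differed at \<open>t\<close>, stability with \<epsilon> equal to their
  distance there would give \<epsilon> < \<epsilon>.\<close>

lemma solution_unique:
  assumes H: "regular H" and \<gamma>: "solves H {0..1} \<gamma>" and \<eta>: "solves H {0..1} \<eta>"
    and st: "s \<in> {0..1}" "t \<in> {0..1}" and s: "\<gamma> s = \<eta> s"
  shows "\<gamma> t = \<eta> t"
proof (rule \<delta>_eq_0D, rule ccontr)
  assume "\<delta> (\<gamma> t) (\<eta> t) \<noteq> 0"
  then have "\<delta> (\<gamma> t) (\<eta> t) > 0" using \<delta>_nonneg by (simp add: order_less_le)
  from stability_self[OF H this] obtain d where "d > 0" "\<delta> (\<gamma> s) (\<eta> s) \<le> d \<longrightarrow> \<delta> (\<gamma> t) (\<eta> t) < \<delta> (\<gamma> t) (\<eta> t)"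
    using \<gamma> \<eta> st by blast
  then show False by (simp add: s)
qed

section \<open>Existence of solutions on the whole time interval\<close>

lemma solves_glue:
  assumes ab: "a \<le> b" "b \<le> d" and \<gamma>: "solves H {a..b} \<gamma>" and \<eta>: "solves H {b..d} \<eta>" and b: "\<gamma> b = \<eta> b"
  shows "solves H {a..d} (\<lambda>t. if t \<le> b then \<gamma> t else \<eta> t)"
proof -
  let ?z = "\<lambda>t. if t \<le> b then \<gamma> t else \<eta> t"
  have un: "{a..d} = {a..b} \<union> {b..d}" using ab by auto
  have cl: "closure {a..b} \<inter> closure {b..d} = {b}" using ab by auto
  have bb: "{a..b} \<union> {b} = {a..b}" "{b..d} \<union> {b} = {b..d}" using ab by auto
  have "continuous_on {a..d} ?z"
    unfolding un by (rule continuous_on_cases) (use solves_continuous[OF \<gamma>] solves_continuous[OF \<eta>] b in auto)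
  moreover have "((cmap c \<circ> ?z) has_vector_derivative vf H t c (cmap c (?z t))) (at t within {a..d})"
    if c: "c \<in> A" and t: "t \<in> {a..d}" and zt: "?z t \<in> cdom c" for c t
  proof -
    let ?f' = "\<lambda>t. vf H t c (cmap c (\<gamma> t))" and ?g' = "\<lambda>t. vf H t c (cmap c (\<eta> t))"
    have "((\<lambda>t. if t \<in> {a..b} then (cmap c \<circ> \<gamma>) t else (cmap c \<circ> \<eta>) t) has_vector_derivative
        (if t \<in> {a..b} then ?f' t else ?g' t)) (at t within {a..d})"
    proof (rule has_vector_derivative_If_within_closures[OF _ un], unfold cl bb)
      show "((cmap c \<circ> \<gamma>) has_vector_derivative ?f' t) (at t within {a..b})" if "t \<in> {a..b}"
        using solvesD[OF \<gamma> c that] zt that by simp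
      show "((cmap c \<circ> \<eta>) has_vector_derivative ?g' t) (at t within {b..d})" if "t \<in> {b..d}"
        using solvesD[OF \<eta> c that] zt that b by (cases "t = b") auto
      \<comment> \<open>The two closures meet only in \<open>b\<close>. There both curves have the
        same position, hence the same prescribed velocity, and the one-sided derivatives
        agree.\<close>
      show "(cmap c \<circ> \<gamma>) t = (cmap c \<circ> \<eta>) t" "?f' t = ?g' t" if "t \<in> closure {a..b}" "t \<in> closure {b..d}"
        using that b by (auto dest: order_antisym)
    qed (use t un in auto)
    moreover have "(if t \<in> {a..b} then ?f' t else ?g' t) = vf H t c (cmap c (?z t))" using t by auto
    ultimately have 1: "((\<lambda>t. if t \<in> {a..b} then (cmap c \<circ> \<gamma>) t else (cmap c \<circ> \<eta>) t) has_vector_derivative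
        vf H t c (cmap c (?z t))) (at t within {a..d})" by simp
    have 2: "(cmap c \<circ> ?z) s = (if s \<in> {a..b} then (cmap c \<circ> \<gamma>) s else (cmap c \<circ> \<eta>) s)" if "s \<in> {a..d}" for s
      using that by simp
    show ?thesis by (rule has_vector_derivative_transform[OF t 2 1])
  qed
  ultimately show ?thesis unfolding solves_def by blast
qed

text \<open>The step length must not depend on the starting point or time, otherwise continuation
  could stall. It comes from bounds for the vector field on the finitely many doubled balls, which
  are uniform in time.\<close>

lemma local_existence:
  assumes H: "regular H"
  shows "\<exists>\<tau>>0. \<forall>t0\<in>{0..1}. \<forall>p. \<exists>\<gamma>. \<gamma> t0 = p \<and> solves H {max 0 (t0 - \<tau>)..min 1 (t0 + \<tau>)} \<gamma>"
proof -
  define P where "P i \<tau> \<longleftrightarrow> (case i of (c, x, r) \<Rightarrow> \<forall>t0\<in>{0..1}. \<forall>p. p \<in> cdom c \<longrightarrow> cmap c p \<in> ball x r \<longrightarrow>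
      (\<exists>\<gamma>. \<gamma> t0 = p \<and> solves H {max 0 (t0 - \<tau>)..min 1 (t0 + \<tau>)} \<gamma>))" for i :: "('m, 'e) chart \<times> 'e \<times> real" and \<tau> :: real
  have "\<exists>\<tau>>0. \<forall>i\<in>I. P i \<tau>"
  proof (rule finite_ex_pos[OF finite_I])
    fix i assume "i \<in> I"
    obtain c x r where i: "i = (c, x, r)" by (cases i)
    then have I: "(c, x, r) \<in> I" using \<open>i \<in> I\<close> by simp
    note c = I_in(1)[OF I] and K = I_in(3)[OF I] and r = I_in(2)[OF I]
    let ?K = "cball x (2 * r)"
    obtain L m where Lm: "L \<ge> 0" "m \<ge> 0" "\<And>t u. t \<in> {0..1} \<Longrightarrow> u \<in> ?K \<Longrightarrow> norm (vf H t c u) \<le> m"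
      "\<And>t u v. t \<in> {0..1} \<Longrightarrow> u \<in> ?K \<Longrightarrow> v \<in> ?K \<Longrightarrow> norm (vf H t c u - vf H t c v) \<le> L * norm (u - v)"
      using vf_lipschitz[OF H c K] vf_bounded[OF H c compact_cball K] by metis
    \<comment> \<open>The interval around \<open>t0\<close> has length at most 2 \<tau>, so the two
      smallness conditions of \<open>picard_local\<close> become 4 \<tau> m \<le> r and 8 \<tau> L
      \<le> 1. Adding 1 in the denominators covers m = 0 and L = 0.\<close>
    define \<tau> where "\<tau> = min (r / (4 * (m + 1))) (1 / (8 * (L + 1)))"
    have \<tau>: "\<tau> > 0" using r Lm by (simp add: \<tau>_def)
    have "4 * \<tau> * m \<le> 4 * (r / (4 * (m + 1))) * m" using Lm by (intro mult_right_mono mult_left_mono) (auto simp: \<tau>_def)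
    also have "\<dots> \<le> r" using r Lm by (simp add: field_simps)
    finally have \<tau>1: "4 * \<tau> * m \<le> r" .
    have "8 * \<tau> * L \<le> 8 * (1 / (8 * (L + 1))) * L" using Lm by (intro mult_right_mono mult_left_mono) (auto simp: \<tau>_def)
    also have "\<dots> \<le> 1" using Lm by (simp add: field_simps)
    finally have \<tau>2: "8 * \<tau> * L \<le> 1" .
    have "\<exists>\<gamma>. \<gamma> t0 = p \<and> solves H {max 0 (t0 - \<tau>)..min 1 (t0 + \<tau>)} \<gamma>"
      if t0: "t0 \<in> {0..1}" and p: "p \<in> cdom c" "cmap c p \<in> ball x r" for t0 p
    proof -
      define a b where "a = max 0 (t0 - \<tau>)" and "b = min 1 (t0 + \<tau>)"
      let ?u0 = "cmap c p"
      have ab: "{a..b} \<subseteq> {0..1}" "t0 \<in> {a..b}" "b - a \<le> 2 * \<tau>" "a \<le> b" using t0 \<tau> by (auto simp: a_def b_def)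
      \<comment> \<open>A ball of radius r around a point of the small ball stays in the doubled
        ball, where the bounds hold.\<close>
      have sub: "cball ?u0 r \<subseteq> ?K"
      proof
        fix v assume "v \<in> cball ?u0 r"
        then show "v \<in> ?K" using dist_triangle[of x v ?u0] p(2) by simp
      qed
      have s1: "2 * (b - a) * m \<le> r"
      proof -
        have "2 * (b - a) * m = 2 * ((b - a) * m)" "4 * \<tau> * m = 2 * (2 * \<tau> * m)" by simp_all
        then show ?thesis using \<tau>1 mult_right_mono[OF ab(3) Lm(2)] by linarith
      qed
      have s2: "4 * (b - a) * L \<le> 1"
      proof -
        have "4 * (b - a) * L = 4 * ((b - a) * L)" "8 * \<tau> * L = 4 * (2 * \<tau> * L)" by simp_all
        then show ?thesis using \<tau>2 mult_right_mono[OF ab(3) Lm(1)] by linarith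
      qed
      have cont: "continuous_on ({a..b} \<times> cball ?u0 r) (\<lambda>(t, u). vf H t c u)"
        by (rule continuous_on_subset[OF vf_continuous[OF H c]]) (use ab sub K in auto)
      obtain u where u: "u t0 = ?u0" "\<And>t. t \<in> {a..b} \<Longrightarrow> u t \<in> cball ?u0 r"
        "\<And>t. t \<in> {a..b} \<Longrightarrow> (u has_vector_derivative vf H t c (u t)) (at t within {a..b})"
      proof (rule picard_local[OF ab(2) _ cont _ _ s1 s2 Lm(1)])
        fix t v w assume "t \<in> {a..b}" "v \<in> cball ?u0 r" "w \<in> cball ?u0 r"
        then show "norm (vf H t c v - vf H t c w) \<le> L * norm (v - w)"
          by (intro Lm(4) subsetD[OF ab(1)] subsetD[OF sub])
      next
        fix t v assume "t \<in> {a..b}" "v \<in> cball ?u0 r"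
        then show "norm (vf H t c v) \<le> m"
          by (intro Lm(3) subsetD[OF ab(1)] subsetD[OF sub])
      qed (use r in auto)
      have ucran: "u t \<in> cran c" if "t \<in> {a..b}" for t using u(2)[OF that] sub K by blast
      have uc: "continuous_on {a..b} u"
        using u(3) has_vector_derivative_continuous continuous_on_eq_continuous_within by blast
      let ?\<gamma> = "cinv c \<circ> u"
      have \<gamma>c: "continuous_on {a..b} ?\<gamma>"
        by (rule continuous_on_compose[OF uc continuous_on_subset[OF continuous_cinv[OF c]]]) (use ucran in auto)
      have \<gamma>d: "?\<gamma> t \<in> cdom c" "cmap c (?\<gamma> t) = u t" if "t \<in> {a..b}" for t using ucran[OF that] c by simp_all
      have der: "((cmap c \<circ> ?\<gamma>) has_vector_derivative vf H t c (cmap c (?\<gamma> t))) (at t within {a..b})" if "t \<in> {a..b}" for t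
        using has_vector_derivative_transform[OF that _ u(3)[OF that], of "cmap c \<circ> ?\<gamma>"] \<gamma>d that by simp
      \<comment> \<open>The curve was constructed in the chart \<open>c\<close> alone; the Jacobian
        carries its velocity and the vector field to any other chart in the same way.\<close>
      have "((cmap c' \<circ> ?\<gamma>) has_vector_derivative vf H t c' (cmap c' (?\<gamma> t))) (at t within {a..b})"
        if c': "c' \<in> A" and t: "t \<in> {a..b}" and d: "?\<gamma> t \<in> cdom c'" for c' t
        using has_vector_derivative_change_chart[OF c c' t \<gamma>d(1)[OF t] d \<gamma>c der[OF t]]
          vf_transform[OF H subsetD[OF ab(1) t] c c' \<gamma>d(1)[OF t] d] by simp
      then have "solves H {a..b} ?\<gamma>" using \<gamma>c unfolding solves_def by blast
      moreover have "?\<gamma> t0 = p" using u(1) c p by simp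
      ultimately show ?thesis unfolding a_def b_def by blast
    qed
    then show "\<exists>\<tau>>0. P i \<tau>" using \<tau> unfolding P_def i by (intro exI[of _ \<tau>]) simp
  next
    fix i \<tau> \<tau>' assume "P i \<tau>" "(0::real) < \<tau>'" "\<tau>' \<le> \<tau>"
    then have sub: "{max 0 (t0 - \<tau>')..min 1 (t0 + \<tau>')} \<subseteq> {max 0 (t0 - \<tau>)..min 1 (t0 + \<tau>)}" for t0 by auto
    obtain c x r where i: "i = (c, x, r)" by (cases i)
    show "P i \<tau>'"
      unfolding P_def i prod.case
    proof (intro ballI allI impI)
      fix t0 :: real and p assume "t0 \<in> {0..1}" "p \<in> cdom c" "cmap c p \<in> ball x r"
      then obtain \<gamma> where "\<gamma> t0 = p" "solves H {max 0 (t0 - \<tau>)..min 1 (t0 + \<tau>)} \<gamma>"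
        using \<open>P i \<tau>\<close> unfolding P_def i prod.case by blast
      then show "\<exists>\<gamma>. \<gamma> t0 = p \<and> solves H {max 0 (t0 - \<tau>')..min 1 (t0 + \<tau>')} \<gamma>"
        using solves_subset[OF _ sub] by blast
    qed
  qed
  then obtain \<tau> where \<tau>: "\<tau> > 0" "\<forall>i\<in>I. P i \<tau>" by blast
  have "\<exists>\<gamma>. \<gamma> t0 = p \<and> solves H {max 0 (t0 - \<tau>)..min 1 (t0 + \<tau>)} \<gamma>" if t0: "t0 \<in> {0..1}" for t0 p
  proof -
    obtain c x r where i: "(c, x, r) \<in> I" "p \<in> cdom c" "cmap c p \<in> ball x r" using I_cover[of p] by blast
    have "P (c, x, r) \<tau>" using \<tau>(2) i(1) by blast
    then show ?thesis using i t0 unfolding P_def prod.case by blast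
  qed
  then show ?thesis using \<tau>(1) by blast
qed

text \<open>The solution is prolonged by \<tau> at both ends in each step; once n \<tau> > 1 the
  clipped interval is all of \<open>{0..1}\<close>.\<close>

lemma global_existence:
  assumes H: "regular H" and t0: "t0 \<in> {0..1}"
  shows "\<exists>\<gamma>. \<gamma> t0 = p \<and> solves H {0..1} \<gamma>"
proof -
  obtain \<tau> where \<tau>: "\<tau> > 0" "\<And>t0 p. t0 \<in> {0..1} \<Longrightarrow> \<exists>\<gamma>. \<gamma> t0 = p \<and> solves H {max 0 (t0 - \<tau>)..min 1 (t0 + \<tau>)} \<gamma>"
    using local_existence[OF H] by blast
  have ex: "\<exists>\<gamma>. \<gamma> t0 = p \<and> solves H {max 0 (t0 - n * \<tau>)..min 1 (t0 + n * \<tau>)} \<gamma>" for n :: nat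
  proof (induction n)
    case 0
    obtain \<gamma> where \<gamma>: "\<gamma> t0 = p" "solves H {max 0 (t0 - \<tau>)..min 1 (t0 + \<tau>)} \<gamma>" using \<tau>(2)[OF t0] by blast
    then have "solves H {max 0 (t0 - real 0 * \<tau>)..min 1 (t0 + real 0 * \<tau>)} \<gamma>"
      by (elim solves_subset) (use \<tau> in auto)
    then show ?case using \<gamma> by blast
  next
    case (Suc n)
    define a b where "a = max 0 (t0 - n * \<tau>)" and "b = min 1 (t0 + n * \<tau>)"
    define a' b' where "a' = max 0 (t0 - Suc n * \<tau>)" and "b' = min 1 (t0 + Suc n * \<tau>)"
    have n0: "real n * \<tau> \<ge> 0" "real (Suc n) * \<tau> = real n * \<tau> + \<tau>" using \<tau> by (simp_all add: algebra_simps)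
    have o: "0 \<le> a'" "a' \<le> a" "a \<le> t0" "t0 \<le> b" "b \<le> b'" "b' \<le> 1" "a - \<tau> \<le> a'" "b' \<le> b + \<tau>"
      using t0 \<tau>(1) n0(1) unfolding a_def b_def a'_def b'_def n0(2) atLeastAtMost_iff by linarith+
    obtain \<gamma> where \<gamma>: "\<gamma> t0 = p" "solves H {a..b} \<gamma>" using Suc by (auto simp: a_def b_def)
    obtain \<eta> where \<eta>: "\<eta> b = \<gamma> b" "solves H {max 0 (b - \<tau>)..min 1 (b + \<tau>)} \<eta>" using \<tau>(2)[of b "\<gamma> b"] o by auto
    have \<eta>': "solves H {b..b'} \<eta>" by (rule solves_subset[OF \<eta>(2)]) (use o \<tau>(1) in auto)
    obtain \<zeta> where \<zeta>: "\<zeta> a = \<gamma> a" "solves H {max 0 (a - \<tau>)..min 1 (a + \<tau>)} \<zeta>" using \<tau>(2)[of a "\<gamma> a"] o by auto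
    have \<zeta>': "solves H {a'..a} \<zeta>" by (rule solves_subset[OF \<zeta>(2)]) (use o \<tau>(1) in auto)
    let ?\<gamma>1 = "\<lambda>t. if t \<le> b then \<gamma> t else \<eta> t"
    let ?\<gamma>2 = "\<lambda>t. if t \<le> a then \<zeta> t else ?\<gamma>1 t"
    have 1: "solves H {a..b'} ?\<gamma>1" by (rule solves_glue[OF _ _ \<gamma>(2) \<eta>']) (use o \<eta> in auto)
    have "solves H {a'..b'} ?\<gamma>2" by (rule solves_glue[OF _ _ \<zeta>' 1]) (use o \<zeta> in auto)
    moreover have "?\<gamma>2 t0 = p" using o \<gamma> \<zeta> by (cases "t0 = a") auto
    ultimately show ?case unfolding a'_def b'_def by (intro exI[of _ ?\<gamma>2] conjI)
  qed
  obtain n :: nat where n: "1 < n * \<tau>" using \<tau>(1) reals_Archimedean3 by blast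
  obtain \<gamma> where \<gamma>: "\<gamma> t0 = p" "solves H {max 0 (t0 - n * \<tau>)..min 1 (t0 + n * \<tau>)} \<gamma>" using ex by blast
  have "solves H {0..1} \<gamma>" by (rule solves_subset[OF \<gamma>(2)]) (use n t0 in auto)
  then show ?thesis using \<gamma> by blast
qed

text \<open>The point \<open>p\<close> is prescribed at an arbitrary time \<open>s\<close>.
  Evaluation at \<open>t\<close> with s = 0 gives the flow, and evaluation at 0 with s = t gives its
  inverse, so both are treated by the same estimates.\<close>

definition trajectory :: "(real \<Rightarrow> 'm \<Rightarrow> real) \<Rightarrow> real \<Rightarrow> 'm \<Rightarrow> real \<Rightarrow> 'm" where
  "trajectory H s p = (SOME \<gamma>. \<gamma> s = p \<and> solves H {0..1} \<gamma>)"

lemma trajectory: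
  assumes "regular H" "s \<in> {0..1}"
  shows "trajectory H s p s = p" "solves H {0..1} (trajectory H s p)"
  using someI_ex[OF global_existence[OF assms, of p]] by (auto simp: trajectory_def)

section \<open>The flow as a path of homeomorphisms\<close>

abbreviation "flow \<equiv> hamiltonian_flow A \<omega>"

lemma flow_eq:
  assumes H: "regular H" and t: "t \<in> {0..1}" and \<gamma>: "solves H {0..1} \<gamma>"
  shows "flow H t (\<gamma> 0) = \<gamma> t"
proof -
  have "flow H t (\<gamma> 0) = (THE q. \<exists>\<eta>. solves H {0..1} \<eta> \<and> \<eta> 0 = \<gamma> 0 \<and> \<eta> t = q)"
    using t by (simp add: hamiltonian_flow_def hamiltonian_solution_iff)
  also have "\<dots> = \<gamma> t"
  proof (rule the_equality)
    show "\<exists>\<eta>. solves H {0..1} \<eta> \<and> \<eta> 0 = \<gamma> 0 \<and> \<eta> t = \<gamma> t" using \<gamma> by blast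
    fix q assume "\<exists>\<eta>. solves H {0..1} \<eta> \<and> \<eta> 0 = \<gamma> 0 \<and> \<eta> t = q"
    then obtain \<eta> where \<eta>: "solves H {0..1} \<eta>" "\<eta> 0 = \<gamma> 0" "\<eta> t = q" by blast
    have "\<eta> t = \<gamma> t" by (rule solution_unique[OF H \<eta>(1) \<gamma> _ t \<eta>(2)]) simp
    then show "q = \<gamma> t" using \<eta> by simp
  qed
  finally show ?thesis .
qed

lemma flow_trajectory:
  assumes "regular H" "t \<in> {0..1}"
  shows "flow H t p = trajectory H 0 p t"
  using flow_eq[OF assms trajectory(2)[of H 0 p]] trajectory(1)[of H 0 p] assms by simp

lemma flow_trajectory_0:
  assumes "regular H" "t \<in> {0..1}"
  shows "flow H t (trajectory H t q 0) = q"
  using flow_eq[OF assms trajectory(2)[OF assms, of q]] trajectory(1)[OF assms] by simp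

lemma flow_inj: assumes H: "regular H" and t: "t \<in> {0..1}" shows "inj (flow H t)"
proof (rule injI)
  fix p q assume "flow H t p = flow H t q"
  then have "trajectory H 0 p t = trajectory H 0 q t" using flow_trajectory[OF assms] by simp
  moreover have z: "(0::real) \<in> {0..1}" by simp
  ultimately have "trajectory H 0 p 0 = trajectory H 0 q 0"
    by (intro solution_unique[OF H trajectory(2)[OF H z] trajectory(2)[OF H z] t z])
  then show "p = q" using trajectory(1)[OF H z] by simp
qed

lemma flow_surj: "regular H \<Longrightarrow> t \<in> {0..1} \<Longrightarrow> surj (flow H t)"
  by (rule surjI) (rule flow_trajectory_0)

lemma inv_flow: "regular H \<Longrightarrow> t \<in> {0..1} \<Longrightarrow> inv (flow H t) q = trajectory H t q 0"
  by (rule inv_f_eq[OF flow_inj flow_trajectory_0])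

lemma flow_continuous:
  assumes H: "regular H" and t: "t \<in> {0..1}"
  shows "continuous_on UNIV (flow H t)"
  unfolding continuous_on_topological
proof (intro ballI allI impI)
  fix p W assume "open W" "flow H t p \<in> W"
  from \<delta>_nhds[OF this] obtain \<eta> where \<eta>: "\<eta> > 0" "\<And>q. \<delta> (flow H t p) q < \<eta> \<Longrightarrow> q \<in> W" by blast
  obtain d where d: "d > 0" "\<And>\<gamma> \<eta>'. solves H {0..1} \<gamma> \<Longrightarrow> solves H {0..1} \<eta>' \<Longrightarrow> \<delta> (\<gamma> 0) (\<eta>' 0) \<le> d \<Longrightarrow> \<delta> (\<gamma> t) (\<eta>' t) < \<eta>"
    using stability_self[OF H \<eta>(1)] t by (meson atLeastAtMost_iff order_refl zero_le_one)
  have "open {q. \<delta> p q < d}" using continuous_\<delta> by (intro open_Collect_less continuous_on_const)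
  moreover have "p \<in> {q. \<delta> p q < d}" using d by simp
  moreover have "flow H t q \<in> W" if "q \<in> {q. \<delta> p q < d}" for q
  proof (rule \<eta>(2))
    have z: "(0::real) \<in> {0..1}" by simp
    show "\<delta> (flow H t p) (flow H t q) < \<eta>"
      unfolding flow_trajectory[OF H t]
      by (rule d(2)) (use that trajectory[OF H z] in auto)
  qed
  ultimately show "\<exists>V. open V \<and> p \<in> V \<and> (\<forall>q\<in>UNIV. q \<in> V \<longrightarrow> flow H t q \<in> W)" by blast
qed

text \<open>A continuous bijection of a compact Hausdorff space has a continuous inverse.\<close>

lemma flow_Homeo: assumes "regular H" "t \<in> {0..1}" shows "flow H t \<in> Homeo"
  unfolding Homeo_def mem_Collect_eq
  by (rule homeomorphism_compact[OF compact_UNIV flow_continuous[OF assms] flow_surj[OF assms] flow_inj[OF assms]])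

text \<open>Each function in \<open>\<F>\<close> changes along a solution at a bounded rate, and
  \<open>\<delta>\<close> is at most the sum of these changes.\<close>

lemma solution_time_lipschitz:
  assumes H: "regular H"
  shows "\<exists>M>0. \<forall>\<gamma>. solves H {0..1} \<gamma> \<longrightarrow> (\<forall>s\<in>{0..1}. \<forall>t\<in>{0..1}. \<delta> (\<gamma> s) (\<gamma> t) \<le> M * \<bar>s - t\<bar>)"
proof -
  obtain L where L: "L > 0" "\<And>f t p. f \<in> \<F> \<Longrightarrow> t \<in> {0..1} \<Longrightarrow> \<bar>along f H t p\<bar> \<le> L"
    using along_bounded[OF H] by blast
  have "\<delta> (\<gamma> s) (\<gamma> t) \<le> (real (card \<F>) * L + 1) * \<bar>s - t\<bar>"
    if \<gamma>: "solves H {0..1} \<gamma>" and st: "s \<in> {0..1}" "t \<in> {0..1}" for \<gamma> s t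
  proof -
    have "\<bar>f (\<gamma> s) - f (\<gamma> t)\<bar> \<le> L * \<bar>s - t\<bar>" if f: "f \<in> \<F>" for f
    proof -
      have "norm (f (\<gamma> s) - f (\<gamma> t)) \<le> L * norm (s - t)"
      proof (rule field_differentiable_bound[of "{0..1}" _ "\<lambda>t. along f H t (\<gamma> t)"])
        show "((\<lambda>s. f (\<gamma> s)) has_real_derivative along f H \<tau> (\<gamma> \<tau>)) (at \<tau> within {0..1})" if "\<tau> \<in> {0..1}" for \<tau>
          by (rule solves_along[OF H _ \<gamma> that smooth_fun_imp_C1[OF smooth_\<F>[OF f]]]) simp
      qed (use L f st in auto)
      then show ?thesis by simp
    qed
    then have "(\<Sum>f\<in>\<F>. \<bar>f (\<gamma> s) - f (\<gamma> t)\<bar>) \<le> real (card \<F>) * (L * \<bar>s - t\<bar>)"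
      by (rule sum_bounded_above)
    moreover have "\<delta> (\<gamma> s) (\<gamma> t) \<le> (\<Sum>f\<in>\<F>. \<bar>f (\<gamma> s) - f (\<gamma> t)\<bar>)"
      using L2_set_le_sum_abs[of "\<lambda>f. f (\<gamma> s) - f (\<gamma> t)" \<F>] by (simp add: \<delta>_def L2_set_def)
    ultimately show ?thesis by (simp add: algebra_simps)
  qed
  moreover have "real (card \<F>) * L + 1 > 0" using L(1) by (intro add_nonneg_pos) auto
  ultimately show ?thesis by blast
qed

text \<open>The property of a distance that makes estimates in terms of \<open>\<delta>\<close> pass
  to \<open>homeo_dist\<close> and \<open>path_dist\<close>. The bound is not strict, because
  suprema are taken afterwards.\<close>

definition dominated :: "('m \<Rightarrow> 'm \<Rightarrow> real) \<Rightarrow> bool" where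
  "dominated d \<longleftrightarrow> (\<forall>\<epsilon>>0. \<exists>\<eta>>0. \<forall>p q. \<delta> p q < \<eta> \<longrightarrow> d p q \<le> \<epsilon>)"

lemma homeo_dist_flow_le:
  assumes H: "regular H" and K: "regular K" and st: "s \<in> {0..1}" "t \<in> {0..1}"
    and d: "\<And>p q. \<delta> p q < \<eta> \<Longrightarrow> d p q \<le> \<epsilon>"
    and 1: "\<And>p. \<delta> (trajectory H 0 p s) (trajectory K 0 p t) < \<eta>"
    and 2: "\<And>p. \<delta> (trajectory H s p 0) (trajectory K t p 0) < \<eta>"
  shows "homeo_dist d (flow H s) (flow K t) \<le> \<epsilon>"
  unfolding homeo_dist_def inv_flow[OF H st(1)] inv_flow[OF K st(2)] flow_trajectory[OF H st(1)] flow_trajectory[OF K st(2)]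
  by (intro max.boundedI cSUP_least d 1 2) auto

lemma flow_in_homeo_paths:
  assumes H: "regular H" and d: "dominated d"
  shows "flow H \<in> homeo_paths d"
proof -
  have z: "(0::real) \<in> {0..1}" by simp
  have "\<exists>\<theta>>0. \<forall>s\<in>{0..1}. \<bar>s - t\<bar> < \<theta> \<longrightarrow> homeo_dist d (flow H s) (flow H t) < \<epsilon>" if t: "t \<in> {0..1}" and \<epsilon>: "\<epsilon> > 0" for t \<epsilon>
  proof -
    obtain \<eta> where \<eta>: "\<eta> > 0" "\<And>p q. \<delta> p q < \<eta> \<Longrightarrow> d p q \<le> \<epsilon> / 2" using d \<epsilon> unfolding dominated_def by (meson half_gt_zero)
    obtain \<theta> where \<theta>: "\<theta> > 0" "\<And>\<gamma> \<eta>' s t. solves H {0..1} \<gamma> \<Longrightarrow> solves H {0..1} \<eta>' \<Longrightarrow> s \<in> {0..1} \<Longrightarrow> t \<in> {0..1} \<Longrightarrow>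
        \<delta> (\<gamma> s) (\<eta>' s) \<le> \<theta> \<Longrightarrow> \<delta> (\<gamma> t) (\<eta>' t) < \<eta>"
      using stability_self[OF H \<eta>(1)] by blast
    obtain M where M: "M > 0" "\<And>\<gamma> s t. solves H {0..1} \<gamma> \<Longrightarrow> s \<in> {0..1} \<Longrightarrow> t \<in> {0..1} \<Longrightarrow> \<delta> (\<gamma> s) (\<gamma> t) \<le> M * \<bar>s - t\<bar>"
      using solution_time_lipschitz[OF H] by blast
    \<comment> \<open>Over this time span a solution moves by less than \<eta>, which settles the
      flow itself, and by less than \<theta>, which makes stability applicable for the
      inverse.\<close>
    have "homeo_dist d (flow H s) (flow H t) < \<epsilon>" if s: "s \<in> {0..1}" and st: "\<bar>s - t\<bar> < min \<eta> \<theta> / M" for s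
    proof -
      have Mst: "M * \<bar>s - t\<bar> < min \<eta> \<theta>" using st M(1) by (simp add: pos_less_divide_eq mult.commute)
      have "homeo_dist d (flow H s) (flow H t) \<le> \<epsilon> / 2"
      proof (rule homeo_dist_flow_le[OF H H s t \<eta>(2)])
        fix p
        show "\<delta> (trajectory H 0 p s) (trajectory H 0 p t) < \<eta>"
          using M(2)[OF trajectory(2)[OF H z] s t, of p] Mst by simp
        \<comment> \<open>At time \<open>s\<close> one solution is at \<open>p\<close>; the other is
          at \<open>p\<close> at time \<open>t\<close>, hence still close to it at time
          \<open>s\<close>. Stability transports this closeness back to time 0.\<close>
        have "\<delta> (trajectory H s p s) (trajectory H t p s) \<le> \<theta>"
          using M(2)[OF trajectory(2)[OF H t] s t, of p] Mst trajectory(1)[OF H s, of p] trajectory(1)[OF H t, of p]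
          by (simp add: \<delta>_sym)
        then show "\<delta> (trajectory H s p 0) (trajectory H t p 0) < \<eta>"
          by (rule \<theta>(2)[OF trajectory(2)[OF H s] trajectory(2)[OF H t] s z])
      qed
      then show ?thesis using \<epsilon> by simp
    qed
    then show ?thesis using \<eta>(1) \<theta>(1) M(1) by (intro exI[of _ "min \<eta> \<theta> / M"]) auto
  qed
  moreover have "flow H 0 = id" using flow_trajectory[OF H z] trajectory(1)[OF H z] by auto
  moreover have "flow H \<in> extensional {0..1}" by (simp add: hamiltonian_flow_def)
  ultimately show ?thesis using flow_Homeo[OF H] unfolding homeo_paths_def by blast
qed

text \<open>Solutions for \<open>H\<close> and \<open>K\<close> that agree at time 0 compare the
  flows; solutions that agree at time \<open>t\<close> compare the inverses. Stability covers both,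
  since its two times are arbitrary.\<close>

lemma flow_close:
  assumes H: "regular H" and d: "dominated d" and \<epsilon>: "\<epsilon> > 0"
  shows "\<exists>e>0. \<forall>K. regular K \<longrightarrow> close_on e H K \<longrightarrow> path_dist d (flow H) (flow K) \<le> \<epsilon>"
proof -
  have z: "(0::real) \<in> {0..1}" by simp
  obtain \<eta> where \<eta>: "\<eta> > 0" "\<And>p q. \<delta> p q < \<eta> \<Longrightarrow> d p q \<le> \<epsilon>" using d \<epsilon> unfolding dominated_def by meson
  obtain e where e: "e > 0" "\<And>K \<gamma> \<eta>' s t. regular K \<Longrightarrow> close_on e H K \<Longrightarrow> solves H {0..1} \<gamma> \<Longrightarrow> solves K {0..1} \<eta>' \<Longrightarrow> s \<in> {0..1} \<Longrightarrow> t \<in> {0..1} \<Longrightarrow>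
        \<delta> (\<gamma> s) (\<eta>' s) \<le> e \<Longrightarrow> \<delta> (\<gamma> t) (\<eta>' t) < \<eta>"
    using stability[OF H \<eta>(1)] by blast
  have "path_dist d (flow H) (flow K) \<le> \<epsilon>" if K: "regular K" and cl: "close_on e H K" for K
    unfolding path_dist_def
  proof (rule cSUP_least)
    fix t :: real assume t: "t \<in> {0..1}"
    show "homeo_dist d (flow H t) (flow K t) \<le> \<epsilon>"
    proof (rule homeo_dist_flow_le[OF H K t t \<eta>(2)])
      fix p
      show "\<delta> (trajectory H 0 p t) (trajectory K 0 p t) < \<eta>"
        by (rule e(2)[OF K cl trajectory(2)[OF H z] trajectory(2)[OF K z] z t])
          (use trajectory(1)[OF H z] trajectory(1)[OF K z] e(1) in simp)
      show "\<delta> (trajectory H t p 0) (trajectory K t p 0) < \<eta>"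
        by (rule e(2)[OF K cl trajectory(2)[OF H t] trajectory(2)[OF K t] t z])
          (use trajectory(1)[OF H t] trajectory(1)[OF K t] e(1) in simp)
    qed
  qed simp
  then show ?thesis using e(1) by blast
qed

end

section \<open>Symmetry of second derivatives\<close>

text \<open>The left hand side is symmetric in \<open>v\<close> and \<open>w\<close>.\<close>

lemma second_difference:
  fixes f :: "'a::euclidean_space \<Rightarrow> real"
  assumes f: "Ck_open 2 U f" and h: "h > 0"
    and U: "\<And>s t. s \<in> {0..h} \<Longrightarrow> t \<in> {0..h} \<Longrightarrow> u + s *\<^sub>R v + t *\<^sub>R w \<in> U"
  shows "\<exists>s\<in>{0..h}. \<exists>t\<in>{0..h}. f (u + h *\<^sub>R v + h *\<^sub>R w) - f (u + h *\<^sub>R v) - (f (u + h *\<^sub>R w) - f u)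
    = h * h * frechet_derivative (\<lambda>y. frechet_derivative f (at y) v) (at (u + s *\<^sub>R v + t *\<^sub>R w)) w"
proof -
  let ?D = "\<lambda>y. frechet_derivative f (at y)"
  let ?E = "\<lambda>y. frechet_derivative (\<lambda>y. ?D y v) (at y)"
  have two: "Ck_open (Suc (Suc 0)) U f" using f by (simp add: numeral_2_eq_2)
  have D: "(f has_derivative ?D y) (at y)" if "y \<in> U" for y using Ck_open_SucD[OF two that] .
  have "Ck_open (Suc 0) U (\<lambda>y. ?D y v)" using two by simp
  then have E: "((\<lambda>y. ?D y v) has_derivative ?E y) (at y)" if "y \<in> U" for y using Ck_open_SucD that by blast
  have lD: "?D y (c *\<^sub>R z) = c * ?D y z" if "y \<in> U" for y z c
    using linear_scale[OF has_derivative_linear[OF D[OF that]]] by simp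
  have lE: "?E y (c *\<^sub>R z) = c * ?E y z" if "y \<in> U" for y z c
    using linear_scale[OF has_derivative_linear[OF E[OF that]]] by simp
  \<comment> \<open>The mean value theorem is used twice: in direction \<open>v\<close> for the
    increment along \<open>w\<close>, and then in direction \<open>w\<close> for the derivative
    along \<open>v\<close>.\<close>
  let ?G = "\<lambda>s. f (u + s *\<^sub>R v + h *\<^sub>R w) - f (u + s *\<^sub>R v)"
  have "\<exists>s\<in>{0..h}. ?G h - ?G 0 = (h - 0) * (?D (u + s *\<^sub>R v + h *\<^sub>R w) v - ?D (u + s *\<^sub>R v) v)"
  proof (rule mvt_very_simple[where f="?G" and f'="\<lambda>s k. k * (?D (u + s *\<^sub>R v + h *\<^sub>R w) v - ?D (u + s *\<^sub>R v) v)"])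
    fix s assume "0 \<le> s" "s \<le> h"
    then have s: "s \<in> {0..h}" by simp
    have 1: "u + s *\<^sub>R v + h *\<^sub>R w \<in> U" "u + s *\<^sub>R v \<in> U" using U[OF s, of h] U[OF s, of 0] h by auto
    have "((\<lambda>s. u + s *\<^sub>R v + h *\<^sub>R w) has_derivative (\<lambda>k. k *\<^sub>R v)) (at s)"
      "((\<lambda>s. u + s *\<^sub>R v) has_derivative (\<lambda>k. k *\<^sub>R v)) (at s)"
      by (auto intro!: derivative_eq_intros)
    from has_derivative_diff[OF has_derivative_compose[OF this(1) D[OF 1(1)]] has_derivative_compose[OF this(2) D[OF 1(2)]]]
    have "(?G has_derivative (\<lambda>k. k * (?D (u + s *\<^sub>R v + h *\<^sub>R w) v - ?D (u + s *\<^sub>R v) v))) (at s)"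
      by (simp add: lD[OF 1(1)] lD[OF 1(2)] right_diff_distrib)
    then show "(?G has_derivative (\<lambda>k. k * (?D (u + s *\<^sub>R v + h *\<^sub>R w) v - ?D (u + s *\<^sub>R v) v))) (at s within {0..h})"
      by (rule has_derivative_at_withinI)
  qed (use h in simp)
  then obtain s where s: "s \<in> {0..h}" "?G h - ?G 0 = h * (?D (u + s *\<^sub>R v + h *\<^sub>R w) v - ?D (u + s *\<^sub>R v) v)" by auto
  let ?F = "\<lambda>t. ?D (u + s *\<^sub>R v + t *\<^sub>R w) v"
  have "\<exists>t\<in>{0..h}. ?F h - ?F 0 = (h - 0) * ?E (u + s *\<^sub>R v + t *\<^sub>R w) w"
  proof (rule mvt_very_simple[where f="?F" and f'="\<lambda>t k. k * ?E (u + s *\<^sub>R v + t *\<^sub>R w) w"])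
    fix t assume "0 \<le> t" "t \<le> h"
    then have t: "t \<in> {0..h}" by simp
    have "((\<lambda>t. u + s *\<^sub>R v + t *\<^sub>R w) has_derivative (\<lambda>k. k *\<^sub>R w)) (at t)"
      by (auto intro!: derivative_eq_intros)
    from has_derivative_compose[OF this E[OF U[OF s(1) t]]]
    have "(?F has_derivative (\<lambda>k. k * ?E (u + s *\<^sub>R v + t *\<^sub>R w) w)) (at t)"
      by (simp add: lE[OF U[OF s(1) t]])
    then show "(?F has_derivative (\<lambda>k. k * ?E (u + s *\<^sub>R v + t *\<^sub>R w) w)) (at t within {0..h})"
      by (rule has_derivative_at_withinI)
  qed (use h in simp)
  then obtain t where t: "t \<in> {0..h}" "?F h - ?F 0 = h * ?E (u + s *\<^sub>R v + t *\<^sub>R w) w" by auto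
  have "f (u + h *\<^sub>R v + h *\<^sub>R w) - f (u + h *\<^sub>R v) - (f (u + h *\<^sub>R w) - f u) = h * (?F h - ?F 0)"
    using s(2) by simp
  also have "\<dots> = h * h * ?E (u + s *\<^sub>R v + t *\<^sub>R w) w" unfolding t(2) by simp
  finally show ?thesis using s(1) t(1) by blast
qed

lemma second_derivative_symmetric_real:
  fixes f :: "'a::euclidean_space \<Rightarrow> real"
  assumes f: "Ck_open 2 U f" and U: "open U" "u \<in> U"
  shows "frechet_derivative (\<lambda>y. frechet_derivative f (at y) v) (at u) w
       = frechet_derivative (\<lambda>y. frechet_derivative f (at y) w) (at u) v"
proof (rule ccontr)
  define E where "E v w y = frechet_derivative (\<lambda>y. frechet_derivative f (at y) v) (at y) w" for v w y
  assume "\<not> ?thesis"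
  then have e: "\<bar>E v w u - E w v u\<bar> > 0" by (simp add: E_def)
  define e where "e = \<bar>E v w u - E w v u\<bar> / 2"
  have c: "continuous_on U (E v w)" for v w
    using f by (simp add: numeral_2_eq_2 E_def[abs_def])
  have "isCont (E v w) u" "isCont (E w v) u"
    using c U continuous_on_eq_continuous_at by blast+
  then obtain d1 d2 where d: "d1 > 0" "\<And>y. dist y u < d1 \<Longrightarrow> dist (E v w y) (E v w u) < e"
    "d2 > 0" "\<And>y. dist y u < d2 \<Longrightarrow> dist (E w v y) (E w v u) < e"
    using e unfolding continuous_at_eps_delta e_def by (metis half_gt_zero)
  obtain d3 where d3: "d3 > 0" "ball u d3 \<subseteq> U" using U open_contains_ball by blast
  define d where "d = min d1 (min d2 d3)"
  define n where "n = norm v + norm w + 1"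
  \<comment> \<open>All points at which the mixed derivatives get evaluated are within h n = d / 2
    of \<open>u\<close>; there each mixed derivative differs from its value at \<open>u\<close> by
    less than \<open>e\<close>, half of the supposed discrepancy.\<close>
  define h where "h = d / (2 * n)"
  have n: "n > 0" by (simp add: n_def add_nonneg_pos)
  have dpos: "d > 0" using d d3 by (simp add: d_def)
  have h: "h > 0" unfolding h_def using dpos n by (intro divide_pos_pos mult_pos_pos) simp_all
  have near: "dist (u + s *\<^sub>R a + t *\<^sub>R b) u < d" if "s \<in> {0..h}" "t \<in> {0..h}" "norm a + norm b = norm v + norm w" for s t a b
  proof -
    have "dist (u + s *\<^sub>R a + t *\<^sub>R b) u = norm (s *\<^sub>R a + t *\<^sub>R b)" by (simp add: dist_norm)
    also have "\<dots> \<le> s * norm a + t * norm b" using that norm_triangle_ineq[of "s *\<^sub>R a" "t *\<^sub>R b"] by simp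
    also have "\<dots> \<le> h * norm a + h * norm b" using that by (intro add_mono mult_right_mono) auto
    also have "\<dots> = h * (norm v + norm w)" using that(3) by (simp add: distrib_left[symmetric])
    also have "\<dots> \<le> h * n" using h by (simp add: n_def)
    also have "\<dots> = d / 2" using n by (simp add: h_def)
    also have "\<dots> < d" using dpos by simp
    finally show ?thesis .
  qed
  let ?\<Delta> = "\<lambda>v w. f (u + h *\<^sub>R v + h *\<^sub>R w) - f (u + h *\<^sub>R v) - (f (u + h *\<^sub>R w) - f u)"
  have in_U: "u + s *\<^sub>R a + t *\<^sub>R b \<in> U" if "s \<in> {0..h}" "t \<in> {0..h}" "norm a + norm b = norm v + norm w" for s t a b
    using near[OF that] d3 by (auto simp: d_def dist_commute)
  obtain s t where st: "s \<in> {0..h}" "t \<in> {0..h}" "?\<Delta> v w = h * h * E v w (u + s *\<^sub>R v + t *\<^sub>R w)"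
    using second_difference[OF f h, of u v w] in_U unfolding E_def by blast
  obtain s' t' where st': "s' \<in> {0..h}" "t' \<in> {0..h}" "?\<Delta> w v = h * h * E w v (u + s' *\<^sub>R w + t' *\<^sub>R v)"
    using second_difference[OF f h, of u w v] in_U[of _ _ w v] unfolding E_def by (auto simp: add.commute)
  have "?\<Delta> v w = ?\<Delta> w v" by (simp add: algebra_simps)
  then have eq: "E v w (u + s *\<^sub>R v + t *\<^sub>R w) = E w v (u + s' *\<^sub>R w + t' *\<^sub>R v)" using st(3) st'(3) h by simp
  have "dist (E v w (u + s *\<^sub>R v + t *\<^sub>R w)) (E v w u) < e"
    by (rule d(2)) (use near[OF st(1,2), of v w] in \<open>simp add: d_def\<close>)
  moreover have "dist (E w v (u + s' *\<^sub>R w + t' *\<^sub>R v)) (E w v u) < e"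
    by (rule d(4)) (use near[OF st'(1,2), of w v] in \<open>simp add: d_def\<close>)
  moreover have "dist (E v w u) (E w v u) = 2 * e" by (simp add: e_def dist_real_def)
  ultimately show False
    using dist_triangle3[of "E v w u" "E w v u" "E v w (u + s *\<^sub>R v + t *\<^sub>R w)"] unfolding eq by linarith
qed

lemma second_derivative_symmetric:
  fixes f :: "'a::euclidean_space \<Rightarrow> 'b::euclidean_space"
  assumes f: "smooth_on U f" and U: "open U" "u \<in> U"
  shows "frechet_derivative (\<lambda>y. frechet_derivative f (at y) v) (at u) w
       = frechet_derivative (\<lambda>y. frechet_derivative f (at y) w) (at u) v"
proof (rule euclidean_eqI)
  fix b :: 'b
  have fd: "frechet_derivative (\<lambda>y. k y \<bullet> b) (at y) z = frechet_derivative k (at y) z \<bullet> b"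
    if "smooth_on U k" "y \<in> U" for k :: "'a \<Rightarrow> 'b" and y z
    using frechet_derivative_at[OF has_derivative_inner_left[OF smooth_on_has_derivative[OF that], of b]] by metis
  have inner: "frechet_derivative (\<lambda>y. frechet_derivative (\<lambda>y. f y \<bullet> b) (at y) z) (at u) x
      = frechet_derivative (\<lambda>y. frechet_derivative f (at y) z) (at u) x \<bullet> b" for z x
  proof -
    have "frechet_derivative (\<lambda>y. frechet_derivative (\<lambda>y. f y \<bullet> b) (at y) z) (at u)
        = frechet_derivative (\<lambda>y. frechet_derivative f (at y) z \<bullet> b) (at u)"
      by (rule frechet_derivative_cong_open[OF U]) (rule fd[OF f])
    then show ?thesis using fd[OF smooth_on_frechet_derivative[OF f] U(2)] by simp
  qed
  have "smooth_on U (\<lambda>y. f y \<bullet> b)" by (intro smooth_intros U f)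
  then have "Ck_open 2 U (\<lambda>y. f y \<bullet> b)" by (simp add: smooth_on_def del: Ck_open.simps)
  from second_derivative_symmetric_real[OF this U]
  show "frechet_derivative (\<lambda>y. frechet_derivative f (at y) v) (at u) w \<bullet> b
       = frechet_derivative (\<lambda>y. frechet_derivative f (at y) w) (at u) v \<bullet> b"
    unfolding inner .
qed

lemma bilinear_expand:
  fixes h :: "'a::euclidean_space \<Rightarrow> 'b::euclidean_space \<Rightarrow> real"
  assumes "bilinear h"
  shows "h v w = (\<Sum>a\<in>Basis. \<Sum>b\<in>Basis. (v \<bullet> a) * (w \<bullet> b) * h a b)"
proof -
  have "h v w = (\<Sum>a\<in>Basis. (v \<bullet> a) *\<^sub>R h a w)" by (rule linear_Basis_expand[OF bilinear_linear(2)[OF assms]])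
  also have "\<dots> = (\<Sum>a\<in>Basis. (v \<bullet> a) *\<^sub>R (\<Sum>b\<in>Basis. (w \<bullet> b) *\<^sub>R h a b))"
    by (intro sum.cong refl) (simp add: linear_Basis_expand[OF bilinear_linear(1)[OF assms], of _ w])
  finally show ?thesis by (simp add: sum_distrib_left mult.assoc)
qed

text \<open>Each identity of bilinearity holds for \<open>B y\<close> with y near x; differentiating
  it and using uniqueness of derivatives transfers it to \<open>B'\<close>.\<close>

lemma derivative_bilinear:
  fixes B :: "'a::euclidean_space \<Rightarrow> 'e::euclidean_space \<Rightarrow> 'e \<Rightarrow> real"
  assumes N: "open N" "x \<in> N" and B: "\<And>y. y \<in> N \<Longrightarrow> bilinear (B y)"
    and B': "\<And>a b. ((\<lambda>y. B y a b) has_derivative (\<lambda>z. B' z a b)) (at x)"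
  shows "bilinear (B' z)"
proof -
  have add1: "B' z (a + a') b = B' z a b + B' z a' b" for a a' b
  proof -
    have "((\<lambda>y. B y (a + a') b) has_derivative (\<lambda>z. B' z a b + B' z a' b)) (at x)"
      by (rule has_derivative_transform_within_open[OF has_derivative_add[OF B' B'] N]) (simp add: bilinear_ladd[OF B])
    from has_derivative_unique[OF B' this] show ?thesis by metis
  qed
  have add2: "B' z b (a + a') = B' z b a + B' z b a'" for a a' b
  proof -
    have "((\<lambda>y. B y b (a + a')) has_derivative (\<lambda>z. B' z b a + B' z b a')) (at x)"
      by (rule has_derivative_transform_within_open[OF has_derivative_add[OF B' B'] N]) (simp add: bilinear_radd[OF B])
    from has_derivative_unique[OF B' this] show ?thesis by metis
  qed
  have scale1: "B' z (k *\<^sub>R a) b = k * B' z a b" for k a b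
  proof -
    have "((\<lambda>y. B y (k *\<^sub>R a) b) has_derivative (\<lambda>z. k * B' z a b)) (at x)"
      by (rule has_derivative_transform_within_open[OF has_derivative_mult_right[OF B'] N]) (simp add: bilinear_lmul[OF B])
    from has_derivative_unique[OF B' this] show ?thesis by metis
  qed
  have scale2: "B' z b (k *\<^sub>R a) = k * B' z b a" for k a b
  proof -
    have "((\<lambda>y. B y b (k *\<^sub>R a)) has_derivative (\<lambda>z. k * B' z b a)) (at x)"
      by (rule has_derivative_transform_within_open[OF has_derivative_mult_right[OF B'] N]) (simp add: bilinear_rmul[OF B])
    from has_derivative_unique[OF B' this] show ?thesis by metis
  qed
  show ?thesis unfolding bilinear_def by (auto intro!: linearI simp: add1 add2 scale1 scale2)
qed

text \<open>The derivative of \<open>B\<close> is given for fixed vectors only; expansion in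
  \<open>Basis\<close> reduces the claim to the product rule for real functions.\<close>

lemma bilinear_product_derivative:
  fixes B :: "'a::euclidean_space \<Rightarrow> 'e::euclidean_space \<Rightarrow> 'e \<Rightarrow> real"
  assumes N: "open N" "x \<in> N" and B: "\<And>y. y \<in> N \<Longrightarrow> bilinear (B y)"
    and B': "\<And>a b. ((\<lambda>y. B y a b) has_derivative (\<lambda>z. B' z a b)) (at x)"
    and X: "(X has_derivative X') (at x)" and Y: "(Y has_derivative Y') (at x)"
  shows "((\<lambda>y. B y (X y) (Y y)) has_derivative
      (\<lambda>z. B' z (X x) (Y x) + B x (X' z) (Y x) + B x (X x) (Y' z))) (at x)"
proof -
  have 1: "((\<lambda>y. \<Sum>a\<in>Basis. \<Sum>b\<in>Basis. (X y \<bullet> a) * (Y y \<bullet> b) * B y a b) has_derivative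
      (\<lambda>z. \<Sum>a\<in>Basis. \<Sum>b\<in>Basis. (X x \<bullet> a) * (Y x \<bullet> b) * B' z a b +
         ((X x \<bullet> a) * (Y' z \<bullet> b) + (X' z \<bullet> a) * (Y x \<bullet> b)) * B x a b)) (at x)"
    by (intro has_derivative_sum has_derivative_mult B' has_derivative_inner_left X Y)
  have e: "B' z (X x) (Y x) = (\<Sum>a\<in>Basis. \<Sum>b\<in>Basis. (X x \<bullet> a) * (Y x \<bullet> b) * B' z a b)"
    "B x (X' z) (Y x) = (\<Sum>a\<in>Basis. \<Sum>b\<in>Basis. (X' z \<bullet> a) * (Y x \<bullet> b) * B x a b)"
    "B x (X x) (Y' z) = (\<Sum>a\<in>Basis. \<Sum>b\<in>Basis. (X x \<bullet> a) * (Y' z \<bullet> b) * B x a b)" for z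
    by (rule bilinear_expand, rule derivative_bilinear[OF N B B'], assumption)
      (rule bilinear_expand[OF B[OF N(2)]])+
  have "(\<Sum>a\<in>Basis. \<Sum>b\<in>Basis. (X x \<bullet> a) * (Y x \<bullet> b) * B' z a b +
         ((X x \<bullet> a) * (Y' z \<bullet> b) + (X' z \<bullet> a) * (Y x \<bullet> b)) * B x a b)
     = B' z (X x) (Y x) + B x (X' z) (Y x) + B x (X x) (Y' z)" for z
    unfolding e by (simp add: sum.distrib distrib_right)
  with 1 have 2: "((\<lambda>y. \<Sum>a\<in>Basis. \<Sum>b\<in>Basis. (X y \<bullet> a) * (Y y \<bullet> b) * B y a b) has_derivative
      (\<lambda>z. B' z (X x) (Y x) + B x (X' z) (Y x) + B x (X x) (Y' z))) (at x)" by simp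
  show ?thesis
    by (rule has_derivative_transform_within_open[OF 2 N]) (rule bilinear_expand[OF B, symmetric])
qed

section \<open>The Levi-Civita connection\<close>

locale riemannian_manifold = closed_manifold A
  for A :: "('m::t2_space, 'e::euclidean_space) chart set" +
  fixes g :: "('m, 'e) tensor2"
  assumes riemannian: "riemannian_metric A g"
begin

lemma smooth_g: "smooth_tensor2 A g" using riemannian by (simp add: riemannian_metric_def)
lemma g_sym: "c \<in> A \<Longrightarrow> u \<in> cran c \<Longrightarrow> g c u v w = g c u w v"
  using riemannian by (simp add: riemannian_metric_def)
lemma g_pos: "c \<in> A \<Longrightarrow> u \<in> cran c \<Longrightarrow> v \<noteq> 0 \<Longrightarrow> g c u v v > 0"
  using riemannian by (simp add: riemannian_metric_def)
lemma g_bilinear: "c \<in> A \<Longrightarrow> u \<in> cran c \<Longrightarrow> bilinear (g c u)"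
  using tensor_bilinear[OF smooth_g] .
lemma nondegenerate_g: "nondegenerate g"
  unfolding nondegenerate_def using smooth_g g_pos by (metis order_less_irrefl)

definition dg :: "('m, 'e) chart \<Rightarrow> 'e \<Rightarrow> 'e \<Rightarrow> 'e \<Rightarrow> 'e \<Rightarrow> real" where
  "dg c u z v w = frechet_derivative (\<lambda>y. g c y v w) (at u) z"

lemma dg_has_derivative:
  "c \<in> A \<Longrightarrow> u \<in> cran c \<Longrightarrow> ((\<lambda>y. g c y v w) has_derivative (\<lambda>z. dg c u z v w)) (at u)"
  unfolding dg_def using smooth_on_has_derivative[OF tensor_smooth[OF smooth_g]] by blast

lemma dg_bilinear: "c \<in> A \<Longrightarrow> u \<in> cran c \<Longrightarrow> bilinear (dg c u z)"
  by (rule derivative_bilinear[OF open_cran _ g_bilinear dg_has_derivative])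

lemma dg_linear: "c \<in> A \<Longrightarrow> u \<in> cran c \<Longrightarrow> linear (\<lambda>z. dg c u z v w)"
  using has_derivative_linear[OF dg_has_derivative] .

lemma dg_continuous: "c \<in> A \<Longrightarrow> continuous_on (cran c) (\<lambda>u. dg c u z v w)"
  unfolding dg_def
  by (rule smooth_on_continuous_on[OF smooth_on_frechet_derivative[OF tensor_smooth[OF smooth_g]]])

text \<open>Half of the right-hand side in \<open>christoffel\<close>, which turns the Koszul
  formula into an equation g(z, -) = l, the form treated for nondegenerate tensors.\<close>

definition koszul :: "('m, 'e) chart \<Rightarrow> 'e \<Rightarrow> 'e \<Rightarrow> 'e \<Rightarrow> 'e \<Rightarrow> real" where
  "koszul c u v w x = (dg c u v w x + dg c u w v x - dg c u x v w) / 2"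

lemma koszul_linear: assumes "c \<in> A" "u \<in> cran c" shows "linear (koszul c u v w)"
  by (intro linearI)
    (simp_all add: koszul_def bilinear_radd[OF dg_bilinear[OF assms]] bilinear_rmul[OF dg_bilinear[OF assms]]
      linear_add[OF dg_linear[OF assms]] linear_scale[OF dg_linear[OF assms]] field_simps)

lemma koszul_bilinear: assumes "c \<in> A" "u \<in> cran c" shows "bilinear (\<lambda>v w. koszul c u v w x)"
  unfolding bilinear_def
  by (intro allI conjI linearI)
    (simp_all add: koszul_def bilinear_radd[OF dg_bilinear[OF assms]] bilinear_rmul[OF dg_bilinear[OF assms]]
      bilinear_ladd[OF dg_bilinear[OF assms]] bilinear_lmul[OF dg_bilinear[OF assms]]
      linear_add[OF dg_linear[OF assms]] linear_scale[OF dg_linear[OF assms]] field_simps)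

lemma christoffel_eq: "christoffel g c u v w = (THE z. \<forall>x. g c u z x = koszul c u v w x)"
proof -
  have "(2 * a = b) \<longleftrightarrow> (a = b / 2)" for a b :: real by auto
  then show ?thesis unfolding christoffel_def koszul_def dg_def by presburger
qed

lemma christoffel_spec:
  "c \<in> A \<Longrightarrow> u \<in> cran c \<Longrightarrow> g c u (christoffel g c u v w) x = koszul c u v w x"
  unfolding christoffel_eq by (rule form_solution[OF nondegenerate_g _ _ koszul_linear])

lemma christoffel_bilinear:
  assumes "c \<in> A" "u \<in> cran c"
  shows "bilinear (christoffel g c u)"
proof -
  note B = g_bilinear[OF assms] and K = koszul_bilinear[OF assms]
  show ?thesis
    unfolding bilinear_def
    by (intro allI conjI linearI; rule form_cancel[OF nondegenerate_g assms])
      (simp_all add: bilinear_ladd[OF B] bilinear_lmul[OF B] christoffel_spec[OF assms]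
        bilinear_ladd[OF K] bilinear_lmul[OF K] bilinear_radd[OF K] bilinear_rmul[OF K])
qed

lemma christoffel_continuous:
  assumes "c \<in> A"
  shows "continuous_on (cran c) (\<lambda>u. christoffel g c u v w)"
proof -
  have "continuous_on (cran c) (\<lambda>u. \<Sum>b\<in>Basis. koszul c u v w b *\<^sub>R frame g c b u)"
    unfolding koszul_def
    by (intro continuous_intros dg_continuous continuous_frame[OF nondegenerate_g] assms) auto
  then show ?thesis
    by (rule continuous_on_eq) (simp add: christoffel_eq form_solution_expand[OF nondegenerate_g assms _ koszul_linear[OF assms]])
qed

definition jac2 :: "('m, 'e) chart \<Rightarrow> ('m, 'e) chart \<Rightarrow> 'e \<Rightarrow> 'e \<Rightarrow> 'e \<Rightarrow> 'e" where
  "jac2 c c' u z v = frechet_derivative (\<lambda>y. jac c c' y v) (at u) z"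

lemma jac_smooth: "c \<in> A \<Longrightarrow> c' \<in> A \<Longrightarrow> smooth_on (overlap c c') (\<lambda>y. jac c c' y v)"
  unfolding jac_def by (rule smooth_on_frechet_derivative[OF smooth_transition])

lemma jac2_has_derivative:
  "c \<in> A \<Longrightarrow> c' \<in> A \<Longrightarrow> u \<in> overlap c c' \<Longrightarrow> ((\<lambda>y. jac c c' y v) has_derivative (\<lambda>z. jac2 c c' u z v)) (at u)"
  unfolding jac2_def using smooth_on_has_derivative[OF jac_smooth] by blast

lemma jac2_sym:
  "c \<in> A \<Longrightarrow> c' \<in> A \<Longrightarrow> u \<in> overlap c c' \<Longrightarrow> jac2 c c' u z v = jac2 c c' u v z"
  unfolding jac2_def jac_def
  by (rule second_derivative_symmetric[OF smooth_transition open_overlap])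

text \<open>The transformation law g(v, w) = g'(J v, J w) is differentiated; the terms with
  \<open>jac2\<close> come from the variation of the Jacobian J.\<close>

lemma dg_transform:
  assumes c: "c \<in> A" "c' \<in> A" and p: "p \<in> cdom c" "p \<in> cdom c'"
  defines "u \<equiv> cmap c p" and "u' \<equiv> cmap c' p"
  shows "dg c u z v w = dg c' u' (jac c c' u z) (jac c c' u v) (jac c c' u w)
     + g c' u' (jac2 c c' u z v) (jac c c' u w) + g c' u' (jac c c' u v) (jac2 c c' u z w)"
proof -
  let ?T = "transition c c'"
  have u: "u \<in> overlap c c'" using p cmap_overlap by (simp add: u_def)
  have Tu: "?T u = u'" using c p by (simp add: u_def u'_def)
  have u': "u' \<in> cran c'" using p by (simp add: u'_def)
  have T: "((\<lambda>y. g c' (?T y) a b) has_derivative (\<lambda>z. dg c' u' (jac c c' u z) a b)) (at u)" for a b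
    by (rule has_derivative_compose[OF jac_has_derivative[OF c u]]) (use dg_has_derivative[OF c(2) u'] Tu in simp)
  have 1: "((\<lambda>y. g c' (?T y) (jac c c' y v) (jac c c' y w)) has_derivative
     (\<lambda>z. dg c' u' (jac c c' u z) (jac c c' u v) (jac c c' u w)
       + g c' (?T u) (jac2 c c' u z v) (jac c c' u w) + g c' (?T u) (jac c c' u v) (jac2 c c' u z w))) (at u)"
    by (rule bilinear_product_derivative[OF open_overlap[OF c] u _ T jac2_has_derivative[OF c u] jac2_has_derivative[OF c u]])
      (rule g_bilinear[OF c(2) transition_cran[OF c]])
  have 2: "((\<lambda>y. g c y v w) has_derivative
     (\<lambda>z. dg c' u' (jac c c' u z) (jac c c' u v) (jac c c' u w)
       + g c' u' (jac2 c c' u z v) (jac c c' u w) + g c' u' (jac c c' u v) (jac2 c c' u z w))) (at u)"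
  proof (rule has_derivative_transform_within_open[OF 1[unfolded Tu] open_overlap[OF c] u])
    fix y assume "y \<in> overlap c c'"
    then obtain q where q: "q \<in> cdom c" "q \<in> cdom c'" "y = cmap c q" by (auto simp: overlap_def)
    show "g c' (?T y) (jac c c' y v) (jac c c' y w) = g c y v w"
      using tensor_transform[OF smooth_g c q(1,2), of v w] q c by simp
  qed
  have "u \<in> cran c" using p by (simp add: u_def)
  from has_derivative_unique[OF dg_has_derivative[OF c(1) this] 2] show ?thesis by metis
qed

text \<open>The non-tensorial term \<open>jac2\<close> is what makes the transport equation
  independent of the chart. It is found by testing both sides against all vectors and inserting
  \<open>dg_transform\<close> into the Koszul formula.\<close>

lemma christoffel_transform:
  assumes c: "c \<in> A" "c' \<in> A" and p: "p \<in> cdom c" "p \<in> cdom c'"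
  defines "u \<equiv> cmap c p" and "u' \<equiv> cmap c' p"
  shows "christoffel g c' u' (jac c c' u v) (jac c c' u w)
    = jac c c' u (christoffel g c u v w) - jac2 c c' u v w"
proof (rule form_cancel[OF nondegenerate_g c(2)])
  show u': "u' \<in> cran c'" using p by (simp add: u'_def)
  have uc: "u \<in> cran c" using p by (simp add: u_def)
  have u: "u \<in> overlap c c'" using p cmap_overlap by (simp add: u_def)
  fix x'
  define x where "x = jac c' c u' x'"
  let ?J = "jac c c' u" and ?S = "jac2 c c' u"
  have x: "?J x = x'" using jac_inverse[OF c(2,1) p(2,1)] by (simp add: x_def u_def u'_def)
  note S = jac2_sym[OF c u] and B = g_bilinear[OF c(2) u'] and sym = g_sym[OF c(2) u']
  note dgt = dg_transform[OF c p, folded u_def u'_def]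
  \<comment> \<open>Of the six terms with second derivatives four cancel in pairs, by the symmetry
    of \<open>jac2\<close> and of g; the other two coincide and lose the factor 1/2.\<close>
  have k: "koszul c u v w x = koszul c' u' (?J v) (?J w) (?J x) + g c' u' (?S v w) (?J x)"
    unfolding koszul_def dgt[of v w x] dgt[of w v x] dgt[of x v w]
      S[of w v] S[of x v] S[of x w] sym[of "?J w" "?S v x"] sym[of "?J v" "?S w x"]
    by (simp add: field_simps)
  have "g c' u' (?J (christoffel g c u v w) - ?S v w) (?J x)
      = g c u (christoffel g c u v w) x - g c' u' (?S v w) (?J x)"
    using tensor_transform[OF smooth_g c p, folded u_def u'_def] by (simp add: bilinear_lsub[OF B])
  also have "\<dots> = koszul c' u' (?J v) (?J w) (?J x)"
    using k christoffel_spec[OF c(1) uc] by simp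
  also have "\<dots> = g c' u' (christoffel g c' u' (?J v) (?J w)) (?J x)"
    using christoffel_spec[OF c(2) u'] by simp
  finally show "g c' u' (christoffel g c' u' (?J v) (?J w)) x' = g c' u' (?J (christoffel g c u v w) - ?S v w) x'"
    unfolding x by simp
qed

end

section \<open>Coordinate segments and parallel transport\<close>

lemma bilinear_norm_bound:
  fixes h :: "'a::euclidean_space \<Rightarrow> 'b::euclidean_space \<Rightarrow> 'c::real_normed_vector"
  assumes h: "bilinear h"
  shows "norm (h v w) \<le> norm v * norm w * (\<Sum>a\<in>Basis. \<Sum>b\<in>Basis. norm (h a b))"
proof -
  have "norm (h v w) \<le> norm v * (\<Sum>a\<in>Basis. norm (h a w))" by (rule linear_norm_bound[OF bilinear_linear(2)[OF h]])
  also have "\<dots> \<le> norm v * (\<Sum>a\<in>Basis. norm w * (\<Sum>b\<in>Basis. norm (h a b)))"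
    by (intro mult_left_mono sum_mono linear_norm_bound[OF bilinear_linear(1)[OF h]]) simp
  finally show ?thesis by (simp add: sum_distrib_left mult.assoc)
qed

lemma compact_continuous_bound:
  fixes f :: "'a::topological_space \<Rightarrow> real"
  assumes "compact K" "continuous_on K f"
  shows "\<exists>M>0. \<forall>x\<in>K. f x \<le> M"
proof -
  obtain M where "M \<ge> 0" "\<forall>x\<in>K. norm (f x) \<le> M" using continuous_compact_bound[OF assms] by blast
  then show ?thesis by (intro exI[of _ "M + 1"]) fastforce
qed

definition seg :: "'e::real_vector \<Rightarrow> 'e \<Rightarrow> real \<Rightarrow> 'e" where
  "seg u v t = u + t *\<^sub>R (v - u)"

lemma seg_simps [simp]: "seg u v 0 = u" "seg u v 1 = v"
  by (simp_all add: seg_def)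

lemma seg_has_vector_derivative: "(seg u v has_vector_derivative (v - u)) (at t within S)"
  unfolding seg_def[abs_def] by (auto intro!: derivative_eq_intros)

lemma continuous_seg: "continuous_on S (seg u v :: real \<Rightarrow> 'e::real_normed_vector)"
  unfolding seg_def[abs_def] by (intro continuous_intros)

lemma seg_in_convex: "convex K \<Longrightarrow> u \<in> K \<Longrightarrow> v \<in> K \<Longrightarrow> t \<in> {0..1} \<Longrightarrow> seg u v t \<in> K"
  using convexD_alt[of K u v t] by (simp add: seg_def algebra_simps)

context riemannian_manifold
begin

definition chart_line :: "('m, 'e) chart \<Rightarrow> 'e \<Rightarrow> 'e \<Rightarrow> real \<Rightarrow> 'm" where
  "chart_line c u v = cinv c \<circ> seg u v"

lemma chart_line_ends [simp]: "chart_line c u v 0 = cinv c u" "chart_line c u v 1 = cinv c v"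
  by (simp_all add: chart_line_def)

lemma tangent_norm_nonneg: "c \<in> A \<Longrightarrow> u \<in> cran c \<Longrightarrow> 0 \<le> tangent_norm g c u v"
  using g_pos[of c u v] bilinear_lzero[OF g_bilinear, of c u] by (cases "v = 0") (simp_all add: tangent_norm_def less_imp_le)

lemma tangent_norm_transform:
  "c \<in> A \<Longrightarrow> c' \<in> A \<Longrightarrow> p \<in> cdom c \<Longrightarrow> p \<in> cdom c' \<Longrightarrow>
    tangent_norm g c' (cmap c' p) (jac c c' (cmap c p) v) = tangent_norm g c (cmap c p) v"
  unfolding tangent_norm_def using tensor_transform[OF smooth_g, of c c' p v v] by presburger

lemma tangent_norm_bound:
  assumes c: "c \<in> A" and K: "compact K" "K \<subseteq> cran c"
  shows "\<exists>G>0. \<forall>w\<in>K. \<forall>y. tangent_norm g c w y \<le> G * norm y"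
proof -
  have "continuous_on K (\<lambda>w. \<Sum>a\<in>Basis. \<Sum>b\<in>Basis. norm (g c w a b))"
    by (intro continuous_intros continuous_on_subset[OF tensor_continuous[OF smooth_g c] K(2)])
  from compact_continuous_bound[OF K(1) this]
  obtain M where M: "M > 0" "\<And>w. w \<in> K \<Longrightarrow> (\<Sum>a\<in>Basis. \<Sum>b\<in>Basis. norm (g c w a b)) \<le> M" by blast
  have "tangent_norm g c w y \<le> sqrt M * norm y" if w: "w \<in> K" for w y
  proof -
    have "g c w y y \<le> norm y * norm y * (\<Sum>a\<in>Basis. \<Sum>b\<in>Basis. norm (g c w a b))"
      using bilinear_norm_bound[OF g_bilinear[OF c], of w y y] w K by auto
    also have "\<dots> \<le> norm y * norm y * M" by (intro mult_left_mono M w) simp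
    finally have "sqrt (g c w y y) \<le> sqrt (norm y * norm y * M)" by simp
    then show ?thesis by (simp add: tangent_norm_def real_sqrt_mult mult.commute)
  qed
  then show ?thesis using M(1) by (intro exI[of _ "sqrt M"]) simp
qed

section \<open>Coordinate segments in a convex part of a chart\<close>

context
  fixes c K u v
  assumes c: "c \<in> A" and K: "convex K" "K \<subseteq> cran c" and uv: "u \<in> K" "v \<in> K"
begin

lemma line_cran: "t \<in> {0..1} \<Longrightarrow> seg u v t \<in> cran c"
  using seg_in_convex[OF K(1) uv] K(2) by blast

lemma line_cdom: "t \<in> {0..1} \<Longrightarrow> chart_line c u v t \<in> cdom c"
  using line_cran c by (simp add: chart_line_def)

lemma cmap_line: "t \<in> {0..1} \<Longrightarrow> cmap c (chart_line c u v t) = seg u v t"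
  using line_cran c by (simp add: chart_line_def)

lemma continuous_line: "continuous_on {0..1} (chart_line c u v)"
  unfolding chart_line_def
  by (rule continuous_on_compose[OF continuous_seg continuous_on_subset[OF continuous_cinv[OF c]]],
      rule image_subsetI, rule line_cran)

lemma C1_curve_line: "C1_curve A (chart_line c u v)"
  unfolding C1_curve_def
proof (intro conjI ballI continuous_line)
  fix c' assume c': "c' \<in> A"
  show "C_on 1 {t \<in> {0..1}. chart_line c u v t \<in> cdom c'} (cmap c' \<circ> chart_line c u v)"
    unfolding C_on_def
  proof
    fix t assume t: "t \<in> {t \<in> {0..1}. chart_line c u v t \<in> cdom c'}"
    \<comment> \<open>\<open>C_on\<close> asks for an extension to an open set of times. The segment
      continues as a line over all real times, which stays in the overlap of the charts near
      \<open>t\<close>.\<close>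
    let ?U = "seg u v -` overlap c c'"
    let ?h = "\<lambda>t. transition c c' (seg u v t)"
    have o: "open ?U" by (rule open_vimage[OF open_overlap[OF c c'] continuous_seg])
    have "smooth_on UNIV (seg u v)"
      unfolding seg_def[abs_def] by (intro smooth_intros open_UNIV)
    then have sseg: "smooth_on ?U (seg u v)" by (rule smooth_on_subset) simp
    have "smooth_on ?U ?h"
      by (rule smooth_on_compose[OF o open_overlap[OF c c'] smooth_transition[OF c c'] sseg]) auto
    then have "\<forall>j. enat j \<le> 1 \<longrightarrow> Ck_open j ?U ?h" by (simp add: smooth_on_def)
    moreover have "t \<in> ?U" using t line_cran c by (simp add: overlap_iff chart_line_def)
    moreover have "?h s = (cmap c' \<circ> chart_line c u v) s" for s by (simp add: transition_def chart_line_def)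
    ultimately show "\<exists>U h. open U \<and> t \<in> U \<and> (\<forall>j. enat j \<le> 1 \<longrightarrow> Ck_open j U h) \<and>
        (\<forall>y\<in>U \<inter> {t \<in> {0..1}. chart_line c u v t \<in> cdom c'}. h y = (cmap c' \<circ> chart_line c u v) y)"
      using o by blast
  qed
qed

lemma line_derivative: "t \<in> {0..1} \<Longrightarrow> ((cmap c \<circ> chart_line c u v) has_vector_derivative (v - u)) (at t within {0..1})"
  by (rule has_vector_derivative_transform[OF _ _ seg_has_vector_derivative]) (simp_all add: cmap_line)

lemma velocity_line:
  assumes t: "t \<in> {0..1}" and c': "c' \<in> A" "chart_line c u v t \<in> cdom c'"
  shows "velocity c' (chart_line c u v) t = jac c c' (seg u v t) (v - u)"
  unfolding velocity_def
proof (rule vector_derivative_within_closed_interval[OF _ t])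
  show "((cmap c' \<circ> chart_line c u v) has_vector_derivative jac c c' (seg u v t) (v - u)) (at t within {0..1})"
    using has_vector_derivative_change_chart[OF c c'(1) t line_cdom[OF t] c'(2) continuous_line line_derivative[OF t]]
    unfolding cmap_line[OF t] .
qed simp

lemma speed_line:
  assumes t: "t \<in> {0..1}"
  shows "speed A g (chart_line c u v) t = tangent_norm g c (seg u v t) (v - u)"
proof -
  define c' where "c' = (SOME c'. c' \<in> A \<and> chart_line c u v t \<in> cdom c')"
  have "\<exists>c'. c' \<in> A \<and> chart_line c u v t \<in> cdom c'" using ex_chart[of "chart_line c u v t"] by (simp only: Bex_def)
  from someI_ex[OF this] have "c' \<in> A \<and> chart_line c u v t \<in> cdom c'" by (simp add: c'_def)
  then have c': "c' \<in> A" "chart_line c u v t \<in> cdom c'" by blast+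
  have "speed A g (chart_line c u v) t = tangent_norm g c' (cmap c' (chart_line c u v t)) (velocity c' (chart_line c u v) t)"
    by (simp add: speed_def c'_def Let_def)
  also have "\<dots> = tangent_norm g c (seg u v t) (v - u)"
    unfolding velocity_line[OF t c'] cmap_line[OF t, symmetric]
    by (rule tangent_norm_transform[OF c c'(1) line_cdom[OF t] c'(2)])
  finally show ?thesis .
qed

lemma curve_length_line:
  assumes G: "\<And>w y. w \<in> K \<Longrightarrow> tangent_norm g c w y \<le> G * norm y" "G > 0"
  shows "curve_length A g (chart_line c u v) \<le> G * norm (v - u)" "0 \<le> curve_length A g (chart_line c u v)"
proof -
  let ?s = "speed A g (chart_line c u v)"
  have nn: "0 \<le> ?s t" if "t \<in> {0..1}" for t
    using tangent_norm_nonneg[OF c line_cran[OF that]] speed_line[OF that] by simp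
  have "?s t \<le> G * norm (v - u)" if "t \<in> {0..1}" for t
    using G(1)[OF seg_in_convex[OF K(1) uv that]] speed_line[OF that] by simp
  then have le: "integral {0..1} ?s \<le> G * norm (v - u)" if "?s integrable_on {0..1}"
    using integral_le[OF that, of "\<lambda>_. G * norm (v - u)"] by (simp add: integrable_const_ivl)
  \<comment> \<open>For a non-integrable speed \<open>integral\<close> takes the default value 0,
    which obeys both bounds as well.\<close>
  show "curve_length A g (chart_line c u v) \<le> G * norm (v - u)"
    unfolding curve_length_def using le G(2) by (cases "?s integrable_on {0..1}") (auto simp: not_integrable_integral)
  show "0 \<le> curve_length A g (chart_line c u v)"
    unfolding curve_length_def using nn integral_nonneg[of ?s "{0..1}"]
    by (cases "?s integrable_on {0..1}") (blast, simp add: not_integrable_integral)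
qed

lemma jac2_bilinear:
  assumes c': "c' \<in> A" and w: "w \<in> overlap c c'"
  shows "bilinear (jac2 c c' w)"
proof -
  have l: "linear (\<lambda>z. jac2 c c' w z y)" for y using has_derivative_linear[OF jac2_has_derivative[OF c c' w]] .
  moreover have "linear (jac2 c c' w z)" for z
  proof -
    have "jac2 c c' w z = (\<lambda>y. jac2 c c' w y z)" by (rule ext) (rule jac2_sym[OF c c' w])
    then show ?thesis using l[of z] by (simp only:)
  qed
  ultimately show ?thesis by (simp add: bilinear_def)
qed

text \<open>A field solving the transport equation in \<open>c\<close> is pushed to the other charts
  by the Jacobian. Differentiating the Jacobian along the segment produces the term
  \<open>jac2\<close> applied to the velocity and the field, and this is exactly the inhomogeneous
  term of \<open>christoffel_transform\<close>.\<close>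

lemma parallel_along_line:
  assumes W: "\<And>t. t \<in> {0..1} \<Longrightarrow> (W has_vector_derivative - christoffel g c (seg u v t) (v - u) (W t)) (at t within {0..1})"
  shows "parallel_along A g (chart_line c u v) (\<lambda>c' t. jac c c' (seg u v t) (W t))"
  unfolding parallel_along_def
proof (intro conjI ballI impI)
  fix c1 c2 t assume c12: "c1 \<in> A" "c2 \<in> A" and t: "t \<in> {0..1}" and "chart_line c u v t \<in> cdom c1 \<inter> cdom c2"
  then have d: "chart_line c u v t \<in> cdom c1" "chart_line c u v t \<in> cdom c2" by auto
  show "jac c c2 (seg u v t) (W t) = jac c1 c2 (cmap c1 (chart_line c u v t)) (jac c c1 (seg u v t) (W t))"
    using jac_cocycle[OF c c12 line_cdom[OF t] d] by (simp add: cmap_line[OF t])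
next
  fix c' t assume c': "c' \<in> A" and t: "t \<in> {0..1}" and d: "chart_line c u v t \<in> cdom c'"
  let ?w = "seg u v t" and ?y = "v - u" and ?W' = "- christoffel g c (seg u v t) (v - u) (W t)"
  have w: "?w \<in> overlap c c'" using cmap_overlap[OF line_cdom[OF t] d] by (simp add: cmap_line[OF t])
  have wc: "?w \<in> cran c" by (rule line_cran[OF t])
  note j2 = jac2_bilinear[OF c' w]
  have J: "((\<lambda>s. jac c c' (seg u v s) b) has_derivative (\<lambda>k. jac2 c c' ?w (k *\<^sub>R ?y) b)) (at t within {0..1})" for b
    by (rule has_derivative_compose[OF seg_has_vector_derivative[unfolded has_vector_derivative_def] jac2_has_derivative[OF c c' w]])
  \<comment> \<open>The product rule is applied to the expansion in \<open>Basis\<close>, because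
    the Jacobian is differentiated on fixed vectors.\<close>
  have "((\<lambda>s. \<Sum>b\<in>Basis. (W s \<bullet> b) *\<^sub>R jac c c' (seg u v s) b) has_derivative
     (\<lambda>k. \<Sum>b\<in>Basis. (W t \<bullet> b) *\<^sub>R jac2 c c' ?w (k *\<^sub>R ?y) b + ((k *\<^sub>R ?W') \<bullet> b) *\<^sub>R jac c c' ?w b)) (at t within {0..1})"
    by (intro has_derivative_sum has_derivative_scaleR J has_derivative_inner_left
        W[OF t, unfolded has_vector_derivative_def])
  moreover have "(\<Sum>b\<in>Basis. (W t \<bullet> b) *\<^sub>R jac2 c c' ?w (k *\<^sub>R ?y) b + ((k *\<^sub>R ?W') \<bullet> b) *\<^sub>R jac c c' ?w b)
     = k *\<^sub>R (jac2 c c' ?w ?y (W t) + jac c c' ?w ?W')" for k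
    unfolding bilinear_lmul[OF j2] linear_Basis_expand[OF bilinear_linear(1)[OF j2], of ?y "W t"]
      linear_Basis_expand[OF linear_jac[OF c c' w], of ?W']
    by (simp add: sum.distrib scaleR_sum_right scaleR_add_right mult.commute sum_subtractf sum_negf scaleR_diff_right)
  moreover have "jac2 c c' ?w ?y (W t) + jac c c' ?w ?W'
      = - christoffel g c' (cmap c' (chart_line c u v t)) (velocity c' (chart_line c u v) t) (jac c c' ?w (W t))"
    unfolding velocity_line[OF t c' d]
    using christoffel_transform[OF c c' line_cdom[OF t] d, of ?y "W t"]
    by (simp add: cmap_line[OF t] linear_neg[OF linear_jac[OF c c' w]])
  ultimately have 1: "((\<lambda>s. \<Sum>b\<in>Basis. (W s \<bullet> b) *\<^sub>R jac c c' (seg u v s) b) has_derivative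
     (\<lambda>k. k *\<^sub>R - christoffel g c' (cmap c' (chart_line c u v t)) (velocity c' (chart_line c u v) t) (jac c c' ?w (W t)))) (at t within {0..1})"
    by simp
  have "\<forall>\<^sub>F s in at t within {0..1}. seg u v s \<in> overlap c c'"
    using continuous_seg[of "{0..1}" u v] t w open_overlap[OF c c'] unfolding continuous_on_def by (blast intro: topological_tendstoD)
  then have ev: "\<forall>\<^sub>F s in at t within {0..1}. (\<Sum>b\<in>Basis. (W s \<bullet> b) *\<^sub>R jac c c' (seg u v s) b) = jac c c' (seg u v s) (W s)"
    by eventually_elim (rule linear_Basis_expand[OF linear_jac[OF c c'], symmetric])
  show "((\<lambda>t. jac c c' (seg u v t) (W t)) has_vector_derivative
     - christoffel g c' (cmap c' (chart_line c u v t)) (velocity c' (chart_line c u v) t) (jac c c' ?w (W t))) (at t within {0..1})"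
    unfolding has_vector_derivative_def
    by (rule has_derivative_transform_eventually[OF 1 ev])
      (use t linear_Basis_expand[OF linear_jac[OF c c' w], of "W t"] in simp_all)
qed

text \<open>Picard iteration in the ball of radius 1 around \<open>b\<close>. Fields there have norm
  at most 2, so their derivative is at most 2 B |v - u|, and both smallness conditions of
  \<open>picard_local\<close> reduce to 4 B |v - u| \<le> 1. The same bound on the derivative gives
  the displacement at time 1.\<close>

lemma parallel_transport_line:
  assumes B: "\<And>w y z. w \<in> K \<Longrightarrow> norm (christoffel g c w y z) \<le> B * norm y * norm z" "B > 0"
    and small: "4 * B * norm (v - u) \<le> 1" and b: "norm b = 1"
  obtains W where "W 0 = b" "norm (W 1 - b) \<le> 2 * B * norm (v - u)"
    "\<And>t. t \<in> {0..1} \<Longrightarrow> (W has_vector_derivative - christoffel g c (seg u v t) (v - u) (W t)) (at t within {0..1})"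
proof -
  let ?X = "\<lambda>t V. - christoffel g c (seg u v t) (v - u) V"
  have inK: "seg u v t \<in> K" if "t \<in> {0..1}" for t using seg_in_convex[OF K(1) uv that] .
  have bil: "bilinear (christoffel g c (seg u v t))" if "t \<in> {0..1}" for t
    using christoffel_bilinear[OF c line_cran[OF that]] .
  have bound: "norm (?X t V) \<le> 2 * B * norm (v - u)" if t: "t \<in> {0..1}" and V: "V \<in> cball b 1" for t V
  proof -
    have "norm V \<le> 2" using norm_triangle_sub[of V b] V b by (simp add: dist_norm norm_minus_commute)
    then have "B * norm (v - u) * norm V \<le> B * norm (v - u) * 2" using B(2) by (intro mult_left_mono) auto
    then show ?thesis using B(1)[OF inK[OF t], of "v - u" V] by simp
  qed
  have "continuous_on ({0..1} \<times> cball b 1) (\<lambda>p. - (\<Sum>a\<in>Basis. (snd p \<bullet> a) *\<^sub>R christoffel g c (seg u v (fst p)) (v - u) a))"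
    by (intro continuous_intros continuous_on_compose2[OF christoffel_continuous[OF c]]
        continuous_on_compose2[OF continuous_seg[of UNIV]]) (use line_cran in auto)
  then have cont: "continuous_on ({0..1} \<times> cball b 1) (\<lambda>(t, V). ?X t V)"
    by (rule continuous_on_eq) (use linear_Basis_expand[OF bilinear_linear(1)[OF bil]] in \<open>auto simp: split_beta\<close>)
  have lip: "norm (?X t V - ?X t V') \<le> (B * norm (v - u)) * norm (V - V')" if t: "t \<in> {0..1}" for t V V'
  proof -
    have "?X t V - ?X t V' = - christoffel g c (seg u v t) (v - u) (V - V')"
      by (simp add: bilinear_rsub[OF bil[OF t]])
    then show ?thesis using B(1)[OF inK[OF t], of "v - u" "V - V'"] by simp
  qed
  obtain W where W: "W 0 = b" "\<And>t. t \<in> {0..1} \<Longrightarrow> W t \<in> cball b 1"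
    "\<And>t. t \<in> {0..1} \<Longrightarrow> (W has_vector_derivative ?X t (W t)) (at t within {0..1})"
    by (rule picard_local[of 0 0 1 1 b ?X "B * norm (v - u)" "2 * B * norm (v - u)"])
      (use cont lip bound small B(2) in auto)
  have "norm (W 1 - W 0) \<le> (2 * B * norm (v - u)) * norm (1 - 0 :: real)"
  proof (rule differentiable_bound[of "{0..1}" W "\<lambda>t h. h *\<^sub>R ?X t (W t)"])
    fix t :: real assume t: "t \<in> {0..1}"
    show "(W has_derivative (\<lambda>h. h *\<^sub>R ?X t (W t))) (at t within {0..1})"
      using W(3)[OF t] by (simp add: has_vector_derivative_def)
    show "onorm (\<lambda>h. h *\<^sub>R ?X t (W t)) \<le> 2 * B * norm (v - u)"
    proof (rule onorm_le)
      fix h :: real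
      have "norm (h *\<^sub>R ?X t (W t)) = norm (?X t (W t)) * norm h" by simp
      also have "\<dots> \<le> 2 * B * norm (v - u) * norm h" by (intro mult_right_mono bound[OF t W(2)[OF t]]) simp
      finally show "norm (h *\<^sub>R ?X t (W t)) \<le> 2 * B * norm (v - u) * norm h" .
    qed
  qed auto
  then have "norm (W 1 - b) \<le> 2 * B * norm (v - u)" by (simp add: W(1))
  then show ?thesis using that W by blast
qed

end

section \<open>Distance and Lipschitz bounds in coordinates\<close>

lemma riemannian_dist_le:
  assumes c: "c \<in> A" and K: "convex K" "K \<subseteq> cran c" and uv: "u \<in> K" "v \<in> K"
    and G: "\<And>w y. w \<in> K \<Longrightarrow> tangent_norm g c w y \<le> G * norm y" "G > 0"
  shows "riemannian_dist A g (cinv c u) (cinv c v) \<le> G * norm (v - u)"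
proof -
  \<comment> \<open>Nonnegative lengths make the set of lengths bounded below, so that its infimum
    is at most the length of the segment.\<close>
  have "0 \<le> curve_length A g \<gamma>" for \<gamma>
  proof -
    have nn: "0 \<le> speed A g \<gamma> t" for t
    proof -
      define c' where "c' = (SOME c. c \<in> A \<and> \<gamma> t \<in> cdom c)"
      have "\<exists>c. c \<in> A \<and> \<gamma> t \<in> cdom c" using ex_chart by blast
      from someI_ex[OF this] have "c' \<in> A \<and> \<gamma> t \<in> cdom c'" by (simp add: c'_def)
      then have "c' \<in> A" "cmap c' (\<gamma> t) \<in> cran c'" by auto
      from tangent_norm_nonneg[OF this] show ?thesis
        unfolding speed_def Let_def c'_def .
    qed
    then show ?thesis
      unfolding curve_length_def using integral_nonneg[of "speed A g \<gamma>" "{0..1}"]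
      by (cases "speed A g \<gamma> integrable_on {0..1}") (blast, simp add: not_integrable_integral)
  qed
  then have "bdd_below {curve_length A g \<gamma> |\<gamma>. C1_curve A \<gamma> \<and> \<gamma> 0 = cinv c u \<and> \<gamma> 1 = cinv c v}"
    by (intro bdd_belowI[of _ 0]) auto
  then have "riemannian_dist A g (cinv c u) (cinv c v) \<le> curve_length A g (chart_line c u v)"
    unfolding riemannian_dist_def
    by (intro cInf_lower) (use C1_curve_line[OF c K uv] in \<open>auto intro!: exI[of _ "chart_line c u v"]\<close>)
  also have "\<dots> \<le> G * norm (v - u)" by (rule curve_length_line[OF c K uv G])
  finally show ?thesis .
qed

lemma christoffel_bound:
  assumes c: "c \<in> A" and K: "compact K" "K \<subseteq> cran c"
  shows "\<exists>B>0. \<forall>w\<in>K. \<forall>y z. norm (christoffel g c w y z) \<le> B * norm y * norm z"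
proof -
  have "continuous_on K (\<lambda>w. \<Sum>a\<in>Basis. \<Sum>b\<in>Basis. norm (christoffel g c w a b))"
    by (intro continuous_intros continuous_on_subset[OF christoffel_continuous[OF c] K(2)])
  from compact_continuous_bound[OF K(1) this]
  obtain M where M: "M > 0" "\<And>w. w \<in> K \<Longrightarrow> (\<Sum>a\<in>Basis. \<Sum>b\<in>Basis. norm (christoffel g c w a b)) \<le> M" by blast
  have "norm (christoffel g c w y z) \<le> M * norm y * norm z" if w: "w \<in> K" for w y z
  proof -
    have "norm (christoffel g c w y z) \<le> norm y * norm z * (\<Sum>a\<in>Basis. \<Sum>b\<in>Basis. norm (christoffel g c w a b))"
      by (rule bilinear_norm_bound[OF christoffel_bilinear[OF c]]) (use w K in auto)
    also have "\<dots> \<le> norm y * norm z * M" by (intro mult_left_mono M w) simp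
    finally show ?thesis by (simp add: mult_ac)
  qed
  then show ?thesis using M(1) by blast
qed

text \<open>Along a short coordinate segment, parallel transport differs from the constant extension of a
  vector by at most a multiple of the length. The bound \<open>D\<close> must not depend on \<open>F\<close>, because it is
  needed uniformly in time.\<close>

lemma coordinate_lipschitz:
  assumes c: "c \<in> A" and K: "cball x r \<subseteq> cran c" and L0: "L0 \<ge> 0" and M: "M > 0"
  shows "\<exists>D\<ge>0. \<forall>F L. C1_fun F \<longrightarrow> differential_lipschitz A g F L \<longrightarrow> L \<le> L0 \<longrightarrow>
    (\<forall>u\<in>cball x r. (\<Sum>b\<in>Basis. \<bar>differential c F u b\<bar>) \<le> M) \<longrightarrow>
    (\<forall>u\<in>cball x r. \<forall>v\<in>cball x r. \<forall>b\<in>Basis. \<bar>differential c F u b - differential c F v b\<bar> \<le> D * norm (u - v))"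
proof -
  let ?K = "cball x r"
  obtain G where G: "G > 0" "\<And>w y. w \<in> ?K \<Longrightarrow> tangent_norm g c w y \<le> G * norm y"
    using tangent_norm_bound[OF c compact_cball K] by blast
  obtain B where B: "B > 0" "\<And>w y z. w \<in> ?K \<Longrightarrow> norm (christoffel g c w y z) \<le> B * norm y * norm z"
    using christoffel_bound[OF c compact_cball K] by blast
  \<comment> \<open>Short segments give the first entry: L0 times length times norm of
    \<open>b\<close>, each of the latter contributing a factor G, plus M times the displacement 2 B
    |v - u| of the transported vector. The second entry is for 4 B |v - u| > 1, where the crude
    bound 2 M is multiplied by this quantity.\<close>
  define D where "D = max (L0 * G * G + M * (2 * B)) (2 * M * (4 * B))"
  have D0: "D \<ge> 0" using M B by (simp add: D_def le_max_iff_disj)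
  have "\<bar>differential c F u b - differential c F v b\<bar> \<le> D * norm (u - v)"
    if F: "C1_fun F" and L: "differential_lipschitz A g F L" "L \<le> L0"
      and FM: "\<forall>u\<in>?K. (\<Sum>b\<in>Basis. \<bar>differential c F u b\<bar>) \<le> M"
      and uv: "u \<in> ?K" "v \<in> ?K" and b: "b \<in> Basis" for F L u v b
  proof (cases "4 * B * norm (v - u) \<le> 1")
    case True
    obtain W where W: "W 0 = b" "norm (W 1 - b) \<le> 2 * B * norm (v - u)"
      "\<And>t. t \<in> {0..1} \<Longrightarrow> (W has_vector_derivative - christoffel g c (seg u v t) (v - u) (W t)) (at t within {0..1})"
      using parallel_transport_line[OF c convex_cball K uv B(2,1) True, of b] b by auto
    have ucr: "u \<in> cran c" "v \<in> cran c" using uv K by auto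
    have d: "chart_line c u v 0 \<in> cdom c" "chart_line c u v 1 \<in> cdom c" using ucr c by simp_all
    note par = parallel_along_line[OF c convex_cball K uv W(3)]
    note len = curve_length_line[OF c convex_cball K uv G(2,1)]
    have "\<bar>differential c F (cmap c (chart_line c u v 1)) (jac c c (seg u v 1) (W 1))
        - differential c F (cmap c (chart_line c u v 0)) (jac c c (seg u v 0) (W 0))\<bar>
        \<le> L * curve_length A g (chart_line c u v)
          * tangent_norm g c (cmap c (chart_line c u v 0)) (jac c c (seg u v 0) (W 0))"
      using conjunct2[OF L(1)[unfolded differential_lipschitz_def], rule_format,
        OF conjI[OF C1_curve_line[OF c convex_cball K uv] par] c c conjI[OF d]] .
    then have "\<bar>differential c F v (W 1) - differential c F u b\<bar>
        \<le> L * curve_length A g (chart_line c u v) * tangent_norm g c u b"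
      by (simp add: jac_self c ucr W(1))
    also have "\<dots> \<le> L0 * (G * norm (v - u)) * (G * norm b)"
      using L L0 len G uv tangent_norm_nonneg[OF c ucr(1)]
      by (intro mult_mono) (auto simp: differential_lipschitz_def)
    finally have 1: "\<bar>differential c F v (W 1) - differential c F u b\<bar> \<le> L0 * G * G * norm (v - u)"
      using b by (simp add: mult_ac)
    have "\<bar>differential c F v (W 1) - differential c F v b\<bar> = norm (differential c F v (W 1 - b))"
      by (simp add: linear_diff[OF differential_linear[OF F c ucr(2)]])
    also have "\<dots> \<le> norm (W 1 - b) * (\<Sum>b\<in>Basis. norm (differential c F v b))"
      by (rule linear_norm_bound[OF differential_linear[OF F c ucr(2)]])
    also have "\<dots> \<le> (2 * B * norm (v - u)) * M"
      using FM uv W(2) B by (intro mult_mono) (auto intro: sum_nonneg)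
    finally have 2: "\<bar>differential c F v (W 1) - differential c F v b\<bar> \<le> M * (2 * B) * norm (v - u)" by (simp add: mult_ac)
    have "\<bar>differential c F u b - differential c F v b\<bar> \<le> (L0 * G * G + M * (2 * B)) * norm (v - u)"
      using 1 2 unfolding distrib_right by linarith
    also have "\<dots> \<le> D * norm (v - u)" by (rule mult_right_mono) (simp_all add: D_def)
    finally show ?thesis by (simp add: norm_minus_commute)
  next
    case False
    have le: "\<bar>differential c F w b\<bar> \<le> M" if "w \<in> ?K" for w
      using bspec[OF FM that] member_le_sum[of b Basis "\<lambda>b. \<bar>differential c F w b\<bar>"] b by simp
    have "\<bar>differential c F u b - differential c F v b\<bar> \<le> 2 * M * 1" using le[OF uv(1)] le[OF uv(2)] by linarith
    also have "\<dots> \<le> 2 * M * (4 * B * norm (v - u))" using False M by (intro mult_left_mono) auto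
    also have "\<dots> \<le> D * norm (v - u)" unfolding mult.assoc[symmetric] by (rule mult_right_mono) (simp_all add: D_def)
    finally show ?thesis by (simp add: norm_minus_commute)
  qed
  then show ?thesis using D0 by blast
qed

end

section \<open>Hamiltonians of class C^{1,1} are regular\<close>

locale hamiltonian_setting = symplectic_manifold A I \<omega> + riemannian_manifold A g
  for A :: "('m::t2_space, 'e::euclidean_space) chart set" and I \<omega> g
begin

text \<open>Points that are close in \<open>\<delta>\<close> lie in a common doubled ball, and the
  coordinate segment joining them has length at most G C \<delta>.\<close>

lemma dominated_riemannian_dist: "dominated (riemannian_dist A g)"
  unfolding dominated_def
proof (intro allI impI)
  fix \<epsilon> :: real assume \<epsilon>: "\<epsilon> > 0"
  define P where "P i C \<longleftrightarrow> (case i of (c, x, r) \<Rightarrow> \<forall>w\<in>cball x (2 * r). \<forall>y. tangent_norm g c w y \<le> C * norm y)"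
    for i :: "('m, 'e) chart \<times> 'e \<times> real" and C :: real
  have "\<exists>C>0. \<forall>i\<in>I. P i C"
  proof (rule finite_ex_bound[OF finite_I])
    fix i assume "i \<in> I"
    obtain c x r where i: "i = (c, x, r)" by (cases i)
    then have I: "(c, x, r) \<in> I" using \<open>i \<in> I\<close> by simp
    show "\<exists>C. P i C" unfolding P_def i using tangent_norm_bound[OF I_in(1)[OF I] compact_cball I_in(3)[OF I]] by auto
  next
    fix i C C' assume "P i C" "(C::real) \<le> C'"
    have "C * norm y \<le> C' * norm y" for y :: 'e using \<open>C \<le> C'\<close> by (rule mult_right_mono) simp
    then show "P i C'" using \<open>P i C\<close> unfolding P_def by (cases i) (simp only: prod.case, blast intro: order_trans)
  qed
  then obtain G where G: "G > 0" "\<And>c x r w y. (c, x, r) \<in> I \<Longrightarrow> w \<in> cball x (2 * r) \<Longrightarrow> tangent_norm g c w y \<le> G * norm y"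
    unfolding P_def by fast
  obtain C where C: "C > 0" "\<And>c x r p q. (c, x, r) \<in> I \<Longrightarrow> p \<in> cdom c \<Longrightarrow> cmap c p \<in> cball x r \<Longrightarrow> \<delta> p q < 1/2 \<Longrightarrow>
     q \<in> cdom c \<and> cmap c q \<in> cball x (2 * r) \<and> norm (cmap c q - cmap c p) \<le> C * \<delta> p q"
    using \<delta>_local by fast
  show "\<exists>\<eta>>0. \<forall>p q. \<delta> p q < \<eta> \<longrightarrow> riemannian_dist A g p q \<le> \<epsilon>"
  proof (intro exI[of _ "min (1/2) (\<epsilon> / (G * C))"] conjI allI impI)
    fix p q assume d: "\<delta> p q < min (1/2) (\<epsilon> / (G * C))"
    obtain c x r where i: "(c, x, r) \<in> I" "p \<in> cdom c" "cmap c p \<in> ball x r" using I_cover[of p] by blast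
    note c = I_in(1)[OF i(1)] and K = I_in(3)[OF i(1)]
    have p: "cmap c p \<in> cball x (2 * r)" "cmap c p \<in> cball x r" using i(3) I_in(2)[OF i(1)] by (simp_all add: less_imp_le)
    have q: "q \<in> cdom c" "cmap c q \<in> cball x (2 * r)" "norm (cmap c q - cmap c p) \<le> C * \<delta> p q"
      using C(2)[OF i(1,2) p(2), of q] d by auto
    have "riemannian_dist A g (cinv c (cmap c p)) (cinv c (cmap c q)) \<le> G * norm (cmap c q - cmap c p)"
      by (rule riemannian_dist_le[OF c convex_cball K p(1) q(2) G(2)[OF i(1)] G(1)])
    also have "\<dots> \<le> G * (C * \<delta> p q)" using q(3) G(1) by (intro mult_left_mono) auto
    also have "\<dots> \<le> \<epsilon>" using d G(1) C(1) by (simp add: pos_less_divide_eq mult_ac less_imp_le)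
    finally show "riemannian_dist A g p q \<le> \<epsilon>" using i(2) q(1) c by simp
  qed (use \<epsilon> G C in auto)
qed

text \<open>The infimum in \<open>C11_norm\<close> is not claimed to be attained; the slack 1 yields
  an actual Lipschitz constant, still bounded uniformly in time.\<close>

lemma C11_differential_lipschitz:
  assumes "C11_norm A g F \<le> ennreal C" "C > 0"
  shows "\<exists>L\<le>C + 1. differential_lipschitz A g F L"
proof -
  have "Inf (ennreal ` {L. differential_lipschitz A g F L}) \<le> C11_norm A g F"
    unfolding C11_norm_def by simp
  also have "\<dots> < ennreal (C + 1)"
    using assms by (simp add: le_less_trans[OF assms(1)] ennreal_less_iff)
  finally obtain L where "differential_lipschitz A g F L" "ennreal L < ennreal (C + 1)"
    unfolding Inf_less_iff by blast
  moreover from this have "L \<ge> 0" by (simp add: differential_lipschitz_def)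
  ultimately have "L < C + 1" using ennreal_less_iff by blast
  then show ?thesis using \<open>differential_lipschitz A g F L\<close> by (intro exI[of _ L]) simp
qed

text \<open>Differentiability in space comes from a local C^1 extension in time and space,
  restricted to the slice; continuity of the derivative is taken from
  \<open>continuous_differential\<close>.\<close>

lemma C1_fun_slice:
  assumes H: "C_hamiltonian 1 A H" and cd: "continuous_differential A H" and t: "t \<in> {0..1}"
  shows "C1_fun (H t)"
  unfolding C1_fun_iff
proof (intro ballI conjI allI)
  fix c v assume c: "c \<in> A"
  have "continuous_on ({0..1} \<times> cran c) (\<lambda>(t, u). differential c (H t) u v)"
    using cd c by (simp add: continuous_differential_def)
  then have "continuous_on (cran c) (\<lambda>u. (\<lambda>(t, u). differential c (H t) u v) (t, u))"
    by (rule continuous_on_compose2) (use t in \<open>auto intro!: continuous_intros\<close>)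
  then show "continuous_on (cran c) (\<lambda>u. differential c (H t) u v)" by simp
next
  fix c u assume c: "c \<in> A" and u: "u \<in> cran c"
  have C: "C_on 1 ({0..1} \<times> cran c) (\<lambda>(t, u). H t (cinv c u))" using H c by (simp add: C_hamiltonian_def)
  have "(t, u) \<in> {0..1} \<times> cran c" using t u by simp
  from bspec[OF C[unfolded C_on_def] this] obtain U h where
    U: "open U" "(t, u) \<in> U" "\<And>j. enat j \<le> 1 \<Longrightarrow> Ck_open j U h" "\<And>y. y \<in> U \<inter> ({0..1} \<times> cran c) \<Longrightarrow> h y = (\<lambda>(t, u). H t (cinv c u)) y"
    by blast
  have "Ck_open 1 U h" using U(3)[of 1] by (simp add: one_enat_def del: Ck_open.simps One_nat_def)
  then have "h differentiable at (t, u)" using U(2) by simp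
  then obtain D where D: "(h has_derivative D) (at (t, u))" by (auto simp: differentiable_def)
  have P: "((\<lambda>v. (t, v)) has_derivative (\<lambda>v. (0, v))) (at u)" by (auto intro!: derivative_eq_intros)
  have d: "((\<lambda>v. h (t, v)) has_derivative (\<lambda>v. D (0, v))) (at u)" by (rule has_derivative_compose[OF P D])
  have "open ((\<lambda>v. (t, v)) -` U \<inter> cran c)"
    by (intro open_Int open_vimage U open_cran[OF c] continuous_intros)
  from has_derivative_transform_within_open[OF d this]
  have "((H t \<circ> cinv c) has_derivative (\<lambda>v. D (0, v))) (at u)"
    using U(2,4) u t by auto
  then show "(H t \<circ> cinv c) differentiable at u" by (auto simp: differentiable_def)
qed

text \<open>The bound \<open>M\<close> on the differentials comes from compactness of the unit
  interval times the ball, the Lipschitz constants are at most C + 1; both are uniform in time, and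
  so is the resulting \<open>D\<close>.\<close>

lemma regular_C11:
  assumes H: "C_hamiltonian 1 A H" and cd: "continuous_differential A H" and C: "C > 0"
    and C11: "\<forall>t\<in>{0..1}. C11_norm A g (H t) \<le> ennreal C"
  shows "regular H"
  unfolding regular_def
proof (intro conjI ballI allI impI)
  show "C1_fun (H t)" if "t \<in> {0..1}" for t by (rule C1_fun_slice[OF H cd that])
  show cont: "continuous_on ({0..1} \<times> cran c) (\<lambda>(t, u). differential c (H t) u v)" if "c \<in> A" for c v
    using cd that by (simp add: continuous_differential_def)
  fix c x r assume c: "c \<in> A" and K: "cball x r \<subseteq> cran c"
  have cK: "continuous_on ({0..1} \<times> cball x r) (\<lambda>(t, u). differential c (H t) u b)" for b
    by (rule continuous_on_subset[OF cont[OF c]]) (use K in auto)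
  have "continuous_on ({0..1} \<times> cball x r) (\<lambda>p. \<Sum>b\<in>Basis. \<bar>(\<lambda>(t, u). differential c (H t) u b) p\<bar>)"
    by (intro continuous_on_sum continuous_on_rabs cK)
  from compact_continuous_bound[OF _ this] obtain M where
    M: "M > 0" "\<And>t u. t \<in> {0..1} \<Longrightarrow> u \<in> cball x r \<Longrightarrow> (\<Sum>b\<in>Basis. \<bar>differential c (H t) u b\<bar>) \<le> M"
    by (auto simp: compact_Times)
  obtain D where D: "D \<ge> 0" "\<And>F L. C1_fun F \<Longrightarrow> differential_lipschitz A g F L \<Longrightarrow> L \<le> C + 1 \<Longrightarrow>
    (\<forall>u\<in>cball x r. (\<Sum>b\<in>Basis. \<bar>differential c F u b\<bar>) \<le> M) \<Longrightarrow>
    (\<forall>u\<in>cball x r. \<forall>v\<in>cball x r. \<forall>b\<in>Basis. \<bar>differential c F u b - differential c F v b\<bar> \<le> D * norm (u - v))"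
    using coordinate_lipschitz[OF c K _ M(1), of "C + 1"] C by auto
  have "\<forall>u\<in>cball x r. \<forall>v\<in>cball x r. \<forall>b\<in>Basis. \<bar>differential c (H t) u b - differential c (H t) v b\<bar> \<le> D * norm (u - v)"
    if t: "t \<in> {0..1}" for t
  proof -
    obtain L where L: "L \<le> C + 1" "differential_lipschitz A g (H t) L"
      using C11_differential_lipschitz[OF bspec[OF C11 t] C] by blast
    show ?thesis by (rule D(2)[OF C1_fun_slice[OF H cd t] L(2,1)]) (use M(2)[OF t] in blast)
  qed
  then show "\<exists>L\<ge>0. \<forall>t\<in>{0..1}. \<forall>u\<in>cball x r. \<forall>v\<in>cball x r. \<forall>b\<in>Basis.
      \<bar>differential c (H t) u b - differential c (H t) v b\<bar> \<le> L * norm (u - v)" using D(1) by blast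
qed

end

section \<open>Smooth approximation in the C^1 topology\<close>

context covered_manifold
begin

lemma differential_eqI: "((f \<circ> cinv c) has_derivative D) (at u) \<Longrightarrow> differential c f u = D"
  unfolding differential_def using frechet_derivative_at by metis

lemma C1_fun_mult: "C1_fun f \<Longrightarrow> C1_fun g \<Longrightarrow> C1_fun (\<lambda>p. f p * g p)"
  unfolding C1_fun_def o_def by (intro ballI Ck_open_mult open_cran) simp_all

lemma differential_diff:
  assumes "C1_fun f" "C1_fun g" "c \<in> A" "u \<in> cran c"
  shows "differential c (\<lambda>p. f p - g p) u v = differential c f u v - differential c g u v"
proof -
  have "(((\<lambda>p. f p - g p) \<circ> cinv c) has_derivative (\<lambda>v. differential c f u v - differential c g u v)) (at u)"
    using has_derivative_diff[OF C1_fun_has_derivative[OF assms(1,3,4)] C1_fun_has_derivative[OF assms(2,3,4)]]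
    by (simp add: o_def)
  from differential_eqI[OF this] show ?thesis by simp
qed

lemma differential_sum:
  assumes "\<And>i. i \<in> J \<Longrightarrow> C1_fun (f i)" "c \<in> A" "u \<in> cran c"
  shows "differential c (\<lambda>p. \<Sum>i\<in>J. a i * f i p) u v = (\<Sum>i\<in>J. a i * differential c (f i) u v)"
proof -
  have "((\<lambda>u. \<Sum>i\<in>J. a i * (f i \<circ> cinv c) u) has_derivative (\<lambda>v. \<Sum>i\<in>J. a i * differential c (f i) u v)) (at u)"
    by (intro has_derivative_sum has_derivative_mult_right C1_fun_has_derivative assms)
  then have "(((\<lambda>p. \<Sum>i\<in>J. a i * f i p) \<circ> cinv c) has_derivative (\<lambda>v. \<Sum>i\<in>J. a i * differential c (f i) u v)) (at u)"
    by (simp add: o_def)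
  from differential_eqI[OF this] show ?thesis by simp
qed

lemma jac_bound:
  assumes c: "c \<in> A" "c' \<in> A" and Q: "compact Q" "Q \<subseteq> overlap c c'"
  shows "\<exists>T>0. \<forall>u\<in>Q. \<forall>b\<in>Basis. (\<Sum>a\<in>Basis. \<bar>jac c c' u b \<bullet> a\<bar>) \<le> T"
proof (rule exE)
  have s: "continuous_on (overlap c c') (\<lambda>u. jac c c' u b)" for b
    unfolding jac_def by (rule smooth_on_continuous_on[OF smooth_on_frechet_derivative[OF smooth_transition[OF c]]])
  have "continuous_on Q (\<lambda>u. \<Sum>b\<in>Basis. \<Sum>a\<in>Basis. \<bar>jac c c' u b \<bullet> a\<bar>)"
    by (intro continuous_intros continuous_on_subset[OF s Q(2)])
  from compact_continuous_bound[OF Q(1) this]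
  show "\<exists>T. T > 0 \<and> (\<forall>u\<in>Q. (\<Sum>b\<in>Basis. \<Sum>a\<in>Basis. \<bar>jac c c' u b \<bullet> a\<bar>) \<le> T)" by blast
  fix T assume T: "T > 0 \<and> (\<forall>u\<in>Q. (\<Sum>b\<in>Basis. \<Sum>a\<in>Basis. \<bar>jac c c' u b \<bullet> a\<bar>) \<le> T)"
  have "(\<Sum>a\<in>Basis. \<bar>jac c c' u b \<bullet> a\<bar>) \<le> T" if "u \<in> Q" "b \<in> Basis" for u b
    using member_le_sum[of b Basis "\<lambda>b. \<Sum>a\<in>Basis. \<bar>jac c c' u b \<bullet> a\<bar>"] T that
    by (force simp: sum_nonneg)
  then show "\<exists>T>0. \<forall>u\<in>Q. \<forall>b\<in>Basis. (\<Sum>a\<in>Basis. \<bar>jac c c' u b \<bullet> a\<bar>) \<le> T" using T by blast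
qed

text \<open>A function supported in \<open>K\<close> is seen from the other charts through Jacobians
  evaluated only where the point lies in the image of \<open>K\<close>. These points form compact
  sets, so the Jacobians are bounded there by a \<open>T\<close> that is independent of
  \<open>e\<close>; elsewhere the differential is 0.\<close>

lemma lift_differential_bound:
  assumes c: "c \<in> A" and K: "compact K" "K \<subseteq> cran c"
  shows "\<exists>T>0. \<forall>e \<theta>. Ck_open 1 (cran c) e \<longrightarrow> (\<forall>u\<in>cran c. u \<notin> K \<longrightarrow> e u = 0) \<longrightarrow>
    (\<forall>u\<in>K. \<forall>b\<in>Basis. \<bar>frechet_derivative e (at u) b\<bar> \<le> \<theta>) \<longrightarrow> 0 \<le> \<theta> \<longrightarrow>
    C1_fun (lift c e) \<and> (\<forall>(c', x', r')\<in>I. \<forall>u\<in>cball x' r'. \<forall>b\<in>Basis. \<bar>differential c' (lift c e) u b\<bar> \<le> T * \<theta>)"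
proof -
  \<comment> \<open>The part of the ball that corresponds to points in the image of
    \<open>K\<close>: closed in the ball, hence compact, and contained in the overlap with
    \<open>c\<close>.\<close>
  define Q where "Q i = (case i of (c', x', r') \<Rightarrow> cball x' r' \<inter> cinv c' -` (cinv c ` K))" for i :: "('m, 'e) chart \<times> 'e \<times> real"
  define P where "P i T \<longleftrightarrow> (\<forall>u\<in>Q i. \<forall>b\<in>Basis. (\<Sum>a\<in>Basis. \<bar>jac (fst i) c u b \<bullet> a\<bar>) \<le> T)"
    for i :: "('m, 'e) chart \<times> 'e \<times> real" and T :: real
  have "compact (cinv c ` K)"
    by (rule compact_continuous_image[OF continuous_on_subset[OF continuous_cinv[OF c]]]) (use K in auto)
  then have cK: "closed (cinv c ` K)" by (rule compact_imp_closed)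
  have "\<exists>T>0. \<forall>i\<in>I. P i T"
  proof (rule finite_ex_bound[OF finite_I])
    fix i assume "i \<in> I"
    obtain c' x' r' where i: "i = (c', x', r')" by (cases i)
    then have I: "(c', x', r') \<in> I" using \<open>i \<in> I\<close> by simp
    note c' = I_in(1)[OF I] and K' = I_in(4)[OF I]
    have "closed (cball x' r' \<inter> cinv c' -` (cinv c ` K))"
      by (rule continuous_closed_preimage[OF continuous_on_subset[OF continuous_cinv[OF c'] K'] closed_cball cK])
    then have "compact (cball x' r' \<inter> (cball x' r' \<inter> cinv c' -` (cinv c ` K)))" by (rule compact_Int_closed[OF compact_cball])
    then have Qc: "compact (Q i)" by (simp add: Q_def i)
    have Qo: "Q i \<subseteq> overlap c' c"
    proof
      fix u assume "u \<in> Q i"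
      then have u: "u \<in> cball x' r'" "cinv c' u \<in> cinv c ` K" by (auto simp: Q_def i)
      have "u \<in> cran c'" using u(1) K' by blast
      moreover have "cinv c' u \<in> cdom c" using u(2) K c by auto
      ultimately show "u \<in> overlap c' c" by (simp add: overlap_iff c')
    qed
    show "\<exists>T. P i T" unfolding P_def using jac_bound[OF c' c Qc Qo] by (auto simp: i)
  next
    fix i T T' assume "P i T" "(T::real) \<le> T'"
    then show "P i T'" unfolding P_def by (blast intro: order_trans)
  qed
  then obtain T where T: "T > 0" "\<And>i. i \<in> I \<Longrightarrow> P i T" by blast
  have "C1_fun (lift c e) \<and> (\<forall>(c', x', r')\<in>I. \<forall>u\<in>cball x' r'. \<forall>b\<in>Basis. \<bar>differential c' (lift c e) u b\<bar> \<le> T * \<theta>)"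
    if e: "Ck_open 1 (cran c) e" and e0: "\<forall>u\<in>cran c. u \<notin> K \<longrightarrow> e u = 0"
      and b: "\<forall>u\<in>K. \<forall>b\<in>Basis. \<bar>frechet_derivative e (at u) b\<bar> \<le> \<theta>" and \<theta>: "0 \<le> \<theta>" for e \<theta>
  proof -
    have C1: "C1_fun (lift c e)"
      unfolding C1_fun_def
    proof
      fix c' assume "c' \<in> A"
      then show "Ck_open 1 (cran c') (lift c e \<circ> cinv c')"
        by (intro Ck_open_lift[OF c K _ e]) (use e0 in blast)
    qed
    have "\<bar>differential c' (lift c e) u b\<bar> \<le> T * \<theta>" if I: "(c', x', r') \<in> I" and u: "u \<in> cball x' r'" and bB: "b \<in> Basis" for c' x' r' u b
    proof -
      note c' = I_in(1)[OF I] and K' = I_in(4)[OF I]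
      have uc: "u \<in> cran c'" using u K' by blast
      let ?p = "cinv c' u"
      have p: "?p \<in> cdom c'" "cmap c' ?p = u" using uc c' by simp_all
      show ?thesis
      proof (cases "?p \<in> cinv c ` K")
        case True
        then have pc: "?p \<in> cdom c" using K c by auto
        have wK: "cmap c ?p \<in> K" using True K c by auto
        let ?w = "cmap c ?p"
        have wc: "?w \<in> cran c" using wK K by blast
        have uQ: "u \<in> Q (c', x', r')" using u True by (simp add: Q_def)
        have "((lift c e \<circ> cinv c) has_derivative frechet_derivative e (at ?w)) (at ?w)"
        proof (rule has_derivative_transform_within_open[OF _ open_cran[OF c] wc])
          show "(e has_derivative frechet_derivative e (at ?w)) (at ?w)"
            using Ck_open_SucD[of 0 "cran c" e ?w] e wc by simp
        qed (use c in \<open>simp add: lift_def\<close>)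
        then have D: "differential c (lift c e) ?w = frechet_derivative e (at ?w)" by (rule differential_eqI)
        have "differential c' (lift c e) u b = frechet_derivative e (at ?w) (jac c' c u b)"
          using differential_transform[OF C1 c' c p(1) pc, of b] p(2) D by simp
        also have "\<dots> = (\<Sum>a\<in>Basis. (jac c' c u b \<bullet> a) * frechet_derivative e (at ?w) a)"
          using linear_Basis_expand[OF differential_linear[OF C1 c wc], of "jac c' c u b"] D by simp
        also have "\<bar>\<dots>\<bar> \<le> (\<Sum>a\<in>Basis. \<bar>jac c' c u b \<bullet> a\<bar> * \<theta>)"
          by (rule order_trans[OF sum_abs sum_mono]) (use b wK in \<open>auto simp: abs_mult intro!: mult_left_mono\<close>)
        also have "\<dots> = (\<Sum>a\<in>Basis. \<bar>jac c' c u b \<bullet> a\<bar>) * \<theta>" by (simp add: sum_distrib_right)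
        also have "\<dots> \<le> T * \<theta>" using T(2)[OF I] uQ bB \<theta> unfolding P_def by (intro mult_right_mono) auto
        finally show ?thesis .
      next
        case False
        have o: "open (cran c' \<inter> cinv c' -` (- cinv c ` K))"
          by (rule open_cran_preimage[OF c']) (use cK in auto)
        have "((lift c e \<circ> cinv c') has_derivative (\<lambda>v. 0)) (at u)"
        proof (rule has_derivative_transform_within_open[OF has_derivative_const o])
          show "u \<in> cran c' \<inter> cinv c' -` (- cinv c ` K)" using uc False by simp
          fix y assume "y \<in> cran c' \<inter> cinv c' -` (- cinv c ` K)"
          then show "0 = (lift c e \<circ> cinv c') y" using lift_outside(2)[OF c K, of e] e0 by auto
        qed
        then have "differential c' (lift c e) u = (\<lambda>v. 0)" by (rule differential_eqI)
        then show ?thesis using T(1) \<theta> by simp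
      qed
    qed
    then show ?thesis using C1 by blast
  qed
  then show ?thesis using T(1) by blast
qed

section \<open>Approximation by means of a partition of unity\<close>

definition partition :: "('m, 'e) chart \<times> 'e \<times> real \<Rightarrow> 'm \<Rightarrow> real" where
  "partition i p = \<beta> i p * inverse (\<Sum>j\<in>I. \<beta> j p)"

lemma \<beta>_nonneg: "0 \<le> \<beta> i p"
  by (cases i) (simp add: \<beta>_def lift_def bump_range)

lemma sum_\<beta>_pos: "(\<Sum>j\<in>I. \<beta> j p) > 0"
proof -
  obtain c x r where i: "(c, x, r) \<in> I" "p \<in> cdom c" "cmap c p \<in> ball x r" using I_cover[of p] by blast
  have "\<beta> (c, x, r) p = 1" using \<beta>_eq_1[OF i(1,2)] i(3) by simp
  moreover have "\<beta> (c, x, r) p \<le> (\<Sum>j\<in>I. \<beta> j p)"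
    by (rule member_le_sum) (use i finite_I \<beta>_nonneg in auto)
  ultimately show ?thesis by simp
qed

lemma smooth_partition: "i \<in> I \<Longrightarrow> smooth_fun (partition i)"
  unfolding partition_def[abs_def]
  by (intro smooth_fun_mult smooth_fun_inverse smooth_fun_sum smooth_\<beta> sum_\<beta>_pos)

lemma sum_partition: "(\<Sum>i\<in>I. partition i p) = 1"
  using sum_\<beta>_pos[of p] by (simp add: partition_def sum_distrib_right[symmetric])

text \<open>The error \<open>h - partition i * F\<close> is supported in a compact part of the chart, where the transition
  maps to the other charts have bounded derivatives.\<close>

lemma C1_approximation_local:
  assumes F: "C1_fun F" and i: "(c, x, r) \<in> I"
  shows "\<exists>T>0. \<forall>\<epsilon>>0. \<exists>h. smooth_fun h \<and> C1_fun (\<lambda>p. h p - partition (c, x, r) p * F p) \<and>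
    (\<forall>p. \<bar>h p - partition (c, x, r) p * F p\<bar> \<le> \<epsilon>) \<and>
    (\<forall>(c', x', r')\<in>I. \<forall>u\<in>cball x' r'. \<forall>b\<in>Basis.
      \<bar>differential c' (\<lambda>p. h p - partition (c, x, r) p * F p) u b\<bar> \<le> T * \<epsilon>)"
proof -
  note c = I_in(1)[OF i] and r = I_in(2)[OF i] and K = I_in(3)[OF i]
  let ?K = "cball x (2 * r)"
  let ?\<rho>F = "\<lambda>p. partition (c, x, r) p * F p"
  define f where "f u = (if u \<in> cran c then ?\<rho>F (cinv c u) else 0)" for u
  \<comment> \<open>Equal to 1 up to radius sqrt 3 * r, thus on the support of the bump function,
    and to 0 from radius 2 * r on. Multiplying the mollified function by it restores a support
    inside the chart without disturbing \<open>f\<close>.\<close>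
  define \<kappa> where "\<kappa> u = smooth_step (4 - ((u - x) \<bullet> (u - x)) * inverse (r\<^sup>2))" for u
  have \<kappa>s: "smooth_on UNIV \<kappa>"
    unfolding \<kappa>_def[abs_def]
    by (rule smooth_on_compose[OF _ _ smooth_smooth_step]) (auto intro!: smooth_intros)
  have \<kappa>0: "\<kappa> u = 0" if "u \<notin> ?K" for u
  proof -
    have "norm (u - x) \<ge> 2 * r" using that by (simp add: dist_norm norm_minus_commute)
    then have "(norm (u - x))\<^sup>2 \<ge> (2 * r)\<^sup>2" using r by (intro power_mono) auto
    then have "4 * r\<^sup>2 \<le> (u - x) \<bullet> (u - x)" by (simp add: power2_norm_eq_inner power_mult_distrib)
    then have "((u - x) \<bullet> (u - x)) * inverse (r\<^sup>2) \<ge> 4" using r by (simp add: divide_inverse[symmetric] le_divide_eq)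
    then show ?thesis by (simp add: \<kappa>_def smooth_step_simps)
  qed
  have b0: "bump x r u = 0" if "\<kappa> u \<noteq> 1" for u
  proof -
    have "((u - x) \<bullet> (u - x)) * inverse (r\<^sup>2) > 3"
    proof (rule ccontr)
      assume "\<not> ?thesis"
      then have "\<kappa> u = 1" unfolding \<kappa>_def by (intro smooth_step_simps) simp
      then show False using that by simp
    qed
    then show ?thesis by (simp add: bump_def smooth_step_simps)
  qed
  have \<rho>0: "partition (c, x, r) p = 0" if "p \<in> cdom c \<Longrightarrow> \<kappa> (cmap c p) \<noteq> 1" for p
    using that b0[of "cmap c p"] by (auto simp: partition_def \<beta>_def lift_def)
  have f0: "f u = 0" if "\<kappa> u \<noteq> 1" for u
    using that \<rho>0[of "cinv c u"] c by (simp add: f_def)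
  have \<kappa>f: "\<kappa> u * f u = f u" for u using f0[of u] by (cases "\<kappa> u = 1") auto
  have fK: "f u = 0" if "u \<notin> ?K" for u using f0[of u] \<kappa>0[OF that] by simp
  have lf: "lift c f p = ?\<rho>F p" for p
    using \<rho>0[of p] c by (auto simp: lift_def f_def)
  have \<rho>F: "C1_fun ?\<rho>F" by (intro C1_fun_mult smooth_fun_imp_C1 smooth_partition i F)
  \<comment> \<open>The extension by zero is C^1 beyond the range of the chart, since
    \<open>f\<close> vanishes on the complement of the doubled ball, which is open.\<close>
  have fC1: "Ck_open 1 UNIV f"
  proof (rule Ck_open_locally)
    fix u :: 'e
    show "\<exists>U. open U \<and> u \<in> U \<and> Ck_open 1 U f"
    proof (cases "u \<in> cran c")
      case True
      have "Ck_open 1 (cran c) (?\<rho>F \<circ> cinv c)" using \<rho>F c unfolding C1_fun_def by blast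
      then have "Ck_open 1 (cran c) f"
        using Ck_open_cong[OF open_cran[OF c], of f "?\<rho>F \<circ> cinv c" 1] by (simp add: f_def del: Ck_open.simps One_nat_def)
      then show ?thesis using True open_cran[OF c] by blast
    next
      case False
      then have u: "u \<in> - ?K" using K by blast
      have "Ck_open 1 (- ?K) f"
        using Ck_open_cong[of "- ?K" f "\<lambda>_. 0" 1] Ck_open_const[of "- ?K" 1 "0::real"] fK
        by (simp add: open_Compl closed_cball del: Ck_open.simps One_nat_def)
      then show ?thesis using u by (intro exI[of _ "- ?K"]) (auto simp: open_Compl)
    qed
  qed
  have fD: "(f has_derivative frechet_derivative f (at u)) (at u)" for u
    using Ck_open_SucD[of 0 UNIV f u] fC1 by simp
  have fDc: "continuous_on UNIV (\<lambda>u. frechet_derivative f (at u) v)" for v using fC1 by simp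
  have fR: "f u = 0" if "norm u \<ge> norm x + 2 * r + 1" for u
  proof (rule fK)
    show "u \<notin> ?K" using that norm_triangle_ineq2[of u x] r by (auto simp: dist_norm norm_minus_commute)
  qed
  have \<kappa>1: "Ck_open 1 UNIV \<kappa>" using \<kappa>s unfolding smooth_on_def by blast
  have "continuous_on ?K (\<lambda>u. \<bar>\<kappa> u\<bar> + (\<Sum>b\<in>Basis. \<bar>frechet_derivative \<kappa> (at u) b\<bar>))"
    using \<kappa>1 by (intro continuous_intros continuous_on_subset[OF smooth_on_continuous_on[OF \<kappa>s]]
       continuous_on_subset[OF smooth_on_continuous_on[OF smooth_on_frechet_derivative[OF \<kappa>s]]]) auto
  from compact_continuous_bound[OF compact_cball this]
  obtain M where M: "M > 0" "\<And>u. u \<in> ?K \<Longrightarrow> \<bar>\<kappa> u\<bar> + (\<Sum>b\<in>Basis. \<bar>frechet_derivative \<kappa> (at u) b\<bar>) \<le> M" by blast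
  obtain T where T: "T > 0" "\<And>e \<theta>. Ck_open 1 (cran c) e \<Longrightarrow> (\<forall>u\<in>cran c. u \<notin> ?K \<longrightarrow> e u = 0) \<Longrightarrow>
    (\<forall>u\<in>?K. \<forall>b\<in>Basis. \<bar>frechet_derivative e (at u) b\<bar> \<le> \<theta>) \<Longrightarrow> 0 \<le> \<theta> \<Longrightarrow>
    C1_fun (lift c e) \<and> (\<forall>(c', x', r')\<in>I. \<forall>u\<in>cball x' r'. \<forall>b\<in>Basis. \<bar>differential c' (lift c e) u b\<bar> \<le> T * \<theta>)"
    using lift_differential_bound[OF c compact_cball K] by blast
  have "\<exists>h. smooth_fun h \<and> C1_fun (\<lambda>p. h p - ?\<rho>F p) \<and> (\<forall>p. \<bar>h p - ?\<rho>F p\<bar> \<le> \<epsilon>) \<and>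
    (\<forall>(c', x', r')\<in>I. \<forall>u\<in>cball x' r'. \<forall>b\<in>Basis. \<bar>differential c' (\<lambda>p. h p - ?\<rho>F p) u b\<bar> \<le> (T * (2 * M)) * \<epsilon>)"
    if \<epsilon>: "\<epsilon> > 0" for \<epsilon>
  proof -
    obtain k where k: "smooth_on UNIV k" "\<And>u. \<bar>k u - f u\<bar> < \<epsilon>"
      "\<And>u b. b \<in> Basis \<Longrightarrow> \<bar>frechet_derivative k (at u) b - frechet_derivative f (at u) b\<bar> < \<epsilon>"
      using smooth_C1_approximation[of f "\<lambda>u. frechet_derivative f (at u)", OF fD fDc fR \<epsilon>] by blast
    \<comment> \<open>Since \<kappa> f = f, this is the error in coordinates. By the product rule
      its derivatives are at most 2 M \<epsilon>, with \<open>M\<close> bounding \<kappa> and its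
      derivatives.\<close>
    define e where "e u = \<kappa> u * (k u - f u)" for u
    define h where "h = lift c (\<lambda>u. \<kappa> u * k u)"
    have k1: "Ck_open 1 UNIV k" using k(1) unfolding smooth_on_def by blast
    have "Ck_open 1 UNIV e" unfolding e_def[abs_def] by (intro Ck_open_mult Ck_open_diff \<kappa>1 k1 fC1 open_UNIV)
    then have e1: "Ck_open 1 (cran c) e" by (rule Ck_open_subset[OF subset_UNIV])
    have eK: "\<forall>u\<in>cran c. u \<notin> ?K \<longrightarrow> e u = 0" by (simp add: e_def \<kappa>0)
    have eD: "\<bar>frechet_derivative e (at u) b\<bar> \<le> 2 * M * \<epsilon>" if u: "u \<in> ?K" and b: "b \<in> Basis" for u b
    proof -
      let ?k = "frechet_derivative k (at u) b" and ?f = "frechet_derivative f (at u) b" and ?\<kappa> = "frechet_derivative \<kappa> (at u) b"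
      have "(e has_derivative (\<lambda>v. \<kappa> u * (frechet_derivative k (at u) v - frechet_derivative f (at u) v)
           + frechet_derivative \<kappa> (at u) v * (k u - f u))) (at u)"
        unfolding e_def[abs_def]
        by (intro has_derivative_mult has_derivative_diff fD smooth_on_has_derivative[OF \<kappa>s UNIV_I] smooth_on_has_derivative[OF k(1) UNIV_I])
      from frechet_derivative_at[OF this]
      have "frechet_derivative e (at u) b = \<kappa> u * (?k - ?f) + ?\<kappa> * (k u - f u)" by (rule fun_cong[OF sym])
      also have "\<bar>\<dots>\<bar> \<le> \<bar>\<kappa> u\<bar> * \<bar>?k - ?f\<bar> + \<bar>?\<kappa>\<bar> * \<bar>k u - f u\<bar>" by (metis abs_mult abs_triangle_ineq)
      also have "\<dots> \<le> M * \<epsilon> + M * \<epsilon>"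
      proof (intro add_mono mult_mono)
        have s: "\<bar>?\<kappa>\<bar> \<le> (\<Sum>b\<in>Basis. \<bar>frechet_derivative \<kappa> (at u) b\<bar>)" by (rule member_le_sum) (use b in auto)
        show "\<bar>\<kappa> u\<bar> \<le> M" using M(2)[OF u] s by linarith
        show "\<bar>?\<kappa>\<bar> \<le> M" using M(2)[OF u] s by linarith
      qed (use k(2)[of u] k(3)[OF b, of u] M(1) in auto)
      finally show ?thesis by simp
    qed
    have "0 \<le> 2 * M * \<epsilon>" using M(1) \<epsilon> by simp
    note le = T(2)[OF e1 eK _ this]
    have hs: "smooth_fun h"
      unfolding h_def
      by (rule smooth_fun_lift[OF c compact_cball K])
        (simp_all add: \<kappa>0 smooth_on_mult open_cran[OF c] smooth_on_subset[OF \<kappa>s] smooth_on_subset[OF k(1)])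
    have eq: "(\<lambda>p. h p - ?\<rho>F p) = lift c e"
    proof
      fix p show "h p - ?\<rho>F p = lift c e p"
        unfolding lf[symmetric] using \<kappa>f[of "cmap c p"] by (auto simp: h_def lift_def e_def right_diff_distrib)
    qed
    have "\<bar>e u\<bar> \<le> \<epsilon>" for u
    proof -
      have "\<bar>e u\<bar> = \<bar>\<kappa> u\<bar> * \<bar>k u - f u\<bar>" by (simp add: e_def abs_mult)
      also have "\<dots> \<le> 1 * \<epsilon>" by (intro mult_mono) (use k(2)[of u] smooth_step_range in \<open>auto simp: \<kappa>_def\<close>)
      finally show ?thesis by simp
    qed
    then have "\<bar>lift c e p\<bar> \<le> \<epsilon>" for p using \<epsilon> by (simp add: lift_def)
    then show ?thesis using hs le eD unfolding eq[symmetric] mult.assoc by blast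
  qed
  then show ?thesis using T(1) M(1) by (intro exI[of _ "T * (2 * M)"]) simp
qed

lemma C1_approximation:
  assumes F: "C1_fun F" and \<epsilon>: "\<epsilon> > 0"
  shows "\<exists>h. smooth_fun h \<and> (\<forall>p. \<bar>h p - F p\<bar> \<le> \<epsilon>) \<and>
    (\<forall>(c, x, r)\<in>I. \<forall>u\<in>cball x r. \<forall>b\<in>Basis. \<bar>differential c h u b - differential c F u b\<bar> \<le> \<epsilon>)"
proof -
  let ?e = "\<lambda>i h p. h p - partition i p * F p"
  have "\<forall>i\<in>I. \<exists>T>0. \<forall>\<epsilon>>0. \<exists>h. smooth_fun h \<and> C1_fun (?e i h) \<and> (\<forall>p. \<bar>?e i h p\<bar> \<le> \<epsilon>) \<and>
    (\<forall>(c', x', r')\<in>I. \<forall>u\<in>cball x' r'. \<forall>b\<in>Basis. \<bar>differential c' (?e i h) u b\<bar> \<le> T * \<epsilon>)"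
    using C1_approximation_local[OF F] by (auto simp: split_paired_all)
  from bchoice[OF this] obtain T where T: "\<And>i. i \<in> I \<Longrightarrow> T i > 0" "\<And>i \<epsilon>. i \<in> I \<Longrightarrow> \<epsilon> > 0 \<Longrightarrow> \<exists>h. smooth_fun h \<and> C1_fun (?e i h) \<and> (\<forall>p. \<bar>?e i h p\<bar> \<le> \<epsilon>) \<and>
    (\<forall>(c', x', r')\<in>I. \<forall>u\<in>cball x' r'. \<forall>b\<in>Basis. \<bar>differential c' (?e i h) u b\<bar> \<le> T i * \<epsilon>)"
    by blast
  \<comment> \<open>The sum of the \<open>T i\<close> pays for the differentials, the number of
    pieces for the values, and 1 ensures positivity.\<close>
  define S where "S = (\<Sum>i\<in>I. T i) + real (card I) + 1"
  have S: "S > 0" using T(1) by (simp add: S_def sum_nonneg less_imp_le add_nonneg_pos)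
  define \<epsilon>' where "\<epsilon>' = \<epsilon> / S"
  have \<epsilon>': "\<epsilon>' > 0" using \<epsilon> S by (simp add: \<epsilon>'_def)
  obtain h where h: "\<And>i. i \<in> I \<Longrightarrow> smooth_fun (h i)" "\<And>i. i \<in> I \<Longrightarrow> C1_fun (?e i (h i))" "\<And>i p. i \<in> I \<Longrightarrow> \<bar>?e i (h i) p\<bar> \<le> \<epsilon>'"
    "\<And>i c' x' r' u b. i \<in> I \<Longrightarrow> (c', x', r') \<in> I \<Longrightarrow> u \<in> cball x' r' \<Longrightarrow> b \<in> Basis \<Longrightarrow> \<bar>differential c' (?e i (h i)) u b\<bar> \<le> T i * \<epsilon>'"
  proof -
    have "\<forall>i\<in>I. \<exists>h. smooth_fun h \<and> C1_fun (?e i h) \<and> (\<forall>p. \<bar>?e i h p\<bar> \<le> \<epsilon>') \<and>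
    (\<forall>(c', x', r')\<in>I. \<forall>u\<in>cball x' r'. \<forall>b\<in>Basis. \<bar>differential c' (?e i h) u b\<bar> \<le> T i * \<epsilon>')" using T(2) \<epsilon>' by blast
    from bchoice[OF this] obtain h where "\<forall>i\<in>I. smooth_fun (h i) \<and> C1_fun (?e i (h i)) \<and> (\<forall>p. \<bar>?e i (h i) p\<bar> \<le> \<epsilon>') \<and>
    (\<forall>(c', x', r')\<in>I. \<forall>u\<in>cball x' r'. \<forall>b\<in>Basis. \<bar>differential c' (?e i (h i)) u b\<bar> \<le> T i * \<epsilon>')" ..
    then show ?thesis by (intro that[of h]) blast+
  qed
  let ?h = "\<lambda>p. \<Sum>i\<in>I. h i p"
  have hs: "smooth_fun ?h" by (intro smooth_fun_sum h(1))
  have eq: "?h p - F p = (\<Sum>i\<in>I. ?e i (h i) p)" for p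
  proof -
    have "(\<Sum>i\<in>I. partition i p * F p) = F p" by (simp add: sum_distrib_right[symmetric] sum_partition)
    then show ?thesis by (simp add: sum_subtractf)
  qed
  have "\<bar>?h p - F p\<bar> \<le> \<epsilon>" for p
  proof -
    have "\<bar>?h p - F p\<bar> \<le> (\<Sum>i\<in>I. \<epsilon>')" unfolding eq by (rule order_trans[OF sum_abs sum_mono]) (rule h(3))
    also have "\<dots> = real (card I) * \<epsilon>'" by simp
    also have "\<dots> \<le> S * \<epsilon>'" using \<epsilon>' T(1) by (intro mult_right_mono) (auto simp: S_def sum_nonneg less_imp_le)
    also have "\<dots> = \<epsilon>" using S by (simp add: \<epsilon>'_def)
    finally show ?thesis .
  qed
  moreover have "\<bar>differential c ?h u b - differential c F u b\<bar> \<le> \<epsilon>" if I: "(c, x, r) \<in> I" and u: "u \<in> cball x r" and b: "b \<in> Basis" for c x r u b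
  proof -
    note c = I_in(1)[OF I]
    have uc: "u \<in> cran c" using u I_in(4)[OF I] by blast
    have "differential c ?h u b - differential c F u b = differential c (\<lambda>p. ?h p - F p) u b"
      by (rule differential_diff[OF smooth_fun_imp_C1[OF hs] F c uc, symmetric])
    also have "(\<lambda>p. ?h p - F p) = (\<lambda>p. \<Sum>i\<in>I. 1 * ?e i (h i) p)" by (rule ext) (simp add: eq)
    also have "differential c \<dots> u b = (\<Sum>i\<in>I. 1 * differential c (?e i (h i)) u b)"
      by (rule differential_sum[OF h(2) c uc])
    also have "\<bar>\<dots>\<bar> \<le> (\<Sum>i\<in>I. T i * \<epsilon>')"
      by (rule order_trans[OF sum_abs sum_mono]) (use h(4)[OF _ I u b] in simp)
    also have "\<dots> \<le> S * \<epsilon>'" unfolding sum_distrib_right[symmetric] using \<epsilon>' by (intro mult_right_mono) (auto simp: S_def)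
    also have "\<dots> = \<epsilon>" using S by (simp add: \<epsilon>'_def)
    finally show ?thesis .
  qed
  ultimately show ?thesis using hs by blast
qed

end

section \<open>Interpolation in time by normalized smooth Hamiltonians\<close>

lemma C_on_continuous: "C_on k S f \<Longrightarrow> continuous_on S f"
  unfolding continuous_on_eq_continuous_within
proof
  fix x assume f: "C_on k S f" and x: "x \<in> S"
  from bspec[OF f[unfolded C_on_def] x] obtain U h where
    U: "open U" "x \<in> U" "\<And>j. enat j \<le> k \<Longrightarrow> Ck_open j U h" "\<And>y. y \<in> U \<inter> S \<Longrightarrow> h y = f y" by blast
  have "Ck_open 0 U h" by (rule U(3)) (simp add: zero_enat_def[symmetric])
  then have "continuous_on U h" by simp
  then have "isCont h x" using U continuous_on_eq_continuous_at by blast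
  then have h: "continuous (at x within S) h" by (rule continuous_at_imp_continuous_at_within)
  obtain d where d: "d > 0" "ball x d \<subseteq> U" using U open_contains_ball by blast
  show "continuous (at x within S) f"
  proof (rule continuous_transform_within[OF h d(1) x])
    fix x' assume "x' \<in> S" "dist x' x < d"
    then have "x' \<in> U \<inter> S" using d(2) by (auto simp: dist_commute)
    then show "h x' = f x'" by (rule U(4))
  qed
qed

lemma uniform_in_time:
  fixes f :: "real \<Rightarrow> 'a::metric_space \<Rightarrow> real"
  assumes f: "continuous_on ({0..1} \<times> K) (\<lambda>(t, u). f t u)" and K: "compact K" and \<epsilon>: "\<epsilon> > 0"
  shows "\<exists>\<eta>>0. \<forall>s\<in>{0..1}. \<forall>t\<in>{0..1}. \<bar>s - t\<bar> < \<eta> \<longrightarrow> (\<forall>u\<in>K. \<bar>f s u - f t u\<bar> \<le> \<epsilon>)"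
proof -
  have "uniformly_continuous_on ({0..1} \<times> K) (\<lambda>(t, u). f t u)"
    by (rule compact_uniformly_continuous[OF f]) (simp add: compact_Times K)
  from uniformly_continuous_onE[OF this \<epsilon>]
  obtain \<eta> where \<eta>: "\<eta> > 0" "\<And>p q. p \<in> {0..1} \<times> K \<Longrightarrow> q \<in> {0..1} \<times> K \<Longrightarrow> dist q p < \<eta> \<Longrightarrow>
      dist ((\<lambda>(t, u). f t u) q) ((\<lambda>(t, u). f t u) p) < \<epsilon>" by metis
  have "\<bar>f s u - f t u\<bar> \<le> \<epsilon>" if "s \<in> {0..1}" "t \<in> {0..1}" "\<bar>s - t\<bar> < \<eta>" "u \<in> K" for s t u
    using \<eta>(2)[of "(t, u)" "(s, u)"] that by (simp add: dist_Pair_Pair dist_real_def)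
  then show ?thesis using \<eta>(1) by blast
qed

text \<open>The difference of two shifted copies of the step, so that the sum over k telescopes to
  1; for positive N, each summand is supported within 1/N of its node k/N.\<close>

definition time_bump :: "nat \<Rightarrow> nat \<Rightarrow> real \<Rightarrow> real" where
  "time_bump N k t = smooth_step (real N * t - real k + 1) - smooth_step (real N * t - real k)"

lemma time_bump_nonneg: "0 \<le> time_bump N k t"
  using smooth_step_mono[of "real N * t - real k" "real N * t - real k + 1"] by (simp add: time_bump_def)

lemma time_bump_le_1: "time_bump N k t \<le> 1"
  using smooth_step_range[of "real N * t - real k + 1"] smooth_step_range[of "real N * t - real k"] by (simp add: time_bump_def)

lemma sum_time_bump:
  assumes t: "t \<in> {0..1}"
  shows "(\<Sum>k\<le>N. time_bump N k t) = 1"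
proof -
  have "time_bump N k t = smooth_step (real N * t - real k + 1) - smooth_step (real N * t - real (Suc k) + 1)" for k
    by (simp add: time_bump_def)
  then have "(\<Sum>k\<le>N. time_bump N k t) = smooth_step (real N * t + 1) - smooth_step (real N * t - real N)"
    using sum_telescope[of "\<lambda>k. smooth_step (real N * t - real k + 1)" N] by simp
  also have "smooth_step (real N * t + 1) = 1" using t by (intro smooth_step_simps) simp
  also have "smooth_step (real N * t - real N) = 0" using t by (intro smooth_step_simps) (simp add: mult_left_le)
  finally show ?thesis by simp
qed

lemma time_bump_support:
  assumes "time_bump N k t \<noteq> 0" "N > 0"
  shows "\<bar>t - real k / real N\<bar> < 1 / real N"
proof -
  have "\<not> real N * t - real k + 1 \<le> 0"
  proof
    assume "real N * t - real k + 1 \<le> 0"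
    then show False using assms by (simp add: time_bump_def smooth_step_simps)
  qed
  moreover have "\<not> real N * t - real k \<ge> 1"
  proof
    assume "real N * t - real k \<ge> 1"
    then show False using assms by (simp add: time_bump_def smooth_step_simps)
  qed
  ultimately have "\<bar>real N * t - real k\<bar> < 1" by linarith
  also have "real N * t - real k = real N * (t - real k / real N)" using assms(2) by (simp add: right_diff_distrib)
  finally show ?thesis using assms(2) by (simp add: abs_mult pos_less_divide_eq mult.commute)
qed

lemma smooth_time_bump: "smooth_on UNIV (time_bump N k)"
  unfolding time_bump_def[abs_def]
  by (intro smooth_intros open_UNIV smooth_on_compose[OF _ _ smooth_smooth_step]) auto

text \<open>The restriction makes the result extensional, as elements of
  \<open>normalized_smooth\<close> have to be.\<close>

definition interp :: "nat \<Rightarrow> (nat \<Rightarrow> 'a \<Rightarrow> real) \<Rightarrow> real \<Rightarrow> 'a \<Rightarrow> real" where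
  "interp N h = restrict (\<lambda>t p. \<Sum>k\<le>N. time_bump N k t * h k p) {0..1}"

lemma interp_eq: "t \<in> {0..1} \<Longrightarrow> interp N h t = (\<lambda>p. \<Sum>k\<le>N. time_bump N k t * h k p)"
  by (simp add: interp_def)

text \<open>The left-hand sum is a convex combination in which only nodes within 1/N of
  \<open>t\<close> have nonzero weight.\<close>

lemma time_average_bound:
  assumes t: "t \<in> {0..1}" and N: "N > 0"
    and e: "\<And>k. k \<le> N \<Longrightarrow> \<bar>t - real k / real N\<bar> < 1 / real N \<Longrightarrow> \<bar>x k - y\<bar> \<le> \<epsilon>"
  shows "\<bar>(\<Sum>k\<le>N. time_bump N k t * x k) - y\<bar> \<le> \<epsilon>"
proof -
  have "(\<Sum>k\<le>N. time_bump N k t * x k) - y = (\<Sum>k\<le>N. time_bump N k t * (x k - y))"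
    using sum_time_bump[OF t, of N] by (simp add: right_diff_distrib sum_subtractf sum_distrib_right[symmetric])
  also have "\<bar>\<dots>\<bar> \<le> (\<Sum>k\<le>N. time_bump N k t * \<epsilon>)"
  proof (rule order_trans[OF sum_abs sum_mono])
    fix k assume "k \<in> {..N}"
    then show "\<bar>time_bump N k t * (x k - y)\<bar> \<le> time_bump N k t * \<epsilon>"
      using e[of k] time_bump_support[OF _ N, of k t] time_bump_nonneg[of N k t]
      by (cases "time_bump N k t = 0") (auto simp: abs_mult intro!: mult_left_mono)
  qed
  also have "\<dots> = \<epsilon>" using sum_time_bump[OF t, of N] by (simp add: sum_distrib_right[symmetric])
  finally show ?thesis .
qed

context symplectic_manifold
begin

lemma differential_interp:
  assumes "\<And>k. smooth_fun (h k)" "t \<in> {0..1}" "c \<in> A" "u \<in> cran c"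
  shows "differential c (interp N h t) u v = (\<Sum>k\<le>N. time_bump N k t * differential c (h k) u v)"
  unfolding interp_eq[OF assms(2)] by (rule differential_sum[OF smooth_fun_imp_C1[OF assms(1)] assms(3,4)])

lemma smooth_interp: "(\<And>k. smooth_fun (h k)) \<Longrightarrow> t \<in> {0..1} \<Longrightarrow> smooth_fun (interp N h t)"
  unfolding interp_eq by (intro smooth_fun_sum smooth_fun_mult smooth_fun_const)

lemma regular_interp:
  assumes h: "\<And>k. smooth_fun (h k)"
  shows "regular (interp N h)"
  unfolding regular_def
proof (intro conjI ballI allI impI)
  show "C1_fun (interp N h t)" if "t \<in> {0..1}" for t
    by (rule smooth_fun_imp_C1[OF smooth_interp[OF h that]])
  have dc: "smooth_on (cran c) (\<lambda>u. differential c (h k) u v)" if "c \<in> A" for c k v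
    unfolding differential_def using h[of k] that by (auto simp: smooth_fun_def intro!: smooth_on_frechet_derivative)
  show "continuous_on ({0..1} \<times> cran c) (\<lambda>(t, u). differential c (interp N h t) u v)" if c: "c \<in> A" for c v
  proof -
    have "continuous_on ({0..1} \<times> cran c) (\<lambda>p. \<Sum>k\<le>N. time_bump N k (fst p) * differential c (h k) (snd p) v)"
      by (intro continuous_intros continuous_on_compose2[OF smooth_on_continuous_on[OF smooth_time_bump]]
          continuous_on_compose2[OF smooth_on_continuous_on[OF dc[OF c]]]) auto
    then show ?thesis by (rule continuous_on_eq) (auto simp: differential_interp[OF h _ c])
  qed
  fix c x r assume c: "c \<in> A" and K: "cball x r \<subseteq> cran c"
  have "\<exists>L\<ge>0. \<forall>u\<in>cball x r. \<forall>v\<in>cball x r. \<bar>differential c (h k) u b - differential c (h k) v b\<bar> \<le> L * norm (u - v)" for k b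
  proof -
    have "Ck_open 1 (cran c) (\<lambda>u. differential c (h k) u b)" using dc[OF c] unfolding smooth_on_def by blast
    from C1_lipschitz[OF this compact_cball convex_cball K] show ?thesis .
  qed
  then obtain L where L: "\<And>k b. L k b \<ge> 0" "\<And>k b u v. u \<in> cball x r \<Longrightarrow> v \<in> cball x r \<Longrightarrow>
      \<bar>differential c (h k) u b - differential c (h k) v b\<bar> \<le> L k b * norm (u - v)" by metis
  define L' where "L' = (\<Sum>k\<le>N. \<Sum>b\<in>Basis. L k b)"
  have "\<bar>differential c (interp N h t) u b - differential c (interp N h t) v b\<bar> \<le> L' * norm (u - v)"
    if t: "t \<in> {0..1}" and uv: "u \<in> cball x r" "v \<in> cball x r" and b: "b \<in> Basis" for t u v b
  proof -
    have uvc: "u \<in> cran c" "v \<in> cran c" using uv K by auto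
    have "differential c (interp N h t) u b - differential c (interp N h t) v b
       = (\<Sum>k\<le>N. time_bump N k t * (differential c (h k) u b - differential c (h k) v b))"
      unfolding differential_interp[OF h t c uvc(1)] differential_interp[OF h t c uvc(2)]
      by (simp add: sum_subtractf right_diff_distrib)
    also have "\<bar>\<dots>\<bar> \<le> (\<Sum>k\<le>N. (\<Sum>b\<in>Basis. L k b) * norm (u - v))"
    proof (rule order_trans[OF sum_abs sum_mono])
      fix k
      have "\<bar>time_bump N k t * (differential c (h k) u b - differential c (h k) v b)\<bar> \<le> 1 * (L k b * norm (u - v))"
        unfolding abs_mult using time_bump_nonneg[of N k t] time_bump_le_1[of N k t] L(2)[OF uv] by (intro mult_mono) auto
      also have "\<dots> \<le> (\<Sum>b\<in>Basis. L k b) * norm (u - v)"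
        using member_le_sum[of b Basis "L k"] b L(1) by (auto intro!: mult_right_mono)
      finally show "\<bar>time_bump N k t * (differential c (h k) u b - differential c (h k) v b)\<bar> \<le> (\<Sum>b\<in>Basis. L k b) * norm (u - v)" .
    qed
    finally show ?thesis by (simp add: L'_def sum_distrib_right)
  qed
  moreover have "L' \<ge> 0" by (simp add: L'_def sum_nonneg L(1))
  ultimately show "\<exists>L\<ge>0. \<forall>t\<in>{0..1}. \<forall>u\<in>cball x r. \<forall>v\<in>cball x r. \<forall>b\<in>Basis.
      \<bar>differential c (interp N h t) u b - differential c (interp N h t) v b\<bar> \<le> L * norm (u - v)" by blast
qed

lemma interp_C_hamiltonian:
  assumes h: "\<And>k. smooth_fun (h k)"
  shows "C_hamiltonian \<infinity> A (interp N h)"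
  unfolding C_hamiltonian_def C_on_def
proof (intro ballI)
  fix c and z :: "real \<times> 'e" assume c: "c \<in> A" and z: "z \<in> {0..1} \<times> cran c"
  let ?U = "UNIV \<times> cran c :: (real \<times> 'e) set"
  \<comment> \<open>Without the restriction to the unit interval the formula is smooth for all real
    times; this is the extension demanded by \<open>C_on\<close>.\<close>
  let ?H = "\<lambda>z. \<Sum>k\<le>N. time_bump N k (fst z) * (h k \<circ> cinv c) (snd z)"
  have o: "open ?U" by (intro open_Times open_UNIV open_cran c)
  have "smooth_on ?U ?H"
  proof (intro smooth_intros o)
    fix k
    show "smooth_on ?U (\<lambda>z. time_bump N k (fst z))"
      by (rule smooth_on_compose[OF o open_UNIV smooth_time_bump smooth_on_linear[OF bounded_linear_fst o]]) simp
    have "smooth_on (cran c) (h k \<circ> cinv c)" using h c by (simp add: smooth_fun_def)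
    then show "smooth_on ?U (\<lambda>z. (h k \<circ> cinv c) (snd z))"
      by (rule smooth_on_compose[OF o open_cran[OF c] _ smooth_on_linear[OF bounded_linear_snd o]]) auto
  qed
  then have "\<forall>j. enat j \<le> \<infinity> \<longrightarrow> Ck_open j ?U ?H" by (simp add: smooth_on_def)
  moreover have "\<forall>y\<in>?U \<inter> {0..1} \<times> cran c. ?H y = (\<lambda>(t, u). interp N h t (cinv c u)) y"
    by (auto simp: interp_eq)
  ultimately show "\<exists>U H. open U \<and> z \<in> U \<and> (\<forall>j. enat j \<le> \<infinity> \<longrightarrow> Ck_open j U H) \<and>
      (\<forall>y\<in>U \<inter> {0..1} \<times> cran c. H y = (\<lambda>(t, u). interp N h t (cinv c u)) y)"
    using o z by (intro exI[of _ ?U] exI[of _ ?H]) auto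
qed

lemma interp_approximation:
  assumes H: "regular H" and C1: "C_hamiltonian 1 A H" and \<epsilon>: "\<epsilon> > 0"
  shows "\<exists>N h. (\<forall>k. smooth_fun (h k)) \<and> (\<forall>t\<in>{0..1}. \<forall>p. \<bar>interp N h t p - H t p\<bar> \<le> \<epsilon>) \<and> close_on \<epsilon> H (interp N h)"
proof -
  define \<epsilon>' where "\<epsilon>' = \<epsilon> / 2"
  have \<epsilon>': "\<epsilon>' > 0" using \<epsilon> by (simp add: \<epsilon>'_def)
  define P where "P i \<eta> \<longleftrightarrow> (case i of (c, x, r) \<Rightarrow> \<forall>s\<in>{0..1}. \<forall>t\<in>{0..1}. \<bar>s - t\<bar> < \<eta> \<longrightarrow>
     (\<forall>u\<in>cball x r. \<bar>H s (cinv c u) - H t (cinv c u)\<bar> \<le> \<epsilon>' \<and>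
       (\<forall>b\<in>Basis. \<bar>differential c (H s) u b - differential c (H t) u b\<bar> \<le> \<epsilon>')))"
    for i :: "('m, 'e) chart \<times> 'e \<times> real" and \<eta> :: real
  have "\<exists>\<eta>>0. \<forall>i\<in>I. P i \<eta>"
  proof (rule finite_ex_pos[OF finite_I])
    fix i assume "i \<in> I"
    obtain c x r where i: "i = (c, x, r)" by (cases i)
    then have I: "(c, x, r) \<in> I" using \<open>i \<in> I\<close> by simp
    note c = I_in(1)[OF I] and K = I_in(4)[OF I]
    have sub: "{0..1::real} \<times> cball x r \<subseteq> {0..1} \<times> cran c" using K by auto
    have "continuous_on ({0..1} \<times> cran c) (\<lambda>(t, u). H t (cinv c u))"
      using C1 c C_on_continuous unfolding C_hamiltonian_def by blast
    from uniform_in_time[OF continuous_on_subset[OF this sub] compact_cball \<epsilon>']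
    obtain \<eta>1 where \<eta>1: "\<eta>1 > 0" "\<forall>s\<in>{0..1}. \<forall>t\<in>{0..1}. \<bar>s - t\<bar> < \<eta>1 \<longrightarrow> (\<forall>u\<in>cball x r. \<bar>H s (cinv c u) - H t (cinv c u)\<bar> \<le> \<epsilon>')"
      by blast
    have "\<exists>\<eta>>0. \<forall>b\<in>Basis. \<forall>s\<in>{0..1}. \<forall>t\<in>{0..1}. \<bar>s - t\<bar> < \<eta> \<longrightarrow> (\<forall>u\<in>cball x r. \<bar>differential c (H s) u b - differential c (H t) u b\<bar> \<le> \<epsilon>')"
    proof (rule finite_ex_pos[OF finite_Basis])
      fix b :: 'e
      show "\<exists>\<eta>>0. \<forall>s\<in>{0..1}. \<forall>t\<in>{0..1}. \<bar>s - t\<bar> < \<eta> \<longrightarrow> (\<forall>u\<in>cball x r. \<bar>differential c (H s) u b - differential c (H t) u b\<bar> \<le> \<epsilon>')"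
        by (rule uniform_in_time[OF continuous_on_subset[OF regular_continuous[OF H c] sub] compact_cball \<epsilon>'])
    qed auto
    then obtain \<eta>2 where \<eta>2: "\<eta>2 > 0" "\<forall>b\<in>Basis. \<forall>s\<in>{0..1}. \<forall>t\<in>{0..1}. \<bar>s - t\<bar> < \<eta>2 \<longrightarrow> (\<forall>u\<in>cball x r. \<bar>differential c (H s) u b - differential c (H t) u b\<bar> \<le> \<epsilon>')"
      by blast
    have "P i (min \<eta>1 \<eta>2)" unfolding P_def i prod.case using \<eta>1(2) \<eta>2(2) by simp
    then show "\<exists>\<eta>>0. P i \<eta>" using \<eta>1(1) \<eta>2(1) by (intro exI[of _ "min \<eta>1 \<eta>2"]) simp
  next
    fix i \<eta> \<eta>' assume "P i \<eta>" "(0::real) < \<eta>'" "\<eta>' \<le> \<eta>"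
    then show "P i \<eta>'" unfolding P_def by (cases i) simp
  qed
  then obtain \<eta> where \<eta>: "\<eta> > 0" "\<And>i. i \<in> I \<Longrightarrow> P i \<eta>" by blast
  have near_val: "\<bar>H s p - H t p\<bar> \<le> \<epsilon>'" if "s \<in> {0..1}" "t \<in> {0..1}" "\<bar>s - t\<bar> < \<eta>" for s t p
  proof -
    obtain c x r where i: "(c, x, r) \<in> I" "p \<in> cdom c" "cmap c p \<in> ball x r" using I_cover[of p] by blast
    have u: "cmap c p \<in> cball x r" "cinv c (cmap c p) = p" using i I_in(1)[OF i(1)] by simp_all
    have "\<bar>H s (cinv c (cmap c p)) - H t (cinv c (cmap c p))\<bar> \<le> \<epsilon>'"
      using \<eta>(2)[OF i(1)] that u(1) unfolding P_def prod.case by blast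
    then show ?thesis using u(2) by simp
  qed
  have near_diff: "\<bar>differential c (H s) u b - differential c (H t) u b\<bar> \<le> \<epsilon>'"
    if "s \<in> {0..1}" "t \<in> {0..1}" "\<bar>s - t\<bar> < \<eta>" "(c, x, r) \<in> I" "u \<in> cball x r" "b \<in> Basis" for s t c x r u b
    using \<eta>(2)[OF that(4)] that unfolding P_def prod.case by blast
  obtain N0 :: nat where N0: "inverse (real (Suc N0)) < \<eta>" using reals_Archimedean[OF \<eta>(1)] by blast
  define N where "N = Suc N0"
  have N: "N > 0" "1 / real N < \<eta>" using N0 by (simp_all add: N_def inverse_eq_divide)
  have node: "real k / real N \<in> {0..1}" if "k \<le> N" for k using that N(1) by simp
  have "\<forall>k. \<exists>h. smooth_fun h \<and> (k \<le> N \<longrightarrow> (\<forall>p. \<bar>h p - H (real k / real N) p\<bar> \<le> \<epsilon>') \<and>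
    (\<forall>(c, x, r)\<in>I. \<forall>u\<in>cball x r. \<forall>b\<in>Basis. \<bar>differential c h u b - differential c (H (real k / real N)) u b\<bar> \<le> \<epsilon>'))"
  proof
    fix k
    show "\<exists>h. smooth_fun h \<and> (k \<le> N \<longrightarrow> (\<forall>p. \<bar>h p - H (real k / real N) p\<bar> \<le> \<epsilon>') \<and>
    (\<forall>(c, x, r)\<in>I. \<forall>u\<in>cball x r. \<forall>b\<in>Basis. \<bar>differential c h u b - differential c (H (real k / real N)) u b\<bar> \<le> \<epsilon>'))"
    proof (cases "k \<le> N")
      case True
      from C1_approximation[OF regular_C1[OF H node[OF True]] \<epsilon>'] show ?thesis by blast
    next
      case False
      \<comment> \<open>Beyond the last node any smooth function will do; it only makes the sequence
        \<open>h\<close> total.\<close>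
      then show ?thesis using smooth_fun_const[of 0] by blast
    qed
  qed
  then obtain h where h: "\<And>k. smooth_fun (h k)" "\<And>k p. k \<le> N \<Longrightarrow> \<bar>h k p - H (real k / real N) p\<bar> \<le> \<epsilon>'"
    "\<And>k c x r u b. k \<le> N \<Longrightarrow> (c, x, r) \<in> I \<Longrightarrow> u \<in> cball x r \<Longrightarrow> b \<in> Basis \<Longrightarrow>
       \<bar>differential c (h k) u b - differential c (H (real k / real N)) u b\<bar> \<le> \<epsilon>'"
    unfolding choice_iff by fast
  have "\<bar>interp N h t p - H t p\<bar> \<le> \<epsilon>" if t: "t \<in> {0..1}" for t p
    unfolding interp_eq[OF t]
  proof (rule time_average_bound[OF t N(1)])
    fix k assume k: "k \<le> N" "\<bar>t - real k / real N\<bar> < 1 / real N"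
    have "\<bar>H t p - H (real k / real N) p\<bar> \<le> \<epsilon>'" using k N(2) by (intro near_val t node) auto
    then show "\<bar>h k p - H t p\<bar> \<le> \<epsilon>" using h(2)[OF k(1), of p] unfolding \<epsilon>'_def by linarith
  qed
  moreover have "close_on \<epsilon> H (interp N h)"
    unfolding close_on_def
  proof (intro ballI, unfold split_paired_all prod.case, intro ballI)
    fix t c x r u b assume t: "t \<in> {0..1::real}" and I: "(c, x, r) \<in> I" and u: "u \<in> cball x r" and b: "b \<in> (Basis::'e set)"
    have uc: "u \<in> cran c" using u I_in(4)[OF I] by blast
    have "\<bar>differential c (interp N h t) u b - differential c (H t) u b\<bar> \<le> \<epsilon>"
      unfolding differential_interp[OF h(1) t I_in(1)[OF I] uc]
    proof (rule time_average_bound[OF t N(1)])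
      fix k assume k: "k \<le> N" "\<bar>t - real k / real N\<bar> < 1 / real N"
      have "\<bar>differential c (H t) u b - differential c (H (real k / real N)) u b\<bar> \<le> \<epsilon>'"
        using k N(2) by (intro near_diff[OF t node _ I u b]) auto
      then show "\<bar>differential c (h k) u b - differential c (H t) u b\<bar> \<le> \<epsilon>" using h(3)[OF k(1) I u b] unfolding \<epsilon>'_def by linarith
    qed
    then show "\<bar>differential c (H t) u b - differential c (interp N h t) u b\<bar> \<le> \<epsilon>" by (simp add: abs_minus_commute)
  qed
  ultimately show ?thesis using h(1) by blast
qed

section \<open>Finiteness of the Liouville measure and normalization\<close>

lemma finite_liouville:
  assumes \<mu>: "liouville_measure n A \<omega> \<mu>"
  shows "finite_measure \<mu>" "sets \<mu> = sets borel" "space \<mu> = UNIV"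
proof -
  show s: "sets \<mu> = sets borel" using \<mu> by (simp add: liouville_measure_def)
  show sp: "space \<mu> = UNIV" using sets_eq_imp_space_eq[OF s] by simp
  define B where "B = (\<lambda>(c::('m, 'e) chart, x, r). cdom c \<inter> cmap c -` ball x r)"
  have "emeasure \<mu> (B i) < \<infinity> \<and> B i \<in> sets \<mu>" if "i \<in> I" for i
  proof -
    obtain c x r where i: "i = (c, x, r)" by (cases i)
    then have I: "(c, x, r) \<in> I" using \<open>i \<in> I\<close> by simp
    note c = I_in(1)[OF I] and K = I_in(4)[OF I]
    have "open (B i)" unfolding B_def i prod.case by (rule open_cdom_preimage[OF c open_ball])
    then have Bb: "B i \<in> sets borel" by simp
    \<comment> \<open>The density is the absolute value of a polynomial in the components of
      \<omega>, hence bounded on each closed ball of the cover; finitely many balls of finite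
      measure exhaust the manifold.\<close>
    have "continuous_on (cran c) (liouville_density n \<omega> c)"
      unfolding liouville_density_def[abs_def] wedge_power_form_def
      by (intro continuous_intros tensor_continuous[OF smooth_\<omega> c])
    from compact_continuous_bound[OF compact_cball continuous_on_subset[OF this K]]
    obtain M where M: "M > 0" "\<And>u. u \<in> cball x r \<Longrightarrow> liouville_density n \<omega> c u \<le> M" by blast
    have "B i \<subseteq> cdom c" by (auto simp: B_def i)
    then have "emeasure \<mu> (B i) = (\<integral>\<^sup>+ u\<in>cmap c ` B i. ennreal (liouville_density n \<omega> c u) \<partial>lborel)"
      using \<mu> c Bb unfolding liouville_measure_def by blast
    also have "\<dots> \<le> (\<integral>\<^sup>+ u. ennreal M * indicator (cball x r) u \<partial>lborel)"
    proof (rule nn_integral_mono)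
      fix u
      show "ennreal (liouville_density n \<omega> c u) * indicator (cmap c ` B i) u \<le> ennreal M * indicator (cball x r) u"
      proof (cases "u \<in> cmap c ` B i")
        case True
        then have "u \<in> cball x r" by (auto simp: B_def i)
        then show ?thesis using M(2)[of u] True by (simp add: ennreal_leI)
      qed simp
    qed
    also have "\<dots> = ennreal M * emeasure lborel (cball x r)" by (simp add: nn_integral_cmult_indicator)
    also have "\<dots> < \<infinity>" using emeasure_bounded_finite[OF bounded_cball, of x r] by (simp add: ennreal_mult_less_top)
    finally show ?thesis using Bb s by simp
  qed
  then have fin: "emeasure \<mu> (B i) < \<infinity>" "B i \<in> sets \<mu>" if "i \<in> I" for i using that by blast+
  have "p \<in> (\<Union>i\<in>I. B i)" for p
  proof -
    obtain c x r where "(c, x, r) \<in> I" "p \<in> cdom c" "cmap c p \<in> ball x r" using I_cover[of p] by blast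
    then show ?thesis by (intro UN_I[of "(c, x, r)"]) (simp_all add: B_def)
  qed
  then have "(\<Union>i\<in>I. B i) = UNIV" by blast
  moreover have "emeasure \<mu> (\<Union>i\<in>I. B i) \<le> (\<Sum>i\<in>I. emeasure \<mu> (B i))"
    by (rule emeasure_subadditive_finite[OF finite_I]) (use fin in auto)
  moreover have "(\<Sum>i\<in>I. emeasure \<mu> (B i)) < \<infinity>" using fin(1) finite_I by (simp add: ennreal_sum_less_top)
  ultimately have "emeasure \<mu> (space \<mu>) < \<infinity>" using sp by simp
  then show "finite_measure \<mu>" by (intro finite_measureI) simp
qed

lemma integrable_smooth:
  assumes \<mu>: "liouville_measure n A \<omega> \<mu>" and f: "smooth_fun f"
  shows "integrable \<mu> f"
proof -
  interpret finite_measure \<mu> by (rule finite_liouville[OF \<mu>])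
  have c: "continuous_on UNIV f" by (rule C1_fun_continuous[OF smooth_fun_imp_C1[OF f]])
  have "bounded (f ` UNIV)" by (rule compact_imp_bounded[OF compact_continuous_image[OF c compact_UNIV]])
  then obtain B where B: "\<And>x. norm (f x) \<le> B" unfolding bounded_iff by auto
  have "f \<in> borel_measurable \<mu>"
    using borel_measurable_continuous_onI[OF c] measurable_cong_sets[OF finite_liouville(2)[OF \<mu>] refl] by blast
  then show ?thesis by (rule integrable_const_bound[rotated]) (use B in auto)
qed

text \<open>Only finiteness of the measure is used: if it vanishes, so do all integrals.\<close>

lemma normalizing_constant:
  assumes \<mu>: "liouville_measure n A \<omega> \<mu>" and f: "smooth_fun f"
  shows "\<exists>a. (LINT x|\<mu>. f x - a) = 0"
proof -
  interpret finite_measure \<mu> by (rule finite_liouville[OF \<mu>])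
  show ?thesis
  proof (cases "measure \<mu> (space \<mu>) = 0")
    case True
    then have "emeasure \<mu> (space \<mu>) = 0" by (simp add: emeasure_eq_measure)
    then have "AE x in \<mu>. f x - 0 = 0" by (intro AE_I[of _ _ "space \<mu>"]) auto
    from integral_eq_zero_AE[OF this] show ?thesis by blast
  next
    case False
    have "(LINT x|\<mu>. f x - (LINT x|\<mu>. f x) / measure \<mu> (space \<mu>)) = 0"
      using False integrable_smooth[OF \<mu> f] by (subst Bochner_Integration.integral_diff) auto
    then show ?thesis by blast
  qed
qed

lemma normalized_approximation:
  assumes \<mu>: "liouville_measure n A \<omega> \<mu>" and H: "regular H" and C1: "C_hamiltonian 1 A H" and \<epsilon>: "\<epsilon> > 0"
  shows "\<exists>K\<in>normalized_smooth A \<mu>. regular K \<and> close_on \<epsilon> H K \<and> (\<exists>a. \<forall>t\<in>{0..1}. \<forall>p. \<bar>K t p - H t p - a t\<bar> \<le> \<epsilon>)"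
proof -
  obtain N h where h: "\<And>k. smooth_fun (h k)" "\<And>t p. t \<in> {0..1} \<Longrightarrow> \<bar>interp N h t p - H t p\<bar> \<le> \<epsilon>" "close_on \<epsilon> H (interp N h)"
    using interp_approximation[OF H C1 \<epsilon>] by blast
  obtain a where a: "\<And>k. (LINT x|\<mu>. h k x - a k) = 0" using normalizing_constant[OF \<mu> h(1)] by metis
  \<comment> \<open>The functions at the nodes are normalized, rather than their interpolation: a
    combination of functions with integral 0 has integral 0 at every time, and smoothness in time is
    kept automatically.\<close>
  define h' where "h' k p = h k p - a k" for k p
  have h's: "smooth_fun (h' k)" for k unfolding h'_def[abs_def] by (intro smooth_fun_diff h(1) smooth_fun_const)
  let ?K = "interp N h'"
  have K: "?K t p = interp N h t p - (\<Sum>k\<le>N. time_bump N k t * a k)" if "t \<in> {0..1}" for t p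
    using that by (simp add: interp_eq h'_def right_diff_distrib sum_subtractf)
  have "differential c (h' k) u v = differential c (h k) u v" if "c \<in> A" "u \<in> cran c" for c k u v
  proof -
    have "((\<lambda>p. a k) \<circ> cinv c has_derivative (\<lambda>v. 0)) (at u)" by (simp add: o_def)
    from differential_eqI[OF this] have "differential c (\<lambda>p. a k) u v = 0" by simp
    then show ?thesis unfolding h'_def[abs_def]
      using differential_diff[OF smooth_fun_imp_C1[OF h(1)] smooth_fun_imp_C1[OF smooth_fun_const] that] by simp
  qed
  then have "differential c (?K t) u v = differential c (interp N h t) u v" if "t \<in> {0..1}" "c \<in> A" "u \<in> cran c" for t c u v
    using that by (simp add: differential_interp[OF h's] differential_interp[OF h(1)])
  then have "close_on \<epsilon> H ?K"
    using h(3) I_in(1,4) unfolding close_on_def by (fastforce simp: subset_eq)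
  moreover have "\<forall>t\<in>{0..1}. \<forall>p. \<bar>?K t p - H t p - (- (\<Sum>k\<le>N. time_bump N k t * a k))\<bar> \<le> \<epsilon>"
    using h(2) by (simp add: K)
  moreover have "?K \<in> normalized_smooth A \<mu>"
  proof -
    have "(LINT x|\<mu>. ?K t x) = 0" if t: "t \<in> {0..1}" for t
    proof -
      have "(LINT x|\<mu>. ?K t x) = (\<Sum>k\<le>N. LINT x|\<mu>. time_bump N k t * h' k x)"
        unfolding interp_eq[OF t]
        by (rule Bochner_Integration.integral_sum) (simp add: integrable_smooth[OF \<mu> h's])
      also have "\<dots> = 0" using a by (simp add: h'_def)
      finally show ?thesis .
    qed
    moreover have "?K \<in> extensional {0..1}" by (simp add: interp_def)
    ultimately show ?thesis using interp_C_hamiltonian[OF h's] by (simp add: normalized_smooth_def)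
  qed
  ultimately show ?thesis
    by (intro bexI[of _ ?K] conjI exI[of _ "\<lambda>t. - (\<Sum>k\<le>N. time_bump N k t * a k)"] regular_interp[OF h's])
qed

end

section \<open>Oscillation and completion\<close>

definition osc :: "('a \<Rightarrow> real) \<Rightarrow> real" where
  "osc f = (SUP x. f x) - (INF x. f x)"

text \<open>In differences of values additive constants cancel, which later disposes of the unknown
  function of time by which the approximants deviate from \<open>H\<close>.\<close>

lemma osc_le:
  assumes "\<And>p q. f p - f q \<le> b"
  shows "osc f \<le> b"
proof -
  have "f p \<le> b + (INF x. f x)" for p
  proof -
    have "f p - b \<le> (INF x. f x)"
    proof (rule cINF_greatest)
      show "f p - b \<le> f q" for q using assms[of p q] by linarith
    qed simp
    then show ?thesis by linarith
  qed
  then have "(SUP x. f x) \<le> b + (INF x. f x)" by (intro cSUP_least) auto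
  then show ?thesis by (simp add: osc_def)
qed

lemma osc_ge:
  assumes "bounded (range f)"
  shows "f p - f q \<le> osc f"
proof -
  have "f p \<le> (SUP x. f x)" by (intro cSUP_upper bounded_imp_bdd_above assms) simp
  moreover have "(INF x. f x) \<le> f q" by (intro cINF_lower bounded_imp_bdd_below assms) simp
  ultimately show ?thesis by (simp add: osc_def)
qed

lemma osc_perturb:
  assumes "bounded (range g)" "\<And>p. \<bar>f p - g p\<bar> \<le> e"
  shows "osc f \<le> osc g + 2 * e"
proof (rule osc_le)
  fix p q
  show "f p - f q \<le> osc g + 2 * e" using osc_ge[OF assms(1), of p q] assms(2)[of p] assms(2)[of q] by linarith
qed

lemma osc_triangle:
  assumes "bounded (range f)" "bounded (range g)"
  shows "osc (\<lambda>x. f x + g x) \<le> osc f + osc g"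
proof (rule osc_le)
  fix p q show "f p + g p - (f q + g q) \<le> osc f + osc g"
    using osc_ge[OF assms(1), of p q] osc_ge[OF assms(2), of p q] by linarith
qed

lemma osc_swap:
  assumes "bounded (range (\<lambda>x. f x - g x))"
  shows "osc (\<lambda>x. g x - f x) \<le> osc (\<lambda>x. f x - g x)"
proof (rule osc_le)
  fix p q show "g p - f p - (g q - f q) \<le> osc (\<lambda>x. f x - g x)" using osc_ge[OF assms, of q p] by linarith
qed

text \<open>Provides the integrability in time on which monotonicity and additivity of the integral
  in \<open>ham_dist\<close> depend. By compactness of the manifold, a small change of time changes
  all values at once by little, and \<open>osc_perturb\<close> applies.\<close>

lemma osc_continuous:
  fixes D :: "real \<Rightarrow> 'a::topological_space \<Rightarrow> real"
  assumes K: "compact (UNIV :: 'a set)" and D: "continuous_on ({0..1} \<times> UNIV) (\<lambda>(t, p). D t p)"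
  shows "t \<in> {0..1} \<Longrightarrow> bounded (range (D t))" "continuous_on {0..1} (\<lambda>t. osc (D t))"
proof -
  show b: "bounded (range (D t))" if t: "t \<in> {0..1}" for t
  proof -
    have "continuous_on UNIV (\<lambda>p. (\<lambda>(t, p). D t p) (t, p))"
      by (rule continuous_on_compose2[OF D]) (use t in \<open>auto intro!: continuous_intros\<close>)
    then show ?thesis using compact_imp_bounded[OF compact_continuous_image[OF _ K]] by simp
  qed
  show "continuous_on {0..1} (\<lambda>t. osc (D t))"
    unfolding continuous_on_def
  proof (intro ballI tendstoI)
    fix t :: real and e :: real assume t: "t \<in> {0..1}" and e: "e > 0"
    obtain T where T: "t \<in> T" "open T" "\<forall>s\<in>T \<inter> {0..1}. \<forall>p\<in>UNIV. dist ((\<lambda>(t, p). D t p) (s, p)) ((\<lambda>(t, p). D t p) (t, p)) \<le> e / 3"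
      using continuous_on_prod_compactE[OF D K t, of "e / 3"] e by auto
    have "\<forall>\<^sub>F s in at t within {0..1}. s \<in> T \<inter> {0..1}"
      using T(1,2) by (auto simp: eventually_at_topological)
    then show "\<forall>\<^sub>F s in at t within {0..1}. dist (osc (D s)) (osc (D t)) < e"
    proof eventually_elim
      fix s assume s: "s \<in> T \<inter> {0..1}"
      have c: "\<bar>D s p - D t p\<bar> \<le> e / 3" "\<bar>D t p - D s p\<bar> \<le> e / 3" for p
        using bspec[OF bspec[OF T(3) s] UNIV_I[of p]] by (auto simp: dist_real_def abs_minus_commute)
      have "osc (D s) \<le> osc (D t) + 2 * (e / 3)" by (rule osc_perturb[OF b[OF t] c(1)])
      moreover have "osc (D t) \<le> osc (D s) + 2 * (e / 3)" by (rule osc_perturb[OF b c(2)]) (use s in simp)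
      ultimately show "dist (osc (D s)) (osc (D t)) < e" using e by (simp add: dist_real_def abs_less_iff)
    qed
  qed
qed

text \<open>The definite description in \<open>completion_dist\<close> ranges over all
  representatives of both classes. The limit exists and is the same for all of them, so that chosen
  representatives compute the distance.\<close>

lemma completion_dist_limit:
  fixes d :: "'a \<Rightarrow> 'a \<Rightarrow> real"
  assumes sym: "\<And>x y. x \<in> X \<Longrightarrow> y \<in> X \<Longrightarrow> d x y = d y x"
    and tri: "\<And>x y z. x \<in> X \<Longrightarrow> y \<in> X \<Longrightarrow> z \<in> X \<Longrightarrow> d x z \<le> d x y + d y z"
    and s: "s \<in> cauchy_seqs X d" and r: "r \<in> cauchy_seqs X d"
    and self: "(s, s) \<in> cauchy_equiv X d" "(r, r) \<in> cauchy_equiv X d"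
  shows "(\<lambda>i. d (s i) (r i)) \<longlonglongrightarrow> completion_dist d (cauchy_equiv X d `` {s}) (cauchy_equiv X d `` {r})"
proof -
  have sX: "s i \<in> X" "r i \<in> X" for i using s r by (auto simp: cauchy_seqs_def)
  \<comment> \<open>The quadrilateral inequality serves twice: for the Cauchy property of the
    distances, and for the independence of their limit from the representatives.\<close>
  have quad: "\<bar>d x y - d x' y'\<bar> \<le> d x x' + d y y'" if "x \<in> X" "y \<in> X" "x' \<in> X" "y' \<in> X" for x y x' y'
    using tri[of x x' y] tri[of x' y' y] tri[of x' x y'] tri[of x y y'] sym[of x x'] sym[of y y'] that by linarith
  have "Cauchy (\<lambda>i. d (s i) (r i))"
  proof (rule metric_CauchyI)
    fix e :: real assume "e > 0"
    then obtain N M where N: "\<And>i j. i \<ge> N \<Longrightarrow> j \<ge> N \<Longrightarrow> d (s i) (s j) < e / 2"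
      and M: "\<And>i j. i \<ge> M \<Longrightarrow> j \<ge> M \<Longrightarrow> d (r i) (r j) < e / 2"
      using s r unfolding cauchy_seqs_def mem_Collect_eq by (meson half_gt_zero)
    have "dist (d (s i) (r i)) (d (s j) (r j)) < e" if "i \<ge> max N M" "j \<ge> max N M" for i j
      using quad[OF sX(1)[of i] sX(2)[of i] sX(1)[of j] sX(2)[of j]] N[of i j] M[of i j] that by (simp add: dist_real_def)
    then show "\<exists>M. \<forall>m\<ge>M. \<forall>n\<ge>M. dist (d (s m) (r m)) (d (s n) (r n)) < e" by blast
  qed
  then obtain l where l: "(\<lambda>i. d (s i) (r i)) \<longlonglongrightarrow> l" by (auto simp: Cauchy_convergent_iff convergent_def)
  have "completion_dist d (cauchy_equiv X d `` {s}) (cauchy_equiv X d `` {r}) = l"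
    unfolding completion_dist_def
  proof (rule the_equality)
    show "\<exists>s'\<in>cauchy_equiv X d `` {s}. \<exists>r'\<in>cauchy_equiv X d `` {r}. (\<lambda>i. d (s' i) (r' i)) \<longlonglongrightarrow> l"
      using l self by blast
    fix l' assume "\<exists>s'\<in>cauchy_equiv X d `` {s}. \<exists>r'\<in>cauchy_equiv X d `` {r}. (\<lambda>i. d (s' i) (r' i)) \<longlonglongrightarrow> l'"
    then obtain s' r' where sr: "(s, s') \<in> cauchy_equiv X d" "(r, r') \<in> cauchy_equiv X d" "(\<lambda>i. d (s' i) (r' i)) \<longlonglongrightarrow> l'" by blast
    then have z: "(\<lambda>i. d (s i) (s' i)) \<longlonglongrightarrow> 0" "(\<lambda>i. d (r i) (r' i)) \<longlonglongrightarrow> 0"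
      and X': "s' i \<in> X" "r' i \<in> X" for i
      by (auto simp: cauchy_equiv_def cauchy_seqs_def)
    have "(\<lambda>i. d (s i) (r i) - d (s' i) (r' i)) \<longlonglongrightarrow> 0"
    proof (rule Lim_null_comparison)
      show "\<forall>\<^sub>F i in sequentially. norm (d (s i) (r i) - d (s' i) (r' i)) \<le> d (s i) (s' i) + d (r i) (r' i)"
        using quad[OF sX X'] by (intro always_eventually) simp
      show "(\<lambda>i. d (s i) (s' i) + d (r i) (r' i)) \<longlonglongrightarrow> 0" using tendsto_add[OF z] by simp
    qed
    moreover have "(\<lambda>i. d (s i) (r i) - d (s' i) (r' i)) \<longlonglongrightarrow> l - l'" by (rule tendsto_diff[OF l sr(3)])
    ultimately show "l' = l" using LIMSEQ_unique by fastforce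
  qed
  then show ?thesis using l by simp
qed

context closed_manifold
begin

section \<open>The Hofer distance on normalized Hamiltonians\<close>

lemma C_hamiltonian_jointly_continuous:
  assumes H: "C_hamiltonian k A H"
  shows "continuous_on ({0..1} \<times> UNIV) (\<lambda>(t, p). H t p)"
  unfolding continuous_on_def
proof (intro ballI)
  fix z :: "real \<times> 'm" assume z: "z \<in> {0..1} \<times> UNIV"
  obtain c where c: "c \<in> A" "snd z \<in> cdom c" using ex_chart by blast
  have "continuous_on ({0..1} \<times> cran c) (\<lambda>(t, u). H t (cinv c u))"
    using H c(1) C_on_continuous unfolding C_hamiltonian_def by blast
  then have "continuous_on ({0..1} \<times> cdom c) (\<lambda>q. (\<lambda>(t, u). H t (cinv c u)) (fst q, cmap c (snd q)))"
    by (rule continuous_on_compose2)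
      (auto intro!: continuous_intros continuous_on_compose2[OF continuous_cmap[OF c(1)]])
  then have "continuous_on ({0..1} \<times> cdom c) (\<lambda>(t, p). H t p)"
    by (rule continuous_on_eq) (use c(1) in auto)
  then have 1: "((\<lambda>(t, p). H t p) \<longlongrightarrow> (\<lambda>(t, p). H t p) z) (at z within {0..1} \<times> cdom c)"
    using z c(2) unfolding continuous_on_def by (cases z) auto
  have "at z within ({0..1} \<times> UNIV) = at z within (({0..1} \<times> UNIV) \<inter> (UNIV \<times> cdom c))"
    by (rule at_within_nhd[of _ "UNIV \<times> cdom c"])
      (use c(2) open_Times[OF open_UNIV open_cdom[OF c(1)]] in \<open>auto simp: mem_Times_iff\<close>)
  also have "({0..1} \<times> UNIV) \<inter> (UNIV \<times> cdom c) = {0..1} \<times> cdom c" by auto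
  finally show "((\<lambda>(t, p). H t p) \<longlongrightarrow> (\<lambda>(t, p). H t p) z) (at z within {0..1} \<times> UNIV)" using 1 by simp
qed

lemma normalized_difference:
  assumes "H \<in> normalized_smooth A \<mu>" "K \<in> normalized_smooth A \<mu>"
  shows "t \<in> {0..1} \<Longrightarrow> bounded (range (\<lambda>x. H t x - K t x))"
    "(\<lambda>t. osc (\<lambda>x. H t x - K t x)) integrable_on {0..1}"
proof -
  have "continuous_on ({0..1} \<times> UNIV) (\<lambda>q. (\<lambda>(t, p). H t p) q - (\<lambda>(t, p). K t p) q)"
    using assms C_hamiltonian_jointly_continuous unfolding normalized_smooth_def by (intro continuous_intros) blast+
  then have "continuous_on ({0..1} \<times> UNIV) (\<lambda>(t, p). H t p - K t p)" by (simp add: split_beta)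
  from osc_continuous[OF compact_UNIV this]
  show "t \<in> {0..1} \<Longrightarrow> bounded (range (\<lambda>x. H t x - K t x))"
    "(\<lambda>t. osc (\<lambda>x. H t x - K t x)) integrable_on {0..1}"
    by (auto intro: integrable_continuous_interval)
qed

lemma ham_dist_osc: "ham_dist H K = integral {0..1} (\<lambda>t. osc (\<lambda>x. H t x - K t x))"
  by (simp add: ham_dist_def ham_norm_def osc_def)

lemma ham_dist_triangle:
  assumes "H \<in> normalized_smooth A \<mu>" "K \<in> normalized_smooth A \<mu>" "L \<in> normalized_smooth A \<mu>"
  shows "ham_dist H L \<le> ham_dist H K + ham_dist K L"
proof -
  note HK = normalized_difference[OF assms(1,2)] and KL = normalized_difference[OF assms(2,3)] and HL = normalized_difference[OF assms(1,3)]
  have "osc (\<lambda>x. H t x - L t x) \<le> osc (\<lambda>x. H t x - K t x) + osc (\<lambda>x. K t x - L t x)" if "t \<in> {0..1}" for t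
    using osc_triangle[OF HK(1)[OF that] KL(1)[OF that]] by simp
  then show ?thesis
    unfolding ham_dist_osc integral_add[OF HK(2) KL(2), symmetric]
    by (intro integral_le HL(2) integrable_add HK(2) KL(2))
qed

lemma ham_dist_sym:
  assumes "H \<in> normalized_smooth A \<mu>" "K \<in> normalized_smooth A \<mu>"
  shows "ham_dist H K = ham_dist K H"
  unfolding ham_dist_osc
proof (rule integral_cong)
  fix t :: real assume t: "t \<in> {0..1}"
  show "osc (\<lambda>x. H t x - K t x) = osc (\<lambda>x. K t x - H t x)"
    by (intro antisym osc_swap normalized_difference(1)[OF assms t] normalized_difference(1)[OF assms(2,1) t])
qed

end

section \<open>Hamiltonian homeomorphisms\<close>

context hamiltonian_setting
begin

text \<open>The approximants \<open>K j\<close> play two roles: as a sequence they represent the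
  point of the completion that is paired with the flow of \<open>H\<close>, and one by one they
  furnish the smooth pairs converging to it.\<close>

lemma regular_flow_in_Hameo:
  assumes \<mu>: "liouville_measure n A \<omega> \<mu>" and H: "regular H" and C1: "C_hamiltonian 1 A H"
  shows "flow H 1 \<in> Hameo A g \<omega> \<mu>"
proof -
  let ?X = "normalized_smooth A \<mu>" and ?d = "riemannian_dist A g"
  define e where "e j = 1 / real (Suc j)" for j
  have e: "e j > 0" for j by (simp add: e_def)
  have e_mono: "e i \<le> e j" if "j \<le> i" for i j using that by (simp add: e_def frac_le)
  have e_small: "\<exists>j. e j < \<epsilon>" if "\<epsilon> > 0" for \<epsilon>
    using reals_Archimedean[OF that] by (simp add: e_def inverse_eq_divide)
  have "\<forall>j. \<exists>K. K \<in> ?X \<and> regular K \<and> close_on (e j) H K \<and> (\<exists>a. \<forall>t\<in>{0..1}. \<forall>p. \<bar>K t p - H t p - a t\<bar> \<le> e j)"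
    using normalized_approximation[OF \<mu> H C1 e] by blast
  from choice[OF this] obtain K where K: "\<And>j. K j \<in> ?X" "\<And>j. regular (K j)" "\<And>j. close_on (e j) H (K j)"
    "\<And>j. \<exists>a. \<forall>t\<in>{0..1}. \<forall>p. \<bar>K j t p - H t p - a t\<bar> \<le> e j" by blast
  \<comment> \<open>The functions of time by which \<open>K i\<close> and \<open>K j\<close> deviate
    from \<open>H\<close> cancel in the oscillation, so the distance is small although the values of
    \<open>K i\<close> and \<open>K j\<close> need not be close.\<close>
  have dist: "ham_dist (K i) (K j) \<le> 2 * e i + 2 * e j" for i j
  proof -
    obtain a where a: "\<And>t p. t \<in> {0..1} \<Longrightarrow> \<bar>K i t p - H t p - a t\<bar> \<le> e i" using K(4)[of i] by blast
    obtain b where b: "\<And>t p. t \<in> {0..1} \<Longrightarrow> \<bar>K j t p - H t p - b t\<bar> \<le> e j" using K(4)[of j] by blast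
    have "osc (\<lambda>x. K i t x - K j t x) \<le> 2 * e i + 2 * e j" if t: "t \<in> {0..1}" for t
    proof (rule osc_le)
      fix p q
      show "K i t p - K j t p - (K i t q - K j t q) \<le> 2 * e i + 2 * e j"
        using a[OF t, of p] a[OF t, of q] b[OF t, of p] b[OF t, of q] by linarith
    qed
    then have "integral {0..1} (\<lambda>t. osc (\<lambda>x. K i t x - K j t x)) \<le> integral {0..1::real} (\<lambda>t. 2 * e i + 2 * e j)"
      by (intro integral_le normalized_difference(2)[OF K(1) K(1)]) (auto simp: integrable_const_ivl)
    then show ?thesis by (simp add: ham_dist_osc)
  qed
  have dist_small: "ham_dist (K i) (K j) \<le> 4 * e k" if "k \<le> i" "k \<le> j" for i j k
    using dist[of i j] e_mono[OF that(1)] e_mono[OF that(2)] by linarith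
  have Ks: "K \<in> cauchy_seqs ?X ham_dist"
  proof -
    have "\<exists>N. \<forall>i\<ge>N. \<forall>j\<ge>N. ham_dist (K i) (K j) < \<epsilon>" if "\<epsilon> > 0" for \<epsilon>
    proof -
      have "\<epsilon> / 4 > 0" using that by simp
      from e_small[OF this] obtain k where "e k < \<epsilon> / 4" by blast
      then have "4 * e k < \<epsilon>" by simp
      then show ?thesis using dist_small by (intro exI[of _ k]) (auto intro: le_less_trans)
    qed
    then show ?thesis using K(1) by (auto simp: cauchy_seqs_def)
  qed
  have self0: "ham_dist L L = 0" for L :: "real \<Rightarrow> 'm \<Rightarrow> real"
    by (simp add: ham_dist_osc osc_def)
  have const: "(\<lambda>_. L) \<in> cauchy_seqs ?X ham_dist" if "L \<in> ?X" for L
    using that by (auto simp: cauchy_seqs_def self0)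
  have equiv_self: "(s, s) \<in> cauchy_equiv ?X ham_dist" if "s \<in> cauchy_seqs ?X ham_dist" for s
    using that by (simp add: cauchy_equiv_def self0)
  let ?\<xi> = "cauchy_equiv ?X ham_dist `` {K}"
  have mem: "(flow H, ?\<xi>) \<in> homeo_paths ?d \<times> completion ?X ham_dist"
    using flow_in_homeo_paths[OF H dominated_riemannian_dist] Ks by (simp add: completion_def quotientI)
  have "\<exists>y\<in>smooth_ham_pairs A \<omega> \<mu>. (\<lambda>(\<Lambda>, \<xi>1) (\<Theta>, \<xi>2). path_dist ?d \<Lambda> \<Theta> + completion_dist ham_dist \<xi>1 \<xi>2) (flow H, ?\<xi>) y < \<epsilon>"
    if \<epsilon>: "\<epsilon> > 0" for \<epsilon>
  proof -
    obtain \<eta> where \<eta>: "\<eta> > 0" "\<And>K. regular K \<Longrightarrow> close_on \<eta> H K \<Longrightarrow> path_dist ?d (flow H) (flow K) \<le> \<epsilon> / 2"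
      using flow_close[OF H dominated_riemannian_dist, of "\<epsilon> / 2"] \<epsilon> by auto
    have "min \<eta> (\<epsilon> / 16) > 0" using \<eta>(1) \<epsilon> by simp
    \<comment> \<open>With e j < \<epsilon> / 16 the bound 4 e j for the tail of the sequence falls
      below \<epsilon> / 2.\<close>
    from e_small[OF this] obtain j where j: "e j < min \<eta> (\<epsilon> / 16)" by blast
    have "close_on \<eta> H (K j)"
      unfolding close_on_def
    proof (intro ballI, unfold split_paired_all prod.case, intro ballI)
      fix t c x r u b assume "t \<in> {0..1::real}" "(c, x, r) \<in> I" "u \<in> cball x r" "b \<in> (Basis::'e set)"
      then have "\<bar>differential c (H t) u b - differential c (K j t) u b\<bar> \<le> e j"
        using K(3)[of j] unfolding close_on_def by blast
      then show "\<bar>differential c (H t) u b - differential c (K j t) u b\<bar> \<le> \<eta>" using j by linarith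
    qed
    then have 1: "path_dist ?d (flow H) (flow (K j)) \<le> \<epsilon> / 2" by (rule \<eta>(2)[OF K(2)])
    have "(\<lambda>i. ham_dist (K i) ((\<lambda>_. K j) i)) \<longlonglongrightarrow> completion_dist ham_dist ?\<xi> (cauchy_equiv ?X ham_dist `` {\<lambda>_. K j})"
      by (rule completion_dist_limit[OF ham_dist_sym ham_dist_triangle Ks const[OF K(1)] equiv_self[OF Ks] equiv_self[OF const[OF K(1)]]])
    then have "completion_dist ham_dist ?\<xi> (completion_embed ?X ham_dist (K j)) \<le> 4 * e j"
      unfolding completion_embed_def
      \<comment> \<open>The class of the sequence is compared with the constant sequence
        \<open>K j\<close>: all later members are within 4 e j of it, and the bound passes to the
        limit.\<close>
      by (rule LIMSEQ_le_const2) (use dist_small[of j _ j] in blast)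
    also have "\<dots> < \<epsilon> / 2" using j \<epsilon> by simp
    finally have "path_dist ?d (flow H) (flow (K j)) + completion_dist ham_dist ?\<xi> (completion_embed ?X ham_dist (K j)) < \<epsilon>"
      using 1 by linarith
    moreover have "(flow (K j), completion_embed ?X ham_dist (K j)) \<in> smooth_ham_pairs A \<omega> \<mu>"
      unfolding smooth_ham_pairs_def using K(1) by blast
    ultimately show ?thesis by (intro bexI[of _ "(flow (K j), completion_embed ?X ham_dist (K j))"]) auto
  qed
  with mem have "(flow H, ?\<xi>) \<in> ham_pairs_closure A g \<omega> \<mu>"
    unfolding ham_pairs_closure_def dist_closure_def by blast
  then show ?thesis unfolding Hameo_def by (rule image_eqI[rotated]) simp
qed

end

theorem theorem4p1:
  fixes A :: "('m::t2_space, 'e::euclidean_space) chart set"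
    and \<omega> g :: "('m, 'e) tensor2"
    and \<mu> :: "'m measure"
    and n :: nat
    and H :: "real \<Rightarrow> 'm \<Rightarrow> real"
    and \<phi> :: "'m \<Rightarrow> 'm"
    and C :: real
  assumes "closed_connected_manifold A"
    and "DIM('e) = 2 * n"
    and "symplectic_form A \<omega>"
    and "liouville_measure n A \<omega> \<mu>"
    and "riemannian_metric A g"
    and "C_hamiltonian 1 A H"
    and "C > 0"
    and "\<forall>t\<in>{0..1}. C11_norm A g (H t) \<le> ennreal C"
    and "continuous_differential A H"
    and "\<phi> = hamiltonian_flow A \<omega> H 1"
  shows "\<phi> \<in> Hameo A g \<omega> \<mu>"
proof -
  interpret M: closed_manifold A by unfold_locales (rule assms(1))
  \<comment> \<open>The cover is an auxiliary choice, on which neither the flow nor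
    \<open>Hameo\<close> depends; compactness provides it.\<close>
  obtain I where "finite I" "\<forall>i\<in>I. M.ball_chart i" "\<forall>p. \<exists>(c, x, r)\<in>I. p \<in> cdom c \<and> cmap c p \<in> ball x r"
    using M.ex_finite_cover by blast
  then interpret hamiltonian_setting A I \<omega> g
    by unfold_locales (use assms(3,5) in blast)+
  have "regular H" by (rule regular_C11[OF assms(6,9,7,8)])
  then show ?thesis unfolding assms(10) by (rule regular_flow_in_Hameo[OF assms(4) _ assms(6)])
qed

end
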